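(* Let $S$ be a connected closed oriented surface with a simple triangulation $G$ with sets of vertices, edges and triangles $V,E,F$. For any $\vec T=(T_v)_{v\in V}\in\partial_0\Omega_T$ there exists a unique degenerated generalized circle packed surface (with nerve $G$) realizing the prescribed total geodesic curvature $\vec T$; that is, there is exactly one $\vec k\in\partial\Omega_k$ such that on the degenerated generalized circle packed surface corresponding to $\vec k$ one has $T_v(\vec k)=T_v$ for all $v\in V$.
   Context: Generalized circles. A generalized circle of geodesic curvature $k\ge 0$ in the hyperbolic plane $\mathbb H^2$ is: for $k>1$ a circle of radius $r$ with $k=\coth r$ (center: its usual center); for $k=1$ a horocycle (center: its ideal point); for $0<k<1$ a hypercycle, i.e. one component of the set of points at distance $r$ from a complete geodesic (the axis, also called its center), $k=\tanh r$; for $k=0$ (degenerate case) a complete geodesic (its own center). Its convex side is the closed disk, the closed horoball, the closed region bounded by the hypercycle containing its axis, or, for $k=0$, a chosen closed half-plane, respectively. Two generalized circles are externally tangent if their convex sides have disjoint interiors and the curves are tangent at a point of $\mathbb H^2$; two geodesics ($k=0$) count as externally tangent if they are distinct, share an ideal endpoint (this ideal point is then the point of tangency) and their chosen half-planes have disjoint interiors. Triangles. A (possibly degenerated) three-circle configuration of curvature $(k_1,k_2,k_3)\in\mathbb R_{\ge0}^3$ consists of three pairwise externally tangent generalized circles $C_1,C_2,C_3$, arranged counterclockwise, with $C_i$ of geodesic curvature $k_i$; it is unique up to isometry. The edge $e_{ij}$ is the geodesic joining the centers of $C_i,C_j$ through their tangency point $t_{ij}$ (perpendicular to the axis of any of the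 two that is a hypercycle or geodesic); it degenerates to the ideal point $t_{ij}$ if $k_i=k_j=0$. The vertex $v_i$ is the center of $C_i$ if $k_i\ge1$, and is the part of the axis of $C_i$ between the two edges at $v_i$ if $k_i<1$. The (degenerated) circle packed triangle $\Delta$ is the closed polygon bounded by the vertices and edges, with the pattern of circles inside. Let $l_i$ be the length of the arc of $C_i$ inside $\Delta$ joining the tangency points $t_{ij},t_{ik}$, and define $T_i(k_1,k_2,k_3)=k_i l_i$ if $k_i>0$ and $T_i=0$ if $k_i=0$ (total geodesic curvature of the arc). Surfaces. For $\vec k=(k_v)_{v\in V}\in\mathbb R_{\ge0}^V$, realize each triangle $f=(uvw)\in F$ (positively oriented) as the circle packed triangle $\Delta_f$ of curvature $(k_u,k_v,k_w)$. For each edge $e=(uv)$ shared by $f,f'$: if $k_u,k_v$ are not both $0$, glue $\Delta_f,\Delta_{f'}$ isometrically along the edges corresponding to $e$ so that the tangency points on these edges coincide; if $k_u=k_v=0$, the two edges are ideal points, nothing is glued, and the two ends (spikes) of $\Delta_f,\Delta_{f'}$ at these ideal points are recorded as paired. If $\vec k\in\mathbb R_{>0}^V$ the result is the generalized circle packed surface with nerve $G$ and curvature $\vec k$; if some $k_v=0$ the resulting (possibly disconnected) hyperbolic surface together with the pairing of spikes is the degenerated generalized circle packed surface corresponding to $\vec k$. The total geodesic curvature at $v$ is $T_v(\vec k)=\sum_{f\ni v}T_v^f(\vec k)$, where $T_v^f(\vec k)$ is the total geodesic curvature of the arc at $v$ in $\Delta_f$ (so $T_v(\vec k)=0$ if $k_v=0$).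 Sets. $\Omega_k=\mathbb R_{>0}^V$, $\overline\Omega_k=\mathbb R_{\ge0}^V$, $\partial\Omega_k=\overline\Omega_k\setminus\Omega_k$. For non-empty $I\subset V$, $F_I$ is the set of triangles with at least one vertex in $I$, and $\eta^I(\vec T)=\pi|F_I|-\sum_{i\in I}T_i$. $\Omega_T=\{\vec T\in\mathbb R_{>0}^V:\eta^I(\vec T)>0\ \forall\,\varnothing\ne I\subset V\}$, $\widehat\Omega_T=\{\vec T\in\mathbb R_{\ge0}^V:\eta^I(\vec T)>0\ \forall\,\varnothing\ne I\subset V\}$, $\partial_0\Omega_T=\widehat\Omega_T\setminus\Omega_T$. *)

theory Defs
  imports "HOL-Complex_Analysis.Complex_Analysis"
begin

text \<open>The hyperbolic plane is the Poincare disk; its ideal points are the points of the unit circle.\<close>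

definition hdisk :: "complex set" where
  "hdisk = ball 0 1"

definition hdist :: "complex \<Rightarrow> complex \<Rightarrow> real" where
  "hdist z w = arcosh (1 + 2 * (norm (z - w))\<^sup>2 / ((1 - (norm z)\<^sup>2) * (1 - (norm w)\<^sup>2)))"

definition hdist_set :: "complex \<Rightarrow> complex set \<Rightarrow> real" where
  "hdist_set z L = (INF w\<in>L. hdist z w)"

definition hlength :: "(real \<Rightarrow> complex) \<Rightarrow> real" where
  "hlength \<gamma> =
     integral {0..1} (\<lambda>s. 2 * norm (vector_derivative \<gamma> (at s)) / (1 - (norm (\<gamma> s))\<^sup>2))"

definition geodesic_line :: "(real \<Rightarrow> complex) \<Rightarrow> bool" where
  "geodesic_line \<gamma> \<longleftrightarrow> range \<gamma> \<subseteq> hdisk \<and> (\<forall>s t. hdist (\<gamma> s) (\<gamma> t) = \<bar>s - t\<bar>)"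

definition complete_geodesic :: "complex set \<Rightarrow> bool" where
  "complete_geodesic L \<longleftrightarrow> (\<exists>\<gamma>. geodesic_line \<gamma> \<and> L = range \<gamma>)"

text \<open>Extension of a geodesic line to its two ideal endpoints, which are its limits in the
  closed unit disk.\<close>

definition ext_line :: "(real \<Rightarrow> complex) \<Rightarrow> ereal \<Rightarrow> complex" where
  "ext_line \<gamma> x = (if x = \<infinity> then Lim at_top \<gamma> else if x = -\<infinity> then Lim at_bot \<gamma>
                    else \<gamma> (real_of_ereal x))"

definition ideal_endpoints :: "complex set \<Rightarrow> complex set" where
  "ideal_endpoints L = closure L \<inter> sphere 0 1"

text \<open>The line \<open>\<gamma>\<close> meets the complete geodesic \<open>L\<close> perpendicularly at time \<open>s\<close>
  (the disk model is conformal, so Euclidean angles may be used).\<close>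

definition perpendicular_at :: "(real \<Rightarrow> complex) \<Rightarrow> complex set \<Rightarrow> real \<Rightarrow> bool" where
  "perpendicular_at \<gamma> L s \<longleftrightarrow>
     (\<exists>\<mu> r. geodesic_line \<mu> \<and> range \<mu> = L \<and> \<mu> r = \<gamma> s \<and>
        vector_derivative \<mu> (at r) \<bullet> vector_derivative \<gamma> (at s) = 0)"

text \<open>The field \<open>centre\<close> is \<open>{c}\<close> for a circle with centre \<open>c\<close>, \<open>{\<xi>}\<close> for a horocycle with ideal
  centre \<open>\<xi>\<close>, the axis for a hypercycle, and the curve itself for a geodesic.\<close>

record gcircle =
  curvature :: real
  curve :: "complex set"
  convex_side :: "complex set"
  centre :: "complex set"

definition is_circle :: "gcircle \<Rightarrow> bool" where
  "is_circle C \<longleftrightarrow> (\<exists>c r. c \<in> hdisk \<and> r > 0 \<and> curvature C = cosh r / sinh r \<and>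
     curve C = {z \<in> hdisk. hdist c z = r} \<and>
     convex_side C = {z \<in> hdisk. hdist c z \<le> r} \<and>
     centre C = {c})"

text \<open>In the disk model the horocycles with ideal centre \<open>\<xi>\<close> are the Euclidean circles internally
  tangent to the unit circle at \<open>\<xi>\<close>, with \<open>\<xi>\<close> removed.\<close>

definition is_horocycle :: "gcircle \<Rightarrow> bool" where
  "is_horocycle C \<longleftrightarrow> (\<exists>\<xi> \<rho>. norm \<xi> = 1 \<and> 0 < \<rho> \<and> \<rho> < 1 \<and> curvature C = 1 \<and>
     curve C = sphere ((1 - \<rho>) *\<^sub>R \<xi>) \<rho> - {\<xi>} \<and>
     convex_side C = cball ((1 - \<rho>) *\<^sub>R \<xi>) \<rho> - {\<xi>} \<and>
     centre C = {\<xi>})"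

definition is_hypercycle :: "gcircle \<Rightarrow> bool" where
  "is_hypercycle C \<longleftrightarrow> (\<exists>L r. complete_geodesic L \<and> r > 0 \<and> curvature C = tanh r \<and>
     curve C \<in> components {z \<in> hdisk. hdist_set z L = r} \<and>
     convex_side C = curve C \<union> \<Union>{H \<in> components (hdisk - curve C). L \<subseteq> H} \<and>
     centre C = L)"

definition is_geodesic_gcircle :: "gcircle \<Rightarrow> bool" where
  "is_geodesic_gcircle C \<longleftrightarrow> (\<exists>L H. complete_geodesic L \<and> curvature C = 0 \<and>
     curve C = L \<and> H \<in> components (hdisk - L) \<and> convex_side C = L \<union> H \<and> centre C = L)"

definition generalized_circle :: "gcircle \<Rightarrow> bool" where
  "generalized_circle C \<longleftrightarrow>
     is_circle C \<or> is_horocycle C \<or> is_hypercycle C \<or> is_geodesic_gcircle C"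

definition tangent_vector :: "complex set \<Rightarrow> complex \<Rightarrow> complex \<Rightarrow> bool" where
  "tangent_vector A t u \<longleftrightarrow>
     (\<exists>\<gamma> \<delta>. \<delta> > 0 \<and> \<gamma> 0 = t \<and> \<gamma> ` {-\<delta><..<\<delta>} \<subseteq> A \<and>
        (\<gamma> has_vector_derivative u) (at (0::real)))"

definition curves_tangent_at :: "complex set \<Rightarrow> complex set \<Rightarrow> complex \<Rightarrow> bool" where
  "curves_tangent_at A B t \<longleftrightarrow>
     (\<exists>u. u \<noteq> 0 \<and> tangent_vector A t u \<and> tangent_vector B t u)"

text \<open>\<open>t\<close> is an ideal point exactly when both circles are geodesics.\<close>

definition is_tangency_point :: "gcircle \<Rightarrow> gcircle \<Rightarrow> complex \<Rightarrow> bool" where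
  "is_tangency_point C C' t \<longleftrightarrow>
     (if curvature C = 0 \<and> curvature C' = 0
      then t \<in> ideal_endpoints (curve C) \<inter> ideal_endpoints (curve C')
      else t \<in> hdisk \<and> curves_tangent_at (curve C) (curve C') t)"

definition externally_tangent :: "gcircle \<Rightarrow> gcircle \<Rightarrow> bool" where
  "externally_tangent C C' \<longleftrightarrow>
     curve C \<noteq> curve C' \<and>
     interior (convex_side C) \<inter> interior (convex_side C') = {} \<and>
     (\<exists>t. is_tangency_point C C' t)"

definition tangency_point :: "gcircle \<Rightarrow> gcircle \<Rightarrow> complex" where
  "tangency_point C C' = (THE t. is_tangency_point C C' t)"

definition counterclockwise :: "complex \<Rightarrow> complex \<Rightarrow> complex \<Rightarrow> bool" where
  "counterclockwise a b c \<longleftrightarrow> Im (cnj (b - a) * (c - a)) > 0"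

text \<open>The Euclidean circle through the three tangency points is contained in the closed unit disk,
  so its orientation is invariant under orientation preserving isometries.\<close>

definition three_circle_configuration ::
  "real \<Rightarrow> real \<Rightarrow> real \<Rightarrow> gcircle \<Rightarrow> gcircle \<Rightarrow> gcircle \<Rightarrow> bool" where
  "three_circle_configuration k1 k2 k3 C1 C2 C3 \<longleftrightarrow>
     generalized_circle C1 \<and> generalized_circle C2 \<and> generalized_circle C3 \<and>
     curvature C1 = k1 \<and> curvature C2 = k2 \<and> curvature C3 = k3 \<and>
     externally_tangent C1 C2 \<and> externally_tangent C2 C3 \<and> externally_tangent C3 C1 \<and>
     counterclockwise (tangency_point C1 C2) (tangency_point C2 C3) (tangency_point C3 C1)"

definition line_ends_at :: "(real \<Rightarrow> complex) \<Rightarrow> ereal \<Rightarrow> gcircle \<Rightarrow> bool" where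
  "line_ends_at \<gamma> x C \<longleftrightarrow> ext_line \<gamma> x \<in> centre C \<and>
     (curvature C < 1 \<longrightarrow> perpendicular_at \<gamma> (centre C) (real_of_ereal x))"

text \<open>The edge from the centre of \<open>C\<close> (time \<open>a\<close>) to the centre of \<open>C'\<close> (time \<open>b\<close>), parametrized
  by hyperbolic arc length with the tangency point at time 0.\<close>

definition edge_param ::
  "gcircle \<Rightarrow> gcircle \<Rightarrow> (real \<Rightarrow> complex) \<Rightarrow> ereal \<Rightarrow> ereal \<Rightarrow> bool" where
  "edge_param C C' \<gamma> a b \<longleftrightarrow> geodesic_line \<gamma> \<and> a \<le> 0 \<and> 0 \<le> b \<and>
     \<gamma> 0 = tangency_point C C' \<and> line_ends_at \<gamma> a C \<and> line_ends_at \<gamma> b C'"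

text \<open>Edges and vertices contain their ideal points.\<close>

definition edge :: "gcircle \<Rightarrow> gcircle \<Rightarrow> complex set" where
  "edge C C' = (if curvature C = 0 \<and> curvature C' = 0 then {tangency_point C C'}
     else (THE e. \<exists>\<gamma> a b. edge_param C C' \<gamma> a b \<and> e = ext_line \<gamma> ` {a..b}))"

text \<open>The vertex at \<open>C\<close> of the triangle whose other two circles are \<open>C'\<close> and \<open>C''\<close>.\<close>

definition vertex :: "gcircle \<Rightarrow> gcircle \<Rightarrow> gcircle \<Rightarrow> complex set" where
  "vertex C C' C'' = (if curvature C \<ge> 1 then centre C
     else (THE v. \<exists>\<gamma> a b. geodesic_line \<gamma> \<and> range \<gamma> = centre C \<and> a \<le> b \<and>
             ext_line \<gamma> a \<in> edge C C' \<and> ext_line \<gamma> b \<in> edge C C'' \<and> v = ext_line \<gamma> ` {a..b}))"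

definition triangle_boundary :: "gcircle \<Rightarrow> gcircle \<Rightarrow> gcircle \<Rightarrow> complex set" where
  "triangle_boundary C1 C2 C3 =
     vertex C1 C2 C3 \<union> vertex C2 C3 C1 \<union> vertex C3 C1 C2 \<union> edge C1 C2 \<union> edge C2 C3 \<union> edge C3 C1"

definition packed_triangle :: "gcircle \<Rightarrow> gcircle \<Rightarrow> gcircle \<Rightarrow> complex set" where
  "packed_triangle C1 C2 C3 =
     (triangle_boundary C1 C2 C3 \<union> inside (triangle_boundary C1 C2 C3)) \<inter> hdisk"

definition arc_length :: "gcircle \<Rightarrow> gcircle \<Rightarrow> gcircle \<Rightarrow> real" where
  "arc_length C1 C2 C3 = (THE l. \<exists>\<gamma>. valid_path \<gamma> \<and> arc \<gamma> \<and>
     path_image \<gamma> \<subseteq> curve C1 \<inter> packed_triangle C1 C2 C3 \<and>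
     pathstart \<gamma> = tangency_point C1 C2 \<and> pathfinish \<gamma> = tangency_point C1 C3 \<and>
     l = hlength \<gamma>)"

text \<open>Total geodesic curvature of the arc of \<open>C1\<close>; the arc may have infinite length
  when the curvature of \<open>C1\<close> is 0.\<close>

definition arc_curvature :: "gcircle \<Rightarrow> gcircle \<Rightarrow> gcircle \<Rightarrow> real" where
  "arc_curvature C1 C2 C3 =
     (if curvature C1 > 0 then curvature C1 * arc_length C1 C2 C3 else 0)"

definition surface_chart :: "'s topology \<Rightarrow> 's set \<Rightarrow> ('s \<Rightarrow> complex) \<Rightarrow> bool" where
  "surface_chart S U \<phi> \<longleftrightarrow> openin S U \<and>
     (\<exists>W. open W \<and> homeomorphic_map (subtopology S U) (top_of_set W) \<phi>)"

text \<open>For an injective continuous map of a plane open set, the winding number of the image of a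
  small counterclockwise circle is 1 or -1, according to whether orientation is preserved.\<close>

definition orientation_preserving_on :: "complex set \<Rightarrow> (complex \<Rightarrow> complex) \<Rightarrow> bool" where
  "orientation_preserving_on W \<tau> \<longleftrightarrow>
     (\<forall>z\<in>W. \<forall>\<^sub>F r in at_right 0. winding_number (\<tau> \<circ> circlepath z r) (\<tau> z) = 1)"

text \<open>The orientation is given by the oriented atlas \<open>\<A>\<close>.\<close>

definition connected_closed_oriented_surface ::
  "'s topology \<Rightarrow> ('s set \<times> ('s \<Rightarrow> complex)) set \<Rightarrow> bool" where
  "connected_closed_oriented_surface S \<A> \<longleftrightarrow>
     topspace S \<noteq> {} \<and> connected_space S \<and> compact_space S \<and> Hausdorff_space S \<and>
     (\<forall>(U, \<phi>) \<in> \<A>. surface_chart S U \<phi>) \<and>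
     \<Union>(fst ` \<A>) = topspace S \<and>
     (\<forall>(U, \<phi>) \<in> \<A>. \<forall>(U', \<phi>') \<in> \<A>.
        orientation_preserving_on (\<phi> ` (U \<inter> U')) (\<phi>' \<circ> inv_into U \<phi>))"

definition std_triangle :: "complex set" where
  "std_triangle = convex hull {0, 1, \<i>}"

type_synonym 's face = "'s \<times> 's \<times> 's"

fun verts :: "'s face \<Rightarrow> 's set" where
  "verts (u, v, w) = {u, v, w}"

text \<open>An edge is an embedded closed arc whose end points are its only points in \<open>V\<close>.\<close>

definition embedded_edge :: "'s topology \<Rightarrow> 's set \<Rightarrow> 's set \<Rightarrow> bool" where
  "embedded_edge S V e \<longleftrightarrow>
     (\<exists>\<gamma>. embedding_map (top_of_set {0..1::real}) S \<gamma> \<and> e = \<gamma> ` {0..1} \<and>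
        \<gamma> 0 \<in> V \<and> \<gamma> 1 \<in> V \<and> \<gamma> ` {0<..<1} \<inter> V = {})"

text \<open>The open set \<open>D\<close> is (the interior of) a triangle of the triangulation whose corners are, in
  positive order, \<open>u\<close>, \<open>v\<close>, \<open>w\<close>.\<close>

definition positive_triangle ::
  "'s topology \<Rightarrow> ('s set \<times> ('s \<Rightarrow> complex)) set \<Rightarrow> 's set set \<Rightarrow> 's face \<Rightarrow> 's set \<Rightarrow> bool" where
  "positive_triangle S \<A> E f D \<longleftrightarrow>
     (\<exists>\<sigma>. embedding_map (top_of_set std_triangle) S \<sigma> \<and> f = (\<sigma> 0, \<sigma> 1, \<sigma> \<i>) \<and>
        \<sigma> ` closed_segment 0 1 \<in> E \<and> \<sigma> ` closed_segment 1 \<i> \<in> E \<and>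
        \<sigma> ` closed_segment \<i> 0 \<in> E \<and>
        D = \<sigma> ` interior std_triangle \<and>
        (\<forall>(U, \<phi>) \<in> \<A>.
           orientation_preserving_on {z \<in> interior std_triangle. \<sigma> z \<in> U} (\<phi> \<circ> \<sigma>)))"

text \<open>Each triangle is listed in \<open>F\<close> by exactly one of the three cyclic rotations of its positively
  ordered corners.\<close>

definition simple_triangulation ::
  "'s topology \<Rightarrow> ('s set \<times> ('s \<Rightarrow> complex)) set \<Rightarrow> 's set \<Rightarrow> 's set set \<Rightarrow> 's face set \<Rightarrow> bool" where
  "simple_triangulation S \<A> V E F \<longleftrightarrow>
     finite V \<and> V \<subseteq> topspace S \<and>
     (\<forall>e\<in>E. embedded_edge S V e) \<and>
     (\<forall>e\<in>E. \<forall>e'\<in>E. e \<noteq> e' \<longrightarrow> e \<inter> e' \<subseteq> V \<and> e \<inter> V \<noteq> e' \<inter> V) \<and>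
     (let Ds = connected_components_of (subtopology S (topspace S - (V \<union> \<Union>E))) in
        (\<forall>f\<in>F. \<exists>D\<in>Ds. positive_triangle S \<A> E f D) \<and>
        (\<forall>D\<in>Ds. \<exists>!f. f \<in> F \<and> positive_triangle S \<A> E f D))"

text \<open>Here \<open>circ f v\<close> is the circle at the vertex \<open>v\<close> in the triangle realizing the face \<open>f\<close>.\<close>

fun realized_face :: "('s face \<Rightarrow> 's \<Rightarrow> gcircle) \<Rightarrow> 's face \<Rightarrow> complex set" where
  "realized_face circ (u, v, w) =
     packed_triangle (circ (u, v, w) u) (circ (u, v, w) v) (circ (u, v, w) w)"

fun face_configuration :: "('s \<Rightarrow> real) \<Rightarrow> ('s face \<Rightarrow> 's \<Rightarrow> gcircle) \<Rightarrow> 's face \<Rightarrow> bool" where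
  "face_configuration k circ (u, v, w) \<longleftrightarrow>
     three_circle_configuration (k u) (k v) (k w)
       (circ (u, v, w) u) (circ (u, v, w) v) (circ (u, v, w) w)"

fun face_curvature :: "('s face \<Rightarrow> 's \<Rightarrow> gcircle) \<Rightarrow> 's face \<Rightarrow> 's \<Rightarrow> real" where
  "face_curvature circ (u, v, w) x =
     (let C = circ (u, v, w) in
      if x = u then arc_curvature (C u) (C v) (C w)
      else if x = v then arc_curvature (C v) (C w) (C u)
      else if x = w then arc_curvature (C w) (C u) (C v)
      else 0)"

definition adjacent_along :: "'s face set \<Rightarrow> 's face \<Rightarrow> 's face \<Rightarrow> 's \<Rightarrow> 's \<Rightarrow> bool" where
  "adjacent_along F f g u v \<longleftrightarrow>
     f \<in> F \<and> g \<in> F \<and> f \<noteq> g \<and> u \<noteq> v \<and> {u, v} \<subseteq> verts f \<inter> verts g"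

definition edge_gluing ::
  "'s face set \<Rightarrow> ('s \<Rightarrow> real) \<Rightarrow> ('s face \<Rightarrow> 's \<Rightarrow> gcircle)
     \<Rightarrow> (('s face \<times> complex) \<times> ('s face \<times> complex)) set" where
  "edge_gluing F k circ = {((f, \<gamma> s), (g, \<delta> s)) | f g u v \<gamma> \<delta> a b s.
     adjacent_along F f g u v \<and> \<not> (k u = 0 \<and> k v = 0) \<and>
     edge_param (circ f u) (circ f v) \<gamma> a b \<and> edge_param (circ g u) (circ g v) \<delta> a b \<and>
     a \<le> ereal s \<and> ereal s \<le> b}"

definition spike_pairing ::
  "'s face set \<Rightarrow> ('s \<Rightarrow> real) \<Rightarrow> ('s face \<Rightarrow> 's \<Rightarrow> gcircle)
     \<Rightarrow> (('s face \<times> complex) \<times> ('s face \<times> complex)) set" where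
  "spike_pairing F k circ =
     {((f, tangency_point (circ f u) (circ f v)), (g, tangency_point (circ g u) (circ g v))) | f g u v.
        adjacent_along F f g u v \<and> k u = 0 \<and> k v = 0}"

text \<open>Distance on the quotient of the disjoint union \<open>P\<close> of the pieces by the equivalence relation
  \<open>R\<close>: the infimum of the lengths of chains \<open>(p1, q1), (p2, q2), ...\<close> with \<open>pi\<close>, \<open>qi\<close> in
  a common (convex) piece and \<open>qi\<close> identified with \<open>p(i+1)\<close>. It is infinite between different
  connected components.\<close>

definition gluing_chain ::
  "('f \<times> complex) set \<Rightarrow> (('f \<times> complex) \<times> ('f \<times> complex)) set \<Rightarrow>
   ('f \<times> complex) set \<Rightarrow> ('f \<times> complex) set \<Rightarrow> (('f \<times> complex) \<times> ('f \<times> complex)) list \<Rightarrow> bool" where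
  "gluing_chain P R x y ps \<longleftrightarrow> ps \<noteq> [] \<and> fst (hd ps) \<in> x \<and> snd (last ps) \<in> y \<and>
     (\<forall>(p, q) \<in> set ps. p \<in> P \<and> q \<in> P \<and> fst p = fst q) \<and>
     (\<forall>i. Suc i < length ps \<longrightarrow> (snd (ps ! i), fst (ps ! Suc i)) \<in> R)"

definition quotient_dist ::
  "('f \<times> complex) set \<Rightarrow> (('f \<times> complex) \<times> ('f \<times> complex)) set \<Rightarrow>
   ('f \<times> complex) set \<Rightarrow> ('f \<times> complex) set \<Rightarrow> ereal" where
  "quotient_dist P R x y =
     (INF ps\<in>{ps. gluing_chain P R x y ps}.
        ereal (\<Sum>(p, q)\<leftarrow>ps. hdist (snd p) (snd q)))"

record 's packed_surface =
  circles :: "'s face \<Rightarrow> 's \<Rightarrow> gcircle"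
  surface_points :: "('s face \<times> complex) set set"
  surface_dist :: "('s face \<times> complex) set \<Rightarrow> ('s face \<times> complex) set \<Rightarrow> ereal"
  paired_spikes :: "(('s face \<times> complex) \<times> ('s face \<times> complex)) set"

text \<open>\<open>X\<close> is a (degenerated, if \<open>k\<close> has a zero) generalized circle packed surface
  corresponding to the curvatures \<open>k\<close>; it depends on the choice of the triangle realizing each
  face, which is unique up to isometry.\<close>

definition corresponding_surface :: "'s face set \<Rightarrow> ('s \<Rightarrow> real) \<Rightarrow> 's packed_surface \<Rightarrow> bool" where
  "corresponding_surface F k X \<longleftrightarrow>
     (\<forall>f\<in>F. face_configuration k (circles X) f) \<and>
     (let P = Sigma F (realized_face (circles X)); R = (edge_gluing F k (circles X))\<^sup>* in
        surface_points X = P // R \<and> surface_dist X = quotient_dist P R) \<and>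
     paired_spikes X = spike_pairing F k (circles X)"

definition total_geodesic_curvature :: "'s face set \<Rightarrow> 's packed_surface \<Rightarrow> 's \<Rightarrow> real" where
  "total_geodesic_curvature F X v = (\<Sum>f\<in>{f \<in> F. v \<in> verts f}. face_curvature (circles X) f v)"

text \<open>Elements of \<open>\<real>\<^sup>V\<close> are functions that are \<open>undefined\<close> outside \<open>V\<close>.\<close>

definition Omega_k :: "'s set \<Rightarrow> ('s \<Rightarrow> real) set" where
  "Omega_k V = V \<rightarrow>\<^sub>E {0<..}"

definition closed_Omega_k :: "'s set \<Rightarrow> ('s \<Rightarrow> real) set" where
  "closed_Omega_k V = V \<rightarrow>\<^sub>E {0..}"

definition boundary_Omega_k :: "'s set \<Rightarrow> ('s \<Rightarrow> real) set" where
  "boundary_Omega_k V = closed_Omega_k V - Omega_k V"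

definition eta :: "'s face set \<Rightarrow> 's set \<Rightarrow> ('s \<Rightarrow> real) \<Rightarrow> real" where
  "eta F I T = pi * real (card {f \<in> F. verts f \<inter> I \<noteq> {}}) - (\<Sum>i\<in>I. T i)"

definition Omega_T :: "'s set \<Rightarrow> 's face set \<Rightarrow> ('s \<Rightarrow> real) set" where
  "Omega_T V F = {T \<in> V \<rightarrow>\<^sub>E {0<..}. \<forall>I. I \<noteq> {} \<and> I \<subseteq> V \<longrightarrow> eta F I T > 0}"

definition hat_Omega_T :: "'s set \<Rightarrow> 's face set \<Rightarrow> ('s \<Rightarrow> real) set" where
  "hat_Omega_T V F = {T \<in> V \<rightarrow>\<^sub>E {0..}. \<forall>I. I \<noteq> {} \<and> I \<subseteq> V \<longrightarrow> eta F I T > 0}"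

definition boundary0_Omega_T :: "'s set \<Rightarrow> 's face set \<Rightarrow> ('s \<Rightarrow> real) set" where
  "boundary0_Omega_T V F = hat_Omega_T V F - Omega_T V F"

end

theory Submission
  imports Defs
begin

text \<open>A generalized circle of curvature \<open>k\<close> is a plane section
\<open>{X. mink X N = - k}\<close> of the hyperboloid model in \<open>\<real>\<^sup>2\<^sup>,\<^sup>1\<close>, where the normal vector
\<open>N\<close> satisfies \<open>mink N N = 1 - k\<^sup>2\<close>; this norm is negative for circles, \<open>0\<close>
for horocycles and positive for hypercycles and geodesics. Two of them are externally tangent exactly when
\<open>mink N1 N2 = -1 - k1 * k2\<close> and \<open>N1 + N2\<close> points to the future
(\<open>externally_tangent_mink\<close>, \<open>mink_tangent_implies\<close>). A three-circle configuration is therefore a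
triple of vectors with a prescribed Gram matrix. The negative of the determinant of this matrix is \<open>4 * (1 + S)\<close> with
\<open>S = k1 * k2 + k2 * k3 + k3 * k1\<close>, so it never degenerates, and configurations exist for all
nonnegative curvatures (\<open>config_exists\<close>). The packed triangle is cut out of the disk by linear
inequalities in Minkowski space, and the arc of the first circle inside it has a rational parametrization. This gives
the length of the arc (\<open>arc_length_eq\<close>), and the total curvature of an arc turns out to be a
function \<open>arcK k S\<close> of only two numbers, its own curvature \<open>k\<close> and the symmetric quantity \<open>S\<close>.

A substitution turns the arc length integral into
\<open>arcK k S = 2 * \<integral>\<^sub>0\<^sup>\<theta> k cos t / sqrt (sin\<^sup>2 t + k\<^sup>2 cos\<^sup>2 t) dt\<close> (\<open>arcK_half_angle\<close>). Here the upper
limit \<open>\<theta> = arctan (k / sqrt S)\<close> is half of an angle of the Euclidean triangle formed by the centres of three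
mutually tangent circles of radii \<open>1 / k1\<close>, \<open>1 / k2\<close>, \<open>1 / k3\<close>. Three properties can be read off.
The total curvature of an arc does not increase when another curvature of its triangle grows, because the
angle shrinks. It strictly increases when all curvatures of the triangle are multiplied by the same
\<open>c > 1\<close>, because the angle stays and the integrand grows. It tends to \<open>2 * \<theta>\<close> when \<open>k\<close>
tends to infinity; since the angles of a Euclidean triangle add up to \<open>\<pi>\<close>, the arcs whose
curvatures tend to infinity while the others stay bounded have total curvature tending to \<open>\<pi>\<close>
altogether (\<open>large_curvatures\<close>).

Uniqueness is a maximum principle (\<open>total_curv_determines_le\<close>). Let \<open>k\<close> and \<open>k'\<close> have the same
total curvatures, and suppose that \<open>c = k' v / k v\<close> is the largest ratio and \<open>c > 1\<close>. At \<open>v\<close> the total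
curvature of \<open>c * k\<close> is larger than that of \<open>k\<close>, and the one of \<open>k'\<close> is at least that of \<open>c * k\<close>, a
contradiction. A curvature vanishes exactly where the prescribed total curvature does, so zeros do not
interfere.

Existence is a Perron argument (\<open>total_curv_exists\<close>). Curvatures whose total curvature is at most the
prescribed one everywhere are closed under pointwise maxima. If they were unbounded exactly on a
non-empty set \<open>I\<close> of vertices, then every triangle meeting \<open>I\<close> would in the limit contribute \<open>\<pi>\<close> to the sum of
the prescribed values over \<open>I\<close>, contradicting the inequality for \<open>I\<close> in the definition of the
admissible total curvatures. Hence their supremum is finite, and it has the prescribed total
curvature everywhere, since otherwise one of its values could be raised.

A triangulation has finitely many triangles, each with three distinct corners in \<open>V\<close>
(\<open>triangulation_faces\<close>), and every vertex lies on one of them by the inequality for the singleton of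
that vertex. The two results above therefore apply to it, and since the prescribed total curvature has a zero,
so does the solution.\<close>

section \<open>Minkowski space of signature (2,1)\<close>

type_synonym mvec = "real \<times> complex"

definition mink :: "mvec \<Rightarrow> mvec \<Rightarrow> real" where
  "mink P Q = Re (snd P) * Re (snd Q) + Im (snd P) * Im (snd Q) - fst P * fst Q"

lemma mink_sym: "mink P Q = mink Q P"
  by (simp add: mink_def algebra_simps)

lemma mink_linear [simp]:
  "mink (P + Q) R = mink P R + mink Q R" "mink R (P + Q) = mink R P + mink R Q"
  "mink (P - Q) R = mink P R - mink Q R" "mink R (P - Q) = mink R P - mink R Q"
  "mink (c *\<^sub>R P) R = c * mink P R" "mink R (c *\<^sub>R P) = c * mink R P"
  "mink (- P) R = - mink P R" "mink R (- P) = - mink R P"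
  "mink 0 R = 0" "mink R 0 = 0"
  by (simp_all add: mink_def algebra_simps)

lemma continuous_on_mink [continuous_intros]:
  assumes "continuous_on A f" "continuous_on A g"
  shows "continuous_on A (\<lambda>x. mink (f x) (g x))"
  unfolding mink_def by (intro continuous_intros assms)

definition mdet :: "mvec \<Rightarrow> mvec \<Rightarrow> mvec \<Rightarrow> real" where
  "mdet P Q R = fst P * (Re (snd Q) * Im (snd R) - Im (snd Q) * Re (snd R))
     - Re (snd P) * (fst Q * Im (snd R) - Im (snd Q) * fst R)
     + Im (snd P) * (fst Q * Re (snd R) - Re (snd Q) * fst R)"

text \<open>The matrix of \<open>mink\<close> has determinant \<open>-1\<close>, so the square of the determinant of three vectors is minus
the determinant of their Gram matrix.\<close>
lemma mdet_gram:
  "(mdet P Q R)\<^sup>2 = - (mink P P * (mink Q Q * mink R R - (mink Q R)\<^sup>2)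
     - mink P Q * (mink P Q * mink R R - mink Q R * mink P R)
     + mink P R * (mink P Q * mink Q R - mink Q Q * mink P R))"
  unfolding mdet_def mink_def by algebra

text \<open>Cramer's rule, in a form without division.\<close>
lemma mdet_cramer:
  "mdet P Q R *\<^sub>R W = mdet W Q R *\<^sub>R P + mdet P W R *\<^sub>R Q + mdet P Q W *\<^sub>R R"
  by (simp add: mdet_def prod_eq_iff complex_eq_iff algebra_simps)

lemma orth_basis_zero:
  assumes "mdet P Q R \<noteq> 0" "mink W P = 0" "mink W Q = 0" "mink W R = 0"
  shows "W = 0"
proof -
  have "mdet P Q R * fst W = 0" "mdet P Q R * Re (snd W) = 0" "mdet P Q R * Im (snd W) = 0"
    using assms(2-4) unfolding mdet_def mink_def by algebra+
  then show ?thesis using assms(1) by (simp add: prod_eq_iff complex_eq_iff)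
qed

lemma orthonormal_expand:
  assumes "mink A A = -1" "mink B B = 1" "mink C C = 1"
    "mink A B = 0" "mink A C = 0" "mink B C = 0"
  shows "W = - mink W A *\<^sub>R A + mink W B *\<^sub>R B + mink W C *\<^sub>R C"
proof -
  have "(mdet A B C)\<^sup>2 = 1" using assms by (simp add: mdet_gram)
  then have "mdet A B C \<noteq> 0" by auto
  then have "W - (- mink W A *\<^sub>R A + mink W B *\<^sub>R B + mink W C *\<^sub>R C) = 0"
    using assms by (intro orth_basis_zero[of A B C]) (auto simp: mink_sym)
  then show ?thesis by simp
qed

text \<open>The orthogonal complement of a timelike vector is positive definite.\<close>
lemma orth_timelike:
  assumes "mink P P < 0" "mink P W = 0"
  shows "mink W W \<ge> 0" "mink W W = 0 \<Longrightarrow> W = 0"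
proof -
  obtain a u v where P: "P = (a, Complex u v)" by (metis prod.exhaust complex.exhaust)
  obtain b x y where W: "W = (b, Complex x y)" by (metis prod.exhaust complex.exhaust)
  have 1: "u\<^sup>2 + v\<^sup>2 < a\<^sup>2" and 2: "u * x + v * y = a*b"
    using assms by (auto simp: P W mink_def power2_eq_square)
  have 3: "(a*b)\<^sup>2 \<le> (u\<^sup>2+v\<^sup>2) * (x\<^sup>2+y\<^sup>2)"
  proof -
    have "(u\<^sup>2+v\<^sup>2) * (x\<^sup>2+y\<^sup>2) - (a*b)\<^sup>2 = (u * y - v * x)\<^sup>2"
      unfolding 2[symmetric] by algebra
    then show ?thesis by (smt (verit) zero_le_power2)
  qed
  have a: "a\<^sup>2 > 0" using 1 by (smt (verit) zero_le_power2)
  have main: "x\<^sup>2 + y\<^sup>2 > b\<^sup>2 \<or> W = 0"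
  proof (rule ccontr)
    assume "\<not> ?thesis"
    then have l: "x\<^sup>2+y\<^sup>2 \<le> b\<^sup>2" and n0: "W \<noteq> 0" by auto
    have "b \<noteq> 0" using l n0 by (auto simp: W zero_prod_def complex_eq_iff sum_power2_le_zero_iff)
    have "(u\<^sup>2+v\<^sup>2) * (x\<^sup>2+y\<^sup>2) \<le> (u\<^sup>2+v\<^sup>2) * b\<^sup>2" using l by (intro mult_left_mono) auto
    also have "\<dots> < a\<^sup>2 * b\<^sup>2" using 1 \<open>b \<noteq> 0\<close> by (intro mult_strict_right_mono) auto
    finally show False using 3 by (simp add: power_mult_distrib)
  qed
  have q: "mink W W = x\<^sup>2 + y\<^sup>2 - b\<^sup>2" by (simp add: W mink_def power2_eq_square)
  show "mink W W \<ge> 0" using main q by fastforce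
  show "mink W W = 0 \<Longrightarrow> W = 0" using main q by auto
qed

text \<open>The closed future cone without its apex: timelike and null vectors pointing upwards. These are the vectors
that represent points of the closed disk, null vectors being the ideal points.\<close>
definition future :: "mvec \<Rightarrow> bool" where
  "future P \<longleftrightarrow> fst P > 0 \<and> mink P P \<le> 0"

lemma future_norm: "future P \<longleftrightarrow> fst P > 0 \<and> norm (snd P) \<le> fst P"
proof -
  have "mink P P = (norm (snd P))\<^sup>2 - (fst P)\<^sup>2"
    by (simp add: mink_def cmod_power2) (simp add: power2_eq_square)
  then show ?thesis unfolding future_def
    by (auto simp: abs_le_square_iff[symmetric])
qed

lemma mink_CS: "mink P Q \<le> norm (snd P) * norm (snd Q) - fst P * fst Q"
proof -
  have "snd P \<bullet> snd Q \<le> norm (snd P) * norm (snd Q)" by (rule norm_cauchy_schwarz)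
  then show ?thesis by (simp add: mink_def inner_complex_def)
qed

lemma future_scale: "future P \<Longrightarrow> c > 0 \<Longrightarrow> future (c *\<^sub>R P)"
  by (auto simp: future_def mult_le_0_iff zero_le_mult_iff)

lemma future_add: "future P \<Longrightarrow> future Q \<Longrightarrow> future (P + Q)"
  unfolding future_norm by (auto intro: order_trans[OF norm_triangle_ineq])

lemma future_mink_le: "future P \<Longrightarrow> future Q \<Longrightarrow> mink P Q \<le> 0"
  using mink_CS[of P Q] mult_mono[of "norm (snd P)" "fst P" "norm (snd Q)" "fst Q"]
  unfolding future_norm by auto

text \<open>By \<open>orth_timelike\<close> no causal vector is orthogonal to a timelike one.\<close>
lemma future_mink_less: "future P \<Longrightarrow> mink P P < 0 \<Longrightarrow> future Q \<Longrightarrow> mink P Q < 0"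
proof -
  assume a: "future P" "mink P P < 0" "future Q"
  have "mink P Q \<noteq> 0"
    using orth_timelike[OF a(2), of Q] a(3) by (auto simp: future_def)
  then show ?thesis using future_mink_le[OF a(1,3)] by auto
qed

lemma timelike_future_iff:
  assumes "mink P P < 0" "future Q" "mink P Q < 0" shows "future P"
proof (rule ccontr)
  assume n: "\<not> future P"
  have "fst P \<noteq> 0" using assms(1) by (auto simp: mink_def) (smt (verit) zero_le_square)
  then have "future (- P)" using n assms(1) by (auto simp: future_def)
  then have "mink (- P) Q \<le> 0" using assms(2) by (rule future_mink_le)
  then show False using assms(3) by simp
qed

text \<open>Orthogonal causal vectors are parallel null vectors. The difference \<open>Q - c *\<^sub>R P\<close> with first
component \<open>0\<close> would otherwise be spacelike, but expanding its square gives a nonpositive number.\<close>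
lemma null_orth_prop:
  assumes "future P" "future Q" "mink P Q = 0"
  shows "\<exists>c>0. Q = c *\<^sub>R P"
proof -
  have fp: "fst P > 0" "fst Q > 0" using assms by (auto simp: future_def)
  define c where "c = fst Q / fst P"
  have c: "c > 0" using fp by (simp add: c_def)
  define R where "R = Q - c *\<^sub>R P"
  have f0: "fst R = 0" using fp by (simp add: R_def c_def)
  have "mink R R = mink Q Q + c\<^sup>2 * mink P P" using assms(3)
    by (simp add: R_def mink_sym power2_eq_square algebra_simps)
  also have "\<dots> \<le> 0" using assms(1,2) by (auto simp: future_def add_nonpos_nonpos mult_nonneg_nonpos)
  finally have "(Re (snd R))\<^sup>2 + (Im (snd R))\<^sup>2 \<le> 0" using f0 by (simp add: mink_def power2_eq_square)
  then have "R = 0" using f0 by (auto simp: prod_eq_iff complex_eq_iff sum_power2_le_zero_iff)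
  then show ?thesis using c by (auto simp: R_def)
qed

section \<open>The disk and the hyperboloid\<close>

text \<open>A representative of the point \<open>z\<close> in the cone. Unlike the point \<open>hpt z\<close> of the
hyperboloid, which escapes to infinity at the unit circle, it is polynomial in \<open>z\<close> and also represents ideal points.\<close>
definition lift :: "complex \<Rightarrow> mvec" where
  "lift z = (1 + (norm z)\<^sup>2, 2 * z)"

definition hpt :: "complex \<Rightarrow> mvec" where
  "hpt z = (1 / (1 - (norm z)\<^sup>2)) *\<^sub>R lift z"

text \<open>The point of the closed disk represented by a vector of the future cone, for arbitrary positive
multiples; on the hyperboloid it is the stereographic projection.\<close>
definition proj :: "mvec \<Rightarrow> complex" where
  "proj P = snd P /\<^sub>R (fst P + sqrt (- mink P P))"

lemma mem_hdisk: "z \<in> hdisk \<longleftrightarrow> norm z < 1"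
  by (simp add: hdisk_def)

lemma one_minus_pos: "z \<in> hdisk \<Longrightarrow> 1 - (norm z)\<^sup>2 > 0"
  by (simp add: mem_hdisk power_less_one_iff abs_square_less_1)

lemma mink_lift_lift: "mink (lift z) (lift w) = 4 * (z \<bullet> w) - (1 + (norm z)\<^sup>2) * (1 + (norm w)\<^sup>2)"
  by (simp add: mink_def lift_def inner_complex_def)

lemma mink_lift_self: "mink (lift z) (lift z) = - (1 - (norm z)\<^sup>2)\<^sup>2"
  by (simp add: mink_lift_lift power2_norm_eq_inner[symmetric]) algebra

lemma future_lift: "future (lift z)"
  unfolding future_def mink_lift_self by (simp add: lift_def add_pos_nonneg)

lemma lift_hpt: "z \<in> hdisk \<Longrightarrow> lift z = (1 - (norm z)\<^sup>2) *\<^sub>R hpt z"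
  using one_minus_pos[of z] by (simp add: hpt_def)

lemma mink_hpt_self: "z \<in> hdisk \<Longrightarrow> mink (hpt z) (hpt z) = -1"
  using one_minus_pos[of z] by (simp add: hpt_def mink_lift_self power2_eq_square divide_simps)

lemma future_hpt: "z \<in> hdisk \<Longrightarrow> future (hpt z)"
  using one_minus_pos[of z] by (simp add: hpt_def future_scale future_lift)

lemma continuous_on_lift [continuous_intros]: "continuous_on A f \<Longrightarrow> continuous_on A (\<lambda>x. lift (f x))"
  unfolding lift_def by (intro continuous_intros)

lemma continuous_on_hpt: "continuous_on hdisk hpt"
  unfolding hpt_def using one_minus_pos by (intro continuous_intros) fastforce

lemma proj_scale: "c > 0 \<Longrightarrow> proj (c *\<^sub>R P) = proj P"
proof -
  assume c: "c > 0"
  have "sqrt (- (c * (c * mink P P))) = c * sqrt (- mink P P)"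
    using c by (metis abs_of_pos mult.assoc mult_minus_right real_sqrt_mult real_sqrt_mult_self abs_real_def)
  then have "fst (c *\<^sub>R P) + sqrt (- mink (c *\<^sub>R P) (c *\<^sub>R P)) = c * (fst P + sqrt (- mink P P))"
    by (simp add: algebra_simps)
  then show ?thesis using c by (simp add: proj_def)
qed

lemma proj_lift: "norm z \<le> 1 \<Longrightarrow> proj (lift z) = z"
proof -
  assume z: "norm z \<le> 1"
  then have "(norm z)\<^sup>2 \<le> 1" by (simp add: power_le_one)
  then have "sqrt ((1 - (norm z)\<^sup>2)\<^sup>2) = 1 - (norm z)\<^sup>2" by (simp add: real_sqrt_abs)
  then show ?thesis by (simp add: proj_def mink_lift_self) (simp add: lift_def scaleR_conv_of_real)
qed

lemma proj_hpt: "z \<in> hdisk \<Longrightarrow> proj (hpt z) = z"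
  using one_minus_pos[of z] by (simp add: hpt_def proj_scale proj_lift mem_hdisk)

lemma lift_proj:
  assumes "future P"
  shows "norm (proj P) \<le> 1" "lift (proj P) = (2 / (fst P + sqrt (- mink P P))) *\<^sub>R P"
    "norm (proj P) = 1 \<longleftrightarrow> mink P P = 0"
proof -
  define t where "t = fst P"
  define s where "s = sqrt (- mink P P)"
  have t: "t > 0" and s: "s \<ge> 0" and s2: "s\<^sup>2 = - mink P P"
    using assms by (auto simp: future_def t_def s_def)
  have w: "(norm (snd P))\<^sup>2 = t\<^sup>2 - s\<^sup>2"
    unfolding s2 by (simp add: mink_def cmod_power2 t_def) (simp add: power2_eq_square)
  have pr: "proj P = snd P /\<^sub>R (t + s)" by (simp add: proj_def t_def s_def)
  have n: "(norm (proj P))\<^sup>2 = (t - s) / (t + s)"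
  proof -
    have "(norm (proj P))\<^sup>2 = (norm (snd P))\<^sup>2 / (t + s)\<^sup>2"
      using t s by (simp add: pr power_divide divide_inverse power_mult_distrib power_inverse mult.commute)
    also have "\<dots> = (t - s) / (t + s)" unfolding w using t s
      by (simp add: divide_simps power2_eq_square) (simp add: algebra_simps)
    finally show ?thesis .
  qed
  have "(norm (proj P))\<^sup>2 \<le> 1" unfolding n using t s by simp
  then show "norm (proj P) \<le> 1" by (simp add: power2_le_iff_abs_le abs_square_le_1)
  have "1 + (norm (proj P))\<^sup>2 = 2 / (t + s) * t" unfolding n using t s by (simp add: field_simps)
  then show "lift (proj P) = (2 / (fst P + sqrt (- mink P P))) *\<^sub>R P"
    unfolding lift_def by (simp add: prod_eq_iff pr t_def[symmetric] s_def[symmetric])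
      (simp add: scaleR_conv_of_real divide_inverse)
  have "norm (proj P) = 1 \<longleftrightarrow> (norm (proj P))\<^sup>2 = 1"
    by (metis norm_ge_zero one_power2 power2_eq_imp_eq zero_le_one)
  also have "\<dots> \<longleftrightarrow> s = 0" unfolding n using t s by (auto simp: field_simps)
  finally show "norm (proj P) = 1 \<longleftrightarrow> mink P P = 0" using s2 by auto
qed

lemma lift_proj_pos:
  assumes "future P" obtains c where "c > 0" "lift (proj P) = c *\<^sub>R P"
proof
  show "2 / (fst P + sqrt (- mink P P)) > 0"
    using assms by (auto simp: future_def intro!: divide_pos_pos add_pos_nonneg)
qed (rule lift_proj(2)[OF assms])

lemma proj_in_hdisk: "future P \<Longrightarrow> mink P P < 0 \<Longrightarrow> proj P \<in> hdisk"
  using lift_proj(1,3)[of P] by (auto simp: mem_hdisk less_le)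

lemma hpt_proj:
  assumes "future P" "mink P P = -1"
  shows "hpt (proj P) = P"
proof -
  obtain c where c: "c > 0" "lift (proj P) = c *\<^sub>R P" using lift_proj_pos[OF assms(1)] .
  have d: "proj P \<in> hdisk" using assms by (simp add: proj_in_hdisk)
  then have h: "hpt (proj P) = (c / (1 - (norm (proj P))\<^sup>2)) *\<^sub>R P"
    by (simp add: hpt_def c)
  define r where "r = c / (1 - (norm (proj P))\<^sup>2)"
  have r: "r > 0" using c one_minus_pos[OF d] by (simp add: r_def)
  have "- (r * r) = -1" using mink_hpt_self[OF d] unfolding h r_def[symmetric] by (simp add: assms)
  then have "(r - 1) * (r + 1) = 0" by (simp add: algebra_simps)
  then have "r = 1" using r by simp
  then show ?thesis by (simp add: h r_def[symmetric])
qed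

lemma proj_eq_iff:
  assumes "future P" "future Q"
  shows "proj P = proj Q \<longleftrightarrow> (\<exists>c>0. P = c *\<^sub>R Q)"
proof
  assume e: "proj P = proj Q"
  obtain c where c: "c > 0" "lift (proj P) = c *\<^sub>R P" using lift_proj_pos[OF assms(1)] .
  obtain d where d: "d > 0" "lift (proj Q) = d *\<^sub>R Q" using lift_proj_pos[OF assms(2)] .
  have "c *\<^sub>R P = d *\<^sub>R Q" using c d e by simp
  then have "(1 / c) *\<^sub>R (c *\<^sub>R P) = (1 / c) *\<^sub>R (d *\<^sub>R Q)" by simp
  then have "P = (d / c) *\<^sub>R Q" using c by simp
  moreover have "d / c > 0" using c d by simp
  ultimately show "\<exists>c>0. P = c *\<^sub>R Q" by blast
qed (auto simp: proj_scale)

lemma continuous_on_proj: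
  "continuous_on {P. future P} proj"
  unfolding proj_def
  by (intro continuous_intros) (auto simp: future_def add_pos_nonneg less_imp_neq[symmetric])

text \<open>The reversed Cauchy-Schwarz inequality: the component of \<open>Q\<close> orthogonal to \<open>P\<close> has
square \<open>(mink P Q)\<^sup>2 - 1\<close>, which is nonnegative by \<open>orth_timelike\<close>.\<close>
lemma unit_mink_le:
  assumes "future P" "mink P P = -1" "future Q" "mink Q Q = -1"
  shows "mink P Q \<le> -1" "mink P Q = -1 \<longleftrightarrow> P = Q"
proof -
  define W where "W = Q + mink P Q *\<^sub>R P"
  have o: "mink P W = 0" by (simp add: W_def assms)
  have w: "mink W W = (mink P Q)\<^sup>2 - 1"
    by (simp add: W_def assms mink_sym power2_eq_square)
  have neg: "mink P Q < 0" using future_mink_less assms by simp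
  have "1 \<le> (mink P Q)\<^sup>2" using orth_timelike(1)[of P W] o w assms by simp
  then have "1 \<le> \<bar>mink P Q\<bar>" using abs_square_less_1[of "mink P Q"] by linarith
  then show "mink P Q \<le> -1" using neg by simp
  show "mink P Q = -1 \<longleftrightarrow> P = Q"
    using orth_timelike(2)[of P W] o w assms by (auto simp: W_def)
qed

text \<open>This identifies the argument of \<open>arcosh\<close> in the distance of the disk model, so that the hyperbolic
distance becomes the one of the hyperboloid.\<close>
lemma minus_mink_hpt:
  assumes "z \<in> hdisk" "w \<in> hdisk"
  shows "- mink (hpt z) (hpt w) = 1 + 2 * (norm (z - w))\<^sup>2 / ((1 - (norm z)\<^sup>2) * (1 - (norm w)\<^sup>2))"
proof -
  define a where "a = 1 - (norm z)\<^sup>2"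
  define b where "b = 1 - (norm w)\<^sup>2"
  have ab: "a > 0" "b > 0" using assms one_minus_pos by (auto simp: a_def b_def)
  have n: "(norm (z - w))\<^sup>2 = (norm z)\<^sup>2 + (norm w)\<^sup>2 - 2 * (z \<bullet> w)"
    by (simp add: power2_norm_eq_inner inner_diff inner_commute)
  have "(norm z)\<^sup>2 = 1 - a" "(norm w)\<^sup>2 = 1 - b" by (auto simp: a_def b_def)
  note e = this
  have "mink (hpt z) (hpt w) = (4 * (z \<bullet> w) - (2 - a) * (2 - b)) / (a * b)"
    by (simp add: hpt_def mink_lift_lift e)
  then show ?thesis unfolding n a_def[symmetric] b_def[symmetric] e using ab
    by (simp add: field_simps)
qed

lemma cosh_hdist:
  assumes "z \<in> hdisk" "w \<in> hdisk"
  shows "cosh (hdist z w) = - mink (hpt z) (hpt w)" "hdist z w \<ge> 0"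
proof -
  have "1 + 2 * (norm (z - w))\<^sup>2 / ((1 - (norm z)\<^sup>2) * (1 - (norm w)\<^sup>2)) \<ge> 1"
    using assms one_minus_pos[of z] one_minus_pos[of w] by simp
  then show "cosh (hdist z w) = - mink (hpt z) (hpt w)" "hdist z w \<ge> 0"
    unfolding hdist_def minus_mink_hpt[OF assms] by (auto simp: cosh_arcosh_real arcosh_nonneg_real)
qed

lemma hdist_eq_iff:
  assumes "z \<in> hdisk" "w \<in> hdisk" "r \<ge> 0"
  shows "hdist z w = r \<longleftrightarrow> mink (hpt z) (hpt w) = - cosh r"
    "hdist z w \<le> r \<longleftrightarrow> mink (hpt z) (hpt w) \<ge> - cosh r"
  using cosh_hdist[OF assms(1,2)] cosh_real_nonneg_le_iff[of "hdist z w" r]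
    cosh_real_nonneg_le_iff[of r "hdist z w"] assms(3) by linarith+

section \<open>Geodesic lines\<close>

text \<open>A point of the hyperboloid with a unit tangent vector.\<close>
definition frame :: "mvec \<Rightarrow> mvec \<Rightarrow> bool" where
  "frame A B \<longleftrightarrow> fst A > 0 \<and> mink A A = -1 \<and> mink B B = 1 \<and> mink A B = 0"

definition gline :: "mvec \<Rightarrow> mvec \<Rightarrow> real \<Rightarrow> complex" where
  "gline A B s = proj (cosh s *\<^sub>R A + sinh s *\<^sub>R B)"

lemma frame_uminus: "frame A B \<Longrightarrow> frame A (- B)"
  by (simp add: frame_def)

lemma frame_future: "frame A B \<Longrightarrow> future A"
  by (simp add: frame_def future_def)

lemma frame_combo:
  assumes "frame A B" "\<bar>\<tau>\<bar> \<le> 1"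
  shows "future (A + \<tau> *\<^sub>R B)" "mink (A + \<tau> *\<^sub>R B) (A + \<tau> *\<^sub>R B) = \<tau>\<^sup>2 - 1"
proof -
  show m: "mink (A + \<tau> *\<^sub>R B) (A + \<tau> *\<^sub>R B) = \<tau>\<^sup>2 - 1"
    using assms by (simp add: frame_def mink_sym power2_eq_square)
  show "future (A + \<tau> *\<^sub>R B)"
  proof (rule ccontr)
    assume n: "\<not> future (A + \<tau> *\<^sub>R B)"
    have le: "mink (A + \<tau> *\<^sub>R B) (A + \<tau> *\<^sub>R B) \<le> 0" using m assms(2) by (simp add: abs_square_le_1)
    then have np: "fst (A + \<tau> *\<^sub>R B) \<le> 0" using n by (simp add: future_def)
    have o: "mink A (A + \<tau> *\<^sub>R B) = -1" using assms(1) by (simp add: frame_def)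
    show False
    proof (cases "fst (A + \<tau> *\<^sub>R B) = 0")
      case True
      define P where "P = A + \<tau> *\<^sub>R B"
      have "(Re (snd P))\<^sup>2 + (Im (snd P))\<^sup>2 \<le> 0" using le True
        by (simp add: mink_def power2_eq_square P_def[symmetric])
      then have "P = 0" using True by (auto simp: prod_eq_iff complex_eq_iff sum_power2_le_zero_iff P_def)
      then show False using o unfolding P_def by (metis mink_linear(10) zero_neq_neg_one)
    next
      case False
      then have "future (- (A + \<tau> *\<^sub>R B))" using np le unfolding future_def by (simp only: mink_linear fst_uminus) linarith
      then have "mink A (- (A + \<tau> *\<^sub>R B)) \<le> 0" by (rule future_mink_le[OF frame_future[OF assms(1)]])
      then show False using o by (simp only: mink_linear)
    qed
  qed
qed

lemma cosh_combo:
  "cosh s *\<^sub>R A + sinh s *\<^sub>R B = cosh s *\<^sub>R (A + tanh s *\<^sub>R (B::mvec))"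
  by (simp add: tanh_def scaleR_add_right)

lemma gline_tanh: "gline A B s = proj (A + tanh s *\<^sub>R B)"
  unfolding gline_def cosh_combo by (simp add: proj_scale)

lemma abs_tanh_less: "\<bar>tanh (s::real)\<bar> < 1"
  using tanh_real_lt_1[of s] tanh_real_gt_neg1[of s] by auto

lemma frame_curve:
  assumes "frame A B"
  shows "future (cosh s *\<^sub>R A + sinh s *\<^sub>R B)"
    "mink (cosh s *\<^sub>R A + sinh s *\<^sub>R B) (cosh t *\<^sub>R A + sinh t *\<^sub>R B) = - cosh (s - t)"
proof -
  show "future (cosh s *\<^sub>R A + sinh s *\<^sub>R B)"
    unfolding cosh_combo using frame_combo(1)[OF assms] abs_tanh_less[of s]
    by (intro future_scale) (auto simp: less_imp_le)
  show "mink (cosh s *\<^sub>R A + sinh s *\<^sub>R B) (cosh t *\<^sub>R A + sinh t *\<^sub>R B) = - cosh (s - t)"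
    using assms by (simp add: frame_def mink_sym cosh_diff algebra_simps)
qed

lemma hpt_gline:
  assumes "frame A B"
  shows "gline A B s \<in> hdisk" "hpt (gline A B s) = cosh s *\<^sub>R A + sinh s *\<^sub>R B"
  using frame_curve[OF assms, of s] frame_curve(2)[OF assms, of s s]
  by (auto simp: gline_def intro!: proj_in_hdisk hpt_proj)

lemma hpt_inj: "z \<in> hdisk \<Longrightarrow> w \<in> hdisk \<Longrightarrow> hpt z = hpt w \<Longrightarrow> z = w"
  by (metis proj_hpt)

lemma geodesic_line_gline:
  assumes "frame A B" shows "geodesic_line (gline A B)"
  unfolding geodesic_line_def
proof (intro conjI allI)
  show "range (gline A B) \<subseteq> hdisk" using hpt_gline[OF assms] by auto
  fix s t
  show "hdist (gline A B s) (gline A B t) = \<bar>s - t\<bar>"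
    using hpt_gline[OF assms] frame_curve(2)[OF assms]
    by (subst hdist_eq_iff) auto
qed

text \<open>A geodesic line is only assumed to preserve distances. Two of its points determine a frame
\<open>(A, B)\<close>. The products of \<open>\<gamma> s\<close> with \<open>A\<close> and \<open>B\<close> are known from distances, and the remaining
component of \<open>\<gamma> s\<close> has square \<open>0\<close> and is orthogonal to \<open>A\<close>, hence vanishes.\<close>
lemma geodesic_line_frame:
  assumes "geodesic_line \<gamma>"
  obtains A B where "frame A B" "\<gamma> = gline A B"
proof -
  have h: "\<gamma> s \<in> hdisk" for s using assms by (auto simp: geodesic_line_def)
  define P where "P s = hpt (\<gamma> s)" for s
  have m: "mink (P s) (P t) = - cosh (s - t)" for s t
  proof -
    have "hdist (\<gamma> s) (\<gamma> t) = \<bar>s - t\<bar>" using assms by (auto simp: geodesic_line_def)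
    then show ?thesis using hdist_eq_iff(1)[OF h h, of "\<bar>s - t\<bar>" s t] by (simp add: P_def)
  qed
  define A where "A = P 0"
  define B where "B = (1 / sinh 1) *\<^sub>R (P 1 - cosh 1 *\<^sub>R P 0)"
  have s1: "sinh (1::real) > 0" by simp
  have c2: "cosh 1 * cosh 1 = 1 + sinh 1 * sinh (1::real)"
    using cosh_square_eq[of "1::real"] by (simp add: power2_eq_square)
  have f: "frame A B"
    unfolding frame_def
  proof (intro conjI)
    show "fst A > 0" using future_hpt[OF h] by (auto simp: A_def P_def future_def)
    show "mink A A = -1" by (simp add: A_def m)
    show "mink A B = 0" by (simp add: A_def B_def m)
    have "mink B B = (cosh 1 * cosh 1 - 1) / (sinh 1 * sinh 1)"
      by (simp add: B_def m)
    then show "mink B B = 1" using s1 c2 by simp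
  qed
  have mA: "mink (P s) A = - cosh s" for s by (simp add: A_def m)
  have mB: "mink (P s) B = sinh s" for s
  proof -
    have "mink (P s) B = (cosh s * cosh 1 - cosh (s - 1)) / sinh 1" by (simp add: B_def m)
    also have "\<dots> = sinh s" using s1 by (simp add: cosh_diff)
    finally show ?thesis .
  qed
  have "P s = cosh s *\<^sub>R A + sinh s *\<^sub>R B" for s
  proof -
    define W where "W = P s - (cosh s *\<^sub>R A + sinh s *\<^sub>R B)"
    have "mink A W = 0" using f mA by (simp add: W_def frame_def mink_sym)
    moreover have "mink W W = 0"
      using f mA[of s] mB[of s] m[of s s] cosh_square_eq[of s]
      by (simp add: W_def frame_def mink_sym power2_eq_square algebra_simps)
    ultimately have "W = 0" using orth_timelike(2)[of A W] f by (simp add: frame_def)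
    then show ?thesis by (simp add: W_def)
  qed
  then have "\<gamma> s = gline A B s" for s
    using proj_hpt[OF h, of s] by (simp add: gline_def P_def)
  then show thesis using f that by blast
qed

text \<open>The coordinate of a time on an extended line for which line segments in the projective (Klein) model
are intervals: \<open>ext_line (gline A B) x = proj (A + th x *\<^sub>R B)\<close>.\<close>
definition th :: "ereal \<Rightarrow> real" where
  "th x = (if x = \<infinity> then 1 else if x = -\<infinity> then -1 else tanh (real_of_ereal x))"

lemma th_simps [simp]: "th \<infinity> = 1" "th (-\<infinity>) = -1" "th (ereal r) = tanh r" "th 0 = 0"
  by (simp_all add: th_def)

lemma th_bounds: "\<bar>th x\<bar> \<le> 1"
  by (cases x) (auto simp: less_imp_le abs_tanh_less)

lemma tanh_strict_mono: "x < y \<Longrightarrow> tanh x < tanh (y::real)"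
  by (rule strict_monoD[OF tanh_real_strict_mono])

lemma th_less: "x < y \<Longrightarrow> th x < th y"
  by (cases x; cases y) (use tanh_real_lt_1 tanh_real_gt_neg1 in \<open>auto simp: tanh_strict_mono\<close>)

lemma th_le_iff: "th x \<le> th y \<longleftrightarrow> x \<le> y"
  using th_less[of x y] th_less[of y x] by (cases x y rule: linorder_cases) auto

lemma tanh_artanh:
  assumes "\<bar>t\<bar> < 1" shows "tanh (artanh t) = (t::real)"
proof -
  have e: "exp (- 2 * artanh t) = (1 - t) / (1 + t)"
    using assms by (simp add: artanh_def exp_minus)
  show ?thesis unfolding tanh_real_altdef e using assms by (simp add: field_simps)
qed

lemma th_surj: assumes "\<bar>\<tau>\<bar> \<le> 1" obtains x where "th x = \<tau>"
proof -
  consider "\<tau> = 1" | "\<tau> = -1" | "\<bar>\<tau>\<bar> < 1" using assms by linarith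
  then show thesis
  proof cases
    case 3
    then have "th (ereal (artanh \<tau>)) = \<tau>" by (simp add: tanh_artanh)
    then show thesis using that by blast
  qed (use that[of \<infinity>] that[of "-\<infinity>"] in auto)
qed

lemma th_image: "th ` {a..b} = {th a..th b}"
proof
  show "th ` {a..b} \<subseteq> {th a..th b}" by (auto simp: th_le_iff)
  show "{th a..th b} \<subseteq> th ` {a..b}"
  proof
    fix t assume t: "t \<in> {th a..th b}"
    then have "\<bar>t\<bar> \<le> 1" using th_bounds[of a] th_bounds[of b] by auto
    then obtain x where "th x = t" by (rule th_surj)
    then show "t \<in> th ` {a..b}" using t by (auto simp: th_le_iff)
  qed
qed

lemma gline_tendsto:
  assumes "frame A B" "(tanh \<longlongrightarrow> \<tau>) F" "\<bar>\<tau>\<bar> \<le> 1"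
  shows "(gline A B \<longlongrightarrow> proj (A + \<tau> *\<^sub>R B)) F"
proof -
  have c: "continuous_on {-1..1} (\<lambda>t. proj (A + t *\<^sub>R B))"
    by (rule continuous_on_compose2[OF continuous_on_proj])
       (auto intro!: continuous_intros frame_combo(1)[OF assms(1)])
  have "((\<lambda>s. proj (A + tanh s *\<^sub>R B)) \<longlongrightarrow> proj (A + \<tau> *\<^sub>R B)) F"
    by (rule continuous_on_tendsto_compose[OF c assms(2)])
       (use assms(3) tanh_real_lt_1 tanh_real_gt_neg1 in \<open>auto simp: abs_le_iff intro!: always_eventually less_imp_le\<close>)
  moreover have "gline A B = (\<lambda>s. proj (A + tanh s *\<^sub>R B))" by (auto simp: gline_tanh)
  ultimately show ?thesis by simp
qed

lemma ext_line_gline: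
  assumes "frame A B"
  shows "ext_line (gline A B) x = proj (A + th x *\<^sub>R B)"
proof (cases x)
  case PInf
  have "(gline A B \<longlongrightarrow> proj (A + 1 *\<^sub>R B)) at_top"
    using assms tanh_real_at_top by (intro gline_tendsto) auto
  then have "Lim at_top (gline A B) = proj (A + 1 *\<^sub>R B)" by (intro tendsto_Lim) auto
  then show ?thesis using PInf by (simp add: ext_line_def)
next
  case MInf
  have "(gline A B \<longlongrightarrow> proj (A + (-1) *\<^sub>R B)) at_bot"
    using assms tanh_real_at_bot by (intro gline_tendsto) auto
  then have "Lim at_bot (gline A B) = proj (A + (-1) *\<^sub>R B)" by (intro tendsto_Lim) auto
  then show ?thesis using MInf by (simp add: ext_line_def)
qed (simp add: ext_line_def gline_tanh)

lemma ext_line_image: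
  assumes "frame A B"
  shows "ext_line (gline A B) ` {a..b} = (\<lambda>t. proj (A + t *\<^sub>R B)) ` {th a..th b}"
  unfolding th_image[symmetric] image_image by (simp add: ext_line_gline[OF assms])

section \<open>Velocities of curves\<close>

text \<open>The derivative of \<open>hpt\<close> at \<open>z\<close> in direction \<open>v\<close>.\<close>
definition dhpt :: "complex \<Rightarrow> complex \<Rightarrow> mvec" where
  "dhpt z v = (4 * (z \<bullet> v) / (1 - (norm z)\<^sup>2)\<^sup>2,
     (2 / (1 - (norm z)\<^sup>2)) *\<^sub>R v + (4 * (z \<bullet> v) / (1 - (norm z)\<^sup>2)\<^sup>2) *\<^sub>R z)"

text \<open>The embedding into the hyperboloid is an isometry for the conformal metric of the disk. Angles and
lengths can therefore be computed in Minkowski space.\<close>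
lemma mink_dhpt:
  assumes "z \<in> hdisk"
  shows "mink (dhpt z v) (dhpt z w) = 4 * (v \<bullet> w) / (1 - (norm z)\<^sup>2)\<^sup>2"
proof -
  define m where "m = 1 - (norm z)\<^sup>2"
  have m: "m > 0" using one_minus_pos[OF assms] by (simp add: m_def)
  have zz: "z \<bullet> z = 1 - m" by (simp add: m_def power2_norm_eq_inner)
  have k: "mink P Q = snd P \<bullet> snd Q - fst P * fst Q" for P Q
    by (simp add: mink_def inner_complex_def)
  have "mink (dhpt z v) (dhpt z w) = 4 * (v \<bullet> w) / m\<^sup>2 + 16 * (z \<bullet> v) * (z \<bullet> w) / m^3
     + 16 * (z \<bullet> v) * (z \<bullet> w) * (z \<bullet> z) / m^4 - 16 * (z \<bullet> v) * (z \<bullet> w) / m^4"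
    unfolding k dhpt_def m_def[symmetric]
    by (simp add: inner_add inner_commute field_simps eval_nat_numeral)
  also have "\<dots> = 4 * (v \<bullet> w) / m\<^sup>2" unfolding zz using m
    by (simp add: field_simps eval_nat_numeral)
  finally show ?thesis by (simp add: m_def)
qed

lemma hpt_has_vector_derivative:
  assumes "(\<gamma> has_vector_derivative v) (at s within T)" "\<gamma> s \<in> hdisk"
  shows "((\<lambda>x. hpt (\<gamma> x)) has_vector_derivative dhpt (\<gamma> s) v) (at s within T)"
proof -
  define m where "m = 1 - (norm (\<gamma> s))\<^sup>2"
  have m: "m > 0" using one_minus_pos[OF assms(2)] by (simp add: m_def)
  have mm: "\<gamma> s \<bullet> \<gamma> s = 1 - m" by (simp add: m_def power2_norm_eq_inner)
  have g: "(\<gamma> has_derivative (\<lambda>x. x *\<^sub>R v)) (at s within T)"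
    using assms(1) by (simp add: has_vector_derivative_def)
  have eq: "hpt z = ((1 + z \<bullet> z) / (1 - z \<bullet> z), (1 / (1 - z \<bullet> z)) *\<^sub>R (2 * z))" for z
    by (simp add: hpt_def lift_def power2_norm_eq_inner)
  have 1: "((\<lambda>x. (1 + \<gamma> x \<bullet> \<gamma> x) / (1 - \<gamma> x \<bullet> \<gamma> x)) has_real_derivative
      4 * (\<gamma> s \<bullet> v) / m\<^sup>2) (at s within T)"
  proof -
    have i: "((\<lambda>x. \<gamma> x \<bullet> \<gamma> x) has_real_derivative 2 * (\<gamma> s \<bullet> v)) (at s within T)"
      unfolding has_field_derivative_def
      by (rule has_derivative_eq_rhs[OF has_derivative_inner[OF g g]]) (auto simp: inner_commute algebra_simps)
    show ?thesis using m
      by (auto intro!: derivative_eq_intros i simp: mm) (simp add: field_simps power2_eq_square)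
  qed
  have 2: "((\<lambda>x. (1 / (1 - \<gamma> x \<bullet> \<gamma> x))) has_real_derivative 2 * (\<gamma> s \<bullet> v) / m\<^sup>2) (at s within T)"
  proof -
    have i: "((\<lambda>x. \<gamma> x \<bullet> \<gamma> x) has_real_derivative 2 * (\<gamma> s \<bullet> v)) (at s within T)"
      unfolding has_field_derivative_def
      by (rule has_derivative_eq_rhs[OF has_derivative_inner[OF g g]]) (auto simp: inner_commute algebra_simps)
    show ?thesis using m
      by (auto intro!: derivative_eq_intros i simp: mm) (simp add: field_simps power2_eq_square)
  qed
  have 3: "((\<lambda>x. (1 / (1 - \<gamma> x \<bullet> \<gamma> x)) *\<^sub>R (2 * \<gamma> x)) has_vector_derivative
     (1 / m) *\<^sub>R (2 * v) + (2 * (\<gamma> s \<bullet> v) / m\<^sup>2) *\<^sub>R (2 * \<gamma> s)) (at s within T)"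
    by (rule has_vector_derivative_eq_rhs[OF has_vector_derivative_scaleR[OF 2
          has_vector_derivative_mult_right[OF assms(1)]]]) (simp add: mm)
  show ?thesis unfolding eq
    by (rule has_vector_derivative_eq_rhs[OF has_vector_derivative_Pair[OF
          1[unfolded has_real_derivative_iff_has_vector_derivative] 3]])
       (simp add: dhpt_def m_def scaleR_conv_of_real)
qed

lemma proj_has_vector_derivative:
  assumes Y: "(Y has_vector_derivative D) (at s)"
    and S: "open S" "s \<in> S" "\<And>x. x \<in> S \<Longrightarrow> future (Y x)" "\<And>x. x \<in> S \<Longrightarrow> mink (Y x) (Y x) = -1"
  shows "((\<lambda>x. proj (Y x)) has_vector_derivative
    (1 / (1 + fst (Y s))\<^sup>2) *\<^sub>R ((1 + fst (Y s)) *\<^sub>R snd D - fst D *\<^sub>R snd (Y s))) (at s)"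
proof -
  have e: "(1 / (1 + fst (Y x))) *\<^sub>R snd (Y x) = proj (Y x)" if "x \<in> S" for x
    using S(4)[OF that] by (simp add: proj_def divide_inverse add.commute)
  have p: "1 + fst (Y s) > 0" using S(3)[OF S(2)] by (simp add: future_def)
  have a: "((\<lambda>x. fst (Y x)) has_real_derivative fst D) (at s)"
    using Y unfolding has_vector_derivative_def has_field_derivative_def
    by (auto dest!: has_derivative_fst elim!: has_derivative_eq_rhs)
  have b: "((\<lambda>x. snd (Y x)) has_vector_derivative snd D) (at s)"
    using Y unfolding has_vector_derivative_def
    by (auto dest!: has_derivative_snd)
  have c: "((\<lambda>x. 1 / (1 + fst (Y x))) has_real_derivative - (fst D / (1 + fst (Y s))\<^sup>2)) (at s)"
    using p by (auto intro!: derivative_eq_intros a simp: power2_eq_square)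
  have "((\<lambda>x. (1 / (1 + fst (Y x))) *\<^sub>R snd (Y x)) has_vector_derivative
     (1 / (1 + fst (Y s))\<^sup>2) *\<^sub>R ((1 + fst (Y s)) *\<^sub>R snd D - fst D *\<^sub>R snd (Y s))) (at s)"
    using p
    by (auto intro!: has_vector_derivative_eq_rhs[OF has_vector_derivative_scaleR[OF c b]]
        simp: scaleR_diff_right divide_simps power2_eq_square)
  then show ?thesis
    by (rule has_vector_derivative_transform_within_open[OF _ S(1,2) e])
qed

text \<open>As \<open>hpt\<close> inverts \<open>proj\<close> on the hyperboloid, the velocity of the projected curve is mapped
back to the velocity of the curve by the chain rule.\<close>
lemma proj_curve_velocity:
  assumes Y: "(Y has_vector_derivative D) (at s)"
    and S: "open S" "s \<in> S" "\<And>x. x \<in> S \<Longrightarrow> future (Y x)" "\<And>x. x \<in> S \<Longrightarrow> mink (Y x) (Y x) = -1"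
  shows "((\<lambda>x. proj (Y x)) has_vector_derivative vector_derivative (\<lambda>x. proj (Y x)) (at s)) (at s)"
    "dhpt (proj (Y s)) (vector_derivative (\<lambda>x. proj (Y x)) (at s)) = D"
proof -
  show 1: "((\<lambda>x. proj (Y x)) has_vector_derivative vector_derivative (\<lambda>x. proj (Y x)) (at s)) (at s)"
    using proj_has_vector_derivative[OF Y S] by (simp add: vector_derivative_at)
  have "((\<lambda>x. hpt (proj (Y x))) has_vector_derivative
     dhpt (proj (Y s)) (vector_derivative (\<lambda>x. proj (Y x)) (at s))) (at s)"
    by (rule hpt_has_vector_derivative[OF 1]) (simp add: proj_in_hdisk S)
  then have "(Y has_vector_derivative
     dhpt (proj (Y s)) (vector_derivative (\<lambda>x. proj (Y x)) (at s))) (at s)"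
    by (rule has_vector_derivative_transform_within_open[OF _ S(1,2)]) (simp add: hpt_proj S)
  then show "dhpt (proj (Y s)) (vector_derivative (\<lambda>x. proj (Y x)) (at s)) = D"
    using Y by (rule vector_derivative_unique_at)
qed

lemma gline_velocity:
  assumes "frame A B"
  shows "(gline A B has_vector_derivative vector_derivative (gline A B) (at s)) (at s)"
    "dhpt (gline A B s) (vector_derivative (gline A B) (at s)) = sinh s *\<^sub>R A + cosh s *\<^sub>R B"
proof -
  have d: "((\<lambda>s. cosh s *\<^sub>R A + sinh s *\<^sub>R B) has_vector_derivative sinh s *\<^sub>R A + cosh s *\<^sub>R B) (at s)"
    by (auto intro!: derivative_eq_intros)
  have e: "gline A B = (\<lambda>s. proj (cosh s *\<^sub>R A + sinh s *\<^sub>R B))" by (auto simp: gline_def)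
  have m: "mink (cosh x *\<^sub>R A + sinh x *\<^sub>R B) (cosh x *\<^sub>R A + sinh x *\<^sub>R B) = -1" for x
    using frame_curve(2)[OF assms, of x x] by simp
  show "(gline A B has_vector_derivative vector_derivative (gline A B) (at s)) (at s)"
    "dhpt (gline A B s) (vector_derivative (gline A B) (at s)) = sinh s *\<^sub>R A + cosh s *\<^sub>R B"
    unfolding e by (rule proj_curve_velocity[OF d open_UNIV UNIV_I frame_curve(1)[OF assms] m])+
qed

section \<open>Half planes and equidistant curves\<close>

text \<open>The Minkowski cross product, which is orthogonal to both factors.\<close>
definition mcross :: "mvec \<Rightarrow> mvec \<Rightarrow> mvec" where
  "mcross P Q = (Im (snd P) * Re (snd Q) - Re (snd P) * Im (snd Q),
     Complex (Im (snd P) * fst Q - fst P * Im (snd Q)) (fst P * Re (snd Q) - Re (snd P) * fst Q))"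

lemma mink_mcross:
  "mink P (mcross P Q) = 0" "mink Q (mcross P Q) = 0"
  "mink (mcross P Q) (mcross P Q) = (mink P Q)\<^sup>2 - mink P P * mink Q Q"
  unfolding mcross_def mink_def by (simp_all add: algebra_simps power2_eq_square)

lemma frame_normal:
  assumes "frame A B" obtains n where "mink n n = 1" "mink A n = 0" "mink B n = 0"
  using that[of "mcross A B"] assms by (simp add: mink_mcross frame_def)

lemma frame_exists:
  assumes "mink n n = 1" obtains A B where "frame A B" "mink A n = 0" "mink B n = 0"
proof -
  define w where "w = norm (snd n)"
  have w2: "w\<^sup>2 = 1 + (fst n)\<^sup>2" using assms
    by (simp add: w_def mink_def cmod_power2) (simp add: power2_eq_square)
  then have "w\<^sup>2 > 0" by (simp add: add_pos_nonneg)
  then have w: "w > 0" by (simp add: w_def)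
  obtain a x y where n: "n = (a, Complex x y)" by (metis prod.exhaust complex.exhaust)
  have xy: "x\<^sup>2 + y\<^sup>2 = w\<^sup>2" by (simp add: w_def n cmod_power2)
  have a: "a\<^sup>2 = w\<^sup>2 - 1" using w2 by (simp add: n)
  define A :: mvec where "A = (w, Complex (a * x / w) (a * y / w))"
  define B :: mvec where "B = (0, Complex (- y / w) (x / w))"
  have "mink A A = (a\<^sup>2 * (x\<^sup>2 + y\<^sup>2) - w\<^sup>2 * w\<^sup>2) / w\<^sup>2" using w
    by (simp add: A_def mink_def field_simps power2_eq_square)
  also have "\<dots> = -1" unfolding xy a using w by (simp add: field_simps power2_eq_square)
  finally have AA: "mink A A = -1" .
  have "mink B B = (x\<^sup>2 + y\<^sup>2) / w\<^sup>2" using w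
    by (simp add: B_def mink_def field_simps power2_eq_square)
  then have BB: "mink B B = 1" unfolding xy using w by simp
  have "mink A n = a * ((x\<^sup>2 + y\<^sup>2) - w\<^sup>2) / w" using w
    by (simp add: A_def n mink_def field_simps power2_eq_square)
  then have An: "mink A n = 0" unfolding xy by simp
  have "mink A B = 0" "mink B n = 0" using w
    by (auto simp: A_def B_def n mink_def field_simps)
  then show thesis using that[of A B] AA BB An w by (simp add: frame_def A_def)
qed

lemma frame_point:
  assumes "frame A B" "mink n n = 1" "mink A n = 0" "mink B n = 0"
  shows "frame (cosh u *\<^sub>R A + sinh u *\<^sub>R B) n"
  using frame_curve(1)[OF assms(1), of u] frame_curve(2)[OF assms(1), of u u] assms
  by (simp add: frame_def future_def mink_sym)

text \<open>Fermi coordinates along the geodesic with unit normal \<open>n\<close>: \<open>u\<close> is the position of the foot of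
the perpendicular from \<open>z\<close>, and \<open>v\<close> is the signed distance, with \<open>sinh v = mink (hpt z) n\<close>.\<close>
lemma fermi_surj:
  assumes "frame A B" "mink n n = 1" "mink A n = 0" "mink B n = 0" "z \<in> hdisk"
  obtains u v where "z = gline (cosh u *\<^sub>R A + sinh u *\<^sub>R B) n v"
    "hpt z = cosh v *\<^sub>R (cosh u *\<^sub>R A + sinh u *\<^sub>R B) + sinh v *\<^sub>R n"
    "mink (hpt z) n = sinh v"
proof -
  define X where "X = hpt z"
  define \<alpha> where "\<alpha> = - mink X A"
  define \<beta> where "\<beta> = mink X B"
  define v where "v = arsinh (mink X n)"
  define u where "u = arsinh (\<beta> / cosh v)"
  have v: "sinh v = mink X n" by (simp add: v_def)
  have X: "X = \<alpha> *\<^sub>R A + \<beta> *\<^sub>R B + sinh v *\<^sub>R n"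
    using orthonormal_expand[of A B n X] assms by (simp add: frame_def \<alpha>_def \<beta>_def v mink_sym)
  have XX: "mink X X = -1" "future X" using assms(5) by (auto simp: X_def mink_hpt_self future_hpt)
  have "mink X X = - \<alpha>\<^sup>2 + \<beta>\<^sup>2 + (sinh v)\<^sup>2"
    unfolding X using assms(1-4) by (simp add: frame_def mink_sym power2_eq_square)
  then have "\<alpha>\<^sup>2 = \<beta>\<^sup>2 + (cosh v)\<^sup>2" using XX by (simp add: cosh_square_eq)
  then have "\<alpha>\<^sup>2 = (cosh v)\<^sup>2 * (cosh u)\<^sup>2"
    by (simp add: cosh_square_eq[of u]) (simp add: u_def field_simps)
  moreover have "\<alpha> > 0" using future_mink_less[of A X] XX frame_future[OF assms(1)] assms(1)
    by (simp add: \<alpha>_def frame_def mink_sym)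
  ultimately have \<alpha>: "\<alpha> = cosh v * cosh u"
    by (subst power2_eq_iff_nonneg[symmetric]) (simp_all add: power_mult_distrib less_imp_le)
  have \<beta>: "\<beta> = cosh v * sinh u" by (simp add: u_def)
  have X': "X = cosh v *\<^sub>R (cosh u *\<^sub>R A + sinh u *\<^sub>R B) + sinh v *\<^sub>R n"
    unfolding X \<alpha> \<beta> by (simp add: scaleR_add_right)
  then have "z = gline (cosh u *\<^sub>R A + sinh u *\<^sub>R B) n v"
    unfolding gline_def using proj_hpt[OF assms(5)] by (simp add: X_def)
  then show thesis using X' v[symmetric] unfolding X_def by (rule that)
qed

lemma fermi_level:
  assumes "frame A B" "mink n n = 1" "mink A n = 0" "mink B n = 0"
  shows "mink (hpt (gline (cosh u *\<^sub>R A + sinh u *\<^sub>R B) n v)) n = sinh v"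
  using hpt_gline[OF frame_point[OF assms], of u v] assms by simp

definition level :: "mvec \<Rightarrow> real set \<Rightarrow> complex set" where
  "level n J = {z \<in> hdisk. mink (hpt z) n \<in> J}"

text \<open>In Fermi coordinates the set is the image of the connected set \<open>UNIV \<times> J\<close>.\<close>
lemma level_connected:
  assumes "mink n n = 1" "connected J"
  shows "connected (level n J)" "J \<noteq> {} \<Longrightarrow> level n J \<noteq> {}"
proof -
  obtain A B where AB: "frame A B" "mink A n = 0" "mink B n = 0"
    using frame_exists[OF assms(1)] .
  note fs = AB(1) assms(1) AB(2,3)
  define g where "g = (\<lambda>p::real\<times>real. gline (cosh (fst p) *\<^sub>R A + sinh (fst p) *\<^sub>R B) n (arsinh (snd p)))"
  have im: "level n J = g ` (UNIV \<times> J)"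
  proof
    show "g ` (UNIV \<times> J) \<subseteq> level n J"
      by (auto simp: level_def g_def fermi_level[OF fs] hpt_gline(1)[OF frame_point[OF fs]])
    show "level n J \<subseteq> g ` (UNIV \<times> J)"
    proof
      fix z assume z: "z \<in> level n J"
      then have "z \<in> hdisk" by (simp add: level_def)
      then obtain u v where uv: "z = gline (cosh u *\<^sub>R A + sinh u *\<^sub>R B) n v" "mink (hpt z) n = sinh v"
        by (rule fermi_surj[OF fs])
      then have "z = g (u, sinh v)" by (simp add: g_def arsinh_sinh_real)
      moreover have "sinh v \<in> J" using z uv(2) by (simp add: level_def)
      ultimately show "z \<in> g ` (UNIV \<times> J)" by blast
    qed
  qed
  have ash: "continuous_on (UNIV \<times> J) (\<lambda>x. arsinh (snd x :: real))"
    by (rule continuous_on_compose2[OF continuous_on_arsinh[of UNIV]]) (auto intro!: continuous_intros)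
  have "continuous_on (UNIV \<times> J) g"
    unfolding g_def gline_def
    by (rule continuous_on_compose2[OF continuous_on_proj])
       (use frame_curve(1)[OF frame_point[OF fs]] in \<open>auto intro!: continuous_intros ash simp del: sinh_arsinh_real cosh_arsinh_real\<close>)
  moreover have "connected ((UNIV::real set) \<times> J)"
    by (intro connected_Times assms connected_UNIV)
  ultimately show "connected (level n J)" unfolding im by (rule connected_continuous_image)
  show "J \<noteq> {} \<Longrightarrow> level n J \<noteq> {}" unfolding im by auto
qed

lemma components_split:
  fixes f :: "complex \<Rightarrow> real"
  assumes "continuous_on U f" "connected {z\<in>U. f z < c}" "connected {z\<in>U. f z > c}"
    "{z\<in>U. f z < c} \<noteq> {}" "{z\<in>U. f z > c} \<noteq> {}"
  shows "components {z\<in>U. f z \<noteq> c} = {{z\<in>U. f z < c}, {z\<in>U. f z > c}}"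
proof -
  let ?A = "{z\<in>U. f z < c}" and ?B = "{z\<in>U. f z > c}" and ?S = "{z\<in>U. f z \<noteq> c}"
  have split: "d \<subseteq> ?A \<or> d \<subseteq> ?B" if cd: "connected d" and dS: "d \<subseteq> ?S" for d
  proof (rule ccontr)
    assume "\<not> ?thesis"
    then obtain x y where xy: "x \<in> d" "f x > c" "y \<in> d" "f y < c" using dS by force
    have "connected (f ` d)"
      using cd dS assms(1) by (intro connected_continuous_image) (auto elim: continuous_on_subset)
    then have "c \<in> f ` d" using xy connectedD_interval[of "f ` d" "f y" "f x" c] by auto
    then show False using dS by auto
  qed
  show ?thesis
  proof (rule set_eqI)
    fix C
    show "C \<in> components ?S \<longleftrightarrow> C \<in> {?A, ?B}"
    proof
      assume C: "C \<in> components ?S"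
      then have "C \<noteq> {}" "C \<subseteq> ?S" "connected C" and mx: "\<And>d. d \<noteq> {} \<Longrightarrow> C \<subseteq> d \<Longrightarrow> d \<subseteq> ?S \<Longrightarrow> connected d \<Longrightarrow> d = C"
        by (auto simp: in_components_maximal)
      then have "C \<subseteq> ?A \<or> C \<subseteq> ?B" using split by blast
      then show "C \<in> {?A, ?B}"
      proof
        assume "C \<subseteq> ?A"
        then have "?A = C" using mx[of ?A] assms(2,4) by auto
        then show ?thesis by blast
      next
        assume "C \<subseteq> ?B"
        then have "?B = C" using mx[of ?B] assms(3,5) by auto
        then show ?thesis by blast
      qed
    next
      assume "C \<in> {?A, ?B}"
      then consider "C = ?A" | "C = ?B" by blast
      then show "C \<in> components ?S"
      proof cases
        case 1
        show ?thesis unfolding in_components_maximal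
        proof (intro conjI allI impI)
          fix d assume d: "d \<noteq> {} \<and> C \<subseteq> d \<and> d \<subseteq> ?S \<and> connected d"
          then have "d \<subseteq> ?A \<or> d \<subseteq> ?B" using split by blast
          moreover have "\<not> d \<subseteq> ?B" using d assms(4) 1 by fastforce
          ultimately show "d = C" using d 1 by blast
        qed (use 1 assms in auto)
      next
        case 2
        show ?thesis unfolding in_components_maximal
        proof (intro conjI allI impI)
          fix d assume d: "d \<noteq> {} \<and> C \<subseteq> d \<and> d \<subseteq> ?S \<and> connected d"
          then have "d \<subseteq> ?A \<or> d \<subseteq> ?B" using split by blast
          moreover have "\<not> d \<subseteq> ?A" using d assms(5) 2 by fastforce
          ultimately show "d = C" using d 2 by blast
        qed (use 2 assms in auto)
      qed
    qed
  qed
qed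

lemma continuous_on_level: "continuous_on U f \<Longrightarrow> f ` U \<subseteq> hdisk \<Longrightarrow> continuous_on U (\<lambda>z. mink (hpt (f z)) n)"
  by (intro continuous_intros continuous_on_compose2[OF continuous_on_hpt])

lemma components_level_compl:
  assumes "mink n n = 1"
  shows "components (hdisk - {z\<in>hdisk. mink (hpt z) n = c}) =
    {{z\<in>hdisk. mink (hpt z) n < c}, {z\<in>hdisk. mink (hpt z) n > c}}"
proof -
  have "hdisk - {z\<in>hdisk. mink (hpt z) n = c} = {z\<in>hdisk. mink (hpt z) n \<noteq> c}" by auto
  moreover have "{z\<in>hdisk. mink (hpt z) n < c} = level n {..<c}" "{z\<in>hdisk. mink (hpt z) n > c} = level n {c<..}"
    by (auto simp: level_def)
  moreover have "continuous_on hdisk (\<lambda>z. mink (hpt z) n)"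
    by (intro continuous_on_level continuous_on_id) auto
  ultimately show ?thesis
    using components_split[of hdisk "\<lambda>z. mink (hpt z) n" c] level_connected[OF assms]
    by (simp only: connected_Iio connected_Ioi greaterThan_non_empty lessThan_non_empty not_False_eq_True)
qed

definition axis :: "mvec \<Rightarrow> complex set" where
  "axis n = {z \<in> hdisk. mink (hpt z) n = 0}"

lemma range_gline:
  assumes "frame A B" "mink n n = 1" "mink A n = 0" "mink B n = 0"
  shows "range (gline A B) = axis n"
proof
  show "range (gline A B) \<subseteq> axis n"
    using hpt_gline[OF assms(1)] assms by (auto simp: axis_def)
  show "axis n \<subseteq> range (gline A B)"
  proof
    fix z assume z: "z \<in> axis n"
    then have "z \<in> hdisk" by (simp add: axis_def)
    then obtain u v where uv: "hpt z = cosh v *\<^sub>R (cosh u *\<^sub>R A + sinh u *\<^sub>R B) + sinh v *\<^sub>R n"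
        "mink (hpt z) n = sinh v" by (rule fermi_surj[OF assms])
    then have "v = 0" using z by (simp add: axis_def)
    then have "hpt z = hpt (gline A B u)" using uv hpt_gline[OF assms(1)] by simp
    then show "z \<in> range (gline A B)" using \<open>z \<in> hdisk\<close> hpt_gline[OF assms(1)] hpt_inj by blast
  qed
qed

lemma complete_geodesic_axis: "complete_geodesic L \<longleftrightarrow> (\<exists>n. mink n n = 1 \<and> L = axis n)"
proof
  assume "complete_geodesic L"
  then obtain \<gamma> where "geodesic_line \<gamma>" "L = range \<gamma>" by (auto simp: complete_geodesic_def)
  then show "\<exists>n. mink n n = 1 \<and> L = axis n"
    by (metis geodesic_line_frame frame_normal range_gline)
next
  assume "\<exists>n. mink n n = 1 \<and> L = axis n"
  then show "complete_geodesic L"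
    by (metis complete_geodesic_def frame_exists range_gline geodesic_line_gline)
qed

text \<open>The point \<open>z\<close> has signed distance \<open>v\<close> from its foot \<open>P\<close>, and
\<open>cosh (hdist z w) = cosh v * cosh (hdist (proj P) w)\<close> for every point \<open>w\<close> of the axis, so the foot is the nearest point.\<close>
lemma hdist_set_axis:
  assumes "mink n n = 1" "z \<in> hdisk"
  shows "hdist_set z (axis n) = arsinh \<bar>mink (hpt z) n\<bar>"
proof -
  obtain A B where AB: "frame A B" "mink A n = 0" "mink B n = 0"
    using frame_exists[OF assms(1)] .
  note fs = AB(1) assms(1) AB(2,3)
  obtain u v where uv: "hpt z = cosh v *\<^sub>R (cosh u *\<^sub>R A + sinh u *\<^sub>R B) + sinh v *\<^sub>R n"
        "mink (hpt z) n = sinh v" using assms(2) by (rule fermi_surj[OF fs])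
  define P where "P = cosh u *\<^sub>R A + sinh u *\<^sub>R B"
  have P: "future P" "mink P P = -1" "mink P n = 0"
    using frame_point[OF fs, of u] by (auto simp: P_def frame_def future_def)
  have d: "cosh (hdist z w) = cosh v * - mink P (hpt w)" if "w \<in> axis n" for w
    using that assms(2) by (simp add: cosh_hdist axis_def uv(1) P_def[symmetric] mink_sym)
  have wa: "proj P \<in> axis n" using P by (simp add: axis_def proj_in_hdisk hpt_proj)
  have "hdist z (proj P) = \<bar>v\<bar>"
  proof -
    have "cosh (hdist z (proj P)) = cosh \<bar>v\<bar>" using d[OF wa] P by (simp add: hpt_proj)
    then show ?thesis using cosh_hdist(2)[of z "proj P"] assms(2) P
      using arcosh_cosh_real[of "\<bar>v\<bar>"] arcosh_cosh_real[of "hdist z (proj P)"] by (simp add: proj_in_hdisk)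
  qed
  moreover have "\<bar>v\<bar> \<le> hdist z w" if w: "w \<in> axis n" for w
  proof -
    have wd: "w \<in> hdisk" using w by (simp add: axis_def)
    have "- mink P (hpt w) \<ge> 1" using unit_mink_le(1)[of P "hpt w"] P future_hpt[OF wd] mink_hpt_self[OF wd] by simp
    then have "cosh v * 1 \<le> cosh (hdist z w)" unfolding d[OF w] by (intro mult_left_mono) auto
    then have "cosh \<bar>v\<bar> \<le> cosh (hdist z w)" by simp
    then show ?thesis using cosh_hdist(2)[OF assms(2) wd] by (subst (asm) cosh_real_nonneg_le_iff) auto
  qed
  ultimately have "hdist_set z (axis n) = \<bar>v\<bar>"
    unfolding hdist_set_def using wa by (intro cInf_eq_minimum) force+
  also have "\<dots> = arsinh \<bar>mink (hpt z) n\<bar>" unfolding uv(2)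
    using arsinh_sinh_real[of "\<bar>v\<bar>"] by (simp add: sinh_real_abs)
  finally show ?thesis .
qed

lemma components_equidistant:
  assumes "mink n n = 1" "r > 0"
  shows "components {z \<in> hdisk. hdist_set z (axis n) = r} =
    {{z\<in>hdisk. mink (hpt z) n = - sinh r}, {z\<in>hdisk. mink (hpt z) n = sinh r}}"
proof -
  define U where "U = {z \<in> hdisk. \<bar>mink (hpt z) n\<bar> = sinh r}"
  have s: "sinh r > 0" using assms by simp
  have "{z \<in> hdisk. hdist_set z (axis n) = r} = U"
    using arsinh_sinh_real[of r] sinh_arsinh_real by (auto simp: U_def hdist_set_axis[OF assms(1)])
  also have "U = {z\<in>U. mink (hpt z) n \<noteq> 0}" using s by (auto simp: U_def)
  finally have e: "{z \<in> hdisk. hdist_set z (axis n) = r} = {z\<in>U. mink (hpt z) n \<noteq> 0}" .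
  have 1: "{z\<in>U. mink (hpt z) n < 0} = level n {- sinh r}" "{z\<in>U. mink (hpt z) n > 0} = level n {sinh r}"
    using s by (auto simp: U_def level_def)
  have 2: "level n {x} = {z\<in>hdisk. mink (hpt z) n = x}" for x by (auto simp: level_def)
  have "continuous_on U (\<lambda>z. mink (hpt z) n)"
    by (intro continuous_on_level continuous_on_id) (auto simp: U_def)
  from components_split[OF this, of 0] level_connected[OF assms(1), of "{_}"]
  show ?thesis unfolding e 1 2 by simp
qed

section \<open>Normal vectors of generalized circles\<close>

text \<open>The vector \<open>N\<close> is normalized so that \<open>N - k *\<^sub>R X\<close> is the unit normal of the curve at each
of its points \<open>X\<close>, pointing into the convex side. For \<open>k \<ge> 1\<close> the convex side is a disk or horoball
around \<open>proj N\<close>; for \<open>k < 1\<close> the vector is spacelike and is a multiple of the unit normal of the axis.\<close>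
definition represents :: "mvec \<Rightarrow> gcircle \<Rightarrow> bool" where
  "represents N C \<longleftrightarrow> curvature C \<ge> 0 \<and> mink N N = 1 - (curvature C)\<^sup>2 \<and>
     (curvature C \<ge> 1 \<longrightarrow> fst N > 0) \<and>
     curve C = {z \<in> hdisk. mink (hpt z) N = - curvature C} \<and>
     convex_side C = {z \<in> hdisk. mink (hpt z) N \<ge> - curvature C} \<and>
     centre C = (if curvature C \<ge> 1 then {proj N} else axis N)"

lemma circle_level:
  assumes "c \<in> hdisk" "r > 0" "z \<in> hdisk"
  shows "hdist c z = r \<longleftrightarrow> mink (hpt z) ((1 / sinh r) *\<^sub>R hpt c) = - (cosh r / sinh r)"
    "hdist c z \<le> r \<longleftrightarrow> mink (hpt z) ((1 / sinh r) *\<^sub>R hpt c) \<ge> - (cosh r / sinh r)"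
proof -
  have s: "sinh r > 0" using assms by simp
  show "hdist c z = r \<longleftrightarrow> mink (hpt z) ((1 / sinh r) *\<^sub>R hpt c) = - (cosh r / sinh r)"
    using s assms by (subst hdist_eq_iff) (auto simp: mink_sym field_simps)
  show "hdist c z \<le> r \<longleftrightarrow> mink (hpt z) ((1 / sinh r) *\<^sub>R hpt c) \<ge> - (cosh r / sinh r)"
    using s assms by (subst hdist_eq_iff) (auto simp: mink_sym field_simps)
qed

lemma coth_sq: "r > 0 \<Longrightarrow> 1 - (cosh r / sinh r)\<^sup>2 = - (1 / sinh r)\<^sup>2" for r :: real
proof -
  assume "r > 0"
  then have "sinh r > 0" by simp
  then show ?thesis by (simp add: field_simps cosh_square_eq)
qed

lemma circle_represents:
  assumes "is_circle C" shows "\<exists>N. represents N C"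
proof -
  obtain c r where C: "c \<in> hdisk" "r > 0" "curvature C = cosh r / sinh r"
     "curve C = {z \<in> hdisk. hdist c z = r}" "convex_side C = {z \<in> hdisk. hdist c z \<le> r}" "centre C = {c}"
    using assms by (auto simp: is_circle_def)
  have s: "sinh r > 0" using C by simp
  have k: "cosh r / sinh r \<ge> 1" using s by (simp add: sinh_le_cosh_real)
  define N where "N = (1 / sinh r) *\<^sub>R hpt c"
  have "mink N N = 1 - (curvature C)\<^sup>2" unfolding C(3) coth_sq[OF C(2)]
    by (simp add: N_def mink_hpt_self[OF C(1)] power2_eq_square)
  moreover have "fst N > 0" using future_hpt[OF C(1)] s by (simp add: N_def future_def)
  moreover have "proj N = c" using s by (simp add: N_def proj_scale proj_hpt C)
  ultimately have "represents N C" unfolding represents_def C(4-6) using k C(3) circle_level[OF C(1,2)]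
    by (auto simp: N_def)
  then show ?thesis by blast
qed

text \<open>A Euclidean circle of radius \<open>\<rho>\<close> inside the unit circle and tangent to it at \<open>\<xi>\<close>
is a level set of the product with a multiple of the null vector \<open>(1, \<xi>)\<close>; the multiple makes the level \<open>-1\<close>.\<close>
lemma horocycle_level:
  assumes "norm \<xi> = 1" "0 < \<rho>" "\<rho> < 1"
  defines "N \<equiv> ((1 - \<rho>) / \<rho>) *\<^sub>R (1, \<xi>)"
  shows "sphere ((1 - \<rho>) *\<^sub>R \<xi>) \<rho> - {\<xi>} = {z \<in> hdisk. mink (hpt z) N = - 1}"
    "cball ((1 - \<rho>) *\<^sub>R \<xi>) \<rho> - {\<xi>} = {z \<in> hdisk. mink (hpt z) N \<ge> - 1}"
proof -
  have xx: "\<xi> \<bullet> \<xi> = 1" using assms(1) by (simp add: power2_norm_eq_inner[symmetric])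
  \<comment> \<open>Both sides are \<open>\<rho> * (1 - (norm z)\<^sup>2)\<close> times \<open>- mink (hpt z) N - 1\<close>.\<close>
  have id: "(norm (z - (1 - \<rho>) *\<^sub>R \<xi>))\<^sup>2 - \<rho>\<^sup>2 = (1 - \<rho>) * (norm (z - \<xi>))\<^sup>2 - \<rho> * (1 - (norm z)\<^sup>2)" for z
    proof -
    have 1: "(norm (z - (1 - \<rho>) *\<^sub>R \<xi>))\<^sup>2 = z \<bullet> z - 2 * (1 - \<rho>) * (z \<bullet> \<xi>) + (1 - \<rho>)\<^sup>2"
      unfolding power2_norm_eq_inner
      by (simp only: inner_diff inner_scaleR_left inner_scaleR_right xx inner_commute[of \<xi> z])
         (simp add: algebra_simps power2_eq_square)
    have 2: "(norm (z - \<xi>))\<^sup>2 = z \<bullet> z - 2 * (z \<bullet> \<xi>) + 1"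
      by (simp add: power2_norm_eq_inner inner_diff inner_commute xx)
    show ?thesis unfolding 1 2 power2_norm_eq_inner[of z] by (simp add: algebra_simps power2_eq_square)
  qed
  have nz: "(norm (z - \<xi>))\<^sup>2 = (norm z)\<^sup>2 + 1 - 2 * (z \<bullet> \<xi>)" for z
    by (simp add: power2_norm_eq_inner inner_diff inner_commute xx)
  have lev: "mink (hpt z) N = - ((1 - \<rho>) * (norm (z - \<xi>))\<^sup>2 / (\<rho> * (1 - (norm z)\<^sup>2)))" for z
  proof -
    have 1: "mink (lift z) (1, \<xi>) = - (norm (z - \<xi>))\<^sup>2"
      unfolding nz by (simp add: lift_def mink_def inner_complex_def algebra_simps)
    show ?thesis unfolding N_def hpt_def mink_linear 1 by (simp add: field_simps)
  qed
  have d: "norm (z - (1 - \<rho>) *\<^sub>R \<xi>) \<le> \<rho> \<Longrightarrow> z \<noteq> \<xi> \<Longrightarrow> z \<in> hdisk" for z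
  proof -
    assume a: "norm (z - (1 - \<rho>) *\<^sub>R \<xi>) \<le> \<rho>" "z \<noteq> \<xi>"
    then have "(norm (z - (1 - \<rho>) *\<^sub>R \<xi>))\<^sup>2 \<le> \<rho>\<^sup>2" by (intro power_mono) auto
    moreover have "(1 - \<rho>) * (norm (z - \<xi>))\<^sup>2 > 0" using a assms by simp
    ultimately have "\<rho> * (1 - (norm z)\<^sup>2) > 0" using id[of z] by linarith
    then show ?thesis using assms by (simp add: zero_less_mult_iff mem_hdisk abs_square_less_1)
  qed
  have e: "norm (z - (1 - \<rho>) *\<^sub>R \<xi>) = \<rho> \<longleftrightarrow> mink (hpt z) N = - 1"
    "norm (z - (1 - \<rho>) *\<^sub>R \<xi>) \<le> \<rho> \<longleftrightarrow> mink (hpt z) N \<ge> - 1" if "z \<in> hdisk" for z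
  proof -
    have m: "\<rho> * (1 - (norm z)\<^sup>2) > 0" using one_minus_pos[OF that] assms by simp
    have "norm (z - (1 - \<rho>) *\<^sub>R \<xi>) = \<rho> \<longleftrightarrow> (norm (z - (1 - \<rho>) *\<^sub>R \<xi>))\<^sup>2 - \<rho>\<^sup>2 = 0"
      using assms by simp
    then show "norm (z - (1 - \<rho>) *\<^sub>R \<xi>) = \<rho> \<longleftrightarrow> mink (hpt z) N = - 1"
      unfolding id lev using m by (auto simp: field_simps)
    have "norm (z - (1 - \<rho>) *\<^sub>R \<xi>) \<le> \<rho> \<longleftrightarrow> (norm (z - (1 - \<rho>) *\<^sub>R \<xi>))\<^sup>2 - \<rho>\<^sup>2 \<le> 0"
      using assms by (simp add: power_mono_iff)
    then show "norm (z - (1 - \<rho>) *\<^sub>R \<xi>) \<le> \<rho> \<longleftrightarrow> mink (hpt z) N \<ge> - 1"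
      unfolding id lev using m by (auto simp: field_simps)
  qed
  have x: "\<xi> \<notin> hdisk" using assms by (simp add: mem_hdisk)
  have d': "norm (z - (1 - \<rho>) *\<^sub>R \<xi>) = \<rho> \<Longrightarrow> z \<noteq> \<xi> \<Longrightarrow> z \<in> hdisk" for z
    using d[of z] by simp
  show "sphere ((1 - \<rho>) *\<^sub>R \<xi>) \<rho> - {\<xi>} = {z \<in> hdisk. mink (hpt z) N = - 1}"
  proof (rule set_eqI)
    fix z
    have "z \<in> sphere ((1 - \<rho>) *\<^sub>R \<xi>) \<rho> - {\<xi>} \<longleftrightarrow> norm (z - (1 - \<rho>) *\<^sub>R \<xi>) = \<rho> \<and> z \<noteq> \<xi>"
      by (simp add: dist_norm norm_minus_commute)
    then show "z \<in> sphere ((1 - \<rho>) *\<^sub>R \<xi>) \<rho> - {\<xi>} \<longleftrightarrow> z \<in> {z \<in> hdisk. mink (hpt z) N = - 1}"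
      using e(1)[of z] d'[of z] x by blast
  qed
  show "cball ((1 - \<rho>) *\<^sub>R \<xi>) \<rho> - {\<xi>} = {z \<in> hdisk. mink (hpt z) N \<ge> - 1}"
  proof (rule set_eqI)
    fix z
    have "z \<in> cball ((1 - \<rho>) *\<^sub>R \<xi>) \<rho> - {\<xi>} \<longleftrightarrow> norm (z - (1 - \<rho>) *\<^sub>R \<xi>) \<le> \<rho> \<and> z \<noteq> \<xi>"
      by (simp add: dist_norm norm_minus_commute)
    then show "z \<in> cball ((1 - \<rho>) *\<^sub>R \<xi>) \<rho> - {\<xi>} \<longleftrightarrow> z \<in> {z \<in> hdisk. mink (hpt z) N \<ge> - 1}"
      using e(2)[of z] d[of z] x by blast
  qed
qed

lemma mink_null_ideal: "norm \<xi> = 1 \<Longrightarrow> mink (c *\<^sub>R (1, \<xi>)) (c *\<^sub>R (1, \<xi>)) = 0"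
  using cmod_power2[of \<xi>] by (simp add: mink_def algebra_simps power2_eq_square) (simp add: distrib_left[symmetric])

lemma proj_ideal: "norm \<xi> = 1 \<Longrightarrow> c > 0 \<Longrightarrow> proj (c *\<^sub>R (1, \<xi>)) = \<xi>"
  using mink_null_ideal[of \<xi> 1] by (simp add: proj_scale del: scaleR_Pair) (simp add: proj_def)

lemma horocycle_represents:
  assumes "is_horocycle C" shows "\<exists>N. represents N C"
proof -
  obtain \<xi> \<rho> where C: "norm \<xi> = 1" "0 < \<rho>" "\<rho> < 1" "curvature C = 1"
     "curve C = sphere ((1 - \<rho>) *\<^sub>R \<xi>) \<rho> - {\<xi>}" "convex_side C = cball ((1 - \<rho>) *\<^sub>R \<xi>) \<rho> - {\<xi>}" "centre C = {\<xi>}"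
    using assms by (auto simp: is_horocycle_def)
  have "represents (((1 - \<rho>) / \<rho>) *\<^sub>R (1, \<xi>)) C"
    unfolding represents_def C(4-7) horocycle_level[OF C(1-3)]
    using C mink_null_ideal[OF C(1)] proj_ideal[OF C(1), of "(1 - \<rho>) / \<rho>"] by simp
  then show ?thesis by blast
qed

lemma axis_scale: "c \<noteq> 0 \<Longrightarrow> axis (c *\<^sub>R n) = axis n"
  by (simp add: axis_def)

lemma axis_nonempty: "mink n n = 1 \<Longrightarrow> axis n \<noteq> {}"
  using level_connected(2)[of n "{0}"] by (simp add: level_def axis_def)

lemma one_minus_tanh_sq: "1 - (tanh r)\<^sup>2 = 1 / (cosh (r::real))\<^sup>2"
proof -
  have "1 - (tanh r)\<^sup>2 = ((cosh r)\<^sup>2 - (sinh r)\<^sup>2) / (cosh r)\<^sup>2"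
    by (simp add: tanh_def power_divide diff_divide_distrib)
  also have "(cosh r)\<^sup>2 - (sinh r)\<^sup>2 = 1" by (simp add: cosh_square_eq)
  finally show ?thesis .
qed

text \<open>The curve at distance \<open>r\<close> from the axis is the level \<open>- sinh r\<close> for the unit normal \<open>n\<close>.
Division by \<open>cosh r\<close> turns the level into \<open>- tanh r\<close>, and the axis lies on the larger side.\<close>
lemma hypercycle_core:
  assumes "mink n n = 1" "r > 0"
  defines "N \<equiv> (1 / cosh r) *\<^sub>R n"
  shows "mink N N = 1 - (tanh r)\<^sup>2" "0 < tanh r" "tanh r < 1"
    "{z\<in>hdisk. mink (hpt z) n = - sinh r} = {z\<in>hdisk. mink (hpt z) N = - tanh r}"
    "{z\<in>hdisk. mink (hpt z) N = - tanh r} \<union>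
      \<Union>{H \<in> components (hdisk - {z\<in>hdisk. mink (hpt z) N = - tanh r}). axis n \<subseteq> H}
      = {z\<in>hdisk. mink (hpt z) N \<ge> - tanh r}"
    "axis n = axis N"
proof -
  have c: "cosh r > 0" by simp
  show "mink N N = 1 - (tanh r)\<^sup>2"
    using assms(1) unfolding one_minus_tanh_sq by (simp add: N_def power2_eq_square)
  show t: "0 < tanh r" "tanh r < 1" using assms(2) tanh_real_lt_1 by auto
  show 1: "{z\<in>hdisk. mink (hpt z) n = - sinh r} = {z\<in>hdisk. mink (hpt z) N = - tanh r}"
    using c by (auto simp: N_def tanh_def field_simps)
  show 2: "axis n = axis N" using c by (simp add: N_def axis_scale)
  have 3: "{z\<in>hdisk. mink (hpt z) n < - sinh r} = {z\<in>hdisk. mink (hpt z) N < - tanh r}"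
     "{z\<in>hdisk. mink (hpt z) n > - sinh r} = {z\<in>hdisk. mink (hpt z) N > - tanh r}"
    using c by (auto simp: N_def tanh_def field_simps)
  have "\<not> axis n \<subseteq> {z\<in>hdisk. mink (hpt z) N < - tanh r}"
    using axis_nonempty[OF assms(1)] t unfolding 2 by (auto simp: axis_def)
  moreover have "axis n \<subseteq> {z\<in>hdisk. mink (hpt z) N > - tanh r}"
    using t unfolding 2 by (auto simp: axis_def)
  ultimately have "{H \<in> components (hdisk - {z\<in>hdisk. mink (hpt z) N = - tanh r}). axis n \<subseteq> H}
     = {{z\<in>hdisk. mink (hpt z) N > - tanh r}}"
    using components_level_compl[OF assms(1), of "- sinh r"] unfolding 1 3 by auto
  then show "{z\<in>hdisk. mink (hpt z) N = - tanh r} \<union>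
      \<Union>{H \<in> components (hdisk - {z\<in>hdisk. mink (hpt z) N = - tanh r}). axis n \<subseteq> H}
      = {z\<in>hdisk. mink (hpt z) N \<ge> - tanh r}" by auto
qed

lemma axis_uminus: "axis (- n) = axis n" by (simp add: axis_def)

lemma hypercycle_represents:
  assumes "is_hypercycle C" shows "\<exists>N. represents N C"
proof -
  obtain L r where C: "complete_geodesic L" "r > 0" "curvature C = tanh r"
     "curve C \<in> components {z \<in> hdisk. hdist_set z L = r}"
     "convex_side C = curve C \<union> \<Union>{H \<in> components (hdisk - curve C). L \<subseteq> H}" "centre C = L"
    using assms by (auto simp: is_hypercycle_def)
  obtain n0 where n0: "mink n0 n0 = 1" "L = axis n0" using C(1) complete_geodesic_axis by auto
  have "\<exists>n. mink n n = 1 \<and> L = axis n \<and> curve C = {z\<in>hdisk. mink (hpt z) n = - sinh r}"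
  proof -
    from C(4) components_equidistant[OF n0(1) C(2)]
    consider "curve C = {z\<in>hdisk. mink (hpt z) n0 = - sinh r}" | "curve C = {z\<in>hdisk. mink (hpt z) n0 = sinh r}"
      unfolding n0(2) by auto
    then show ?thesis
    proof cases
      case 2
      then show ?thesis using n0 by (intro exI[of _ "- n0"]) (auto simp: axis_uminus)
    qed (use n0 in blast)
  qed
  then obtain n where n: "mink n n = 1" "L = axis n" "curve C = {z\<in>hdisk. mink (hpt z) n = - sinh r}" by blast
  note h = hypercycle_core[OF n(1) C(2)]
  have cv: "curve C = {z\<in>hdisk. mink (hpt z) ((1 / cosh r) *\<^sub>R n) = - tanh r}" using n(3) h(4) by simp
  have "represents ((1 / cosh r) *\<^sub>R n) C"
    unfolding represents_def C(3)
    using h cv C(5) n(2) C(6) by (simp only: ) auto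
  then show ?thesis by blast
qed

lemma geodesic_represents:
  assumes "is_geodesic_gcircle C" shows "\<exists>N. represents N C"
proof -
  obtain L H where C: "complete_geodesic L" "curvature C = 0"
     "curve C = L" "H \<in> components (hdisk - L)" "convex_side C = L \<union> H" "centre C = L"
    using assms by (auto simp: is_geodesic_gcircle_def)
  obtain n0 where n0: "mink n0 n0 = 1" "L = axis n0" using C(1) complete_geodesic_axis by auto
  have "\<exists>n. mink n n = 1 \<and> L = axis n \<and> H = {z\<in>hdisk. mink (hpt z) n > 0}"
  proof -
    from C(4) components_level_compl[OF n0(1), of 0]
    consider "H = {z\<in>hdisk. mink (hpt z) n0 < 0}" | "H = {z\<in>hdisk. mink (hpt z) n0 > 0}"
      unfolding n0(2) axis_def by auto
    then show ?thesis
    proof cases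
      case 1
      then show ?thesis using n0 by (intro exI[of _ "- n0"]) (auto simp: axis_uminus)
    qed (use n0 in blast)
  qed
  then obtain n where n: "mink n n = 1" "L = axis n" "H = {z\<in>hdisk. mink (hpt z) n > 0}" by blast
  have "represents n C"
    unfolding represents_def C(2,3,5,6) n(2,3) using n(1) by (auto simp: axis_def)
  then show ?thesis by blast
qed

lemma generalized_circle_represents: "generalized_circle C \<Longrightarrow> \<exists>N. represents N C"
  unfolding generalized_circle_def
  using circle_represents horocycle_represents hypercycle_represents geodesic_represents by blast

text \<open>Every vector of the right norm is the normal of a generalized circle. The radius, the
Euclidean radius of the horocycle or the distance from the axis is computed from \<open>k\<close> and \<open>N\<close>.\<close>
lemma generalized_circle_exists:
  assumes k: "k \<ge> 0" "mink N N = 1 - k\<^sup>2" "k \<ge> 1 \<Longrightarrow> fst N > 0"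
  shows "\<exists>C. generalized_circle C \<and> curvature C = k \<and> represents N C"
proof -
  define C where "C = \<lparr>curvature = k, curve = {z \<in> hdisk. mink (hpt z) N = - k},
     convex_side = {z \<in> hdisk. mink (hpt z) N \<ge> - k}, centre = (if k \<ge> 1 then {proj N} else axis N)\<rparr>"
  have C: "curvature C = k" "curve C = {z \<in> hdisk. mink (hpt z) N = - k}"
     "convex_side C = {z \<in> hdisk. mink (hpt z) N \<ge> - k}" "centre C = (if k \<ge> 1 then {proj N} else axis N)"
    by (simp_all add: C_def)
  have r: "represents N C" unfolding represents_def using C k by simp
  consider "k > 1" | "k = 1" | "0 < k" "k < 1" | "k = 0" using k(1) by linarith
  then have "generalized_circle C"
  proof cases
    case 1
    define d where "d = sqrt (k\<^sup>2 - 1)"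
    have k2: "k\<^sup>2 > 1" using 1 by simp
    then have d: "d > 0" "d\<^sup>2 = k\<^sup>2 - 1" by (auto simp: d_def)
    define r where "r = arsinh (1 / d)"
    have s: "sinh r = 1 / d" by (simp add: r_def)
    have r: "r > 0" using s d by (metis sinh_real_pos_iff zero_less_divide_1_iff)
    have "(cosh r)\<^sup>2 = (k / d)\<^sup>2" unfolding cosh_square_eq s using d by (simp add: field_simps)
    then have c: "cosh r = k / d" using d 1 by (simp add: power2_eq_iff_nonneg)
    define P where "P = (1 / d) *\<^sub>R N"
    have "fst N > 0" using k(3) 1 by simp
    then have P: "future P" "mink P P = -1"
      using d k(2) 1 k2 by (auto simp: P_def future_def divide_simps power2_eq_square)
    have Pc: "proj P = proj N" using d by (simp add: P_def proj_scale)
    have h: "hpt (proj N) = P" using hpt_proj[OF P] Pc by simp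
    have N: "N = (1 / sinh r) *\<^sub>R hpt (proj N)" using d by (simp add: h s P_def)
    have cd: "proj N \<in> hdisk" using proj_in_hdisk[of P] P Pc by simp
    have kc: "k = cosh r / sinh r" using c s d by simp
    have "is_circle C" unfolding is_circle_def
      using circle_level[OF cd r] N kc r cd C 1
      by (intro exI[of _ "proj N"] exI[of _ r]) auto
    then show ?thesis by (simp add: generalized_circle_def)
  next
    case 2
    define l where "l = fst N"
    have l: "l > 0" using k(3) 2 by (simp add: l_def)
    define \<xi> where "\<xi> = (1 / l) *\<^sub>R snd N"
    have N: "N = l *\<^sub>R (1, \<xi>)" using l by (simp add: prod_eq_iff \<xi>_def l_def)
    have "mink N N = l\<^sup>2 * ((norm \<xi>)\<^sup>2 - 1)"
      unfolding N by (simp add: mink_def cmod_power2) (simp add: power2_eq_square algebra_simps)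
    then have "(norm \<xi>)\<^sup>2 = 1\<^sup>2" using k(2) 2 l by simp
    then have x: "norm \<xi> = 1" by (rule power2_eq_imp_eq) auto
    define \<rho> where "\<rho> = 1 / (1 + l)"
    have \<rho>: "0 < \<rho>" "\<rho> < 1" using l by (auto simp: \<rho>_def)
    have N': "N = ((1 - \<rho>) / \<rho>) *\<^sub>R (1, \<xi>)" using l unfolding N \<rho>_def by (simp add: field_simps)
    have pN: "proj N = \<xi>" using proj_ideal[OF x l] N by simp
    have "is_horocycle C" unfolding is_horocycle_def
      using x \<rho> horocycle_level[OF x \<rho>] C 2 pN N'
      by (intro exI[of _ \<xi>] exI[of _ \<rho>]) auto
    then show ?thesis by (simp add: generalized_circle_def)
  next
    case 3
    define r where "r = artanh k"
    have t: "tanh r = k" using 3 by (simp add: r_def tanh_artanh)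
    have r: "r > 0" using t 3 by (metis tanh_real_pos_iff)
    define n where "n = cosh r *\<^sub>R N"
    have N: "N = (1 / cosh r) *\<^sub>R n" by (simp add: n_def)
    have "(cosh r)\<^sup>2 * (1 - k\<^sup>2) = 1" unfolding t[symmetric] one_minus_tanh_sq by simp
    then have n: "mink n n = 1" by (simp add: n_def k(2) power2_eq_square algebra_simps)
    note h = hypercycle_core[OF n r, folded N]
    have "is_hypercycle C" unfolding is_hypercycle_def
    proof (intro exI[of _ "axis n"] exI[of _ r] conjI)
      show "complete_geodesic (axis n)" unfolding complete_geodesic_axis using n by blast
      show "curve C \<in> components {z \<in> hdisk. hdist_set z (axis n) = r}"
        unfolding components_equidistant[OF n r] h(4) C t by simp
      show "convex_side C = curve C \<union> \<Union> {H \<in> components (hdisk - curve C). axis n \<subseteq> H}"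
        unfolding C using h(5) t by simp
      show "centre C = axis n" using C 3 h(6) by simp
    qed (use r t C in auto)
    then show ?thesis by (simp add: generalized_circle_def)
  next
    case 4
    have n: "mink N N = 1" using k 4 by simp
    have "is_geodesic_gcircle C" unfolding is_geodesic_gcircle_def
    proof (rule exI[of _ "axis N"], rule exI[of _ "{z\<in>hdisk. mink (hpt z) N > 0}"], intro conjI)
      show "complete_geodesic (axis N)" unfolding complete_geodesic_axis using n by blast
      show "{z \<in> hdisk. 0 < mink (hpt z) N} \<in> components (hdisk - axis N)"
        unfolding axis_def components_level_compl[OF n] by simp
    qed (use 4 C in \<open>auto simp: axis_def\<close>)
    then show ?thesis by (simp add: generalized_circle_def)
  qed
  then show ?thesis using r C by blast
qed

section \<open>External tangency\<close>

lemma mink_hpt_dhpt: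
  assumes "z \<in> hdisk" shows "mink (hpt z) (dhpt z v) = 0"
proof -
  define m where "m = 1 - (norm z)\<^sup>2"
  have m: "m > 0" using one_minus_pos[OF assms] by (simp add: m_def)
  have zz: "z \<bullet> z = 1 - m" "(norm z)\<^sup>2 = 1 - m" by (simp_all add: m_def power2_norm_eq_inner)
  have k: "mink P Q = snd P \<bullet> snd Q - fst P * fst Q" for P Q
    by (simp add: mink_def inner_complex_def)
  have h: "hpt z = ((2 - m) / m, (2 / m) *\<^sub>R z)"
    by (simp add: hpt_def lift_def m_def scaleR_conv_of_real)
  have "mink (hpt z) (dhpt z v) = 4 * (z \<bullet> v) / m\<^sup>2 + 8 * (z \<bullet> v) * (1 - m) / m ^ 3 - 4 * (z \<bullet> v) * (2 - m) / m ^ 3"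
    unfolding k h dhpt_def m_def[symmetric]
    using m by (simp add: inner_add zz field_simps eval_nat_numeral)
  also have "\<dots> = 0" using m by (simp add: field_simps eval_nat_numeral)
  finally show ?thesis .
qed

lemma mink_inner: "mink P N = P \<bullet> (- fst N, snd N)"
  by (simp add: mink_def inner_prod_def inner_complex_def)

lemma mink_has_derivative:
  assumes "(f has_vector_derivative D) (at s)"
  shows "((\<lambda>x. mink (f x) N) has_vector_derivative mink D N) (at s)"
  unfolding mink_inner
  by (rule bounded_linear.has_vector_derivative[OF bounded_linear_inner_left assms])

text \<open>Along the curve the product with \<open>N\<close> is constant, so its derivative vanishes.\<close>
lemma tangent_vector_curve:
  assumes "represents N C" "tangent_vector (curve C) t u"
  shows "t \<in> curve C" "mink (dhpt t u) N = 0"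
proof -
  obtain \<gamma> \<delta> where g: "\<delta> > 0" "\<gamma> 0 = t" "\<gamma> ` {-\<delta><..<\<delta>} \<subseteq> curve C"
    "(\<gamma> has_vector_derivative u) (at (0::real))"
    using assms(2) by (auto simp: tangent_vector_def)
  show t: "t \<in> curve C" using g by force
  have lev: "\<gamma> x \<in> hdisk \<and> mink (hpt (\<gamma> x)) N = - curvature C" if "x \<in> {-\<delta><..<\<delta>}" for x
  proof -
    have "\<gamma> x \<in> curve C" using that g(3) by blast
    then show ?thesis using assms(1) by (simp add: represents_def)
  qed
  have "((\<lambda>x. hpt (\<gamma> x)) has_vector_derivative dhpt (\<gamma> 0) u) (at 0)"
    using g lev by (intro hpt_has_vector_derivative) auto
  from mink_has_derivative[OF this, of N]
  have 1: "((\<lambda>x. mink (hpt (\<gamma> x)) N) has_vector_derivative mink (dhpt t u) N) (at 0)"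
    by (simp add: g)
  have "((\<lambda>x. - curvature C) has_vector_derivative mink (dhpt t u) N) (at 0)"
    by (rule has_vector_derivative_transform_within_open[OF 1, of "{-\<delta><..<\<delta>}"]) (use g lev in auto)
  then show "mink (dhpt t u) N = 0"
    using vector_derivative_unique_at has_vector_derivative_const by blast
qed

lemma represents_normal:
  assumes "mink N N = 1 - k\<^sup>2" "mink X X = -1" "mink X N = - k"
  shows "mink (N - k *\<^sub>R X) (N - k *\<^sub>R X) = 1" "mink X (N - k *\<^sub>R X) = 0"
  using assms by (simp_all add: mink_sym power2_eq_square algebra_simps)

lemma open_level: "open {z \<in> hdisk. mink (hpt z) N > c}"
proof -
  have "continuous_on hdisk (\<lambda>z. mink (hpt z) N)"
    by (intro continuous_on_level continuous_on_id) auto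
  then have "open (hdisk \<inter> (\<lambda>z. mink (hpt z) N) -` {c<..})"
    by (intro continuous_open_preimage) (auto simp: hdisk_def)
  moreover have "hdisk \<inter> (\<lambda>z. mink (hpt z) N) -` {c<..} = {z \<in> hdisk. mink (hpt z) N > c}" by auto
  ultimately show ?thesis by simp
qed

lemma interior_convex_side:
  assumes "represents N C" "z \<in> hdisk" "mink (hpt z) N > - curvature C"
  shows "z \<in> interior (convex_side C)"
proof (rule interiorI[OF open_level])
  show "z \<in> {z \<in> hdisk. mink (hpt z) N > - curvature C}" using assms by simp
  show "{z \<in> hdisk. mink (hpt z) N > - curvature C} \<subseteq> convex_side C"
    using assms(1) by (auto simp: represents_def)
qed

text \<open>Moving the distance \<open>v\<close> from a point of a curve of curvature \<open>j\<close> along the inner normal changes the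
product with the normal vector from \<open>- j\<close> to \<open>- j * cosh v + sinh v\<close>. A small \<open>v\<close> leads into the
convex sides of all curves of curvature at most \<open>k\<close>.\<close>
lemma step_inside:
  fixes k :: real assumes "k \<ge> 0"
  obtains v where "\<And>j. j \<le> k \<Longrightarrow> - j * cosh v + sinh v > - j"
proof -
  \<comment> \<open>With \<open>v = 2 * w\<close> the difference of the two sides is \<open>2 * sinh w * (cosh w - j * sinh w)\<close>, and \<open>k * tanh w < 1\<close>.\<close>
  define w where "w = artanh (1 / (k + 2))"
  have t: "tanh w = 1 / (k + 2)" unfolding w_def using assms by (intro tanh_artanh) (auto simp: abs_if)
  have w: "sinh w > 0" using t assms by (metis sinh_real_pos_iff tanh_real_pos_iff zero_less_divide_1_iff add_nonneg_pos zero_less_numeral)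
  have s: "sinh w = cosh w / (k + 2)" using t assms by (simp add: tanh_def field_simps)
  have "- j * cosh (2 * w) + sinh (2 * w) > - j" if "j \<le> k" for j
  proof -
    have c: "cosh (2 * w) = 1 + 2 * (sinh w)\<^sup>2" using cosh_square_eq[of w] by (simp add: cosh_double)
    have "j * sinh w \<le> k * sinh w" using that w by (intro mult_right_mono) auto
    also have "\<dots> < cosh w" using assms cosh_real_pos[of w] by (simp add: s field_simps)
    finally have "2 * sinh w * (cosh w - j * sinh w) > 0" using w by simp
    then show ?thesis unfolding c sinh_double by (simp add: algebra_simps power2_eq_square)
  qed
  then show thesis by (rule that)
qed

lemma dhpt_pos:
  assumes "z \<in> hdisk" "u \<noteq> 0" shows "mink (dhpt z u) (dhpt z u) > 0"
  using assms one_minus_pos[OF assms(1)] by (simp add: mink_dhpt)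

text \<open>Both unit normals \<open>n1\<close>, \<open>n2\<close> at the point of tangency \<open>X\<close> are orthogonal to \<open>X\<close> and to the common
tangent vector, so they agree up to sign. If they were equal, a small step in their direction would lead into the interiors of both
convex sides. Hence \<open>n2 = - n1\<close>, and \<open>N1 = k1 *\<^sub>R X + n1\<close>, \<open>N2 = k2 *\<^sub>R X - n1\<close> give both claims.\<close>
lemma tangent_finite:
  assumes r: "represents N1 C1" "represents N2 C2"
    and disj: "interior (convex_side C1) \<inter> interior (convex_side C2) = {}"
    and t: "t \<in> hdisk" "curves_tangent_at (curve C1) (curve C2) t"
  shows "mink N1 N2 = -1 - curvature C1 * curvature C2"
    "N1 + N2 = (curvature C1 + curvature C2) *\<^sub>R hpt t"
proof -
  define k1 where "k1 = curvature C1"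
  define k2 where "k2 = curvature C2"
  define X where "X = hpt t"
  obtain u where u: "u \<noteq> 0" "tangent_vector (curve C1) t u" "tangent_vector (curve C2) t u"
    using t(2) by (auto simp: curves_tangent_at_def)
  note t1 = tangent_vector_curve[OF r(1) u(2)] and t2 = tangent_vector_curve[OF r(2) u(3)]
  have X: "mink X X = -1" "mink X N1 = - k1" "mink X N2 = - k2" "future X"
    using t1 t2 r by (auto simp: represents_def X_def mink_hpt_self k1_def k2_def future_hpt)
  have N: "mink N1 N1 = 1 - k1\<^sup>2" "mink N2 N2 = 1 - k2\<^sup>2" using r by (auto simp: represents_def k1_def k2_def)
  define n1 where "n1 = N1 - k1 *\<^sub>R X"
  define n2 where "n2 = N2 - k2 *\<^sub>R X"
  have n1: "mink n1 n1 = 1" "mink X n1 = 0" using represents_normal[OF N(1) X(1,2)] by (auto simp: n1_def)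
  have n2: "mink n2 n2 = 1" "mink X n2 = 0" using represents_normal[OF N(2) X(1,3)] by (auto simp: n2_def)
  define d where "d = dhpt t u"
  have dd: "mink d d > 0" using dhpt_pos[OF t(1) u(1)] by (simp add: d_def)
  have dX: "mink X d = 0" using mink_hpt_dhpt[OF t(1)] by (simp add: d_def X_def)
  have dn: "mink n1 d = 0" "mink n2 d = 0" using t1(2) t2(2) dX
    by (simp_all add: n1_def n2_def d_def mink_sym)
  define w where "w = (1 / sqrt (mink d d)) *\<^sub>R d"
  have w: "mink w w = 1" "mink X w = 0" "mink n1 w = 0" "mink n2 w = 0"
    using dd dX dn by (auto simp: w_def)
  have "n2 = mink n2 n1 *\<^sub>R n1"
    using orthonormal_expand[of X n1 w n2] X(1) n1 n2 w by (simp add: mink_sym)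
  then obtain a where a: "n2 = a *\<^sub>R n1" by blast
  then have "a * a = 1" using n2(1) n1(1) by simp
  then have "(a - 1) * (a + 1) = 0" by (simp add: algebra_simps)
  moreover have "a \<noteq> 1"
  proof
    assume "a = 1"
    then have e: "n2 = n1" using a by simp
    define k where "k = max k1 k2"
    have "k \<ge> 0" using r by (auto simp: k_def represents_def k1_def)
    then obtain v where v: "\<And>j. j \<le> k \<Longrightarrow> - j * cosh v + sinh v > - j" by (rule step_inside) blast
    have f: "frame X n1" using X n1 by (simp add: frame_def future_def)
    define z where "z = gline X n1 v"
    have z: "z \<in> hdisk" "hpt z = cosh v *\<^sub>R X + sinh v *\<^sub>R n1" using hpt_gline[OF f] by (auto simp: z_def)
    have "mink (hpt z) N1 = - k1 * cosh v + sinh v" "mink (hpt z) N2 = - k2 * cosh v + sinh v"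
    proof -
      have "N2 = k2 *\<^sub>R X + n2" by (simp add: n2_def)
      then have "N2 = k2 *\<^sub>R X + n1" unfolding e .
      moreover have "N1 = k1 *\<^sub>R X + n1" by (simp add: n1_def)
      ultimately show "mink (hpt z) N1 = - k1 * cosh v + sinh v" "mink (hpt z) N2 = - k2 * cosh v + sinh v"
        using X n1 by (auto simp: z mink_sym)
    qed
    then have "z \<in> interior (convex_side C1)" "z \<in> interior (convex_side C2)"
      using v[of k1] v[of k2] z r by (auto intro!: interior_convex_side simp: k_def k1_def k2_def)
    then show False using disj by blast
  qed
  ultimately have "a = -1" by simp
  then have n: "n2 = - n1" using a by simp
  have "N2 = k2 *\<^sub>R X + n2" by (simp add: n2_def)
  then have "N2 = k2 *\<^sub>R X - n1" unfolding n by simp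
  moreover have "N1 = k1 *\<^sub>R X + n1" by (simp add: n1_def)
  ultimately have N12: "N1 = k1 *\<^sub>R X + n1" "N2 = k2 *\<^sub>R X - n1" by blast+
  show "mink N1 N2 = -1 - curvature C1 * curvature C2"
    unfolding N12 using X n1 by (simp add: mink_sym k1_def k2_def)
  show "N1 + N2 = (curvature C1 + curvature C2) *\<^sub>R hpt t"
    unfolding N12 by (simp add: k1_def k2_def X_def scaleR_add_left)
qed

text \<open>A null vector orthogonal to \<open>n\<close> represents an end of the geodesic with normal \<open>n\<close>; the frame is oriented
towards this end.\<close>
lemma null_frame:
  assumes "mink n n = 1" "future P" "mink P P = 0" "mink P n = 0"
  obtains A B c where "frame A B" "mink A n = 0" "mink B n = 0" "c > 0" "P = c *\<^sub>R (A + B)"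
proof -
  obtain A B where AB: "frame A B" "mink A n = 0" "mink B n = 0"
    using frame_exists[OF assms(1)] .
  define c where "c = - mink P A"
  define b where "b = mink P B"
  have P: "P = c *\<^sub>R A + b *\<^sub>R B"
    using orthonormal_expand[of A B n P] AB assms by (simp add: frame_def c_def b_def)
  have c: "c > 0" using future_mink_less[OF frame_future[OF AB(1)] _ assms(2)] AB(1)
    by (simp add: c_def frame_def mink_sym)
  have "b * b = c * c" using assms(3) AB(1) unfolding P by (simp add: frame_def mink_sym)
  then have "(b - c) * (b + c) = 0" by (simp add: algebra_simps)
  then consider "b = c" | "b = - c" by auto
  then show thesis
  proof cases
    case 1 then show thesis using that[OF AB c] P by (simp add: scaleR_add_right)
  next
    case 2 then show thesis using that[OF frame_uminus[OF AB(1)] AB(2) _ c] AB(3) P by (simp add: scaleR_diff_right)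
  qed
qed

lemma ideal_endpoints_axis:
  assumes "mink n n = 1"
  shows "t \<in> ideal_endpoints (axis n) \<longleftrightarrow> norm t = 1 \<and> mink (lift t) n = 0"
proof
  assume t: "t \<in> ideal_endpoints (axis n)"
  then have n: "norm t = 1" and cl: "t \<in> closure (axis n)" by (auto simp: ideal_endpoints_def)
  have "closed {z. mink (lift z) n = 0}"
    by (intro closed_Collect_eq continuous_intros)
  moreover have "axis n \<subseteq> {z. mink (lift z) n = 0}"
    by (auto simp: axis_def lift_hpt)
  ultimately have "closure (axis n) \<subseteq> {z. mink (lift z) n = 0}" by (rule closure_minimal[rotated])
  then show "norm t = 1 \<and> mink (lift t) n = 0" using n cl by auto
next
  assume t: "norm t = 1 \<and> mink (lift t) n = 0"
  then have "mink (lift t) (lift t) = 0" by (simp add: mink_lift_self)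
  then obtain A B c where AB: "frame A B" "mink A n = 0" "mink B n = 0" "c > 0" "lift t = c *\<^sub>R (A + B)"
    using null_frame[OF assms future_lift, of t] t by metis
  have "t = proj (A + 1 *\<^sub>R B)" using proj_lift[of t] t AB(4,5) by (simp add: proj_scale del: scaleR_add_right)
  then have lim: "(gline A B \<longlongrightarrow> t) at_top" using gline_tendsto[OF AB(1) tanh_real_at_top] by simp
  have "\<forall>s. gline A B s \<in> closure (axis n)" using range_gline[OF AB(1) assms AB(2,3)] closure_subset by blast
  then have "t \<in> closure (axis n)"
    using Lim_in_closed_set[OF closed_closure _ _ lim] by auto
  then show "t \<in> ideal_endpoints (axis n)" using t by (auto simp: ideal_endpoints_def)
qed

lemma exp_arb: assumes "(c::real) > 0" obtains u where "exp (- u) = c"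
  using that[of "- ln c"] assms by simp

text \<open>The common ideal point is spanned by \<open>A + B\<close> for a frame of the first geodesic, and
\<open>N2 = b *\<^sub>R (A + B) + a *\<^sub>R N1\<close> with \<open>a\<^sup>2 = 1\<close>. The half planes would overlap unless \<open>a = -1\<close>
and \<open>b \<ge> 0\<close>, and \<open>b = 0\<close> would make the geodesics equal.\<close>
lemma tangent_ideal:
  assumes r: "represents N1 C1" "represents N2 C2"
    and k: "curvature C1 = 0" "curvature C2 = 0"
    and disj: "interior (convex_side C1) \<inter> interior (convex_side C2) = {}"
    and ne: "curve C1 \<noteq> curve C2"
    and t: "t \<in> ideal_endpoints (curve C1) \<inter> ideal_endpoints (curve C2)"
  shows "mink N1 N2 = -1" "future (N1 + N2)" "t = proj (N1 + N2)"
proof -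
  have N: "mink N1 N1 = 1" "mink N2 N2 = 1" "curve C1 = axis N1" "curve C2 = axis N2"
    using r k by (auto simp: represents_def axis_def)
  define P where "P = lift t"
  have P: "norm t = 1" "mink P N1 = 0" "mink P N2 = 0" "future P" "mink P P = 0"
    using t ideal_endpoints_axis N by (auto simp: P_def future_lift mink_lift_self)
  obtain A B c where AB: "frame A B" "mink A N1 = 0" "mink B N1 = 0" "c > 0" "P = c *\<^sub>R (A + B)"
    using null_frame[OF N(1) P(4,5,2)] .
  define a where "a = mink N2 N1"
  define b where "b = mink N2 B"
  have "mink N2 A = - b" using P(3) AB(4) unfolding AB(5) by (simp add: b_def mink_sym)
  then have N2: "N2 = b *\<^sub>R (A + B) + a *\<^sub>R N1"
    using orthonormal_expand[of A B N1 N2] AB N by (simp add: frame_def a_def b_def scaleR_add_right)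
  have "a * a = 1" using N(2) AB N(1) unfolding N2 by (simp add: frame_def mink_sym)
  then have "(a - 1) * (a + 1) = 0" by (simp add: algebra_simps)
  then have a: "a = 1 \<or> a = -1" by auto
  have no: "- b * cosh 1 * exp (- u) + a * sinh 1 \<le> 0" for u
  proof (rule ccontr)
    assume gt: "\<not> ?thesis"
    \<comment> \<open>The point at distance \<open>1\<close> from the first geodesic, inside the first half plane, above the point with parameter \<open>u\<close>.\<close>
    define z where "z = gline (cosh u *\<^sub>R A + sinh u *\<^sub>R B) N1 1"
    note fp = frame_point[OF AB(1) N(1) AB(2,3), of u]
    have z: "z \<in> hdisk" "hpt z = cosh 1 *\<^sub>R (cosh u *\<^sub>R A + sinh u *\<^sub>R B) + sinh 1 *\<^sub>R N1"
      using hpt_gline[OF fp] by (auto simp: z_def)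
    have 1: "mink (hpt z) N1 = sinh 1" using AB N by (simp add: z)
    have "mink (hpt z) (A + B) = cosh 1 * (sinh u - cosh u)" using AB by (simp add: z frame_def mink_sym algebra_simps)
    also have "sinh u - cosh u = - exp (- u)" using cosh_minus_sinh[of u] by simp
    finally have "mink (hpt z) N2 = - b * cosh 1 * exp (- u) + a * sinh 1" unfolding N2 using 1 by simp
    then have "z \<in> interior (convex_side C1)" "z \<in> interior (convex_side C2)"
      using 1 gt z r k by (auto intro!: interior_convex_side)
    then show False using disj by blast
  qed
  have p: "cosh (1::real) > 0" "sinh (1::real) > 0" by auto
  have "a \<noteq> 1"
  proof
    assume "a = 1"
    \<comment> \<open>Close to the common ideal point the contribution of \<open>b\<close> is negligible.\<close>
    obtain u where "exp (- u) = sinh 1 / (2 * cosh 1 * (\<bar>b\<bar> + 1))"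
      using p by (auto intro: exp_arb[of "sinh 1 / (2 * cosh 1 * (\<bar>b\<bar> + 1))"])
    then have "b * cosh 1 * exp (- u) = sinh 1 * (b / (2 * (\<bar>b\<bar> + 1)))" using p by simp
    also have "\<dots> < sinh 1 * 1" using p by (intro mult_strict_left_mono) (auto simp: divide_less_eq)
    finally show False using no[of u] \<open>a = 1\<close> by simp
  qed
  then have a1: "a = -1" using a by simp
  have "b \<ge> 0"
  proof (rule ccontr)
    assume "\<not> ?thesis"
    then have nb: "- b > 0" by simp
    \<comment> \<open>Far away from the common ideal point the contribution of a negative \<open>b\<close> dominates.\<close>
    have "2 * sinh 1 / (cosh 1 * (- b)) > 0" using p nb by (intro divide_pos_pos mult_pos_pos) auto
    then obtain u where "exp (- u) = 2 * sinh 1 / (cosh 1 * (- b))" by (rule exp_arb)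
    then have "- b * cosh 1 * exp (- u) = 2 * sinh 1" using p nb by simp
    then show False using no[of u] a1 p by simp
  qed
  moreover have "b \<noteq> 0"
  proof
    assume "b = 0"
    then have "N2 = - N1" unfolding N2 a1 by simp
    then show False using ne N by (simp add: axis_uminus)
  qed
  ultimately have b: "b > 0" by simp
  have s: "N1 + N2 = b *\<^sub>R (A + B)" unfolding N2 a1 by simp
  have fAB: "future (A + B)" using frame_combo(1)[OF AB(1), of 1] by simp
  show "mink N1 N2 = -1" using a1 by (simp add: a_def mink_sym)
  show "future (N1 + N2)" unfolding s using fAB b by (rule future_scale)
  have "t = proj P" using P(1) by (simp add: P_def proj_lift)
  also have "\<dots> = proj (A + B)" unfolding AB(5) using AB(4) by (simp add: proj_scale del: scaleR_add_right)
  also have "\<dots> = proj (N1 + N2)" unfolding s using b by (simp add: proj_scale del: scaleR_add_right)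
  finally show "t = proj (N1 + N2)" .
qed

lemma externally_tangent_mink:
  assumes r: "represents N1 C1" "represents N2 C2" and e: "externally_tangent C1 C2"
  shows "mink N1 N2 = -1 - curvature C1 * curvature C2" "future (N1 + N2)"
    "tangency_point C1 C2 = proj (N1 + N2)" "tangency_point C2 C1 = proj (N1 + N2)"
proof -
  have disj: "interior (convex_side C1) \<inter> interior (convex_side C2) = {}" and ne: "curve C1 \<noteq> curve C2"
    using e by (auto simp: externally_tangent_def)
  have k0: "curvature C1 \<ge> 0" "curvature C2 \<ge> 0" using r by (auto simp: represents_def)
  have main: "mink N1 N2 = -1 - curvature C1 * curvature C2 \<and> future (N1 + N2) \<and> t = proj (N1 + N2)"
    if t: "is_tangency_point C1 C2 t" for t
  proof (cases "curvature C1 = 0 \<and> curvature C2 = 0")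
    case True
    then show ?thesis using tangent_ideal[OF r _ _ disj ne, of t] t by (auto simp: is_tangency_point_def)
  next
    case False
    then have t: "t \<in> hdisk" "curves_tangent_at (curve C1) (curve C2) t"
      using t unfolding is_tangency_point_def by (metis, metis)
    have p: "curvature C1 + curvature C2 > 0" using False k0 by linarith
    show ?thesis using tangent_finite[OF r disj t] p t(1) by (simp add: future_scale future_hpt proj_scale proj_hpt)
  qed
  obtain t where t: "is_tangency_point C1 C2 t" using e by (auto simp: externally_tangent_def)
  show "mink N1 N2 = -1 - curvature C1 * curvature C2" "future (N1 + N2)" using main[OF t] by auto
  show 1: "tangency_point C1 C2 = proj (N1 + N2)" unfolding tangency_point_def
    using main t by (intro the_equality) auto
  have "is_tangency_point C2 C1 t = is_tangency_point C1 C2 t" for t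
    unfolding is_tangency_point_def curves_tangent_at_def by auto
  then show "tangency_point C2 C1 = proj (N1 + N2)" using 1 by (simp add: tangency_point_def)
qed

section \<open>Arcs of generalized circles\<close>

text \<open>A rational parametrization of the curve with normal vector \<open>k *\<^sub>R X + n\<close> that starts at \<open>X\<close> in direction \<open>U\<close>.
The points of the curve are \<open>X + v *\<^sub>R (X + k *\<^sub>R n) + b *\<^sub>R U\<close> with
\<open>b\<^sup>2 = 2 * v + (1 - k\<^sup>2) * v\<^sup>2\<close>, and \<open>q = v / b\<close> is the slope of the secant of this conic through \<open>X\<close>.\<close>
definition arcY :: "real \<Rightarrow> mvec \<Rightarrow> mvec \<Rightarrow> mvec \<Rightarrow> real \<Rightarrow> mvec" where
  "arcY k X n U q = X + (2 * q\<^sup>2 / (1 - (1 - k\<^sup>2) * q\<^sup>2)) *\<^sub>R (X + k *\<^sub>R n) + (2 * q / (1 - (1 - k\<^sup>2) * q\<^sup>2)) *\<^sub>R U"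

text \<open>The derivative of \<open>arcY\<close>.\<close>
definition arcD :: "real \<Rightarrow> mvec \<Rightarrow> mvec \<Rightarrow> mvec \<Rightarrow> real \<Rightarrow> mvec" where
  "arcD k X n U q = (4 * q / (1 - (1 - k\<^sup>2) * q\<^sup>2)\<^sup>2) *\<^sub>R (X + k *\<^sub>R n)
     + (2 * (1 + (1 - k\<^sup>2) * q\<^sup>2) / (1 - (1 - k\<^sup>2) * q\<^sup>2)\<^sup>2) *\<^sub>R U"

lemma arcY_0: "arcY k X n U 0 = X" "arcD k X n U 0 = 2 *\<^sub>R U"
  by (simp_all add: arcY_def arcD_def)

lemma arcY_facts:
  assumes "frame X n" "mink U U = 1" "mink X U = 0" "mink n U = 0" "1 - (1 - k\<^sup>2) * q\<^sup>2 > 0"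
  shows "mink (arcY k X n U q) (arcY k X n U q) = -1" "mink (arcY k X n U q) (k *\<^sub>R X + n) = - k"
    "future (arcY k X n U q)"
    "mink (arcD k X n U q) (arcD k X n U q) = (2 / (1 - (1 - k\<^sup>2) * q\<^sup>2))\<^sup>2"
    "(arcY k X n U has_vector_derivative arcD k X n U q) (at q)"
proof -
  define e where "e = 1 - k\<^sup>2"
  define m where "m = 1 - e * q\<^sup>2"
  have m: "m > 0" using assms by (simp add: m_def e_def)
  have q2: "e * q\<^sup>2 = 1 - m" by (simp add: m_def)
  note f = assms(1)[unfolded frame_def]
  have g: "mink X X = -1" "mink n n = 1" "mink X n = 0" "mink n X = 0" "mink U X = 0" "mink U n = 0"
    using f assms by (auto simp: mink_sym)
  have kk: "mink (X + k *\<^sub>R n) (X + k *\<^sub>R n) = - e" using g by (simp add: e_def power2_eq_square)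
  have Y: "arcY k X n U q = X + (2 * q\<^sup>2 / m) *\<^sub>R (X + k *\<^sub>R n) + (2 * q / m) *\<^sub>R U"
    by (simp add: arcY_def m_def e_def)
  have "mink (arcY k X n U q) (arcY k X n U q) = -1 - 2 * (2 * q\<^sup>2 / m) - (2 * q\<^sup>2 / m)\<^sup>2 * e + (2 * q / m)\<^sup>2"
    unfolding Y using g assms(2-4) by (simp add: mink_sym e_def algebra_simps power2_eq_square add_divide_distrib diff_divide_distrib)
  also have "(2 * q\<^sup>2 / m)\<^sup>2 * e = 4 * q\<^sup>2 * (e * q\<^sup>2) / m\<^sup>2" by (simp add: power2_eq_square)
  also have "-1 - 2 * (2 * q\<^sup>2 / m) - 4 * q\<^sup>2 * (e * q\<^sup>2) / m\<^sup>2 + (2 * q / m)\<^sup>2 = -1"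
    unfolding q2 using m by (simp add: field_simps power2_eq_square)
  finally show YY: "mink (arcY k X n U q) (arcY k X n U q) = -1" .
  show "mink (arcY k X n U q) (k *\<^sub>R X + n) = - k"
    unfolding Y using g assms(2-4) by (simp add: mink_sym)
  have "mink (arcY k X n U q) X = - 1 - 2 * q\<^sup>2 / m" unfolding Y using g assms(2-4) by (simp add: mink_sym)
  also have "\<dots> < 0"
  proof -
    have "2 * q\<^sup>2 / m \<ge> 0" using m by simp
    then show ?thesis by linarith
  qed
  finally show "future (arcY k X n U q)"
    using timelike_future_iff[of "arcY k X n U q" X] YY frame_future[OF assms(1)] by simp
  have D: "arcD k X n U q = (4 * q / m\<^sup>2) *\<^sub>R (X + k *\<^sub>R n) + (2 * (2 - m) / m\<^sup>2) *\<^sub>R U"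
    by (simp add: arcD_def m_def e_def)
  have VU: "mink (X + k *\<^sub>R n) U = 0" "mink U (X + k *\<^sub>R n) = 0" using g assms(2-4) by simp_all
  have "mink (a *\<^sub>R V + b *\<^sub>R U) (a *\<^sub>R V + b *\<^sub>R U) = b\<^sup>2 - a\<^sup>2 * e"
    if "mink V V = - e" "mink V U = 0" "mink U V = 0" for a b V
    using that assms(2) by (simp add: power2_eq_square)
  from this[OF kk VU]
  have "mink (arcD k X n U q) (arcD k X n U q) = (2 * (2 - m) / m\<^sup>2)\<^sup>2 - (4 * q / m\<^sup>2)\<^sup>2 * e"
    unfolding D .
  also have "(4 * q / m\<^sup>2)\<^sup>2 * e = 16 * (e * q\<^sup>2) / m ^ 4" by (simp add: power_divide power2_eq_square eval_nat_numeral ac_simps)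
  also have "(2 * (2 - m) / m\<^sup>2)\<^sup>2 - 16 * (e * q\<^sup>2) / m ^ 4 = (2 / m)\<^sup>2"
    unfolding q2 using m by (simp add: field_simps eval_nat_numeral)
  finally show "mink (arcD k X n U q) (arcD k X n U q) = (2 / (1 - (1 - k\<^sup>2) * q\<^sup>2))\<^sup>2"
    by (simp add: m_def e_def)
  have 1: "((\<lambda>q. 2 * q\<^sup>2 / (1 - e * q\<^sup>2)) has_real_derivative 4 * q / m\<^sup>2) (at q)"
    using m by (auto intro!: derivative_eq_intros simp: m_def[symmetric])
      (simp add: field_simps power2_eq_square m_def)
  have 2: "((\<lambda>q. 2 * q / (1 - e * q\<^sup>2)) has_real_derivative 2 * (2 - m) / m\<^sup>2) (at q)"
    using m by (auto intro!: derivative_eq_intros simp: m_def[symmetric])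
      (simp add: field_simps power2_eq_square m_def)
  have eq: "arcY k X n U = (\<lambda>q. X + ((2 * q\<^sup>2 / (1 - e * q\<^sup>2)) *\<^sub>R (X + k *\<^sub>R n) + (2 * q / (1 - e * q\<^sup>2)) *\<^sub>R U))"
    by (auto simp: arcY_def e_def add.assoc)
  show "(arcY k X n U has_vector_derivative arcD k X n U q) (at q)"
    unfolding eq D
    by (rule has_vector_derivative_eq_rhs, rule has_vector_derivative_add[OF has_vector_derivative_const
      has_vector_derivative_add[OF has_vector_derivative_scaleR[OF 1 has_vector_derivative_const]
         has_vector_derivative_scaleR[OF 2 has_vector_derivative_const]]]) simp
qed

lemma arcY_open: "open {q. 1 - (1 - k\<^sup>2) * q\<^sup>2 > (0::real)}"
  by (intro open_Collect_less continuous_intros)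

lemma curve_tangent_vector:
  assumes r: "represents N C" and f: "frame X n" "mink U U = 1" "mink X U = 0" "mink n U = 0"
    and N: "N = curvature C *\<^sub>R X + n"
  shows "tangent_vector (curve C) (proj X) ((1 / (1 + fst X)\<^sup>2) *\<^sub>R ((1 + fst X) *\<^sub>R snd (2 *\<^sub>R U) - fst (2 *\<^sub>R U) *\<^sub>R snd X))"
proof -
  define k where "k = curvature C"
  define S where "S = {q. 1 - (1 - k\<^sup>2) * q\<^sup>2 > (0::real)}"
  have "open S" unfolding S_def by (rule arcY_open)
  then have S: "open S" "0 \<in> S" by (simp_all add: S_def)
  then obtain \<delta> where d: "\<delta> > 0" "ball 0 \<delta> \<subseteq> S" by (meson open_contains_ball)
  have Y: "mink (arcY k X n U q) (arcY k X n U q) = -1" "mink (arcY k X n U q) N = - k"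
     "future (arcY k X n U q)" if "q \<in> S" for q
    using arcY_facts(1-3)[OF f, of k q] that by (auto simp: S_def N k_def)
  have "((\<lambda>q. proj (arcY k X n U q)) has_vector_derivative
     (1 / (1 + fst X)\<^sup>2) *\<^sub>R ((1 + fst X) *\<^sub>R snd (2 *\<^sub>R U) - fst (2 *\<^sub>R U) *\<^sub>R snd X)) (at 0)"
    using proj_has_vector_derivative[OF arcY_facts(5)[OF f, of k 0] S Y(3,1)] by (simp add: arcY_0)
  moreover have "(\<lambda>q. proj (arcY k X n U q)) ` {-\<delta><..<\<delta>} \<subseteq> curve C"
  proof -
    have "proj (arcY k X n U q) \<in> curve C" if "q \<in> S" for q
      using Y[OF that] r by (simp add: represents_def k_def[symmetric] hpt_proj proj_in_hdisk)
    then show ?thesis using d(2) by (auto simp: ball_def dist_real_def abs_less_iff subset_iff)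
  qed
  ultimately show ?thesis unfolding tangent_vector_def using d(1)
    by (intro exI[of _ "\<lambda>q. proj (arcY k X n U q)"] exI[of _ \<delta>]) (auto simp: arcY_0)
qed

lemma mink_sum_norm:
  assumes "mink N1 N1 = 1 - k1\<^sup>2" "mink N2 N2 = 1 - k2\<^sup>2" "mink N1 N2 = -1 - k1 * k2"
  shows "mink (N1 + N2) (N1 + N2) = - (k1 + k2)\<^sup>2"
  using assms by (simp add: mink_sym power2_eq_square algebra_simps)

text \<open>The point of tangency \<open>X\<close> and the common normal \<open>n\<close>, which points into the convex side of the first circle.\<close>
lemma tangency_frame:
  assumes "mink N1 N1 = 1 - k1\<^sup>2" "mink N2 N2 = 1 - k2\<^sup>2" "mink N1 N2 = -1 - k1 * k2"
    "fst (N1 + N2) > 0" "k1 + k2 > (0::real)"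
  defines "X \<equiv> (1 / (k1 + k2)) *\<^sub>R (N1 + N2)"
  defines "n \<equiv> (1 / (k1 + k2)) *\<^sub>R (k2 *\<^sub>R N1 - k1 *\<^sub>R N2)"
  shows "frame X n" "N1 = k1 *\<^sub>R X + n" "N2 = k2 *\<^sub>R X - n" "proj (N1 + N2) = proj X"
proof -
  define c where "c = k1 + k2"
  have c: "c > 0" using assms(5) by (simp add: c_def)
  have m21: "mink N2 N1 = -1 - k1 * k2" using assms(3) by (simp add: mink_sym)
  have "mink X X = - (c\<^sup>2) / (c * c)"
    using mink_sum_norm[OF assms(1-3)] by (simp add: X_def c_def[symmetric] del: mink_linear(1,2))
  then have XX: "mink X X = -1" using c by (simp add: power2_eq_square)
  have "mink (k2 *\<^sub>R N1 - k1 *\<^sub>R N2) (k2 *\<^sub>R N1 - k1 *\<^sub>R N2) = c\<^sup>2"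
    by (simp add: assms(1-3) m21) (simp add: c_def power2_eq_square algebra_simps)
  then have "mink n n = c\<^sup>2 / (c * c)"
    by (simp add: n_def c_def[symmetric] del: mink_linear(1-4))
  then have nn: "mink n n = 1" using c by (simp add: power2_eq_square)
  have "mink (N1 + N2) (k2 *\<^sub>R N1 - k1 *\<^sub>R N2) = 0"
    by (simp add: assms(1-3) m21) (simp add: c_def power2_eq_square algebra_simps)
  then have Xn: "mink X n = 0" by (simp add: X_def n_def del: mink_linear(1-4))
  show "frame X n" using XX nn Xn assms(4) c by (simp add: frame_def X_def c_def)
  have "c *\<^sub>R (k1 *\<^sub>R X + n) = k1 *\<^sub>R (N1 + N2) + (k2 *\<^sub>R N1 - k1 *\<^sub>R N2)"
    using c by (simp add: X_def n_def c_def[symmetric] scaleR_add_right)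
  also have "\<dots> = c *\<^sub>R N1" by (simp add: c_def algebra_simps)
  finally show "N1 = k1 *\<^sub>R X + n" using c by simp
  have "c *\<^sub>R (k2 *\<^sub>R X - n) = k2 *\<^sub>R (N1 + N2) - (k2 *\<^sub>R N1 - k1 *\<^sub>R N2)"
    using c by (simp add: X_def n_def c_def[symmetric] scaleR_diff_right)
  also have "\<dots> = c *\<^sub>R N2" by (simp add: c_def algebra_simps)
  finally show "N2 = k2 *\<^sub>R X - n" using c by simp
  show "proj (N1 + N2) = proj X" using c by (simp add: X_def c_def[symmetric] proj_scale del: scaleR_add_right)
qed

text \<open>For curvatures that are not both \<open>0\<close>, the product of a point of both convex sides with
\<open>X = (N1 + N2) / (k1 + k2)\<close> is at least \<open>-1\<close>. By \<open>unit_mink_le\<close> this point is \<open>X\<close>, so the interiors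
are disjoint. For two geodesics \<open>N1 + N2\<close> is null, and every point has a negative product with it.\<close>
lemma mink_tangent_implies:
  assumes r: "represents N1 C1" "represents N2 C2"
    and m: "mink N1 N2 = -1 - curvature C1 * curvature C2" and p: "fst (N1 + N2) > 0"
  shows "externally_tangent C1 C2"
proof -
  define k1 where "k1 = curvature C1"
  define k2 where "k2 = curvature C2"
  have N: "mink N1 N1 = 1 - k1\<^sup>2" "mink N2 N2 = 1 - k2\<^sup>2" "k1 \<ge> 0" "k2 \<ge> 0"
    using r by (auto simp: represents_def k1_def k2_def)
  have cv: "curve C1 = {z \<in> hdisk. mink (hpt z) N1 = - k1}" "curve C2 = {z \<in> hdisk. mink (hpt z) N2 = - k2}"
    "convex_side C1 = {z \<in> hdisk. mink (hpt z) N1 \<ge> - k1}" "convex_side C2 = {z \<in> hdisk. mink (hpt z) N2 \<ge> - k2}"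
    using r by (auto simp: represents_def k1_def k2_def)
  have m': "mink N1 N2 = -1 - k1 * k2" using m by (simp add: k1_def k2_def)
  have fut: "future (N1 + N2)" unfolding future_def using p mink_sum_norm[OF N(1,2) m'] by simp
  have ss: "interior (convex_side C1) \<inter> interior (convex_side C2) \<subseteq> convex_side C1 \<inter> convex_side C2"
    using interior_subset by blast
  show ?thesis
  proof (cases "k1 + k2 = 0")
    case True
    then have k: "k1 = 0" "k2 = 0" using N by auto
    have null: "mink (N1 + N2) (N1 + N2) = 0" using mink_sum_norm[OF N(1,2) m'] k by simp
    have neg: "mink (hpt z) N1 + mink (hpt z) N2 < 0" if "z \<in> hdisk" for z
      using future_mink_less[OF future_hpt[OF that] _ fut] mink_hpt_self[OF that] by simp
    have ax: "curve C1 = axis N1" "curve C2 = axis N2" using cv k by (auto simp: axis_def)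
    have u: "mink N1 N1 = 1" "mink N2 N2 = 1" using N k by auto
    have "curve C1 \<noteq> curve C2"
    proof
      assume e: "curve C1 = curve C2"
      obtain z where "z \<in> axis N1" using axis_nonempty[OF u(1)] by blast
      moreover have "z \<in> axis N2" using calculation e ax by simp
      ultimately have "z \<in> hdisk" "mink (hpt z) N1 = 0" "mink (hpt z) N2 = 0" by (auto simp: axis_def)
      then show False using neg[of z] by simp
    qed
    moreover have "interior (convex_side C1) \<inter> interior (convex_side C2) = {}"
      using ss neg k unfolding cv by force
    moreover have "is_tangency_point C1 C2 (proj (N1 + N2))"
    proof -
      obtain c where c: "c > 0" "lift (proj (N1 + N2)) = c *\<^sub>R (N1 + N2)" using lift_proj_pos[OF fut] .
      have "norm (proj (N1 + N2)) = 1" using lift_proj(3)[OF fut] null by simp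
      then show ?thesis using k u m' c
        by (simp add: is_tangency_point_def k1_def k2_def ax ideal_endpoints_axis mink_sym)
    qed
    ultimately show ?thesis by (auto simp: externally_tangent_def)
  next
    case False
    then have c: "k1 + k2 > 0" using N by linarith
    define X where "X = (1 / (k1 + k2)) *\<^sub>R (N1 + N2)"
    define n where "n = (1 / (k1 + k2)) *\<^sub>R (k2 *\<^sub>R N1 - k1 *\<^sub>R N2)"
    note tf = tangency_frame[OF N(1,2) m' p c, folded X_def n_def]
    have X: "future X" "mink X X = -1" using tf(1) by (auto simp: frame_def future_def)
    obtain U where U: "mink U U = 1" "mink X U = 0" "mink n U = 0" using frame_normal[OF tf(1)] .
    have only: "z = proj X" if "z \<in> hdisk" "mink (hpt z) N1 \<ge> - k1" "mink (hpt z) N2 \<ge> - k2" for z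
    proof -
      have "mink (hpt z) X = (mink (hpt z) N1 + mink (hpt z) N2) / (k1 + k2)" by (simp add: X_def)
      also have "\<dots> \<ge> (- (k1 + k2)) / (k1 + k2)" using c that by (intro divide_right_mono) auto
      also have "(- (k1 + k2)) / (k1 + k2) = -1" using c by (simp add: field_simps)
      finally have "mink (hpt z) X \<ge> -1" .
      then have "hpt z = X" using unit_mink_le[OF future_hpt[OF that(1)] mink_hpt_self[OF that(1)] X] by simp
      then show ?thesis using proj_hpt[OF that(1)] by simp
    qed
    have sub: "convex_side C1 \<inter> convex_side C2 \<subseteq> {proj X}" unfolding cv using only by auto
    have "interior (convex_side C1) \<inter> interior (convex_side C2) = {}"
    proof (rule ccontr)
      assume ne: "interior (convex_side C1) \<inter> interior (convex_side C2) \<noteq> {}"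
      then have "interior (convex_side C1) \<inter> interior (convex_side C2) = {proj X}" using ss sub by blast
      moreover have "open (interior (convex_side C1) \<inter> interior (convex_side C2))" by blast
      ultimately show False by (simp add: not_open_singleton)
    qed
    moreover have "curve C1 \<noteq> curve C2"
    proof
      assume e: "curve C1 = curve C2"
      \<comment> \<open>A second point of the first curve; any small positive parameter will do.\<close>
      define q where "q = 1 / (k1 + 2)"
      have q: "q > 0" "q < 1" using N by (auto simp: q_def)
      have "q\<^sup>2 \<le> 1" using q by (simp add: power_le_one)
      moreover have "(1 - k1\<^sup>2) * q\<^sup>2 = q\<^sup>2 - (k1 * q)\<^sup>2" by (simp add: algebra_simps power_mult_distrib)
      moreover have "q\<^sup>2 < 1" using q by (simp add: power_less_one_iff)
      ultimately have pos: "1 - (1 - k1\<^sup>2) * q\<^sup>2 > 0" by (smt (verit) zero_le_power2)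
      define Y where "Y = arcY k1 X n U q"
      note af = arcY_facts(1-3)[OF tf(1) U pos, folded Y_def tf(2)]
      have "proj Y \<in> curve C1" unfolding cv using af by (simp add: proj_in_hdisk hpt_proj)
      then have "proj Y \<in> curve C1" "proj Y \<in> curve C2" using e by auto
      then have "proj Y = proj X" using only[of "proj Y"] unfolding cv by simp
      then have "Y = X" using hpt_proj af X by metis
      moreover have "mink Y U = 2 * q / (1 - (1 - k1\<^sup>2) * q\<^sup>2)" using U by (simp add: Y_def arcY_def)
      ultimately show False using U q pos by simp
    qed
    moreover have "is_tangency_point C1 C2 (proj X)"
    proof -
      define u where "u = (1 / (1 + fst X)\<^sup>2) *\<^sub>R ((1 + fst X) *\<^sub>R snd (2 *\<^sub>R U) - fst (2 *\<^sub>R U) *\<^sub>R snd X)"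
      have "tangent_vector (curve C1) (proj X) u" unfolding u_def
        using curve_tangent_vector[OF r(1) tf(1) U] tf(2) by (simp add: k1_def)
      moreover have "tangent_vector (curve C2) (proj X) u" unfolding u_def
        using curve_tangent_vector[OF r(2) frame_uminus[OF tf(1)] U(1,2)] U(3) tf(3) by (simp add: k2_def)
      moreover have "u \<noteq> 0"
      proof
        assume "u = 0"
        have pos: "1 + fst X > 0" using X by (simp add: future_def)
        have "u = (2 / (1 + fst X)\<^sup>2) *\<^sub>R ((1 + fst X) *\<^sub>R snd U - fst U *\<^sub>R snd X)"
          by (simp add: u_def scaleR_diff_right mult.commute)
        then have "(1 + fst X) *\<^sub>R snd U = fst U *\<^sub>R snd X" using \<open>u = 0\<close> pos by simp
        then have "(1 / (1 + fst X)) *\<^sub>R ((1 + fst X) *\<^sub>R snd U) = (1 / (1 + fst X)) *\<^sub>R (fst U *\<^sub>R snd X)" by simp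
        then have s: "snd U = (fst U / (1 + fst X)) *\<^sub>R snd X" using pos by simp
        define a where "a = fst U / (1 + fst X)"
        have f: "fst U = a * (1 + fst X)" using pos by (simp add: a_def)
        have UU: "U = a *\<^sub>R (X + (1, 0))"
        proof (rule prod_eqI)
          show "fst U = fst (a *\<^sub>R (X + (1, 0)))" unfolding f by simp
          show "snd U = snd (a *\<^sub>R (X + (1, 0)))" unfolding s a_def[symmetric] by simp
        qed
        have "mink X (1, 0) = - fst X" by (simp add: mink_def)
        then have "a * (-1 - fst X) = 0" using U(2) X(2) unfolding UU by simp
        then have "a = 0" using pos by simp
        then show False using UU U(1) by simp
      qed
      ultimately have "curves_tangent_at (curve C1) (curve C2) (proj X)" unfolding curves_tangent_at_def by blast
      then show ?thesis using False X N by (auto simp: is_tangency_point_def k1_def k2_def proj_in_hdisk)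
    qed
    ultimately show ?thesis by (auto simp: externally_tangent_def)
  qed
qed

section \<open>Edges\<close>

text \<open>The hyperbolic tangent of the distance from a curve of curvature \<open>k\<close> to its centre: \<open>k = coth r\<close>
for circles, \<open>k = tanh r\<close> for hypercycles, and \<open>r = \<infinity>\<close> for horocycles.\<close>
definition kap :: "real \<Rightarrow> real" where
  "kap k = (if k \<ge> 1 then 1 / k else k)"

lemma kap_bounds: "k \<ge> 0 \<Longrightarrow> 0 \<le> kap k \<and> kap k \<le> 1" "k > 0 \<Longrightarrow> kap k > 0"
  by (auto simp: kap_def divide_le_eq_1)

lemma kap_le: "k \<ge> 0 \<Longrightarrow> kap k \<le> k"
  using mult_mono[of 1 k 1 k] by (auto simp: kap_def divide_le_eq)

lemma proj_in_axis:
  assumes "future P" "mink P P < 0"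
  shows "proj P \<in> axis N \<longleftrightarrow> mink P N = 0"
proof -
  obtain c where c: "c > 0" "lift (proj P) = c *\<^sub>R P" using lift_proj_pos[OF assms(1)] .
  have d: "proj P \<in> hdisk" using proj_in_hdisk[OF assms] .
  have "mink (hpt (proj P)) N = c * mink P N / (1 - (norm (proj P))\<^sup>2)" by (simp add: hpt_def c)
  then show ?thesis using d one_minus_pos[OF d] c(1) by (simp add: axis_def)
qed

lemma perpendicular_inner_iff:
  assumes "z \<in> hdisk" shows "v \<bullet> w = 0 \<longleftrightarrow> mink (dhpt z v) (dhpt z w) = 0"
  using one_minus_pos[OF assms] by (simp add: mink_dhpt[OF assms])

text \<open>A geodesic through a point \<open>X\<close> of the curve that ends at the centre in the required way leaves along the normal
of the curve, and the distance to the centre is given by \<open>kap\<close>. If the centre is a point or an ideal point, this says that the geodesic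
through \<open>X\<close> and \<open>proj N\<close> is the one in direction \<open>n\<close>. If the centre is an axis, the velocity at the end
is orthogonal to the axis, hence a multiple of \<open>N\<close>, and lies in the plane of the geodesic.\<close>
lemma line_ends_at_iff:
  assumes r: "represents N C" and E: "frame X E" and n: "frame X n" and N: "N = curvature C *\<^sub>R X + n"
  shows "line_ends_at (gline X E) x C \<longleftrightarrow> (\<exists>\<sigma>\<in>{1,-1}. E = \<sigma> *\<^sub>R n \<and> th x = \<sigma> * kap (curvature C))"
proof -
  define k where "k = curvature C"
  have k0: "k \<ge> 0" using r by (simp add: represents_def k_def)
  have N': "N = k *\<^sub>R X + n" using N by (simp add: k_def)
  have f: "mink X X = -1" "mink n n = 1" "mink X n = 0" "mink n X = 0" "mink E E = 1" "mink X E = 0" "mink E X = 0"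
    using E n by (auto simp: frame_def mink_sym)
  have NN: "mink N N = 1 - k\<^sup>2" "mink X N = - k" using f by (simp_all add: N' power2_eq_square)
  have P: "future (X + th x *\<^sub>R E)" "mink (X + th x *\<^sub>R E) (X + th x *\<^sub>R E) = (th x)\<^sup>2 - 1"
    using frame_combo[OF E th_bounds] by auto
  show ?thesis
  proof (cases "k \<ge> 1")
    case True
    have "fst N > 0" using r True by (simp add: represents_def k_def)
    moreover have "1 \<le> k\<^sup>2" using True by simp
    ultimately have fN: "future N" using NN by (simp add: future_def)
    have "line_ends_at (gline X E) x C \<longleftrightarrow> proj (X + th x *\<^sub>R E) = proj N"
      using True r by (simp add: line_ends_at_def ext_line_gline[OF E] represents_def k_def)
    also have "\<dots> \<longleftrightarrow> (\<exists>c>0. X + th x *\<^sub>R E = c *\<^sub>R N)" using proj_eq_iff[OF P(1) fN] .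
    also have "\<dots> \<longleftrightarrow> (\<exists>\<sigma>\<in>{1,-1}. E = \<sigma> *\<^sub>R n \<and> th x = \<sigma> * (1 / k))"
    proof
      assume "\<exists>c>0. X + th x *\<^sub>R E = c *\<^sub>R N"
      then obtain c where c: "c > 0" "X + th x *\<^sub>R E = c *\<^sub>R N" by blast
      have "mink X (X + th x *\<^sub>R E) = - c * k" unfolding c using NN by simp
      then have "c * k = 1" using f by simp
      then have ck: "c = 1 / k" using True by (simp add: field_simps)
      have tE: "th x *\<^sub>R E = (1 / k) *\<^sub>R n"
      proof -
        have "X + th x *\<^sub>R E = X + (1 / k) *\<^sub>R n" unfolding c(2) N' ck using True by (simp add: scaleR_add_right)
        then show ?thesis by simp
      qed
      then have "mink (th x *\<^sub>R E) (th x *\<^sub>R E) = mink ((1 / k) *\<^sub>R n) ((1 / k) *\<^sub>R n)" by simp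
      then have "th x * th x = 1 / k * (1 / k)" using f by simp
      then have "(th x - 1 / k) * (th x + 1 / k) = 0" by (simp add: algebra_simps)
      then consider "th x = 1 / k" | "th x = - (1 / k)" by auto
      then show "\<exists>\<sigma>\<in>{1,-1}. E = \<sigma> *\<^sub>R n \<and> th x = \<sigma> * (1 / k)"
      proof cases
        case 1
        have "1 / k \<noteq> 0" using True by simp
        moreover have "(1 / k) *\<^sub>R E = (1 / k) *\<^sub>R n" using tE unfolding 1 .
        ultimately have "E = n" using scaleR_cancel_left by blast
        then show ?thesis using 1 by simp
      next
        case 2
        have "1 / k \<noteq> 0" using True by simp
        moreover have "(1 / k) *\<^sub>R - E = (1 / k) *\<^sub>R n" using tE unfolding 2 by simp
        ultimately have "- E = n" using scaleR_cancel_left by blast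
        then show ?thesis using 2 by auto
      qed
    next
      assume "\<exists>\<sigma>\<in>{1,-1}. E = \<sigma> *\<^sub>R n \<and> th x = \<sigma> * (1 / k)"
      then have "X + th x *\<^sub>R E = (1 / k) *\<^sub>R N" using True unfolding N' by (auto simp: scaleR_add_right)
      then show "\<exists>c>0. X + th x *\<^sub>R E = c *\<^sub>R N" using True by (intro exI[of _ "1 / k"]) auto
    qed
    finally show ?thesis using True by (simp add: kap_def k_def)
  next
    case False
    have pos: "1 - k\<^sup>2 > 0" using False k0 by (simp add: power_less_one_iff abs_square_less_1)
    have cen: "centre C = axis N" using r False by (simp add: represents_def k_def)
    define s where "s = sqrt (1 - k\<^sup>2)"
    have s: "s > 0" "s * s = 1 - k\<^sup>2" using pos by (auto simp: s_def)
    define m where "m = (1 / s) *\<^sub>R N"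
    have m: "mink m m = 1" using NN s pos by (simp add: m_def)
    have ax: "axis N = axis m" using s by (simp add: m_def axis_scale)
    have mN: "mink V m = 0 \<longleftrightarrow> mink V N = 0" for V using s by (simp add: m_def)
    show ?thesis
    proof
      assume l: "line_ends_at (gline X E) x C"
      then have e: "proj (X + th x *\<^sub>R E) \<in> axis N" and perp: "perpendicular_at (gline X E) (axis N) (real_of_ereal x)"
        using False cen by (auto simp: line_ends_at_def ext_line_gline[OF E] k_def)
      have "mink (X + th x *\<^sub>R E) (X + th x *\<^sub>R E) \<noteq> 0"
        using lift_proj(3)[OF P(1)] e by (auto simp: axis_def mem_hdisk)
      then have "th x \<noteq> 1" "th x \<noteq> -1" using P(2) by auto
      then obtain a where a: "x = ereal a" by (cases x) auto
      define z where "z = gline X E a"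
      \<comment> \<open>Position \<open>Q\<close> and velocity \<open>V\<close> at the end.\<close>
      define V where "V = sinh a *\<^sub>R X + cosh a *\<^sub>R E"
      define Q where "Q = cosh a *\<^sub>R X + sinh a *\<^sub>R E"
      have z: "z \<in> hdisk" "hpt z = Q" using hpt_gline[OF E] by (auto simp: z_def Q_def)
      have QN: "mink Q N = 0"
      proof -
        have "mink (X + tanh a *\<^sub>R E) (X + tanh a *\<^sub>R E) < 0"
          using P(2) abs_tanh_less[of a] by (simp add: a abs_square_less_1)
        then have "mink (X + tanh a *\<^sub>R E) N = 0" using proj_in_axis P(1) e by (simp add: a)
        then show ?thesis unfolding Q_def cosh_combo by simp
      qed
      obtain \<mu> b where \<mu>: "geodesic_line \<mu>" "range \<mu> = axis N" "\<mu> b = z"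
         "vector_derivative \<mu> (at b) \<bullet> vector_derivative (gline X E) (at a) = 0"
        using perp a by (auto simp: perpendicular_at_def z_def)
      obtain A B where AB: "frame A B" "\<mu> = gline A B" using geodesic_line_frame[OF \<mu>(1)] .
      have AN: "cosh t * mink A N + sinh t * mink B N = 0" for t
      proof -
        have "gline A B t \<in> axis N" using \<mu>(2) AB(2) by blast
        then show ?thesis using hpt_gline[OF AB(1), of t] by (simp add: axis_def)
      qed
      have "mink A N = 0" using AN[of 0] by simp
      then have "mink B N = 0" using AN[of 1] by simp
      define W where "W = sinh b *\<^sub>R A + cosh b *\<^sub>R B"
      have WN: "mink W N = 0" using \<open>mink A N = 0\<close> \<open>mink B N = 0\<close> by (simp add: W_def)
      have Qb: "Q = cosh b *\<^sub>R A + sinh b *\<^sub>R B" using \<mu>(3) hpt_gline[OF AB(1), of b] z AB(2) by simp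
      have fAB: "mink A A = -1" "mink B B = 1" "mink A B = 0" "mink B A = 0" using AB(1) by (auto simp: frame_def mink_sym)
      have WQ: "mink Q W = 0" "mink W W = 1"
        unfolding Qb W_def using fAB cosh_square_eq[of b] by (simp_all add: power2_eq_square)
      have VQ: "mink V Q = 0" "mink Q Q = -1" "mink V V = 1"
        unfolding V_def Q_def using f cosh_square_eq[of a] by (simp_all add: power2_eq_square)
      have "mink (dhpt z (vector_derivative \<mu> (at b))) (dhpt z (vector_derivative (gline X E) (at a))) = 0"
        using \<mu>(4) perpendicular_inner_iff[OF z(1)] by simp
      then have WV: "mink W V = 0"
        using gline_velocity(2)[OF AB(1), of b] gline_velocity(2)[OF E, of a] \<mu>(3)
        by (simp add: AB(2)[symmetric] z_def[symmetric] W_def V_def)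
      \<comment> \<open>\<open>Q\<close>, the direction \<open>W\<close> of the axis and its normal \<open>m\<close> form an orthonormal basis.\<close>
      have "V = mink V m *\<^sub>R m"
        using orthonormal_expand[of Q W m V] VQ WQ m QN WN WV mN by (simp add: mink_sym)
      then obtain c where c: "V = c *\<^sub>R N" unfolding m_def by auto
      have "mink X V = - c * k" unfolding c using NN by simp
      then have sc: "sinh a = c * k" unfolding V_def using f by simp
      have "cosh a *\<^sub>R E = V - sinh a *\<^sub>R X" by (simp add: V_def)
      also have "\<dots> = c *\<^sub>R N - sinh a *\<^sub>R X" unfolding c ..
      also have "\<dots> = c *\<^sub>R n" unfolding N' sc by (simp add: scaleR_add_right)
      finally have cE: "cosh a *\<^sub>R E = c *\<^sub>R n" .
      then have "mink (cosh a *\<^sub>R E) (cosh a *\<^sub>R E) = mink (c *\<^sub>R n) (c *\<^sub>R n)" by simp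
      then have "(c - cosh a) * (c + cosh a) = 0" using f by (simp add: algebra_simps)
      then consider "c = cosh a" | "c = - cosh a" by auto
      then obtain \<sigma> where \<sigma>: "\<sigma> \<in> {1, -1}" "c = \<sigma> * cosh a"
      proof cases
        case 1 then show ?thesis using that[of 1] by simp
      next
        case 2 then show ?thesis using that[of "-1"] by simp
      qed
      have "(1 / cosh a) *\<^sub>R (cosh a *\<^sub>R E) = (1 / cosh a) *\<^sub>R (c *\<^sub>R n)" unfolding cE ..
      then have "E = \<sigma> *\<^sub>R n" using \<sigma>(2) by simp
      moreover have "th x = \<sigma> * kap (curvature C)"
        using sc \<sigma>(2) False by (simp add: a tanh_def kap_def k_def)
      ultimately show "\<exists>\<sigma>\<in>{1,-1}. E = \<sigma> *\<^sub>R n \<and> th x = \<sigma> * kap (curvature C)" using \<sigma>(1) by blast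
    next
      assume "\<exists>\<sigma>\<in>{1,-1}. E = \<sigma> *\<^sub>R n \<and> th x = \<sigma> * kap (curvature C)"
      then obtain \<sigma> where \<sigma>: "\<sigma> \<in> {1,-1}" "E = \<sigma> *\<^sub>R n" "th x = \<sigma> * k"
        using False unfolding kap_def k_def[symmetric] if_not_P[OF False] by blast
      have "\<bar>th x\<bar> < 1" using \<sigma>(1,3) False k0 by auto
      then obtain a where a: "x = ereal a" by (cases x) auto
      have sg: "\<sigma> * \<sigma> = 1" using \<sigma>(1) by auto
      have PE: "X + th x *\<^sub>R E = X + k *\<^sub>R n"
        unfolding \<sigma>(2,3) using sg by (simp add: mult.assoc mult.left_commute[of \<sigma> k])
      have PN: "mink (X + k *\<^sub>R n) N = 0" unfolding N' using f by simp
      have "mink (X + th x *\<^sub>R E) (X + th x *\<^sub>R E) < 0"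
        unfolding PE using f pos by (simp add: power2_eq_square)
      then have e: "proj (X + th x *\<^sub>R E) \<in> axis N" using proj_in_axis[OF P(1)] PN PE by simp
      define Q where "Q = cosh a *\<^sub>R X + sinh a *\<^sub>R E"
      have QN: "mink Q N = 0"
        using PN PE unfolding Q_def cosh_combo a by simp
      obtain U where U: "mink U U = 1" "mink X U = 0" "mink n U = 0" using frame_normal[OF n] .
      have EU: "mink E U = 0" "mink U E = 0" "mink U X = 0" using U \<sigma>(2) by (auto simp: mink_sym)
      have fQ: "frame Q U"
        using frame_curve(1)[OF E, of a] frame_curve(2)[OF E, of a a] U EU
        by (simp add: frame_def Q_def future_def)
      have UN: "mink U N = 0" unfolding N' using U by (simp add: mink_sym)
      have rg: "range (gline Q U) = axis N" unfolding ax using fQ m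
        by (rule range_gline) (auto simp: mN QN UN)
      have z0: "gline Q U 0 = gline X E a" by (simp add: gline_def Q_def)
      have z: "gline X E a \<in> hdisk" using hpt_gline[OF E] by simp
      have "mink (dhpt (gline X E a) (vector_derivative (gline Q U) (at 0)))
          (dhpt (gline X E a) (vector_derivative (gline X E) (at a))) = 0"
        using gline_velocity(2)[OF fQ, of 0] gline_velocity(2)[OF E, of a] EU z0 by simp
      then have "vector_derivative (gline Q U) (at 0) \<bullet> vector_derivative (gline X E) (at a) = 0"
        using perpendicular_inner_iff[OF z] by simp
      then have "perpendicular_at (gline X E) (axis N) a" unfolding perpendicular_at_def
        using geodesic_line_gline[OF fQ] rg z0 by blast
      then show "line_ends_at (gline X E) x C"
        using e a by (simp add: line_ends_at_def ext_line_gline[OF E] cen)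
    qed
  qed
qed

text \<open>Since both ends follow the common normal, the line is determined up to its direction, and the direction is
fixed by the requirement that the end at the first circle comes first.\<close>
lemma edge_param_iff:
  assumes r: "represents N1 C1" "represents N2 C2"
    and X: "tangency_point C1 C2 = proj X" "frame X n"
    and N: "N1 = curvature C1 *\<^sub>R X + n" "N2 = curvature C2 *\<^sub>R X - n"
    and p: "curvature C1 + curvature C2 > 0"
  shows "edge_param C1 C2 \<gamma> a b \<longleftrightarrow> \<gamma> = gline X (- n) \<and> th a = - kap (curvature C1) \<and> th b = kap (curvature C2)"
proof -
  define k1 where "k1 = curvature C1"
  define k2 where "k2 = curvature C2"
  have k: "k1 \<ge> 0" "k2 \<ge> 0" using r by (auto simp: represents_def k1_def k2_def)
  have n': "frame X (- n)" using frame_uminus[OF X(2)] .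
  have nn: "mink n n = 1" using X(2) by (simp add: frame_def)
  have N2': "N2 = curvature C2 *\<^sub>R X + - n" using N by simp
  note L1 = line_ends_at_iff[OF r(1) _ X(2) N(1)] and L2 = line_ends_at_iff[OF r(2) _ n' N2']
  have hX: "hpt (proj X) = X" using X(2) by (intro hpt_proj) (auto simp: frame_def future_def)
  show ?thesis
  proof
    assume e: "edge_param C1 C2 \<gamma> a b"
    then obtain A E where AE: "frame A E" "\<gamma> = gline A E"
      unfolding edge_param_def using geodesic_line_frame by metis
    have "gline A E 0 = proj X" using e X AE by (simp add: edge_param_def)
    then have AX: "A = X" using hpt_gline(2)[OF AE(1), of 0] hX by simp
    note E = AE[unfolded AX]
    have ab: "th a \<le> 0" "th b \<ge> 0" using e th_le_iff[of a 0] th_le_iff[of 0 b] by (auto simp: edge_param_def)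
    obtain \<sigma> where s: "\<sigma> \<in> {1,-1}" "E = \<sigma> *\<^sub>R n" "th a = \<sigma> * kap k1"
    proof -
      have "line_ends_at (gline X E) a C1" using e by (simp add: edge_param_def E(2))
      then show ?thesis using that unfolding L1[OF E(1), of a] k1_def by blast
    qed
    obtain \<sigma>' where s': "\<sigma>' \<in> {1,-1}" "E = \<sigma>' *\<^sub>R - n" "th b = \<sigma>' * kap k2"
    proof -
      have "line_ends_at (gline X E) b C2" using e by (simp add: edge_param_def E(2))
      then show ?thesis using that unfolding L2[OF E(1), of b] k2_def by blast
    qed
    have "mink E n = \<sigma>" unfolding s(2) using nn by simp
    moreover have "mink E n = - \<sigma>'" unfolding s'(2) using nn by simp
    ultimately have ss: "\<sigma>' = - \<sigma>" by simp
    \<comment> \<open>Otherwise both curvatures would vanish.\<close>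
    have "\<sigma> = -1"
    proof (rule ccontr)
      assume "\<sigma> \<noteq> -1"
      then have "\<sigma> = 1" using s(1) by auto
      then have "kap k1 \<le> 0" "kap k2 \<le> 0" using ab s(3) s'(3) ss by auto
      then have "k1 = 0" "k2 = 0" using kap_bounds(2)[of k1] kap_bounds(2)[of k2] k by (auto simp: less_le)
      then show False using p by (simp add: k1_def k2_def)
    qed
    then show "\<gamma> = gline X (- n) \<and> th a = - kap (curvature C1) \<and> th b = kap (curvature C2)"
      using s s' ss E(2) by (simp add: k1_def k2_def)
  next
    assume a: "\<gamma> = gline X (- n) \<and> th a = - kap (curvature C1) \<and> th b = kap (curvature C2)"
    have "a \<le> 0" "0 \<le> b" using a kap_bounds(1)[OF k(1)] kap_bounds(1)[OF k(2)] th_le_iff[of a 0] th_le_iff[of 0 b]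
      by (auto simp: k1_def k2_def)
    moreover have "line_ends_at \<gamma> a C1" using a L1[OF n', of a] by auto
    moreover have "line_ends_at \<gamma> b C2" using a L2[OF n', of b] by auto
    ultimately show "edge_param C1 C2 \<gamma> a b"
      unfolding edge_param_def using a geodesic_line_gline[OF n'] X(1) by (simp add: gline_def)
  qed
qed

text \<open>The edge between two tangent circles as a set described by linear conditions: the points of the plane
of \<open>N1\<close> and \<open>N2\<close> between the two centres. A centre that is a point is reached where a coefficient
vanishes, one that is an axis where the product with its normal vanishes.\<close>
definition wedge :: "mvec \<Rightarrow> mvec \<Rightarrow> complex set" where
  "wedge N1 N2 = {z. norm z \<le> 1 \<and> (\<exists>x1\<ge>0. \<exists>x2\<ge>0. lift z = x1 *\<^sub>R N1 + x2 *\<^sub>R N2) \<and>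
     mink (lift z) N1 \<le> 0 \<and> mink (lift z) N2 \<le> 0}"

lemma wedge_sym: "wedge N1 N2 = wedge N2 N1"
  unfolding wedge_def by (auto simp: add.commute) (metis add.commute)+

lemma proj_in_wedge:
  assumes "future P" "P = x1 *\<^sub>R N1 + x2 *\<^sub>R N2" "x1 \<ge> 0" "x2 \<ge> 0" "mink P N1 \<le> 0" "mink P N2 \<le> 0"
  shows "proj P \<in> wedge N1 N2"
proof -
  obtain c where c: "c > 0" "lift (proj P) = c *\<^sub>R P" using lift_proj_pos[OF assms(1)] .
  have "lift (proj P) = (c * x1) *\<^sub>R N1 + (c * x2) *\<^sub>R N2" unfolding c(2) by (subst (1) assms(2)) (simp add: scaleR_add_right)
  moreover have "c * x1 \<ge> 0" "c * x2 \<ge> 0" using c assms by auto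
  moreover have "mink (lift (proj P)) N1 \<le> 0" "mink (lift (proj P)) N2 \<le> 0"
    unfolding c(2) using c(1) assms(5,6) by (simp_all add: mult_nonneg_nonpos)
  ultimately show ?thesis unfolding wedge_def
    using lift_proj(1)[OF assms(1)] by blast
qed

lemma edge_eq_wedge:
  assumes r: "represents N1 C1" "represents N2 C2" and e: "externally_tangent C1 C2"
  shows "edge C1 C2 = wedge N1 N2"
proof -
  define k1 where "k1 = curvature C1"
  define k2 where "k2 = curvature C2"
  have k: "k1 \<ge> 0" "k2 \<ge> 0" and N: "mink N1 N1 = 1 - k1\<^sup>2" "mink N2 N2 = 1 - k2\<^sup>2"
    using r by (auto simp: represents_def k1_def k2_def)
  note et = externally_tangent_mink[OF r e, folded k1_def k2_def]
  have m21: "mink N2 N1 = -1 - k1 * k2" using et(1) by (simp add: mink_sym)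
  show ?thesis
  proof (cases "k1 + k2 = 0")
    case True
    then have k0: "k1 = 0" "k2 = 0" using k by auto
    have "edge C1 C2 = {proj (N1 + N2)}" using et(3) k0 by (simp add: edge_def k1_def k2_def)
    also have "\<dots> = wedge N1 N2"
    proof
      show "{proj (N1 + N2)} \<subseteq> wedge N1 N2"
        using proj_in_wedge[OF et(2), of 1 N1 1 N2] N et(1) m21 k0 by simp
      show "wedge N1 N2 \<subseteq> {proj (N1 + N2)}"
      proof
        fix z assume "z \<in> wedge N1 N2"
        then obtain x1 x2 where z: "norm z \<le> 1" "x1 \<ge> 0" "x2 \<ge> 0" "lift z = x1 *\<^sub>R N1 + x2 *\<^sub>R N2"
          "mink (lift z) N1 \<le> 0" "mink (lift z) N2 \<le> 0" by (auto simp: wedge_def)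
        have "x1 = x2" using z(5,6) N et(1) m21 k0 unfolding z(4) by simp
        then have l: "lift z = x1 *\<^sub>R (N1 + N2)" using z(4) by (simp add: scaleR_add_right)
        have "x1 \<noteq> 0" using l future_lift[of z] by (auto simp: future_def)
        then have "proj (lift z) = proj (N1 + N2)" unfolding l using z(2) by (simp add: proj_scale del: scaleR_add_right)
        then show "z \<in> {proj (N1 + N2)}" using proj_lift[OF z(1)] by simp
      qed
    qed
    finally show ?thesis .
  next
    case False
    then have p: "k1 + k2 > 0" using k by linarith
    define X where "X = (1 / (k1 + k2)) *\<^sub>R (N1 + N2)"
    define n where "n = (1 / (k1 + k2)) *\<^sub>R (k2 *\<^sub>R N1 - k1 *\<^sub>R N2)"
    have fs: "fst (N1 + N2) > 0" using et(2) by (simp add: future_def)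
    note tf = tangency_frame[OF N et(1) fs p, folded X_def n_def]
    have tX: "tangency_point C1 C2 = proj X" using et(3) tf(4) by simp
    note ep = edge_param_iff[OF r tX tf(1) tf(2,3)[unfolded k1_def k2_def] p[unfolded k1_def k2_def], folded k1_def k2_def]
    have n': "frame X (- n)" using frame_uminus[OF tf(1)] .
    obtain a where a: "th a = - kap k1" using th_surj[of "- kap k1"] kap_bounds(1)[OF k(1)] by auto
    obtain b where b: "th b = kap k2" using th_surj[of "kap k2"] kap_bounds(1)[OF k(2)] by auto
    define Eset where "Eset = (\<lambda>t. proj (X + t *\<^sub>R - n)) ` {- kap k1..kap k2}"
    have "edge C1 C2 = (THE e. \<exists>\<gamma> a b. edge_param C1 C2 \<gamma> a b \<and> e = ext_line \<gamma> ` {a..b})"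
      using False k by (auto simp: edge_def k1_def k2_def)
    also have "\<dots> = Eset"
    proof (rule the_equality)
      show "\<exists>\<gamma> a b. edge_param C1 C2 \<gamma> a b \<and> Eset = ext_line \<gamma> ` {a..b}"
        using ep[of "gline X (- n)" a b] a b ext_line_image[OF n', of a b]
        by (intro exI[of _ "gline X (- n)"] exI[of _ a] exI[of _ b]) (simp add: Eset_def)
      fix e assume "\<exists>\<gamma> a b. edge_param C1 C2 \<gamma> a b \<and> e = ext_line \<gamma> ` {a..b}"
      then show "e = Eset" using ep ext_line_image[OF n'] by (auto simp: Eset_def)
    qed
    also have "Eset = wedge N1 N2"
    proof
      have co: "X + t *\<^sub>R - n = ((1 - k2 * t) / (k1 + k2)) *\<^sub>R N1 + ((1 + k1 * t) / (k1 + k2)) *\<^sub>R N2" for t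
        unfolding X_def n_def using p
        by (simp add: scaleR_add_right scaleR_diff_right add_divide_distrib diff_divide_distrib algebra_simps)
      have y: "mink (X + t *\<^sub>R - n) N1 = - k1 - t" "mink (X + t *\<^sub>R - n) N2 = - k2 + t" for t
        unfolding tf(2,3) using tf(1) by (simp_all add: frame_def mink_sym)
      show "Eset \<subseteq> wedge N1 N2"
      proof
        fix z assume "z \<in> Eset"
        then obtain t where t: "z = proj (X + t *\<^sub>R - n)" "- kap k1 \<le> t" "t \<le> kap k2" by (auto simp: Eset_def)
        have 1: "kap k1 \<le> k1" "kap k2 \<le> k2" using k kap_le by auto
        have "k1 * t \<ge> -1" "k2 * t \<le> 1"
        proof -
          have kk: "k * kap k \<le> 1" if "k \<ge> 0" for k :: real
            using that by (auto simp: kap_def mult_le_one)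
          have "k1 * t \<ge> k1 * - kap k1" using t k by (intro mult_left_mono) auto
          then show "k1 * t \<ge> -1" using kk[OF k(1)] by simp
          have "k2 * t \<le> k2 * kap k2" using t k by (intro mult_left_mono) auto
          then show "k2 * t \<le> 1" using kk[OF k(2)] by simp
        qed
        moreover have "\<bar>t\<bar> \<le> 1" using t kap_bounds(1)[OF k(1)] kap_bounds(1)[OF k(2)] by auto
        ultimately show "z \<in> wedge N1 N2" unfolding t(1)
          using p t 1 frame_combo(1)[OF n', of t] y
          by (intro proj_in_wedge[OF _ co]) auto
      qed
      show "wedge N1 N2 \<subseteq> Eset"
      proof
        fix z assume "z \<in> wedge N1 N2"
        then obtain x1 x2 where z: "norm z \<le> 1" "x1 \<ge> 0" "x2 \<ge> 0" "lift z = x1 *\<^sub>R N1 + x2 *\<^sub>R N2"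
          "mink (lift z) N1 \<le> 0" "mink (lift z) N2 \<le> 0" by (auto simp: wedge_def)
        define c where "c = k1 * x1 + k2 * x2"
        have l: "lift z = c *\<^sub>R X + (x1 - x2) *\<^sub>R n" unfolding z(4) c_def
          by (subst (1) tf(2), subst (1) tf(3)) (simp add: algebra_simps)
        have fx: "mink X X = -1" "mink n n = 1" "mink X n = 0" "mink n X = 0" using tf(1) by (auto simp: frame_def mink_sym)
        have "mink X (lift z) = - c" unfolding l using fx by simp
        then have c: "c > 0" using future_mink_less[OF frame_future[OF tf(1)] _ future_lift[of z]] fx by simp
        define t where "t = (x2 - x1) / c"
        have lt: "lift z = c *\<^sub>R (X + t *\<^sub>R - n)" unfolding l t_def using c
          by (simp add: scaleR_add_right scaleR_diff_right scaleR_diff_left diff_divide_distrib algebra_simps)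
        have "proj (lift z) = proj (X + t *\<^sub>R - n)" unfolding lt using c by (rule proj_scale)
        then have pz: "z = proj (X + t *\<^sub>R - n)" using proj_lift[OF z(1)] by simp
        have "c * (- k1 - t) \<le> 0" "c * (- k2 + t) \<le> 0" using z(5,6) y[of t] unfolding lt by (simp_all only: mink_linear)
        then have 1: "- k1 \<le> t" "t \<le> k2" using c by (auto simp: mult_le_0_iff)
        have 2: "- (1 / k1) \<le> t" if "k1 \<ge> 1"
        proof -
          have "x1 - x2 \<le> x1 + k2 * x2 / k1" using that z(3) k divide_nonneg_nonneg[of "k2 * x2" k1] mult_nonneg_nonneg[of k2 x2] by linarith
          also have "\<dots> = c / k1" using that by (simp add: c_def add_divide_distrib)
          finally have "(x1 - x2) / c \<le> (c / k1) / c" using c by (intro divide_right_mono) auto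
          then show ?thesis using c by (simp add: t_def diff_divide_distrib)
        qed
        have 3: "t \<le> 1 / k2" if "k2 \<ge> 1"
        proof -
          have "x2 - x1 \<le> x2 + k1 * x1 / k2" using that z(2) k divide_nonneg_nonneg[of "k1 * x1" k2] mult_nonneg_nonneg[of k1 x1] by linarith
          also have "\<dots> = c / k2" using that by (simp add: c_def add_divide_distrib)
          finally have "(x2 - x1) / c \<le> (c / k2) / c" using c by (intro divide_right_mono) auto
          then show ?thesis using c by (simp add: t_def)
        qed
        have "t \<in> {- kap k1..kap k2}" using 1 2 3 by (auto simp: kap_def)
        then show "z \<in> Eset" unfolding Eset_def pz by blast
      qed
    qed
    finally show ?thesis .
  qed
qed

section \<open>Domains bounded by closed sets\<close>

lemma mink_lift_sign: "z \<in> hdisk \<Longrightarrow> mink (lift z) M < 0 \<longleftrightarrow> mink (hpt z) M < 0"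
  using one_minus_pos[of z] by (simp add: lift_hpt mult_less_0_iff)

text \<open>A set \<open>B\<close> in the closed disk on one side of a geodesic does not enclose points of the other side: the open half plane
there can be left through an ideal point \<open>p\<close> without meeting \<open>B\<close>, and the exterior of the disk is unbounded.\<close>
lemma inside_halfplane:
  assumes M: "mink M M > 0" and B: "\<And>z. z \<in> B \<Longrightarrow> norm z \<le> 1 \<and> mink (lift z) M \<ge> 0"
    and q: "q \<in> hdisk" "q \<in> B \<union> inside B"
  shows "mink (lift q) M \<ge> 0"
proof (rule ccontr)
  assume "\<not> ?thesis"
  then have neg: "mink (lift q) M < 0" by simp
  then have qB: "q \<notin> B" using B by fastforce
  then have qi: "q \<in> inside B" using q by blast
  define n where "n = (1 / sqrt (mink M M)) *\<^sub>R M"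
  have n: "mink n n = 1" using M by (simp add: n_def)
  have sg: "mink V n < 0 \<longleftrightarrow> mink V M < 0" for V using M by (simp add: n_def divide_less_0_iff)
  define H where "H = level n {..<0}"
  have H: "connected H" unfolding H_def by (rule level_connected[OF n]) simp
  have Hm: "z \<in> H \<longleftrightarrow> z \<in> hdisk \<and> mink (lift z) M < 0" for z
    by (auto simp: H_def level_def sg mink_lift_sign)
  obtain A E where AE: "frame A E" "mink A n = 0" "mink E n = 0" using frame_exists[OF n] .
  have fn: "frame A n" using AE n by (simp add: frame_def)
  define p where "p = proj (A + (-1) *\<^sub>R n)"
  have P: "future (A + (-1) *\<^sub>R n)" "mink (A + (-1) *\<^sub>R n) (A + (-1) *\<^sub>R n) = 0"
    using frame_combo[OF fn, of "-1"] by auto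
  have p1: "norm p = 1" unfolding p_def using lift_proj(3)[OF P(1)] P(2) by simp
  obtain c where c: "c > 0" "lift p = c *\<^sub>R (A + (-1) *\<^sub>R n)" unfolding p_def using lift_proj_pos[OF P(1)] .
  have "mink (lift p) n = - c" unfolding c using AE n by simp
  then have pM: "mink (lift p) M < 0" using c(1) sg[of "lift p"] by simp
  have "(gline A n \<longlongrightarrow> p) at_bot" unfolding p_def by (rule gline_tendsto[OF fn tanh_real_at_bot]) simp
  moreover have "\<forall>\<^sub>F s in at_bot. gline A n s \<in> closure H"
  proof (rule eventually_mono[OF eventually_le_at_bot[of "-1"]])
    fix s :: real assume "s \<le> -1"
    then have "mink (hpt (gline A n s)) n < 0" using hpt_gline(2)[OF fn, of s] AE n by (simp add: mink_sym)
    then have "gline A n s \<in> H" using hpt_gline(1)[OF fn] by (simp add: H_def level_def)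
    then show "gline A n s \<in> closure H" using closure_subset by blast
  qed
  ultimately have pcl: "p \<in> closure H" by (rule Lim_in_closed_set[OF closed_closure, rotated 2]) simp
  have c1: "connected (H \<union> {p})"
    by (rule connected_intermediate_closure[OF H]) (use pcl closure_subset in auto)
  define O1 where "O1 = {z::complex. norm z > 1}"
  have O1: "connected O1"
  proof -
    have "O1 = - cball 0 1" by (auto simp: O1_def)
    then show ?thesis by (simp add: connected_complement_bounded_convex)
  qed
  have "p \<in> closure O1"
  proof (rule Lim_in_closed_set[OF closed_closure])
    show "((\<lambda>t. (1 + t) *\<^sub>R p) \<longlongrightarrow> p) (at_right 0)"
      by (rule tendsto_eq_intros refl | simp)+
    show "\<forall>\<^sub>F t in at_right 0. (1 + t) *\<^sub>R p \<in> closure O1"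
    proof (rule eventually_mono[OF eventually_at_right_less])
      fix t :: real assume "0 < t"
      then have "(1 + t) *\<^sub>R p \<in> O1" using p1 by (simp add: O1_def)
      then show "(1 + t) *\<^sub>R p \<in> closure O1" using closure_subset by blast
    qed
  qed simp
  then have c2: "connected (O1 \<union> {p})"
    using closure_subset by (intro connected_intermediate_closure[OF O1]) auto
  have "connected ((H \<union> {p}) \<union> (O1 \<union> {p}))"
    by (rule connected_Un[OF c1 c2]) auto
  moreover have "q \<in> (H \<union> {p}) \<union> (O1 \<union> {p})" using q(1) neg Hm by auto
  moreover have "(H \<union> {p}) \<union> (O1 \<union> {p}) \<subseteq> - B" using B Hm pM by (fastforce simp: O1_def)
  ultimately have sub: "(H \<union> {p}) \<union> (O1 \<union> {p}) \<subseteq> connected_component_set (- B) q"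
    by (intro connected_component_maximal)
  have "bounded (connected_component_set (- B) q)" using qi by (simp add: inside_def)
  then have "bounded O1" by (rule bounded_subset) (use sub in blast)
  moreover have "\<not> bounded O1"
  proof
    assume "bounded O1"
    then obtain b where b: "\<And>z. z \<in> O1 \<Longrightarrow> norm z \<le> b" by (auto simp: bounded_iff)
    have "complex_of_real (\<bar>b\<bar> + 2) \<in> O1" by (simp add: O1_def)
    from b[OF this] show False by simp
  qed
  ultimately show False by simp
qed

text \<open>A connected subset of the complement of \<open>B\<close> that meets \<open>D\<close> cannot leave \<open>D\<close>.\<close>
lemma bounded_region_subset_inside:
  fixes D :: "complex set"
  assumes "bounded D" "frontier D \<subseteq> B"
  shows "D \<subseteq> B \<union> inside B"
proof
  fix z assume z: "z \<in> D"
  show "z \<in> B \<union> inside B"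
  proof (cases "z \<in> B")
    case False
    have "connected_component_set (- B) z \<subseteq> D"
    proof (rule ccontr)
      assume n: "\<not> ?thesis"
      have "z \<in> connected_component_set (- B) z" using False by simp
      then have "connected_component_set (- B) z \<inter> frontier D \<noteq> {}"
        using n z connected_Int_frontier[OF connected_connected_component[of "- B" z], of D] by blast
      then show False using assms(2) connected_component_subset[of "- B" z] by blast
    qed
    then have "bounded (connected_component_set (- B) z)" by (rule bounded_subset[OF assms(1)])
    then show ?thesis using False by (simp add: inside_def)
  qed simp
qed

lemma continuous_on_mdet:
  assumes "continuous_on A f" "continuous_on A g" "continuous_on A h"
  shows "continuous_on A (\<lambda>x. mdet (f x) (g x) (h x))"
  unfolding mdet_def by (intro continuous_intros assms)

section \<open>Three tangent circles\<close>

locale triple =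
  fixes C1 C2 C3 :: gcircle and N1 N2 N3 :: mvec
  assumes r1: "represents N1 C1" and r2: "represents N2 C2" and r3: "represents N3 C3"
    and e12: "externally_tangent C1 C2" and e23: "externally_tangent C2 C3" and e31: "externally_tangent C3 C1"
begin

abbreviation "k1 \<equiv> curvature C1"
abbreviation "k2 \<equiv> curvature C2"
abbreviation "k3 \<equiv> curvature C3"

lemma k_nonneg: "k1 \<ge> 0" "k2 \<ge> 0" "k3 \<ge> 0"
  using r1 r2 r3 by (auto simp: represents_def)

lemma externally_tangent_sym: "externally_tangent C C' \<Longrightarrow> externally_tangent C' C"
proof -
  assume e: "externally_tangent C C'"
  have "is_tangency_point C' C t = is_tangency_point C C' t" for t
    unfolding is_tangency_point_def curves_tangent_at_def by auto
  then show ?thesis using e unfolding externally_tangent_def by (auto simp: Int_commute)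
qed

lemma e13: "externally_tangent C1 C3"
  using e31 by (rule externally_tangent_sym)

lemma gram:
  "mink N1 N1 = 1 - k1\<^sup>2" "mink N2 N2 = 1 - k2\<^sup>2" "mink N3 N3 = 1 - k3\<^sup>2"
  "mink N1 N2 = -1 - k1 * k2" "mink N2 N3 = -1 - k2 * k3" "mink N1 N3 = -1 - k1 * k3"
  "mink N2 N1 = -1 - k1 * k2" "mink N3 N2 = -1 - k2 * k3" "mink N3 N1 = -1 - k1 * k3"
proof -
  show "mink N1 N1 = 1 - k1\<^sup>2" "mink N2 N2 = 1 - k2\<^sup>2" "mink N3 N3 = 1 - k3\<^sup>2"
    using r1 r2 r3 by (auto simp: represents_def)
  show "mink N1 N2 = -1 - k1 * k2" "mink N2 N3 = -1 - k2 * k3"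
     "mink N2 N1 = -1 - k1 * k2" "mink N3 N2 = -1 - k2 * k3"
    using externally_tangent_mink(1)[OF r1 r2 e12] externally_tangent_mink(1)[OF r2 r3 e23] by (auto simp: mink_sym)
  show "mink N1 N3 = -1 - k1 * k3" "mink N3 N1 = -1 - k1 * k3"
    using externally_tangent_mink(1)[OF r3 r1 e31] by (auto simp: mink_sym mult.commute)
qed

lemma futures: "future (N1 + N2)" "future (N2 + N3)" "future (N1 + N3)"
  using externally_tangent_mink(2)[OF r1 r2 e12] externally_tangent_mink(2)[OF r2 r3 e23]
    externally_tangent_mink(2)[OF r1 r3 e13] by auto

definition "S = k1 * k2 + k2 * k3 + k3 * k1"
definition "K = sqrt (1 + S)"

lemma S_nonneg: "S \<ge> 0" using k_nonneg by (simp add: S_def)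
lemma K_ge: "K \<ge> 1" "K > 0" "K\<^sup>2 = 1 + S" using S_nonneg by (auto simp: K_def intro: less_le_trans[of 0 1])

text \<open>The Gram matrix of the three normals is \<open>2 * I - J - k k\<^sup>T\<close>, where \<open>I\<close> is the unit matrix and \<open>J\<close> has all entries \<open>1\<close>.\<close>
lemma det_sq: "(mdet N1 N2 N3)\<^sup>2 = 4 * K\<^sup>2"
  unfolding mdet_gram gram K_ge(3) S_def by (simp add: power2_eq_square algebra_simps)

lemma det_nz: "mdet N1 N2 N3 \<noteq> 0"
  using det_sq K_ge(2) by auto

text \<open>The coordinates with respect to the basis \<open>N1\<close>, \<open>N2\<close>, \<open>N3\<close>.\<close>
definition "co1 W = mdet W N2 N3 / mdet N1 N2 N3"
definition "co2 W = mdet N1 W N3 / mdet N1 N2 N3"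
definition "co3 W = mdet N1 N2 W / mdet N1 N2 N3"

lemma co_expand: "W = co1 W *\<^sub>R N1 + co2 W *\<^sub>R N2 + co3 W *\<^sub>R N3"
proof -
  have "W = (1 / mdet N1 N2 N3) *\<^sub>R (mdet N1 N2 N3 *\<^sub>R W)" using det_nz by simp
  also have "\<dots> = co1 W *\<^sub>R N1 + co2 W *\<^sub>R N2 + co3 W *\<^sub>R N3"
    unfolding mdet_cramer[of N1 N2 N3 W] by (simp add: co1_def co2_def co3_def scaleR_add_right)
  finally show ?thesis .
qed

lemma co_combo:
  "co1 (a *\<^sub>R N1 + b *\<^sub>R N2 + c *\<^sub>R N3) = a" "co2 (a *\<^sub>R N1 + b *\<^sub>R N2 + c *\<^sub>R N3) = b"
  "co3 (a *\<^sub>R N1 + b *\<^sub>R N2 + c *\<^sub>R N3) = c"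
proof -
  have "mdet (a *\<^sub>R N1 + b *\<^sub>R N2 + c *\<^sub>R N3) N2 N3 = a * mdet N1 N2 N3"
    "mdet N1 (a *\<^sub>R N1 + b *\<^sub>R N2 + c *\<^sub>R N3) N3 = b * mdet N1 N2 N3"
    "mdet N1 N2 (a *\<^sub>R N1 + b *\<^sub>R N2 + c *\<^sub>R N3) = c * mdet N1 N2 N3"
    by (simp_all add: mdet_def algebra_simps)
  then show "co1 (a *\<^sub>R N1 + b *\<^sub>R N2 + c *\<^sub>R N3) = a" "co2 (a *\<^sub>R N1 + b *\<^sub>R N2 + c *\<^sub>R N3) = b"
    "co3 (a *\<^sub>R N1 + b *\<^sub>R N2 + c *\<^sub>R N3) = c"
    using det_nz by (simp_all add: co1_def co2_def co3_def)
qed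

lemma co_continuous:
  assumes "continuous_on A f"
  shows "continuous_on A (\<lambda>x. co1 (f x))" "continuous_on A (\<lambda>x. co2 (f x))" "continuous_on A (\<lambda>x. co3 (f x))"
  unfolding co1_def co2_def co3_def
  by (intro continuous_on_divide continuous_on_mdet assms continuous_on_const; simp add: det_nz)+

text \<open>The packed triangle, described by linear inequalities: it is bounded by an edge where a coordinate
vanishes, and by a vertex that is part of an axis where the product with a normal vanishes.\<close>
definition region :: "complex set" where
  "region = {z. norm z \<le> 1 \<and> co1 (lift z) \<ge> 0 \<and> co2 (lift z) \<ge> 0 \<and> co3 (lift z) \<ge> 0 \<and>
     mink (lift z) N1 \<le> 0 \<and> mink (lift z) N2 \<le> 0 \<and> mink (lift z) N3 \<le> 0}"

lemma regionI:
  assumes "future P" "P = a *\<^sub>R N1 + b *\<^sub>R N2 + c *\<^sub>R N3" "a \<ge> 0" "b \<ge> 0" "c \<ge> 0"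
    "mink P N1 \<le> 0" "mink P N2 \<le> 0" "mink P N3 \<le> 0"
  shows "proj P \<in> region"
proof -
  obtain d where d: "d > 0" "lift (proj P) = d *\<^sub>R P" using lift_proj_pos[OF assms(1)] .
  have l: "lift (proj P) = (d * a) *\<^sub>R N1 + (d * b) *\<^sub>R N2 + (d * c) *\<^sub>R N3"
    unfolding d(2) using arg_cong[OF assms(2), of "\<lambda>P. d *\<^sub>R P"] by (simp add: scaleR_add_right)
  have "mink (lift (proj P)) N1 \<le> 0" "mink (lift (proj P)) N2 \<le> 0" "mink (lift (proj P)) N3 \<le> 0"
    unfolding d(2) using d(1) assms(6-8) by (simp_all add: mult_nonneg_nonpos)
  moreover have "co1 (lift (proj P)) \<ge> 0" "co2 (lift (proj P)) \<ge> 0" "co3 (lift (proj P)) \<ge> 0"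
    unfolding l co_combo using d(1) assms(3-5) by auto
  ultimately show ?thesis unfolding region_def using lift_proj(1)[OF assms(1)] by blast
qed

lemma edges: "edge C1 C2 = wedge N1 N2" "edge C2 C3 = wedge N2 N3" "edge C3 C1 = wedge N3 N1" "edge C1 C3 = wedge N3 N1"
  using edge_eq_wedge[OF r1 r2 e12] edge_eq_wedge[OF r2 r3 e23] edge_eq_wedge[OF r3 r1 e31]
    edge_eq_wedge[OF r1 r3 e13] wedge_sym[of N1 N3] by simp_all

text \<open>The foot of the edge on the axis of the first circle, as a vector of the plane of \<open>N1\<close> and
\<open>N2\<close> orthogonal to \<open>N1\<close>.\<close>
definition "P12 = (1 + k1 * k2) *\<^sub>R N1 + (1 - k1\<^sup>2) *\<^sub>R N2"
definition "P13 = (1 + k1 * k3) *\<^sub>R N1 + (1 - k1\<^sup>2) *\<^sub>R N3"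

text \<open>The edge from a hypercycle or geodesic meets its axis only in \<open>P\<close>. If both curvatures vanish, \<open>P\<close> is the
common ideal point; otherwise it is timelike.\<close>
lemma foot:
  assumes g: "mink N1 N1 = 1 - a\<^sup>2" "mink M M = 1 - b\<^sup>2" "mink N1 M = -1 - a * b" "future (N1 + M)"
    and a: "0 \<le> a" "a < 1" "0 \<le> b"
  defines "P \<equiv> (1 + a * b) *\<^sub>R N1 + (1 - a\<^sup>2) *\<^sub>R M"
  shows "future P" "mink P N1 = 0" "mink P M = - (a + b)\<^sup>2" "proj P \<in> wedge N1 M"
    "\<And>z. z \<in> wedge N1 M \<Longrightarrow> mink (lift z) N1 = 0 \<Longrightarrow> z = proj P"
proof -
  have MN: "mink M N1 = -1 - a * b" using g(3) by (simp add: mink_sym)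
  have pos: "1 - a\<^sup>2 > 0" using a by (simp add: power_less_one_iff abs_square_less_1)
  show 1: "mink P N1 = 0" unfolding P_def by (simp add: g MN algebra_simps)
  show 2: "mink P M = - (a + b)\<^sup>2" unfolding P_def by (simp add: g MN) (simp add: algebra_simps power2_eq_square)
  have PP: "mink P P = (1 - a\<^sup>2) * - (a + b)\<^sup>2"
  proof -
    have "mink P P = (1 + a * b) * mink P N1 + (1 - a\<^sup>2) * mink P M"
      by (subst (2) P_def) simp
    then show ?thesis unfolding 1 2 by simp
  qed
  show fP: "future P"
  proof (cases "a + b = 0")
    case True
    then have "a = 0" "b = 0" using a by auto
    then show ?thesis using g(4) by (simp add: P_def)
  next
    case False
    have "mink P (N1 + M) = - (a + b)\<^sup>2" by (simp add: 1 2)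
    moreover have "(a + b)\<^sup>2 > 0" using False by simp
    ultimately show ?thesis using timelike_future_iff[OF _ g(4), of P] PP pos by (simp add: mult_pos_pos)
  qed
  show "proj P \<in> wedge N1 M"
    by (rule proj_in_wedge[OF fP meta_eq_to_obj_eq[OF P_def]]) (use pos a 1 2 in auto)
  fix z assume z: "z \<in> wedge N1 M" "mink (lift z) N1 = 0"
  then obtain x y where xy: "norm z \<le> 1" "x \<ge> 0" "y \<ge> 0" "lift z = x *\<^sub>R N1 + y *\<^sub>R M" by (auto simp: wedge_def)
  have "x * (1 - a\<^sup>2) = y * (1 + a * b)" using z(2) unfolding xy(4) by (simp add: g MN algebra_simps)
  then have x: "x = (y / (1 - a\<^sup>2)) * (1 + a * b)" using pos by (simp add: field_simps)
  have l: "lift z = (y / (1 - a\<^sup>2)) *\<^sub>R P" unfolding xy(4) P_def x using pos by (simp add: scaleR_add_right)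
  have "y \<noteq> 0" using l future_lift[of z] by (auto simp: future_def)
  then have "proj (lift z) = proj P" unfolding l using xy(3) pos by (intro proj_scale) simp
  then show "z = proj P" using proj_lift[OF xy(1)] by simp
qed

lemmas foot12 = foot[OF gram(1,2,4) futures(1) k_nonneg(1) _ k_nonneg(2), folded P12_def]
lemmas foot13 = foot[OF gram(1,3,6) futures(3) k_nonneg(1) _ k_nonneg(3), folded P13_def]

text \<open>The segment of the axis of the first circle between the feet of its two edges.\<close>
definition vseg :: "complex set" where
  "vseg = {proj (s *\<^sub>R P12 + t *\<^sub>R P13) | s t. 0 \<le> s \<and> 0 \<le> t \<and> 0 < s + t}"

text \<open>Segments of an extended line are projections of cones over their end points, whatever the lengths of the
vectors that represent these end points.\<close>
lemma segment_proj:
  assumes "\<alpha> \<le> \<beta>" "c > 0" "d > 0"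
  shows "(\<lambda>t. proj (A + t *\<^sub>R B)) ` {\<alpha>..\<beta>}
    = {proj (s *\<^sub>R (c *\<^sub>R (A + \<alpha> *\<^sub>R B)) + t *\<^sub>R (d *\<^sub>R (A + \<beta> *\<^sub>R B))) | s t. 0 \<le> s \<and> 0 \<le> t \<and> 0 < s + t}"
    (is "?L = ?R")
proof
  show "?R \<subseteq> ?L"
  proof
    fix z assume "z \<in> ?R"
    then obtain s t where st: "0 \<le> s" "0 \<le> t" "0 < s + t"
       "z = proj (s *\<^sub>R (c *\<^sub>R (A + \<alpha> *\<^sub>R B)) + t *\<^sub>R (d *\<^sub>R (A + \<beta> *\<^sub>R B)))" by blast
    define s' where "s' = s * c"
    define t' where "t' = t * d"
    have p: "s' \<ge> 0" "t' \<ge> 0" "s' + t' > 0" using st assms(2,3)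
    proof -
      show "s' \<ge> 0" "t' \<ge> 0" using st assms(2,3) by (auto simp: s'_def t'_def)
      have "s > 0 \<or> t > 0" using st by linarith
      then show "s' + t' > 0" using st assms(2,3)
        by (auto simp: s'_def t'_def intro: add_pos_nonneg add_nonneg_pos)
    qed
    define u where "u = (s' * \<alpha> + t' * \<beta>) / (s' + t')"
    have "s *\<^sub>R (c *\<^sub>R (A + \<alpha> *\<^sub>R B)) + t *\<^sub>R (d *\<^sub>R (A + \<beta> *\<^sub>R B)) = (s' + t') *\<^sub>R (A + u *\<^sub>R B)"
    proof -
      have "s *\<^sub>R (c *\<^sub>R (A + \<alpha> *\<^sub>R B)) + t *\<^sub>R (d *\<^sub>R (A + \<beta> *\<^sub>R B)) = s' *\<^sub>R (A + \<alpha> *\<^sub>R B) + t' *\<^sub>R (A + \<beta> *\<^sub>R B)"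
        by (simp add: s'_def t'_def)
      also have "\<dots> = (s' + t') *\<^sub>R A + ((s' + t') * u) *\<^sub>R B"
        using p(3) by (simp add: u_def scaleR_add_right scaleR_add_left)
      finally show ?thesis by (simp add: scaleR_add_right)
    qed
    then have "z = proj (A + u *\<^sub>R B)" using st(4) p(3) by (simp only: proj_scale)
    moreover have "u \<in> {\<alpha>..\<beta>}"
    proof -
      have "s' * \<alpha> + t' * \<beta> \<ge> s' * \<alpha> + t' * \<alpha>" "s' * \<alpha> + t' * \<beta> \<le> s' * \<beta> + t' * \<beta>"
        using p assms(1) by (auto intro: mult_left_mono)
      then show ?thesis unfolding u_def using p(3) by (simp add: divide_le_eq le_divide_eq algebra_simps)
    qed
    ultimately show "z \<in> ?L" by blast
  qed
  show "?L \<subseteq> ?R"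
  proof
    fix z assume "z \<in> ?L"
    then obtain u where u: "\<alpha> \<le> u" "u \<le> \<beta>" "z = proj (A + u *\<^sub>R B)" by auto
    obtain s where s: "0 \<le> s" "s \<le> 1" "u = s * \<alpha> + (1 - s) * \<beta>"
    proof (cases "\<alpha> = \<beta>")
      case True then show ?thesis using that[of 0] u by auto
    next
      case False
      then have pos: "\<beta> - \<alpha> > 0" using assms(1) by simp
      define s where "s = (\<beta> - u) / (\<beta> - \<alpha>)"
      have "s * (\<beta> - \<alpha>) = \<beta> - u" using pos by (simp add: s_def)
      then have "u = s * \<alpha> + (1 - s) * \<beta>" by (simp add: algebra_simps)
      moreover have "0 \<le> s" "s \<le> 1" using u pos by (simp_all add: s_def)
      ultimately show ?thesis using that by blast
    qed
    have "(s / c) *\<^sub>R (c *\<^sub>R (A + \<alpha> *\<^sub>R B)) + ((1 - s) / d) *\<^sub>R (d *\<^sub>R (A + \<beta> *\<^sub>R B)) = A + u *\<^sub>R B"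
    proof -
      have "(s / c) *\<^sub>R (c *\<^sub>R (A + \<alpha> *\<^sub>R B)) + ((1 - s) / d) *\<^sub>R (d *\<^sub>R (A + \<beta> *\<^sub>R B))
        = s *\<^sub>R (A + \<alpha> *\<^sub>R B) + (1 - s) *\<^sub>R (A + \<beta> *\<^sub>R B)" using assms(2,3) by simp
      also have "\<dots> = A + u *\<^sub>R B" unfolding s(3) by (simp add: algebra_simps)
      finally show ?thesis .
    qed
    moreover have "0 \<le> s / c" "0 \<le> (1 - s) / d" "0 < s / c + (1 - s) / d"
    proof -
      show "0 \<le> s / c" "0 \<le> (1 - s) / d" using s assms(2,3) by auto
      have "s > 0 \<or> 1 - s > 0" using s by linarith
      then show "0 < s / c + (1 - s) / d" using s assms(2,3)
        by (auto intro: add_pos_nonneg add_nonneg_pos)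
    qed
    ultimately show "z \<in> ?R" unfolding u(3) mem_Collect_eq
      by (intro exI[of _ "s / c"] exI[of _ "(1 - s) / d"] conjI) (simp_all only:)
  qed
qed

lemma axis_param:
  assumes "frame A B" "mink m m = 1" "mink A m = 0" "mink B m = 0" "future P" "mink P m = 0"
  obtains c \<tau> where "c > 0" "\<bar>\<tau>\<bar> \<le> 1" "P = c *\<^sub>R (A + \<tau> *\<^sub>R B)"
proof -
  define c where "c = - mink P A"
  define b where "b = mink P B"
  have P: "P = c *\<^sub>R A + b *\<^sub>R B"
    using orthonormal_expand[of A B m P] assms by (simp add: frame_def c_def b_def)
  have c: "c > 0" using future_mink_less[OF frame_future[OF assms(1)] _ assms(5)] assms(1)
    by (simp add: c_def frame_def mink_sym)
  have "mink P P \<le> 0" using assms(5) by (simp add: future_def)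
  then have "b\<^sup>2 \<le> c\<^sup>2" unfolding P using assms(1) by (simp add: frame_def mink_sym power2_eq_square)
  then have "\<bar>b / c\<bar> \<le> 1" using c by (simp add: abs_le_square_iff[symmetric])
  moreover have "P = c *\<^sub>R (A + (b / c) *\<^sub>R B)" using c by (simp add: P scaleR_add_right)
  ultimately show thesis using that c by blast
qed

text \<open>The axis meets each of the two edges in a single point by \<open>foot\<close>, so all lines along the axis that are admitted in
the definition of a vertex cut out the same segment.\<close>
lemma vertex_eq:
  assumes "k1 < 1"
  shows "vertex C1 C2 C3 = vseg"
proof -
  have cen: "centre C1 = axis N1" using r1 assms by (simp add: represents_def)
  have pos: "1 - k1\<^sup>2 > 0" using assms k_nonneg by (simp add: power_less_one_iff abs_square_less_1)
  define s where "s = sqrt (1 - k1\<^sup>2)"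
  have s: "s > 0" "s * s = 1 - k1\<^sup>2" using pos by (auto simp: s_def)
  define m where "m = (1 / s) *\<^sub>R N1"
  have m: "mink m m = 1" using gram(1) s pos by (simp add: m_def)
  have ax: "axis N1 = axis m" using s by (simp add: m_def axis_scale)
  have mN: "mink V m = 0 \<longleftrightarrow> mink V N1 = 0" for V using s by (simp add: m_def)
  note f12 = foot12[OF assms] and f13 = foot13[OF assms]
  have Pm: "mink P12 m = 0" "mink P13 m = 0" using f12(2) f13(2) mN by auto
  have "vertex C1 C2 C3 = (THE v. \<exists>\<gamma> a b. geodesic_line \<gamma> \<and> range \<gamma> = axis m \<and> a \<le> b \<and>
             ext_line \<gamma> a \<in> wedge N1 N2 \<and> ext_line \<gamma> b \<in> wedge N1 N3 \<and> v = ext_line \<gamma> ` {a..b})"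
    using assms by (simp add: vertex_def cen edges wedge_sym[of N3] ax)
  also have "\<dots> = vseg"
  proof (rule the_equality)
    obtain A0 B0 where AB0: "frame A0 B0" "mink A0 m = 0" "mink B0 m = 0" using frame_exists[OF m] .
    obtain c0 t0 d0 u0 where tu: "c0 > 0" "\<bar>t0\<bar> \<le> 1" "P12 = c0 *\<^sub>R (A0 + t0 *\<^sub>R B0)"
       "d0 > 0" "\<bar>u0\<bar> \<le> 1" "P13 = d0 *\<^sub>R (A0 + u0 *\<^sub>R B0)"
      using axis_param[OF AB0(1) m AB0(2,3) f12(1) Pm(1)] axis_param[OF AB0(1) m AB0(2,3) f13(1) Pm(2)] by metis
    obtain B t u where B: "frame A0 B" "mink B m = 0" "t \<le> u" "\<bar>t\<bar> \<le> 1" "\<bar>u\<bar> \<le> 1"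
      "P12 = c0 *\<^sub>R (A0 + t *\<^sub>R B)" "P13 = d0 *\<^sub>R (A0 + u *\<^sub>R B)"
    proof (cases "t0 \<le> u0")
      case True then show ?thesis using that[of B0 t0 u0] AB0 tu by blast
    next
      case False then show ?thesis using that[of "- B0" "- t0" "- u0"] AB0 tu frame_uminus by auto
    qed
    obtain a b where ab: "th a = t" "th b = u" using th_surj B(4,5) by metis
    have e: "ext_line (gline A0 B) a = proj P12" "ext_line (gline A0 B) b = proj P13"
      unfolding ext_line_gline[OF B(1)] ab B(6,7) using tu by (simp_all only: proj_scale)
    have "ext_line (gline A0 B) ` {a..b} = vseg"
      unfolding ext_line_image[OF B(1)] ab vseg_def B(6,7) by (rule segment_proj[OF B(3) tu(1,4)])
    moreover have "a \<le> b" using B(3) ab th_le_iff[of a b] by simp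
    ultimately show "\<exists>\<gamma> a b. geodesic_line \<gamma> \<and> range \<gamma> = axis m \<and> a \<le> b \<and>
             ext_line \<gamma> a \<in> wedge N1 N2 \<and> ext_line \<gamma> b \<in> wedge N1 N3 \<and> vseg = ext_line \<gamma> ` {a..b}"
      using e f12(4) f13(4) geodesic_line_gline[OF B(1)] range_gline[OF B(1) m AB0(2) B(2)]
      by (intro exI[of _ "gline A0 B"] exI[of _ a] exI[of _ b]) auto
  next
    fix v assume "\<exists>\<gamma> a b. geodesic_line \<gamma> \<and> range \<gamma> = axis m \<and> a \<le> b \<and>
             ext_line \<gamma> a \<in> wedge N1 N2 \<and> ext_line \<gamma> b \<in> wedge N1 N3 \<and> v = ext_line \<gamma> ` {a..b}"
    then obtain \<gamma> a b where g: "geodesic_line \<gamma>" "range \<gamma> = axis m" "a \<le> b"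
       "ext_line \<gamma> a \<in> wedge N1 N2" "ext_line \<gamma> b \<in> wedge N1 N3" "v = ext_line \<gamma> ` {a..b}" by blast
    obtain A B where AB: "frame A B" "\<gamma> = gline A B" using geodesic_line_frame[OF g(1)] .
    have AN: "cosh t * mink A N1 + sinh t * mink B N1 = 0" for t
    proof -
      have "gline A B t \<in> axis N1" using g(2) AB(2) ax by blast
      then show ?thesis using hpt_gline[OF AB(1), of t] by (simp add: axis_def)
    qed
    have A0: "mink A N1 = 0" using AN[of 0] by simp
    then have B0: "mink B N1 = 0" using AN[of 1] by simp
    have lz: "mink (lift (proj (A + th x *\<^sub>R B))) N1 = 0" for x
    proof -
      obtain c where "lift (proj (A + th x *\<^sub>R B)) = c *\<^sub>R (A + th x *\<^sub>R B)"
        using lift_proj_pos[OF frame_combo(1)[OF AB(1) th_bounds]] by metis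
      then show ?thesis using A0 B0 by simp
    qed
    note fc = frame_combo(1)[OF AB(1) th_bounds]
    have "proj (A + th a *\<^sub>R B) = proj P12"
      using f12(5)[of "proj (A + th a *\<^sub>R B)"] g(4) lz by (simp add: AB(2) ext_line_gline[OF AB(1)])
    then obtain c where c: "c > 0" "P12 = c *\<^sub>R (A + th a *\<^sub>R B)"
      using proj_eq_iff[OF f12(1) fc] by metis
    have "proj (A + th b *\<^sub>R B) = proj P13"
      using f13(5)[of "proj (A + th b *\<^sub>R B)"] g(5) lz by (simp add: AB(2) ext_line_gline[OF AB(1)])
    then obtain d where d: "d > 0" "P13 = d *\<^sub>R (A + th b *\<^sub>R B)"
      using proj_eq_iff[OF f13(1) fc] by metis
    have "th a \<le> th b" using g(3) th_le_iff by simp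
    then show "v = vseg" unfolding g(6) AB(2) ext_line_image[OF AB(1)] vseg_def c(2) d(2)
      using segment_proj[OF _ c(1) d(1)] by blast
  qed
  finally show ?thesis .
qed

end

section \<open>Length of an arc inside a parametrized curve\<close>

lemma has_vector_derivative_quotient:
  fixes f :: "real \<Rightarrow> 'a::real_normed_vector"
  assumes "(f has_vector_derivative D) (at x)"
  shows "((\<lambda>y. (f y - f x) /\<^sub>R (y - x)) \<longlongrightarrow> D) (at x)"
proof -
  have "((\<lambda>y. (1 / norm (y - x)) *\<^sub>R (f y - (f x + (y - x) *\<^sub>R D))) \<longlongrightarrow> 0) (at x)"
    using assms unfolding has_vector_derivative_def has_derivative_within by simp
  then have "((\<lambda>y. norm ((1 / norm (y - x)) *\<^sub>R (f y - (f x + (y - x) *\<^sub>R D)))) \<longlongrightarrow> 0) (at x)"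
    by (rule tendsto_norm_zero)
  moreover have "\<forall>\<^sub>F y in at x. norm ((1 / norm (y - x)) *\<^sub>R (f y - (f x + (y - x) *\<^sub>R D)))
      = norm ((f y - f x) /\<^sub>R (y - x) - D)"
  proof (rule eventually_mono[OF eventually_neq_at_within[of x]])
    fix y assume y: "y \<noteq> x"
    have "(f y - f x) /\<^sub>R (y - x) - D = (1 / (y - x)) *\<^sub>R (f y - (f x + (y - x) *\<^sub>R D))"
      using y by (simp add: scaleR_diff_right scaleR_add_right divide_inverse)
    then show "norm ((1 / norm (y - x)) *\<^sub>R (f y - (f x + (y - x) *\<^sub>R D)))
      = norm ((f y - f x) /\<^sub>R (y - x) - D)" by simp
  qed
  ultimately have "((\<lambda>y. norm ((f y - f x) /\<^sub>R (y - x) - D)) \<longlongrightarrow> 0) (at x)"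
    by (rule Lim_transform_eventually)
  then show ?thesis by (simp add: LIM_zero_iff tendsto_norm_zero_iff)
qed

text \<open>Inside an injectively parametrized curve \<open>c\<close>, an arc from one end to the other is a strictly increasing
reparametrization \<open>c \<circ> \<tau>\<close>. Since \<open>\<tau>\<close> is only known to be continuous, its derivative is obtained as
the limit of the quotient of the norms of difference quotients of \<open>\<gamma>\<close> and \<open>c\<close>. The fundamental theorem of calculus, applied to the primitive
\<open>\<Omega>\<close> of \<open>\<omega>\<close> along \<open>\<tau>\<close>, then gives the length, whatever the arc.\<close>
lemma arc_hlength:
  fixes c c' :: "real \<Rightarrow> complex"
  assumes Q: "Q > 0"
    and c: "\<And>q. q \<in> {0..Q} \<Longrightarrow> (c has_vector_derivative c' q) (at q)"
    and inj: "inj_on c {0..Q}"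
    and sp: "\<And>q. q \<in> {0..Q} \<Longrightarrow> 2 * norm (c' q) / (1 - (norm (c q))\<^sup>2) = \<omega> q"
    and \<omega>: "continuous_on {0..Q} \<omega>" "\<And>q. q \<in> {0..Q} \<Longrightarrow> \<omega> q > 0"
    and g: "valid_path \<gamma>" "arc \<gamma>" "path_image \<gamma> \<subseteq> c ` {0..Q}" "pathstart \<gamma> = c 0" "pathfinish \<gamma> = c Q"
  shows "hlength \<gamma> = integral {0..Q} \<omega>"
proof -
  have cc: "continuous_on {0..Q} c"
    by (intro continuous_at_imp_continuous_on ballI) (meson c has_vector_derivative_continuous)
  define \<tau> where "\<tau> s = the_inv_into {0..Q} c (\<gamma> s)" for s
  have im: "\<gamma> s \<in> c ` {0..Q}" if "s \<in> {0..1}" for s using g(3) that by (auto simp: path_image_def)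
  have \<tau>r: "\<tau> s \<in> {0..Q}" and c\<tau>: "c (\<tau> s) = \<gamma> s" if "s \<in> {0..1}" for s
    using im[OF that] inj by (auto simp: \<tau>_def the_inv_into_f_f)
  have "path \<gamma>" using g(1) by (rule valid_path_imp_path)
  then have gc: "continuous_on {0..1} \<gamma>" by (simp add: path_def)
  have "continuous_on (c ` {0..Q}) (the_inv_into {0..Q} c)"
    by (rule continuous_on_inv_into[OF cc _ inj]) simp
  then have \<tau>c: "continuous_on {0..1} \<tau>" unfolding \<tau>_def
    by (rule continuous_on_compose2[OF _ gc]) (use im in auto)
  have ginj: "inj_on \<gamma> {0..1}" using g(2) by (simp add: arc_def)
  have \<tau>inj: "inj_on \<tau> {0..1}"
  proof (rule inj_onI)
    fix s t assume "s \<in> {0..1}" "t \<in> {0..1}" "\<tau> s = \<tau> t"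
    then show "s = t" using c\<tau> ginj by (metis inj_on_eq_iff)
  qed
  have \<tau>0: "\<tau> 0 = 0" and \<tau>1: "\<tau> 1 = Q"
    using g(4,5) inj Q by (simp_all add: \<tau>_def pathstart_def pathfinish_def the_inv_into_f_f)
  have "strict_mono_on {0..1} \<tau> \<or> strict_antimono_on {0..1} \<tau>"
    using injective_eq_monotone_map[of "{0..1}" \<tau>] \<tau>c \<tau>inj by (simp add: is_interval_cc)
  moreover have "\<not> strict_antimono_on {0..1} \<tau>"
  proof
    assume "strict_antimono_on {0..1} \<tau>"
    then have "\<tau> 1 < \<tau> 0" by (rule monotone_onD) auto
    then show False using Q \<tau>0 \<tau>1 by simp
  qed
  ultimately have mono: "\<And>s t. s \<in> {0..1} \<Longrightarrow> t \<in> {0..1} \<Longrightarrow> s < t \<Longrightarrow> \<tau> s < \<tau> t"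
    by (auto simp: monotone_on_def)
  obtain F where F: "finite F" "\<gamma> C1_differentiable_on {0..1} - F"
    using g(1) by (auto simp: valid_path_def piecewise_C1_differentiable_on_def)
  have gd: "(\<gamma> has_vector_derivative vector_derivative \<gamma> (at s)) (at s)" if "s \<in> {0..1} - F" for s
    using F(2) that unfolding C1_differentiable_on_eq by (simp add: vector_derivative_works)
  define \<Omega> where "\<Omega> q = integral {0..q} \<omega>" for q
  have int: "\<omega> integrable_on {0..Q}" using \<omega>(1) by (rule integrable_continuous_real)
  have \<Omega>c: "continuous_on {0..Q} \<Omega>" unfolding \<Omega>_def by (rule indefinite_integral_continuous_1[OF int])
  have \<Omega>d: "(\<Omega> has_real_derivative \<omega> q) (at q)" if "q \<in> {0<..<Q}" for q
  proof -
    have "(\<Omega> has_real_derivative \<omega> q) (at q within {0..Q})" unfolding \<Omega>_def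
      using that by (intro integral_has_real_derivative \<omega>(1)) auto
    then show ?thesis using that at_within_Icc_at[of 0 q Q] by simp
  qed
  have \<tau>d: "(\<tau> has_real_derivative norm (vector_derivative \<gamma> (at s)) / norm (c' (\<tau> s))) (at s)"
    if s: "s \<in> {0<..<1} - F" for s
  proof -
    define v where "v = vector_derivative \<gamma> (at s)"
    define h where "h = c' (\<tau> s)"
    have s01: "s \<in> {0..1}" using s by auto
    have "\<omega> (\<tau> s) > 0" using \<omega>(2) \<tau>r[OF s01] .
    then have h: "h \<noteq> 0" using sp[OF \<tau>r[OF s01]] by (auto simp: h_def)
    have "(\<gamma> has_vector_derivative v) (at s)" using gd[of s] s by (simp add: v_def)
    then have 1: "((\<lambda>y. (\<gamma> y - \<gamma> s) /\<^sub>R (y - s)) \<longlongrightarrow> v) (at s)"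
      by (rule has_vector_derivative_quotient)
    have "(c has_vector_derivative h) (at (\<tau> s))" using c[OF \<tau>r[OF s01]] by (simp add: h_def)
    then have 2: "((\<lambda>q. (c q - c (\<tau> s)) /\<^sub>R (q - \<tau> s)) \<longlongrightarrow> h) (at (\<tau> s))"
      by (rule has_vector_derivative_quotient)
    have nbh: "\<forall>\<^sub>F y in at s. y \<in> {0<..<1} \<and> y \<noteq> s"
      using s eventually_at_in_open[of "{0<..<1}" s] by (auto elim: eventually_mono)
    have ne: "\<tau> y \<noteq> \<tau> s" if "y \<in> {0<..<1} \<and> y \<noteq> s" for y
      using that s01 \<tau>inj by (auto simp: inj_on_def)
    have "isCont \<tau> s" using \<tau>c s by (intro continuous_on_interior) (auto simp: interior_atLeastAtMost_real)
    then have "filterlim \<tau> (at (\<tau> s)) (at s)"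
      unfolding filterlim_at using nbh ne by (auto simp: isCont_def elim: eventually_mono)
    from filterlim_compose[OF 2 this]
    have 3: "((\<lambda>y. (c (\<tau> y) - c (\<tau> s)) /\<^sub>R (\<tau> y - \<tau> s)) \<longlongrightarrow> h) (at s)" .
    have "((\<lambda>y. norm ((\<gamma> y - \<gamma> s) /\<^sub>R (y - s)) / norm ((c (\<tau> y) - c (\<tau> s)) /\<^sub>R (\<tau> y - \<tau> s)))
        \<longlongrightarrow> norm v / norm h) (at s)"
      by (intro tendsto_divide tendsto_norm 1 3) (use h in simp)
    moreover have "\<forall>\<^sub>F y in at s. norm ((\<gamma> y - \<gamma> s) /\<^sub>R (y - s)) / norm ((c (\<tau> y) - c (\<tau> s)) /\<^sub>R (\<tau> y - \<tau> s))
        = (\<tau> y - \<tau> s) / (y - s)"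
    proof (rule eventually_mono[OF nbh])
      fix y assume y: "y \<in> {0<..<1} \<and> y \<noteq> s"
      then have y01: "y \<in> {0..1}" by auto
      have gn: "norm (\<gamma> y - \<gamma> s) \<noteq> 0" using ginj y y01 s01 by (auto simp: inj_on_def)
      have "norm ((\<gamma> y - \<gamma> s) /\<^sub>R (y - s)) / norm ((c (\<tau> y) - c (\<tau> s)) /\<^sub>R (\<tau> y - \<tau> s))
        = \<bar>\<tau> y - \<tau> s\<bar> / \<bar>y - s\<bar>"
      proof -
        have n: "norm (x /\<^sub>R r) = norm x / \<bar>r\<bar>" for x :: complex and r by (simp add: divide_inverse mult.commute)
        show ?thesis unfolding c\<tau>[OF y01] c\<tau>[OF s01] n using gn by simp
      qed
      also have "\<dots> = (\<tau> y - \<tau> s) / (y - s)"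
      proof -
        have "0 \<le> (\<tau> y - \<tau> s) / (y - s)"
          using mono[OF y01 s01] mono[OF s01 y01] y by (cases "y < s") (auto simp: zero_le_divide_iff)
        then show ?thesis unfolding abs_divide[symmetric] by (rule abs_of_nonneg)
      qed
      finally show "norm ((\<gamma> y - \<gamma> s) /\<^sub>R (y - s)) / norm ((c (\<tau> y) - c (\<tau> s)) /\<^sub>R (\<tau> y - \<tau> s))
        = (\<tau> y - \<tau> s) / (y - s)" .
    qed
    ultimately have "((\<lambda>y. (\<tau> y - \<tau> s) / (y - s)) \<longlongrightarrow> norm v / norm h) (at s)"
      by (rule Lim_transform_eventually)
    then show ?thesis by (simp add: has_field_derivative_iff v_def h_def)
  qed
  have "((\<lambda>s. 2 * norm (vector_derivative \<gamma> (at s)) / (1 - (norm (\<gamma> s))\<^sup>2)) has_integral (\<Omega> (\<tau> 1) - \<Omega> (\<tau> 0))) {0..1}"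
  proof (rule fundamental_theorem_of_calculus_interior_strong[OF F(1)])
    show "continuous_on {0..1} (\<lambda>s. \<Omega> (\<tau> s))"
      by (rule continuous_on_compose2[OF \<Omega>c \<tau>c]) (use \<tau>r in auto)
    fix s :: real assume s: "s \<in> {0<..<1} - F"
    then have s01: "s \<in> {0..1}" by auto
    have ti: "\<tau> s \<in> {0<..<Q}" using mono[of 0 s] mono[of s 1] s \<tau>0 \<tau>1 by auto
    have t0: "\<tau> s \<in> {0..Q}" using ti by auto
    have nz: "norm (c' (\<tau> s)) \<noteq> 0" using \<omega>(2)[OF t0] sp[OF t0] by auto
    have "((\<lambda>s. \<Omega> (\<tau> s)) has_real_derivative
        \<omega> (\<tau> s) * (norm (vector_derivative \<gamma> (at s)) / norm (c' (\<tau> s)))) (at s)"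
      by (rule DERIV_chain2[OF \<Omega>d[OF ti] \<tau>d[OF s]])
    also have "\<omega> (\<tau> s) * (norm (vector_derivative \<gamma> (at s)) / norm (c' (\<tau> s)))
        = 2 * norm (vector_derivative \<gamma> (at s)) / (1 - (norm (\<gamma> s))\<^sup>2)"
      unfolding sp[OF t0, symmetric] c\<tau>[OF s01] using nz by simp
    finally show "((\<lambda>s. \<Omega> (\<tau> s)) has_vector_derivative
        2 * norm (vector_derivative \<gamma> (at s)) / (1 - (norm (\<gamma> s))\<^sup>2)) (at s)"
      by (simp add: has_real_derivative_iff_has_vector_derivative)
  qed simp
  then have "hlength \<gamma> = \<Omega> (\<tau> 1) - \<Omega> (\<tau> 0)" unfolding hlength_def by (rule integral_unique)
  also have "\<dots> = integral {0..Q} \<omega>" by (simp add: \<tau>0 \<tau>1 \<Omega>_def)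
  finally show ?thesis .
qed

section \<open>The packed triangle\<close>

context triple
begin

text \<open>Statements about the first circle are transferred to the others by cyclic rotation.\<close>
lemma rotate: "triple C2 C3 C1 N2 N3 N1"
  using r1 r2 r3 e12 e23 e31 by (simp add: triple_def)

lemma region_alt:
  "z \<in> region \<longleftrightarrow> norm z \<le> 1 \<and> (\<exists>a\<ge>0. \<exists>b\<ge>0. \<exists>c\<ge>0. lift z = a *\<^sub>R N1 + b *\<^sub>R N2 + c *\<^sub>R N3) \<and>
     mink (lift z) N1 \<le> 0 \<and> mink (lift z) N2 \<le> 0 \<and> mink (lift z) N3 \<le> 0"
proof
  assume "z \<in> region"
  then show "norm z \<le> 1 \<and> (\<exists>a\<ge>0. \<exists>b\<ge>0. \<exists>c\<ge>0. lift z = a *\<^sub>R N1 + b *\<^sub>R N2 + c *\<^sub>R N3) \<and>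
     mink (lift z) N1 \<le> 0 \<and> mink (lift z) N2 \<le> 0 \<and> mink (lift z) N3 \<le> 0"
    using co_expand[of "lift z"] by (auto simp: region_def)
next
  assume a: "norm z \<le> 1 \<and> (\<exists>a\<ge>0. \<exists>b\<ge>0. \<exists>c\<ge>0. lift z = a *\<^sub>R N1 + b *\<^sub>R N2 + c *\<^sub>R N3) \<and>
     mink (lift z) N1 \<le> 0 \<and> mink (lift z) N2 \<le> 0 \<and> mink (lift z) N3 \<le> 0"
  then obtain x1 x2 x3 where x: "x1 \<ge> 0" "x2 \<ge> 0" "x3 \<ge> 0" "lift z = x1 *\<^sub>R N1 + x2 *\<^sub>R N2 + x3 *\<^sub>R N3" by blast
  have "co1 (lift z) \<ge> 0" "co2 (lift z) \<ge> 0" "co3 (lift z) \<ge> 0" unfolding x(4) co_combo using x by auto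
  then show "z \<in> region" using a by (simp add: region_def)
qed

lemma region_rotate: "triple.region N2 N3 N1 = region"
proof (rule set_eqI)
  fix z
  have "(\<exists>a\<ge>0. \<exists>b\<ge>0. \<exists>c\<ge>0. lift z = a *\<^sub>R N2 + b *\<^sub>R N3 + c *\<^sub>R N1) \<longleftrightarrow>
    (\<exists>a\<ge>0. \<exists>b\<ge>0. \<exists>c\<ge>0. lift z = a *\<^sub>R N1 + b *\<^sub>R N2 + c *\<^sub>R N3)"
    (is "?l \<longleftrightarrow> ?r")
  proof
    assume ?l
    then obtain a b c where "a \<ge> 0" "b \<ge> 0" "c \<ge> 0" "lift z = a *\<^sub>R N2 + b *\<^sub>R N3 + c *\<^sub>R N1" by blast
    then show ?r by (intro exI[of _ c] exI[of _ a] exI[of _ b] conjI) (auto simp: add_ac)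
  next
    assume ?r
    then obtain a b c where "a \<ge> 0" "b \<ge> 0" "c \<ge> 0" "lift z = a *\<^sub>R N1 + b *\<^sub>R N2 + c *\<^sub>R N3" by blast
    then show ?l by (intro exI[of _ b] exI[of _ c] exI[of _ a] conjI) (auto simp: add_ac)
  qed
  then show "z \<in> triple.region N2 N3 N1 \<longleftrightarrow> z \<in> region"
    unfolding region_alt triple.region_alt[OF rotate] by blast
qed

lemma wedge_subset_region: "wedge N1 N2 \<subseteq> region"
proof
  fix z assume "z \<in> wedge N1 N2"
  then obtain a b where z: "norm z \<le> 1" "a \<ge> 0" "b \<ge> 0" "lift z = a *\<^sub>R N1 + b *\<^sub>R N2"
     "mink (lift z) N1 \<le> 0" "mink (lift z) N2 \<le> 0" by (auto simp: wedge_def)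
  have "mink (lift z) N3 = - (a * (1 + k1 * k3)) - b * (1 + k2 * k3)" unfolding z(4) by (simp add: gram algebra_simps)
  also have "\<dots> \<le> 0"
  proof -
    have "a * (1 + k1 * k3) \<ge> 0" "b * (1 + k2 * k3) \<ge> 0" using z(2,3) k_nonneg by simp_all
    then show ?thesis by linarith
  qed
  finally have "mink (lift z) N3 \<le> 0" .
  moreover have "lift z = a *\<^sub>R N1 + b *\<^sub>R N2 + 0 *\<^sub>R N3" using z(4) by simp
  ultimately show "z \<in> region" unfolding region_alt using z by (meson order_refl)
qed

lemma vertex_subset_region: "vertex C1 C2 C3 \<subseteq> region"
proof (cases "k1 < 1")
  case True
  note f12 = foot12[OF True] and f13 = foot13[OF True]
  have pos: "1 - k1\<^sup>2 \<ge> 0" using True k_nonneg by (simp add: abs_square_le_1)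
  show ?thesis unfolding vertex_eq[OF True]
  proof
    fix z assume "z \<in> vseg"
    then obtain s t where st: "z = proj (s *\<^sub>R P12 + t *\<^sub>R P13)" "0 \<le> s" "0 \<le> t" "0 < s + t" by (auto simp: vseg_def)
    define P where "P = s *\<^sub>R P12 + t *\<^sub>R P13"
    have fP: "future P"
    proof (cases "s = 0 \<or> t = 0")
      case True
      then show ?thesis using st f12(1) f13(1) by (auto simp: P_def intro: future_scale)
    next
      case False
      then show ?thesis using st f12(1) f13(1) by (auto simp: P_def intro!: future_add future_scale)
    qed
    have 1: "mink P N1 = 0" using f12(2) f13(2) by (simp add: P_def)
    have q: "(1 + k1 * k2) * (1 + k1 * k3) \<ge> 0" "(1 + k1 * k3) * (1 + k1 * k2) \<ge> 0"
      "(1 - k1\<^sup>2) * (1 + k2 * k3) \<ge> 0" using pos k_nonneg by simp_all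
    have m23: "mink P12 N3 \<le> 0"
    proof -
      have "mink P12 N3 = - ((1 + k1 * k2) * (1 + k1 * k3)) - (1 - k1\<^sup>2) * (1 + k2 * k3)"
        unfolding P12_def by (simp add: gram algebra_simps)
      also have "\<dots> \<le> 0" using q by linarith
      finally show ?thesis .
    qed
    have m32: "mink P13 N2 \<le> 0"
    proof -
      have "mink P13 N2 = - ((1 + k1 * k3) * (1 + k1 * k2)) - (1 - k1\<^sup>2) * (1 + k2 * k3)"
        unfolding P13_def by (simp add: gram algebra_simps)
      also have "\<dots> \<le> 0" using q by linarith
      finally show ?thesis .
    qed
    have m22: "mink P12 N2 \<le> 0" "mink P13 N3 \<le> 0" unfolding f12(3) f13(3) by simp_all
    have 2: "mink P N2 \<le> 0" "mink P N3 \<le> 0" unfolding P_def mink_linear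
      by (intro add_nonpos_nonpos mult_nonneg_nonpos st(2,3) m23 m32 m22)+
    have P: "P = (s * (1 + k1 * k2) + t * (1 + k1 * k3)) *\<^sub>R N1 + (s * (1 - k1\<^sup>2)) *\<^sub>R N2 + (t * (1 - k1\<^sup>2)) *\<^sub>R N3"
      unfolding P_def P12_def P13_def by (simp add: algebra_simps)
    show "z \<in> region" unfolding st(1) P_def[symmetric]
      by (rule regionI[OF fP P]) (use st pos k_nonneg 1 2 in auto)
  qed
next
  case False
  have "fst N1 > 0" "centre C1 = {proj N1}" using r1 False by (auto simp: represents_def)
  moreover have "1 \<le> k1\<^sup>2" using False by simp
  ultimately have f: "future N1" using gram(1) by (simp add: future_def)
  have "proj N1 \<in> region"
    by (rule regionI[OF f, of 1 0 0]) (use \<open>1 \<le> k1\<^sup>2\<close> gram k_nonneg in \<open>auto simp: add_nonneg_nonneg intro: order_trans[of _ 0]\<close>)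
  then show ?thesis using False \<open>centre C1 = {proj N1}\<close> by (simp add: vertex_def)
qed

lemma vertex_mem:
  assumes z: "norm z \<le> 1" "lift z = a *\<^sub>R N1 + b *\<^sub>R N2 + c *\<^sub>R N3" "a \<ge> 0" "b \<ge> 0" "c \<ge> 0" "mink (lift z) N1 = 0"
  shows "z \<in> vertex C1 C2 C3"
proof (cases "k1 < 1")
  case True
  have pos: "1 - k1\<^sup>2 > 0" using True k_nonneg by (simp add: power_less_one_iff abs_square_less_1)
  define e where "e = 1 - k1\<^sup>2"
  have e: "e > 0" using pos by (simp add: e_def)
  have "a * e = b * (1 + k1 * k2) + c * (1 + k1 * k3)" using z(6) unfolding z(2) by (simp add: gram e_def algebra_simps)
  then have "a = (b * (1 + k1 * k2) + c * (1 + k1 * k3)) / e" using e by (simp add: eq_divide_eq)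
  then have "a = (b / e) * (1 + k1 * k2) + (c / e) * (1 + k1 * k3)" by (simp add: add_divide_distrib)
  moreover have "b = (b / e) * e" "c = (c / e) * e" using e by auto
  ultimately have l: "lift z = (b / e) *\<^sub>R P12 + (c / e) *\<^sub>R P13"
  proof -
    assume abc: "a = (b / e) * (1 + k1 * k2) + (c / e) * (1 + k1 * k3)" "b = (b / e) * e" "c = (c / e) * e"
    have "(b / e) *\<^sub>R (p *\<^sub>R N1 + e *\<^sub>R N2) + (c / e) *\<^sub>R (q *\<^sub>R N1 + e *\<^sub>R N3)
      = ((b / e) * p + (c / e) * q) *\<^sub>R N1 + ((b / e) * e) *\<^sub>R N2 + ((c / e) * e) *\<^sub>R N3" for p q
      by (simp only: scaleR_add_right scaleR_add_left scaleR_scaleR add_ac)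
    then have "(b / e) *\<^sub>R P12 + (c / e) *\<^sub>R P13
      = ((b / e) * (1 + k1 * k2) + (c / e) * (1 + k1 * k3)) *\<^sub>R N1 + ((b / e) * e) *\<^sub>R N2 + ((c / e) * e) *\<^sub>R N3"
      unfolding P12_def P13_def e_def[symmetric] .
    also have "\<dots> = lift z" unfolding z(2) abc[symmetric] ..
    finally show ?thesis by simp
  qed
  have "b / e + c / e > 0"
  proof (rule ccontr)
    assume "\<not> ?thesis"
    moreover have "b / e \<ge> 0" "c / e \<ge> 0" using z e by auto
    ultimately have "b / e = 0" "c / e = 0" by linarith+
    then have "lift z = 0" unfolding l by (simp only: scaleR_zero_left add_0)
    then show False using future_lift[of z] by (simp add: future_def)
  qed
  moreover have "z = proj ((b / e) *\<^sub>R P12 + (c / e) *\<^sub>R P13)" using proj_lift[OF z(1)] l by simp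
  moreover have "b / e \<ge> 0" "c / e \<ge> 0" using z e by auto
  ultimately show ?thesis unfolding vertex_eq[OF True] vseg_def by blast
next
  case False
  have 0: "fst N1 > 0" "centre C1 = {proj N1}" using r1 False by (auto simp: represents_def)
  moreover have "1 \<le> k1\<^sup>2" using False by simp
  ultimately have f: "future N1" using gram(1) by (simp add: future_def)
  have "mink N1 (lift z) = 0" using z(6) by (simp add: mink_sym)
  then obtain d where "d > 0" "lift z = d *\<^sub>R N1" using null_orth_prop[OF f future_lift] by blast
  then have "proj (lift z) = proj N1" by (simp add: proj_scale)
  then show ?thesis using False 0 proj_lift[OF z(1)] by (simp add: vertex_def)
qed

lemma region_closed: "closed region"
proof -
  have "region = cball 0 1 \<inter> {z. 0 \<le> co1 (lift z)} \<inter> {z. 0 \<le> co2 (lift z)} \<inter> {z. 0 \<le> co3 (lift z)}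
     \<inter> {z. mink (lift z) N1 \<le> 0} \<inter> {z. mink (lift z) N2 \<le> 0} \<inter> {z. mink (lift z) N3 \<le> 0}"
    by (auto simp: region_def)
  then show ?thesis
    by (simp only:) (intro closed_Int closed_cball closed_Collect_le co_continuous continuous_intros)
qed

text \<open>At a frontier point one of the six linear inequalities is an equality. If a coordinate vanishes, the point lies
on an edge, and if a product with a normal vanishes, it lies on a vertex. The condition \<open>norm z \<le> 1\<close> adds no frontier: if all
six inequalities are strict, then \<open>mink W W < 0\<close>, so the point is in the open disk.\<close>
lemma frontier_region: "frontier region \<subseteq> triangle_boundary C1 C2 C3"
proof
  fix z assume z: "z \<in> frontier region"
  then have zr: "z \<in> region" and ni: "z \<notin> interior region"
    using region_closed by (auto simp: frontier_def)
  define W where "W = lift z"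
  have c: "norm z \<le> 1" "co1 W \<ge> 0" "co2 W \<ge> 0" "co3 W \<ge> 0" "mink W N1 \<le> 0" "mink W N2 \<le> 0" "mink W N3 \<le> 0"
    using zr by (auto simp: region_def W_def)
  have W: "W = co1 W *\<^sub>R N1 + co2 W *\<^sub>R N2 + co3 W *\<^sub>R N3" by (rule co_expand)
  have WW: "mink W W = co1 W * mink W N1 + co2 W * mink W N2 + co3 W * mink W N3"
    by (subst (2) W) simp
  have "co1 W = 0 \<or> co2 W = 0 \<or> co3 W = 0 \<or> mink W N1 = 0 \<or> mink W N2 = 0 \<or> mink W N3 = 0"
  proof (rule ccontr)
    assume n: "\<not> ?thesis"
    then have s: "co1 W > 0" "co2 W > 0" "co3 W > 0" "mink W N1 < 0" "mink W N2 < 0" "mink W N3 < 0" using c by auto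
    have "mink W W < 0" unfolding WW
      using mult_pos_neg[OF s(1,4)] mult_pos_neg[OF s(2,5)] mult_pos_neg[OF s(3,6)] by linarith
    then have "norm z \<noteq> 1" by (auto simp: W_def mink_lift_self)
    then have nz: "norm z < 1" using c(1) by simp
    define G where "G = ball 0 1 \<inter> {z. 0 < co1 (lift z)} \<inter> {z. 0 < co2 (lift z)} \<inter> {z. 0 < co3 (lift z)}
     \<inter> {z. mink (lift z) N1 < 0} \<inter> {z. mink (lift z) N2 < 0} \<inter> {z. mink (lift z) N3 < 0}"
    have "open G" unfolding G_def
      by (intro open_Int open_ball open_Collect_less co_continuous continuous_intros)
    moreover have "z \<in> G" using s nz by (simp add: G_def W_def)
    moreover have "G \<subseteq> region" by (auto simp: G_def region_def)
    ultimately show False using ni interiorI by blast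
  qed
  then show "z \<in> triangle_boundary C1 C2 C3"
  proof (elim disjE)
    assume "co1 W = 0"
    then have "lift z = co2 W *\<^sub>R N2 + co3 W *\<^sub>R N3" using W by (simp add: W_def)
    then have "z \<in> wedge N2 N3" unfolding wedge_def using c by (auto simp: W_def)
    then show ?thesis by (simp add: triangle_boundary_def edges)
  next
    assume "co2 W = 0"
    then have "lift z = co3 W *\<^sub>R N3 + co1 W *\<^sub>R N1" using W by (simp add: W_def add.commute)
    then have "z \<in> wedge N3 N1" unfolding wedge_def using c by (auto simp: W_def)
    then show ?thesis by (simp add: triangle_boundary_def edges)
  next
    assume "co3 W = 0"
    then have "lift z = co1 W *\<^sub>R N1 + co2 W *\<^sub>R N2" using W by (simp add: W_def)
    then have "z \<in> wedge N1 N2" unfolding wedge_def using c by (auto simp: W_def)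
    then show ?thesis by (simp add: triangle_boundary_def edges)
  next
    assume "mink W N1 = 0"
    then have "z \<in> vertex C1 C2 C3" using vertex_mem[OF c(1) _ c(2,3,4)] W by (simp add: W_def)
    then show ?thesis by (simp add: triangle_boundary_def)
  next
    assume m: "mink W N2 = 0"
    have "lift z = co2 W *\<^sub>R N2 + co3 W *\<^sub>R N3 + co1 W *\<^sub>R N1" using W by (simp add: W_def add_ac)
    then have "z \<in> vertex C2 C3 C1" using triple.vertex_mem[OF rotate c(1) _ c(3,4,2)] m by (simp add: W_def)
    then show ?thesis by (simp add: triangle_boundary_def)
  next
    assume m: "mink W N3 = 0"
    have "lift z = co3 W *\<^sub>R N3 + co1 W *\<^sub>R N1 + co2 W *\<^sub>R N2" using W by (simp add: W_def add_ac)
    then have "z \<in> vertex C3 C1 C2" using triple.vertex_mem[OF triple.rotate[OF rotate] c(1) _ c(4,2,3)] m by (simp add: W_def)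
    then show ?thesis by (simp add: triangle_boundary_def)
  qed
qed

lemma boundary_subset_region: "triangle_boundary C1 C2 C3 \<subseteq> region"
proof -
  have R2: "triple.region N3 N1 N2 = region"
    using triple.region_rotate[OF rotate] region_rotate by simp
  note t2 = rotate and t3 = triple.rotate[OF rotate]
  show ?thesis
    unfolding triangle_boundary_def edges
    using vertex_subset_region triple.vertex_subset_region[OF t2] triple.vertex_subset_region[OF t3]
      wedge_subset_region triple.wedge_subset_region[OF t2] triple.wedge_subset_region[OF t3]
    unfolding region_rotate R2 by blast
qed

text \<open>The region is bounded and its frontier lies in the boundary of the triangle.\<close>
lemma region_subset_packed: "region \<inter> hdisk \<subseteq> packed_triangle C1 C2 C3"
proof -
  have "bounded region" by (rule bounded_subset[of "cball 0 1"]) (auto simp: region_def)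
  then show ?thesis using bounded_region_subset_inside[OF _ frontier_region]
    by (auto simp: packed_triangle_def)
qed

lemma co_mcross:
  "co2 W = mink W ((1 / mdet N1 N2 N3) *\<^sub>R mcross N3 N1)"
  "co3 W = mink W ((1 / mdet N1 N2 N3) *\<^sub>R mcross N1 N2)"
proof -
  have "mdet N1 W N3 = mink W (mcross N3 N1)" "mdet N1 N2 W = mink W (mcross N1 N2)"
    by (simp_all add: mcross_def mdet_def mink_def algebra_simps)
  then show "co2 W = mink W ((1 / mdet N1 N2 N3) *\<^sub>R mcross N3 N1)"
    "co3 W = mink W ((1 / mdet N1 N2 N3) *\<^sub>R mcross N1 N2)"
    by (simp_all add: co2_def co3_def)
qed

text \<open>Each edge at the first circle lies on a complete geodesic, with normal \<open>mcross N1 N2\<close> or \<open>mcross N3 N1\<close> up to a factor, and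
the boundary of the triangle lies on one side of it. Hence so does everything that the boundary encloses.\<close>
lemma packed_coords:
  assumes "k1 > 0" "z \<in> packed_triangle C1 C2 C3"
  shows "co2 (lift z) \<ge> 0" "co3 (lift z) \<ge> 0"
proof -
  have z: "z \<in> hdisk" "z \<in> triangle_boundary C1 C2 C3 \<union> inside (triangle_boundary C1 C2 C3)"
    using assms(2) by (auto simp: packed_triangle_def)
  have B: "norm w \<le> 1 \<and> co2 (lift w) \<ge> 0 \<and> co3 (lift w) \<ge> 0" if "w \<in> triangle_boundary C1 C2 C3" for w
    using boundary_subset_region that by (auto simp: region_def)
  define D where "D = mdet N1 N2 N3"
  have D: "(1 / D)\<^sup>2 > 0" using det_nz by (simp add: D_def)
  have 1: "mink (mcross N3 N1) (mcross N3 N1) = (k1 + k3)\<^sup>2" "mink (mcross N1 N2) (mcross N1 N2) = (k1 + k2)\<^sup>2"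
    unfolding mink_mcross gram by (simp_all add: power2_eq_square algebra_simps)
  have "(k1 + k3)\<^sup>2 > 0" "(k1 + k2)\<^sup>2 > 0" using assms(1) k_nonneg by (simp_all add: add_pos_nonneg)
  then have "mink ((1 / D) *\<^sub>R mcross N3 N1) ((1 / D) *\<^sub>R mcross N3 N1) > 0"
    "mink ((1 / D) *\<^sub>R mcross N1 N2) ((1 / D) *\<^sub>R mcross N1 N2) > 0"
    unfolding mink_linear 1 mult.assoc[symmetric] power2_eq_square[of "1 / D", symmetric] using D by (simp_all only: mult_pos_pos)
  then show "co2 (lift z) \<ge> 0" "co3 (lift z) \<ge> 0"
    using inside_halfplane[OF _ _ z] B unfolding co_mcross D_def by blast+
qed

section \<open>The arc inside the triangle\<close>

lemma co_linear:
  "co1 (V + W) = co1 V + co1 W" "co2 (V + W) = co2 V + co2 W" "co3 (V + W) = co3 V + co3 W"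
  "co1 (V - W) = co1 V - co1 W" "co2 (V - W) = co2 V - co2 W" "co3 (V - W) = co3 V - co3 W"
  "co1 (r *\<^sub>R W) = r * co1 W" "co2 (r *\<^sub>R W) = r * co2 W" "co3 (r *\<^sub>R W) = r * co3 W"
  by (simp_all add: co1_def co2_def co3_def mdet_def add_divide_distrib[symmetric] diff_divide_distrib[symmetric] algebra_simps)

lemma co_basis:
  "co1 N1 = 1" "co2 N1 = 0" "co3 N1 = 0" "co1 N2 = 0" "co2 N2 = 1" "co3 N2 = 0"
  "co1 N3 = 0" "co2 N3 = 0" "co3 N3 = 1"
  using co_combo[of 1 0 0] co_combo[of 0 1 0] co_combo[of 0 0 1] by auto

text \<open>A point of the first curve between the two edges at the first circle lies in the triangle. By tangency it is not in the interior of another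
convex side, so the only question is the sign of its first coordinate. With \<open>d\<close> as below this coordinate is
\<open>x2 + x3 - k1 * d\<close>, and the equation of the hyperboloid becomes \<open>d * (1 + m + k1 * \<sigma>) = 4 * x2 * x3\<close>, whose right side
is at most \<open>\<sigma>\<^sup>2\<close>.\<close>
lemma curve_in_region:
  assumes k: "k1 > 0" and z: "z \<in> curve C1" "co2 (hpt z) \<ge> 0" "co3 (hpt z) \<ge> 0"
  shows "z \<in> region"
proof -
  define W where "W = hpt z"
  have zd: "z \<in> hdisk" and y1: "mink W N1 = - k1" using z(1) r1 by (auto simp: represents_def W_def)
  have W: "future W" "mink W W = -1" using zd by (auto simp: W_def future_hpt mink_hpt_self)
  define x1 where "x1 = co1 W"
  define x2 where "x2 = co2 W"
  define x3 where "x3 = co3 W"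
  have x: "W = x1 *\<^sub>R N1 + x2 *\<^sub>R N2 + x3 *\<^sub>R N3" unfolding x1_def x2_def x3_def by (rule co_expand)
  have x23: "x2 \<ge> 0" "x3 \<ge> 0" using z by (auto simp: x2_def x3_def W_def)
  have far: "mink W M \<le> - k" if M: "mink N1 M = -1 - k1 * k" "mink M M = 1 - k\<^sup>2" "future (N1 + M)" "k \<ge> 0" for M k
  proof -
    have c: "k1 + k > 0" using k M(4) by simp
    have fs: "fst (N1 + M) > 0" using M(3) by (simp add: future_def)
    define X where "X = (1 / (k1 + k)) *\<^sub>R (N1 + M)"
    note tf = tangency_frame(1)[OF gram(1) M(2,1) fs c, folded X_def]
    have X: "future X" "mink X X = -1" using tf by (auto simp: frame_def future_def)
    have "mink W X \<le> -1" using unit_mink_le(1)[OF W X] .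
    then have "(mink W N1 + mink W M) / (k1 + k) \<le> -1" by (simp add: X_def)
    then have "mink W N1 + mink W M \<le> - (k1 + k)" using c by (simp add: divide_le_eq)
    then show ?thesis using y1 by simp
  qed
  have y2: "mink W N2 \<le> 0" using far[OF gram(4,2) futures(1) k_nonneg(2)] k_nonneg(2) by linarith
  have y3: "mink W N3 \<le> 0" using far[OF gram(6,3) futures(3) k_nonneg(3)] k_nonneg(3) by linarith
  define \<sigma> where "\<sigma> = x2 + x3"
  define m where "m = k2 * x2 + k3 * x3"
  define d where "d = 1 - k1 * x1 - m"
  have m0: "m \<ge> 0" and s0: "\<sigma> \<ge> 0" using x23 k_nonneg by (auto simp: m_def \<sigma>_def)
  have "x1 * (1 - k1\<^sup>2) - x2 * (1 + k1 * k2) - x3 * (1 + k1 * k3) = - k1"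
    using y1 unfolding x by (simp add: gram algebra_simps)
  then have x1: "x1 = \<sigma> - k1 * d" by (simp add: \<sigma>_def d_def m_def power2_eq_square algebra_simps)
  have "- 1 = x1 * mink W N1 + x2 * mink W N2 + x3 * mink W N3"
    using W(2) by (subst (asm) (2) x) simp
  also have "\<dots> = 2 * (x1\<^sup>2 + x2\<^sup>2 + x3\<^sup>2) - (x1 + x2 + x3)\<^sup>2 - (k1 * x1 + k2 * x2 + k3 * x3)\<^sup>2"
    unfolding x by (simp add: gram power2_eq_square algebra_simps)
  finally have q: "2 * (x1\<^sup>2 + x2\<^sup>2 + x3\<^sup>2) - (x1 + x2 + x3)\<^sup>2 - (1 - d)\<^sup>2 = -1"
    by (simp add: d_def m_def algebra_simps)
  have e1: "d * (1 + m + k1 * \<sigma>) = 4 * x2 * x3"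
  proof -
    have md: "m = 1 - k1 * (\<sigma> - k1 * d) - d" using x1 d_def by simp
    have "(x1 - \<sigma>)\<^sup>2 - 2 * \<sigma>\<^sup>2 + 2 * (x2\<^sup>2 + x3\<^sup>2) - (1 - d)\<^sup>2 = -1"
      using q by (simp add: \<sigma>_def power2_eq_square algebra_simps)
    then have "k1\<^sup>2 * d\<^sup>2 - 4 * x2 * x3 - (1 - d)\<^sup>2 = -1"
      unfolding x1 by (simp add: \<sigma>_def power2_eq_square algebra_simps)
    then show ?thesis unfolding md by (simp add: power2_eq_square algebra_simps)
  qed
  have "4 * x2 * x3 \<le> \<sigma>\<^sup>2"
  proof -
    have "\<sigma>\<^sup>2 - 4 * x2 * x3 = (x2 - x3)\<^sup>2" by (simp add: \<sigma>_def power2_eq_square algebra_simps)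
    then show ?thesis by (metis diff_ge_0_iff_ge zero_le_power2)
  qed
  then have le: "d * (1 + m + k1 * \<sigma>) \<le> \<sigma>\<^sup>2" using e1 by simp
  have "x1 \<ge> 0"
  proof (rule ccontr)
    assume "\<not> ?thesis"
    then have gt: "k1 * d > \<sigma>" using x1 by simp
    then have "k1 * d > 0" using s0 by linarith
    then have d0: "d > 0" using k by (simp add: zero_less_mult_iff)
    have "d * (1 + m) > 0" using d0 m0 by simp
    then have "k1 * d * \<sigma> < \<sigma> * \<sigma>" using le by (simp add: power2_eq_square algebra_simps)
    then show False using gt s0 by (smt (verit) mult_right_mono)
  qed
  then have "proj W \<in> region"
    using x23 y1 y2 y3 k by (intro regionI[OF W(1) x]) auto
  then show ?thesis by (simp add: W_def proj_hpt zd)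
qed

text \<open>The point of tangency of the first two circles, the common normal there, and the common unit tangent vector. The
latter is orthogonal to \<open>N1\<close> and \<open>N2\<close> and points towards the third circle.\<close>
definition "X12 = (1 / (k1 + k2)) *\<^sub>R (N1 + N2)"
definition "n12 = (1 / (k1 + k2)) *\<^sub>R (k2 *\<^sub>R N1 - k1 *\<^sub>R N2)"
definition "U12 = (1 / (2 * K * (k1 + k2))) *\<^sub>R
  ((- (K\<^sup>2 + 1 - k2\<^sup>2)) *\<^sub>R N1 + (- (K\<^sup>2 + 1 - k1\<^sup>2)) *\<^sub>R N2 + (k1 + k2)\<^sup>2 *\<^sub>R N3)"
definition "e1 = 1 - k1\<^sup>2"
text \<open>The arc of the first curve that starts at the tangency point with the second circle.\<close>
definition "Y q = arcY k1 X12 n12 U12 q"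

context
  assumes k1_pos: "k1 > 0"
begin

lemma kk_pos: "k1 + k2 > 0" using k1_pos k_nonneg by simp

lemma frame12: "frame X12 n12" "N1 = k1 *\<^sub>R X12 + n12" "N2 = k2 *\<^sub>R X12 - n12" "proj (N1 + N2) = proj X12"
proof -
  have "fst (N1 + N2) > 0" using futures(1) by (simp add: future_def)
  note tf = tangency_frame[OF gram(1,2,4) this kk_pos, folded X12_def n12_def]
  show "frame X12 n12" "N1 = k1 *\<^sub>R X12 + n12" "N2 = k2 *\<^sub>R X12 - n12" "proj (N1 + N2) = proj X12"
    using tf by auto
qed

lemma U12_facts: "mink U12 U12 = 1" "mink X12 U12 = 0" "mink n12 U12 = 0"
proof -
  define V where "V = (- (K\<^sup>2 + 1 - k2\<^sup>2)) *\<^sub>R N1 + (- (K\<^sup>2 + 1 - k1\<^sup>2)) *\<^sub>R N2 + (k1 + k2)\<^sup>2 *\<^sub>R N3"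
  define r where "r = 1 / (2 * K * (k1 + k2))"
  have U: "U12 = r *\<^sub>R V" by (simp add: U12_def V_def r_def)
  have V1: "mink V N1 = 0" "mink V N2 = 0" "mink V N3 = 4 * K\<^sup>2"
    unfolding V_def mink_linear gram K_ge(3) S_def by (simp_all add: power2_eq_square algebra_simps)
  have "mink V V = (k1 + k2)\<^sup>2 * (4 * K\<^sup>2)"
    by (subst (2) V_def) (simp add: V1)
  then have "mink U12 U12 = r * (r * ((k1 + k2)\<^sup>2 * (4 * K\<^sup>2)))" by (simp add: U)
  also have "\<dots> = 1" unfolding r_def using kk_pos K_ge(2) by (simp add: power2_eq_square)
  finally show "mink U12 U12 = 1" .
  have s: "mink N1 V = 0" "mink N2 V = 0" using V1 by (auto simp: mink_sym)
  show "mink X12 U12 = 0" "mink n12 U12 = 0" by (simp_all add: U X12_def n12_def s)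
qed

lemma e1_bound: "q \<in> {0..1 / K} \<Longrightarrow> 1 - e1 * q\<^sup>2 > 0" "1 - e1 * q\<^sup>2 > 0 \<Longrightarrow> q \<ge> 0 \<Longrightarrow> 1 - q * e1 / K > 0"
proof -
  have e: "e1 < 1" using k1_pos by (simp add: e1_def)
  show "1 - e1 * q\<^sup>2 > 0" if "q \<in> {0..1 / K}"
  proof (cases "e1 \<le> 0")
    case True
    then have "e1 * q\<^sup>2 \<le> 0" by (simp add: mult_nonpos_nonneg)
    then show ?thesis by linarith
  next
    case False
    have "1 / K \<le> 1" using K_ge by simp
    then have "q \<le> 1" "q \<ge> 0" using that by auto
    then have "q\<^sup>2 \<le> 1" by (simp add: power_le_one)
    then have "e1 * q\<^sup>2 \<le> e1 * 1" using False by (intro mult_left_mono) auto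
    then show ?thesis using e by simp
  qed
  show "1 - q * e1 / K > 0" if a: "1 - e1 * q\<^sup>2 > 0" "q \<ge> 0"
  proof (cases "e1 \<le> 0")
    case True
    then have "q * e1 / K \<le> 0" using a K_ge by (simp add: divide_nonpos_pos mult_nonneg_nonpos)
    then show ?thesis by simp
  next
    case False
    have "(q * e1)\<^sup>2 = e1 * (e1 * q\<^sup>2)" by (simp add: power2_eq_square)
    also have "\<dots> < e1 * 1" using False a by (intro mult_strict_left_mono) auto
    finally have "(q * e1)\<^sup>2 < 1" using e by simp
    then have "q * e1 < 1" using abs_square_less_1[of "q * e1"] by linarith
    then have "q * e1 < K" using K_ge by linarith
    then show ?thesis using K_ge(2) by simp
  qed
qed

lemma Y_facts:
  assumes "1 - e1 * q\<^sup>2 > 0"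
  shows "mink (Y q) (Y q) = -1" "mink (Y q) N1 = - k1" "future (Y q)"
    "mink (arcD k1 X12 n12 U12 q) (arcD k1 X12 n12 U12 q) = (2 / (1 - e1 * q\<^sup>2))\<^sup>2"
    "(Y has_vector_derivative arcD k1 X12 n12 U12 q) (at q)"
  using arcY_facts[OF frame12(1) U12_facts, of k1 q] assms frame12(2)
  unfolding Y_def[abs_def] e1_def by simp_all

lemma co_frame:
  "co2 X12 = 1 / (k1 + k2)" "co3 X12 = 0" "co2 n12 = - k1 / (k1 + k2)" "co3 n12 = 0"
  "co2 U12 = - (K\<^sup>2 + e1) / (2 * K * (k1 + k2))" "co3 U12 = (k1 + k2) / (2 * K)"
  using kk_pos unfolding X12_def n12_def U12_def e1_def co_linear co_basis by (simp_all add: power2_eq_square)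

text \<open>The third coordinate vanishes only at the beginning. The second one vanishes first at \<open>q = 1 / K\<close>, where the
arc meets the edge to the third circle.\<close>
lemma Y_coords:
  assumes "1 - e1 * q\<^sup>2 > 0"
  shows "co3 (Y q) = q * (k1 + k2) / (K * (1 - e1 * q\<^sup>2))"
    "co2 (Y q) = (1 - q * K) * (1 - q * e1 / K) / ((k1 + k2) * (1 - e1 * q\<^sup>2))"
proof -
  define m where "m = 1 - e1 * q\<^sup>2"
  define s where "s = k1 + k2"
  have m: "m > 0" and s: "s > 0" using assms kk_pos by (auto simp: m_def s_def)
  have Kp: "K > 0" using K_ge by simp
  have Y: "Y q = X12 + (2 * q\<^sup>2 / m) *\<^sub>R (X12 + k1 *\<^sub>R n12) + (2 * q / m) *\<^sub>R U12"
    by (simp add: Y_def arcY_def m_def e1_def)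
  show "co3 (Y q) = q * (k1 + k2) / (K * (1 - e1 * q\<^sup>2))"
    unfolding Y co_linear co_frame m_def[symmetric] s_def[symmetric] using m Kp by simp
  have "co2 (Y q) = (1 / s) * (1 + 2 * q\<^sup>2 / m * (1 - k1 * k1) - (2 * q / m) * (K\<^sup>2 + e1) / (2 * K))"
    unfolding Y co_linear co_frame s_def[symmetric] using s Kp m by (simp add: field_simps)
  also have "1 - k1 * k1 = e1" by (simp add: e1_def power2_eq_square)
  also have "1 + 2 * q\<^sup>2 / m * e1 - (2 * q / m) * (K\<^sup>2 + e1) / (2 * K) = (m + 2 * (e1 * q\<^sup>2) - q * (K\<^sup>2 + e1) / K) / m"
    using m Kp by (simp add: field_simps)
  also have "m + 2 * (e1 * q\<^sup>2) - q * (K\<^sup>2 + e1) / K = (1 - q * K) * (1 - q * e1 / K)"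
    unfolding m_def using Kp by (simp add: field_simps power2_eq_square)
  finally show "co2 (Y q) = (1 - q * K) * (1 - q * e1 / K) / ((k1 + k2) * (1 - e1 * q\<^sup>2))"
    using m s by (simp add: m_def s_def)
qed

lemma Y_on_curve:
  assumes "q \<in> {0..1 / K}"
  shows "proj (Y q) \<in> curve C1" "proj (Y q) \<in> hdisk" "hpt (proj (Y q)) = Y q" "co2 (Y q) \<ge> 0" "co3 (Y q) \<ge> 0"
proof -
  have m: "1 - e1 * q\<^sup>2 > 0" using e1_bound(1)[OF assms] .
  note Y = Y_facts[OF m]
  show d: "proj (Y q) \<in> hdisk" and h: "hpt (proj (Y q)) = Y q" using Y by (auto simp: proj_in_hdisk hpt_proj)
  show "proj (Y q) \<in> curve C1" using r1 d h Y by (simp add: represents_def)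
  have "q * K \<le> 1" "q \<ge> 0" using assms K_ge(2) by (auto simp: field_simps)
  then show "co2 (Y q) \<ge> 0" "co3 (Y q) \<ge> 0"
    unfolding Y_coords[OF m] using e1_bound(2)[OF m] m kk_pos K_ge(2)
    by (auto intro!: divide_nonneg_pos mult_nonneg_nonneg mult_pos_pos)
qed

text \<open>In terms of the coordinates \<open>v\<close> and \<open>\<gamma>\<close> of the point, the parameter is \<open>q = v / \<gamma>\<close>.\<close>
lemma curve_param:
  assumes z: "z \<in> curve C1" "co2 (hpt z) \<ge> 0" "co3 (hpt z) \<ge> 0"
  obtains q where "q \<in> {0..1 / K}" "z = proj (Y q)"
proof -
  define W where "W = hpt z"
  have zd: "z \<in> hdisk" and y1: "mink W N1 = - k1" using z(1) r1 by (auto simp: represents_def W_def)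
  have W: "future W" "mink W W = -1" using zd by (auto simp: W_def future_hpt mink_hpt_self)
  have f: "mink X12 X12 = -1" "mink n12 n12 = 1" "mink X12 n12 = 0" "mink n12 X12 = 0" "future X12"
    using frame12(1) by (auto simp: frame_def mink_sym future_def)
  define v where "v = - mink W X12 - 1"
  define \<gamma> where "\<gamma> = mink W U12"
  have b: "mink W n12 = k1 * v"
  proof -
    have "mink W N1 = k1 * mink W X12 + mink W n12" by (subst frame12(2)) simp
    then show ?thesis using y1 by (simp add: v_def algebra_simps)
  qed
  have We: "W = (1 + v) *\<^sub>R X12 + (k1 * v) *\<^sub>R n12 + \<gamma> *\<^sub>R U12"
    using orthonormal_expand[OF f(1,2) U12_facts(1) f(3) U12_facts(2,3), of W]
    by (simp add: b \<gamma>_def[symmetric]) (simp add: v_def)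
  have v0: "v \<ge> 0" using unit_mink_le(1)[OF W f(5,1)] by (simp add: v_def)
  have s: "mink U12 X12 = 0" "mink U12 n12 = 0" using U12_facts by (auto simp: mink_sym)
  have "- 1 = - (1 + v)\<^sup>2 + (k1 * v)\<^sup>2 + \<gamma>\<^sup>2"
    using W(2) unfolding We using f U12_facts s by (simp add: power2_eq_square algebra_simps)
  then have g2: "\<gamma>\<^sup>2 = 2 * v + e1 * v\<^sup>2" by (simp add: e1_def power2_eq_square algebra_simps)
  have "co3 W = \<gamma> * ((k1 + k2) / (2 * K))" unfolding We co_linear co_frame by simp
  then have g0: "\<gamma> \<ge> 0" using z(3) kk_pos K_ge(2)
    by (simp add: W_def zero_le_mult_iff zero_le_divide_iff)
  have main: "\<exists>q\<ge>0. 1 - e1 * q\<^sup>2 > 0 \<and> W = Y q"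
  proof (cases "\<gamma> = 0")
    case True
    \<comment> \<open>Only a full circle has a second point with \<open>\<gamma> = 0\<close>, the one opposite to \<open>X12\<close>, which lies behind the edge.\<close>
    have "v = 0"
    proof (rule ccontr)
      assume "v \<noteq> 0"
      have "v * (2 + e1 * v) = 0" using g2 True by (simp add: power2_eq_square algebra_simps)
      then have ev: "e1 * v = -2" using \<open>v \<noteq> 0\<close> by simp
      have "co2 W = (1 + v - k1 * v * k1) / (k1 + k2)" unfolding We co_linear co_frame True
        by (simp add: diff_divide_distrib add_divide_distrib)
      also have "1 + v - k1 * v * k1 = 1 + e1 * v" by (simp add: e1_def power2_eq_square algebra_simps)
      finally have "co2 W = -1 / (k1 + k2)" using ev by simp
      then show False using z(2) kk_pos by (simp add: W_def)
    qed
    then have "W = Y 0" using True We by (simp add: Y_def arcY_0)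
    then show ?thesis by (intro exI[of _ 0]) simp
  next
    case False
    then have gp: "\<gamma> > 0" using g0 by simp
    have vp: "v > 0" using g2 gp v0 by (cases "v = 0") auto
    define q where "q = v / \<gamma>"
    have m: "1 - e1 * q\<^sup>2 = 2 * v / \<gamma>\<^sup>2"
    proof -
      have "1 - e1 * q\<^sup>2 = (\<gamma>\<^sup>2 - e1 * v\<^sup>2) / \<gamma>\<^sup>2" using gp by (simp add: q_def power_divide diff_divide_distrib)
      then show ?thesis using g2 by simp
    qed
    have 1: "2 * q / (1 - e1 * q\<^sup>2) = \<gamma>" unfolding m using gp vp by (simp add: q_def power2_eq_square)
    have 2: "2 * q\<^sup>2 / (1 - e1 * q\<^sup>2) = v" unfolding m using gp vp by (simp add: q_def power2_eq_square)
    have "Y q = X12 + v *\<^sub>R (X12 + k1 *\<^sub>R n12) + \<gamma> *\<^sub>R U12"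
      unfolding Y_def arcY_def e1_def[symmetric] 1 2 ..
    also have "\<dots> = W" unfolding We by (simp add: scaleR_add_right scaleR_add_left mult.commute)
    finally show ?thesis using m gp vp by (intro exI[of _ q]) (auto simp: q_def)
  qed
  then obtain q where q: "q \<ge> 0" "1 - e1 * q\<^sup>2 > 0" "W = Y q" by blast
  have "(1 - q * K) * (1 - q * e1 / K) / ((k1 + k2) * (1 - e1 * q\<^sup>2)) \<ge> 0"
    using z(2) Y_coords(2)[OF q(2)] q(3) by (simp add: W_def)
  moreover have "(k1 + k2) * (1 - e1 * q\<^sup>2) > 0" using q(2) kk_pos by simp
  ultimately have "(1 - q * K) * (1 - q * e1 / K) \<ge> 0" by (simp only: zero_le_divide_iff) linarith
  then have "1 - q * K \<ge> 0" using e1_bound(2)[OF q(2,1)] by (simp only: zero_le_mult_iff) linarith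
  then have "q \<in> {0..1 / K}" using q(1) K_ge(2) by (simp add: field_simps)
  moreover have "z = proj (Y q)" using q(3) proj_hpt[OF zd] by (simp add: W_def)
  ultimately show thesis by (rule that)
qed

lemma hpt_co_sign: "z \<in> hdisk \<Longrightarrow> co2 (lift z) \<ge> 0 \<longleftrightarrow> co2 (hpt z) \<ge> 0" "z \<in> hdisk \<Longrightarrow> co3 (lift z) \<ge> 0 \<longleftrightarrow> co3 (hpt z) \<ge> 0"
  using one_minus_pos[of z] by (simp_all add: lift_hpt co_linear zero_le_mult_iff)

text \<open>The inclusion from left to right uses only the half planes of \<open>packed_coords\<close>, the other one that the region is
part of the triangle.\<close>
lemma curve_packed: "curve C1 \<inter> packed_triangle C1 C2 C3 = (\<lambda>q. proj (Y q)) ` {0..1 / K}"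
proof
  show "curve C1 \<inter> packed_triangle C1 C2 C3 \<subseteq> (\<lambda>q. proj (Y q)) ` {0..1 / K}"
  proof
    fix z assume z: "z \<in> curve C1 \<inter> packed_triangle C1 C2 C3"
    then have zd: "z \<in> hdisk" by (simp add: packed_triangle_def)
    have "co2 (hpt z) \<ge> 0" "co3 (hpt z) \<ge> 0"
      using packed_coords[OF k1_pos] z hpt_co_sign[OF zd] by auto
    then obtain q where "q \<in> {0..1 / K}" "z = proj (Y q)" using curve_param z by blast
    then show "z \<in> (\<lambda>q. proj (Y q)) ` {0..1 / K}" by blast
  qed
  show "(\<lambda>q. proj (Y q)) ` {0..1 / K} \<subseteq> curve C1 \<inter> packed_triangle C1 C2 C3"
  proof
    fix z assume "z \<in> (\<lambda>q. proj (Y q)) ` {0..1 / K}"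
    then obtain q where q: "q \<in> {0..1 / K}" "z = proj (Y q)" by blast
    note Yq = Y_on_curve[OF q(1)]
    have "z \<in> region" using curve_in_region[OF k1_pos Yq(1)] Yq q by simp
    then show "z \<in> curve C1 \<inter> packed_triangle C1 C2 C3"
      using Yq q region_subset_packed by blast
  qed
qed

lemma arc_start: "tangency_point C1 C2 = proj (Y 0)"
  using externally_tangent_mink(3)[OF r1 r2 e12] frame12(4) by (simp add: Y_def arcY_0)

lemma arc_end: "tangency_point C1 C3 = proj (Y (1 / K))"
proof -
  define t where "t = tangency_point C1 C3"
  have kp: "k1 + k3 > 0" using k1_pos k_nonneg by simp
  have fs: "fst (N1 + N3) > 0" using futures(3) by (simp add: future_def)
  define X where "X = (1 / (k1 + k3)) *\<^sub>R (N1 + N3)"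
  note tf = tangency_frame[OF gram(1,3,6) fs kp, folded X_def]
  have X: "future X" "mink X X = -1" using tf(1) by (auto simp: frame_def future_def)
  have tX: "t = proj X" using externally_tangent_mink(3)[OF r1 r3 e13] tf(4) by (simp add: t_def)
  have td: "t \<in> hdisk" and h: "hpt t = X" using X tX by (auto simp: proj_in_hdisk hpt_proj)
  have "mink X N1 = (1 - k1\<^sup>2 + (-1 - k1 * k3)) / (k1 + k3)" by (simp add: X_def gram)
  also have "\<dots> = - k1" using kp by (simp add: divide_eq_eq power2_eq_square algebra_simps)
  finally have "t \<in> curve C1" using r1 td h by (simp add: represents_def)
  moreover have c: "co2 X = 0" "co3 X = 1 / (k1 + k3)" by (simp_all add: X_def co_linear co_basis)
  ultimately obtain q where q: "q \<in> {0..1 / K}" "t = proj (Y q)"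
    using curve_param[of t] h kp by auto
  have m: "1 - e1 * q\<^sup>2 > 0" using e1_bound(1)[OF q(1)] .
  have "Y q = X" using Y_on_curve(3)[OF q(1)] q(2) h by simp
  then have "(1 - q * K) * (1 - q * e1 / K) / ((k1 + k2) * (1 - e1 * q\<^sup>2)) = 0" using c Y_coords(2)[OF m] by simp
  then have "1 - q * K = 0" using e1_bound(2)[OF m] q(1) m kk_pos by auto
  then have "q = 1 / K" using K_ge(2) by (simp add: field_simps)
  then show ?thesis using q(2) by (simp add: t_def)
qed

lemma Y_inj: "inj_on (\<lambda>q. proj (Y q)) {0..1 / K}"
proof (rule inj_onI)
  fix p q assume a: "p \<in> {0..1 / K}" "q \<in> {0..1 / K}" "proj (Y p) = proj (Y q)"
  then have "Y p = Y q" using Y_on_curve(3) by metis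
  moreover have "mink (Y x) U12 = 2 * x / (1 - e1 * x\<^sup>2)" "mink (Y x) n12 = x * (2 * x / (1 - e1 * x\<^sup>2)) * k1" for x
    using frame12(1) U12_facts unfolding Y_def arcY_def e1_def
    by (simp_all add: frame_def mink_sym power2_eq_square)
  ultimately have e: "2 * p / (1 - e1 * p\<^sup>2) = 2 * q / (1 - e1 * q\<^sup>2)"
    "p * (2 * p / (1 - e1 * p\<^sup>2)) * k1 = q * (2 * q / (1 - e1 * q\<^sup>2)) * k1" by metis+
  have m: "1 - e1 * p\<^sup>2 > 0" "1 - e1 * q\<^sup>2 > 0" using e1_bound(1) a by auto
  show "p = q"
  proof (cases "p = 0")
    case True then show ?thesis using e(1) m by simp
  next
    case False
    then have "2 * p / (1 - e1 * p\<^sup>2) * k1 \<noteq> 0" using m k1_pos by simp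
    moreover have "p * (2 * p / (1 - e1 * p\<^sup>2) * k1) = q * (2 * p / (1 - e1 * p\<^sup>2) * k1)"
      using e(2) unfolding e(1) by (simp only: mult.assoc)
    ultimately show ?thesis by (simp only: mult_cancel_right) blast
  qed
qed

definition "velocity q = (1 / (1 + fst (Y q))\<^sup>2) *\<^sub>R
  ((1 + fst (Y q)) *\<^sub>R snd (arcD k1 X12 n12 U12 q) - fst (arcD k1 X12 n12 U12 q) *\<^sub>R snd (Y q))"

lemma velocity:
  assumes "q \<in> {0..1 / K}"
  shows "((\<lambda>q. proj (Y q)) has_vector_derivative velocity q) (at q)"
    "2 * norm (velocity q) / (1 - (norm (proj (Y q)))\<^sup>2) = 2 / (1 - e1 * q\<^sup>2)"
proof -
  define T where "T = {q. 1 - e1 * q\<^sup>2 > 0}"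
  have T: "open T" "q \<in> T" unfolding T_def e1_def using arcY_open e1_bound(1)[OF assms] by (auto simp: e1_def)
  have Y: "future (Y x)" "mink (Y x) (Y x) = -1" if "x \<in> T" for x using Y_facts that by (auto simp: T_def)
  have m: "1 - e1 * q\<^sup>2 > 0" using T(2) by (simp add: T_def)
  note Yd = Y_facts(5)[OF m]
  show v: "((\<lambda>q. proj (Y q)) has_vector_derivative velocity q) (at q)"
    unfolding velocity_def by (rule proj_has_vector_derivative[OF Yd T Y])
  define z where "z = proj (Y q)"
  have z: "z \<in> hdisk" using Y_on_curve(2)[OF assms] by (simp add: z_def)
  have "vector_derivative (\<lambda>q. proj (Y q)) (at q) = velocity q" using v by (rule vector_derivative_at)
  then have "dhpt z (velocity q) = arcD k1 X12 n12 U12 q"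
    using proj_curve_velocity(2)[OF Yd T Y] by (simp add: z_def)
  then have "(2 / (1 - e1 * q\<^sup>2))\<^sup>2 = 4 * (velocity q \<bullet> velocity q) / (1 - (norm z)\<^sup>2)\<^sup>2"
    using Y_facts(4)[OF m] mink_dhpt[OF z, of "velocity q" "velocity q"] by simp
  also have "\<dots> = (2 * norm (velocity q) / (1 - (norm z)\<^sup>2))\<^sup>2"
    by (simp add: power_divide power_mult_distrib power2_norm_eq_inner)
  finally have "(2 * norm (velocity q) / (1 - (norm z)\<^sup>2))\<^sup>2 = (2 / (1 - e1 * q\<^sup>2))\<^sup>2" ..
  then show "2 * norm (velocity q) / (1 - (norm (proj (Y q)))\<^sup>2) = 2 / (1 - e1 * q\<^sup>2)"
    unfolding z_def[symmetric] by (rule power2_eq_imp_eq) (use m one_minus_pos[OF z] in auto)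
qed

text \<open>Continuity makes the parametrized arc a valid path.\<close>
lemma velocity_continuous: "continuous_on {0..1 / K} velocity"
proof -
  have Yc: "continuous_on {0..1 / K} Y"
    by (intro continuous_at_imp_continuous_on ballI) (meson Y_facts(5) e1_bound(1) has_vector_derivative_continuous)
  have Dc: "continuous_on {0..1 / K} (arcD k1 X12 n12 U12)"
    unfolding arcD_def[abs_def] e1_def[symmetric]
    by (intro continuous_intros) (use e1_bound(1) in fastforce)+
  have "1 + fst (Y q) \<noteq> 0" if "q \<in> {0..1 / K}" for q
    using Y_facts(3)[OF e1_bound(1)[OF that]] by (simp add: future_def)
  then show ?thesis unfolding velocity_def[abs_def]
    by (intro continuous_intros Yc Dc) auto
qed

text \<open>The parametrized arc itself is admitted in the definition of the arc length, and by \<open>arc_hlength\<close> every other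
admitted arc has the same length.\<close>
lemma arc_length_eq: "arc_length C1 C2 C3 = integral {0..1 / K} (\<lambda>q. 2 / (1 - e1 * q\<^sup>2))"
proof -
  define \<omega> where "\<omega> q = 2 / (1 - e1 * q\<^sup>2)" for q
  define c where "c q = proj (Y q)" for q
  have Q: "1 / K > 0" using K_ge by simp
  have \<omega>c: "continuous_on {0..1 / K} \<omega>" unfolding \<omega>_def by (intro continuous_intros) (use e1_bound(1) in force)
  have \<omega>p: "\<omega> q > 0" if "q \<in> {0..1 / K}" for q using e1_bound(1)[OF that] by (simp add: \<omega>_def)
  have cd: "(c has_vector_derivative velocity q) (at q)" if "q \<in> {0..1 / K}" for q
    using velocity(1)[OF that] by (simp add: c_def[abs_def])
  have inj: "inj_on c {0..1 / K}" using Y_inj by (simp add: c_def[abs_def])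
  have all: "hlength \<gamma> = integral {0..1 / K} \<omega>"
    if "valid_path \<gamma>" "arc \<gamma>" "path_image \<gamma> \<subseteq> curve C1 \<inter> packed_triangle C1 C2 C3"
     "pathstart \<gamma> = tangency_point C1 C2" "pathfinish \<gamma> = tangency_point C1 C3" for \<gamma>
    using that unfolding curve_packed arc_start arc_end
    by (intro arc_hlength[OF Q cd inj _ \<omega>c \<omega>p])
       (auto simp: c_def[abs_def] Y_on_curve(2) velocity(2) \<omega>_def)
  define \<gamma> where "\<gamma> s = c (s / K)" for s
  have sK: "s / K \<in> {0..1 / K}" if "s \<in> {0..1}" for s using that K_ge(2) by (simp add: divide_right_mono)
  have gd: "(\<gamma> has_vector_derivative (1 / K) *\<^sub>R velocity (s / K)) (at s)" if "s \<in> {0..1}" for s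
  proof -
    have "((\<lambda>s. s / K) has_vector_derivative 1 / K) (at s)"
      using K_ge(2)
      by (auto intro!: derivative_eq_intros simp: has_real_derivative_iff_has_vector_derivative[symmetric])
    from vector_diff_chain_at[OF this cd[OF sK[OF that]]] show ?thesis by (simp add: \<gamma>_def[abs_def] o_def)
  qed
  have vp: "valid_path \<gamma>"
  proof -
    have "continuous_on {0..1} (\<lambda>s. s / K)" using K_ge(2) by (intro continuous_intros) simp
    moreover have "(\<lambda>s. s / K) ` {0..1} \<subseteq> {0..1 / K}" using sK by blast
    ultimately have "continuous_on {0..1} (\<lambda>s. velocity (s / K))"
      by (rule continuous_on_compose2[OF velocity_continuous])
    then have "continuous_on {0..1} (\<lambda>s. (1 / K) *\<^sub>R velocity (s / K))"
      by (rule continuous_on_scaleR[OF continuous_on_const])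
    then have "\<gamma> C1_differentiable_on {0..1}" unfolding C1_differentiable_on_def using gd
      by (intro exI[of _ "\<lambda>s. (1 / K) *\<^sub>R velocity (s / K)"] conjI ballI) simp_all
    then show ?thesis unfolding valid_path_def by (rule C1_differentiable_imp_piecewise)
  qed
  have ar: "arc \<gamma>" unfolding arc_def
  proof
    show "path \<gamma>" using vp by (rule valid_path_imp_path)
    show "inj_on \<gamma> {0..1}"
    proof (rule inj_onI)
      fix s t assume "s \<in> {0..1}" "t \<in> {0..1}" "\<gamma> s = \<gamma> t"
      then have "s / K = t / K" using inj_onD[OF inj, of "s / K" "t / K"] sK by (simp add: \<gamma>_def)
      then show "s = t" using K_ge(2) by simp
    qed
  qed
  have pi: "path_image \<gamma> \<subseteq> curve C1 \<inter> packed_triangle C1 C2 C3"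
    unfolding curve_packed path_image_def using sK by (auto simp: \<gamma>_def c_def)
  have ends: "pathstart \<gamma> = tangency_point C1 C2" "pathfinish \<gamma> = tangency_point C1 C3"
    by (simp_all add: pathstart_def pathfinish_def \<gamma>_def c_def arc_start arc_end)
  have "arc_length C1 C2 C3 = integral {0..1 / K} \<omega>"
    unfolding arc_length_def
  proof (rule the_equality)
    show "\<exists>\<gamma>. valid_path \<gamma> \<and> arc \<gamma> \<and> path_image \<gamma> \<subseteq> curve C1 \<inter> packed_triangle C1 C2 C3 \<and>
      pathstart \<gamma> = tangency_point C1 C2 \<and> pathfinish \<gamma> = tangency_point C1 C3 \<and> integral {0..1 / K} \<omega> = hlength \<gamma>"
      using vp ar pi ends all[OF vp ar pi ends] by (intro exI[of _ \<gamma>]) simp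
  qed (use all in blast)
  then show ?thesis by (simp add: \<omega>_def[abs_def])
qed

end

end

section \<open>Existence of configurations\<close>

lemma config_from_vectors:
  assumes k: "k1 \<ge> 0" "k2 \<ge> 0" "k3 \<ge> 0"
    and g: "mink N1 N1 = 1 - k1\<^sup>2" "mink N2 N2 = 1 - k2\<^sup>2" "mink N3 N3 = 1 - k3\<^sup>2"
      "mink N1 N2 = -1 - k1 * k2" "mink N2 N3 = -1 - k2 * k3" "mink N3 N1 = -1 - k3 * k1"
    and f: "k1 \<ge> 1 \<Longrightarrow> fst N1 > 0" "k2 \<ge> 1 \<Longrightarrow> fst N2 > 0" "k3 \<ge> 1 \<Longrightarrow> fst N3 > 0"
      "fst (N1 + N2) > 0" "fst (N2 + N3) > 0" "fst (N3 + N1) > 0"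
    and o: "counterclockwise (proj (N1 + N2)) (proj (N2 + N3)) (proj (N3 + N1))"
  shows "\<exists>C1 C2 C3. three_circle_configuration k1 k2 k3 C1 C2 C3"
proof -
  obtain C1 where C1: "generalized_circle C1" "curvature C1 = k1" "represents N1 C1"
    using generalized_circle_exists[OF k(1) g(1) f(1)] by blast
  obtain C2 where C2: "generalized_circle C2" "curvature C2 = k2" "represents N2 C2"
    using generalized_circle_exists[OF k(2) g(2) f(2)] by blast
  obtain C3 where C3: "generalized_circle C3" "curvature C3 = k3" "represents N3 C3"
    using generalized_circle_exists[OF k(3) g(3) f(3)] by blast
  have e12: "externally_tangent C1 C2" using mink_tangent_implies[OF C1(3) C2(3)] g(4) f(4) C1 C2 by simp
  have e23: "externally_tangent C2 C3" using mink_tangent_implies[OF C2(3) C3(3)] g(5) f(5) C2 C3 by simp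
  have e31: "externally_tangent C3 C1" using mink_tangent_implies[OF C3(3) C1(3)] g(6) f(6) C3 C1 by simp
  have "three_circle_configuration k1 k2 k3 C1 C2 C3"
    unfolding three_circle_configuration_def
    using C1 C2 C3 e12 e23 e31 o externally_tangent_mink(3)[OF C1(3) C2(3) e12]
      externally_tangent_mink(3)[OF C2(3) C3(3) e23] externally_tangent_mink(3)[OF C3(3) C1(3) e31] by simp
  then show ?thesis by blast
qed

text \<open>The first two circles are placed such that they touch at the centre of the disk with normal along the real axis.
The products with \<open>N1\<close> and \<open>N2\<close> and the norm then determine \<open>N3\<close> up to the sign of \<open>c\<close>, and a negative
\<open>c\<close> gives the counterclockwise order.\<close>
lemma config_exists_pos:
  assumes k: "k1 \<ge> 0" "k2 \<ge> 0" "k3 \<ge> 0" and p: "k1 + k2 > (0::real)"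
  shows "\<exists>C1 C2 C3. three_circle_configuration k1 k2 k3 C1 C2 C3"
proof -
  define s where "s = k1 + k2"
  define K where "K = sqrt (1 + (k1 * k2 + k2 * k3 + k3 * k1))"
  have s: "s > 0" using p by (simp add: s_def)
  have S0: "k1 * k2 + k2 * k3 + k3 * k1 \<ge> 0" using k by simp
  have K: "K > 0" "K\<^sup>2 = 1 + (k1 * k2 + k2 * k3 + k3 * k1)" using S0 by (auto simp: K_def)
  define b where "b = (k1 - k2) / s"
  define t where "t = k3 + 2 / s"
  define c where "c = - 2 * K / s"
  define N1 :: mvec where "N1 = (k1, Complex 1 0)"
  define N2 :: mvec where "N2 = (k2, Complex (-1) 0)"
  define N3 :: mvec where "N3 = (t, Complex b c)"
  have t: "t > 0" using k s by (simp add: t_def add_nonneg_pos)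
  have c: "c < 0" using K s by (simp add: c_def)
  have sb: "s * b = k1 - k2" and st: "s * t = s * k3 + 2" and sc: "s * c = - 2 * K"
    using s by (simp_all add: b_def t_def c_def field_simps)
  have g3: "mink N3 N3 = 1 - k3\<^sup>2"
  proof -
    have "s\<^sup>2 * (b\<^sup>2 + c\<^sup>2 - t\<^sup>2) = (s * b)\<^sup>2 + (s * c)\<^sup>2 - (s * t)\<^sup>2" by (simp add: power_mult_distrib algebra_simps)
    also have "\<dots> = (k1 - k2)\<^sup>2 + 4 * K\<^sup>2 - (s * k3 + 2)\<^sup>2" unfolding sb st sc by (simp add: power_mult_distrib)
    also have "\<dots> = s\<^sup>2 * (1 - k3\<^sup>2)" unfolding K(2) s_def by (simp add: power2_eq_square algebra_simps)
    finally have "b\<^sup>2 + c\<^sup>2 - t\<^sup>2 = 1 - k3\<^sup>2" using s by simp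
    then show ?thesis by (simp add: N3_def mink_def power2_eq_square)
  qed
  have g23: "mink N2 N3 = -1 - k2 * k3"
  proof -
    have "s * (- b - k2 * t) = s * (-1 - k2 * k3)" using sb st by (simp add: s_def algebra_simps)
    then show ?thesis using s by (simp add: N2_def N3_def mink_def)
  qed
  have g31: "mink N3 N1 = -1 - k3 * k1"
  proof -
    have "s * (b - t * k1) = s * (-1 - k3 * k1)" using sb st by (simp add: s_def algebra_simps)
    then show ?thesis using s by (simp add: N1_def N3_def mink_def)
  qed
  have pos: "fst (N2 + N3) > 0" "fst (N3 + N1) > 0" using k t by (auto simp: N1_def N2_def N3_def)
  define D1 where "D1 = fst (N2 + N3) + sqrt (- mink (N2 + N3) (N2 + N3))"
  define D2 where "D2 = fst (N3 + N1) + sqrt (- mink (N3 + N1) (N3 + N1))"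
  have D: "D1 > 0" "D2 > 0"
  proof -
    have m: "mink N3 N2 = -1 - k2 * k3" "mink N1 N3 = -1 - k3 * k1" using g23 g31 by (auto simp: mink_sym)
    have "mink (N2 + N3) (N2 + N3) = - (k2 + k3)\<^sup>2"
      using g3 g23 m by (simp add: N2_def mink_def power2_eq_square algebra_simps)
    then have "- mink (N2 + N3) (N2 + N3) \<ge> 0" by simp
    then show "D1 > 0" using pos(1) unfolding D1_def by (simp only: add_pos_nonneg real_sqrt_ge_zero)
    have "mink (N3 + N1) (N3 + N1) = - (k3 + k1)\<^sup>2"
      using g3 g31 m by (simp add: N1_def mink_def power2_eq_square algebra_simps)
    then have "- mink (N3 + N1) (N3 + N1) \<ge> 0" by simp
    then show "D2 > 0" using pos(2) unfolding D2_def by (simp only: add_pos_nonneg real_sqrt_ge_zero)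
  qed
  have z1: "proj (N1 + N2) = 0" by (simp add: proj_def N1_def N2_def complex_eq_iff)
  have z2: "proj (N2 + N3) = Complex ((b - 1) / D1) (c / D1)"
    unfolding proj_def D1_def[symmetric] by (simp add: N2_def N3_def complex_eq_iff divide_inverse mult.commute)
  have z3: "proj (N3 + N1) = Complex ((b + 1) / D2) (c / D2)"
    unfolding proj_def D2_def[symmetric] by (simp add: N1_def N3_def complex_eq_iff divide_inverse mult.commute)
  have "Im (cnj (Complex ((b - 1) / D1) (c / D1)) * Complex ((b + 1) / D2) (c / D2)) = (- 2 * c) / (D1 * D2)"
    using D by (simp add: field_simps)
  note im = this
  have "(- 2 * c) / (D1 * D2) > 0" using D c by (intro divide_pos_pos) auto
  then have ccw: "counterclockwise (proj (N1 + N2)) (proj (N2 + N3)) (proj (N3 + N1))"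
    unfolding counterclockwise_def z1 z2 z3 diff_zero im .
  have g12: "mink N1 N1 = 1 - k1\<^sup>2" "mink N2 N2 = 1 - k2\<^sup>2" "mink N1 N2 = -1 - k1 * k2"
    by (simp_all add: N1_def N2_def mink_def power2_eq_square)
  have f: "k1 \<ge> 1 \<Longrightarrow> fst N1 > 0" "k2 \<ge> 1 \<Longrightarrow> fst N2 > 0" "fst N3 > 0" "fst (N1 + N2) > 0"
    using t p by (simp_all add: N1_def N2_def N3_def)
  show ?thesis
    by (rule config_from_vectors[OF k g12(1,2) g3 g12(3) g23 g31 f(1,2,3,4) pos ccw])
qed

text \<open>The three sides of the ideal triangle with vertices \<open>-1\<close>, \<open>1\<close>, \<open>\<i>\<close>, each with the half plane
outside the triangle.\<close>
lemma config_exists_zero: "\<exists>C1 C2 C3. three_circle_configuration 0 0 0 C1 C2 C3"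
proof -
  define N1 :: mvec where "N1 = (1, Complex (-1) 1)"
  define N2 :: mvec where "N2 = (0, Complex 0 (-1))"
  define N3 :: mvec where "N3 = (1, Complex 1 1)"
  have z: "proj (N1 + N2) = -1" "proj (N2 + N3) = 1" "proj (N3 + N1) = \<i>"
    by (simp_all add: proj_def N1_def N2_def N3_def mink_def complex_eq_iff)
  have m: "mink N1 N1 = 1 - 0\<^sup>2" "mink N2 N2 = 1 - 0\<^sup>2" "mink N3 N3 = 1 - 0\<^sup>2"
    "mink N1 N2 = -1 - 0 * 0" "mink N2 N3 = -1 - 0 * 0" "mink N3 N1 = -1 - 0 * 0"
    by (simp_all add: N1_def N2_def N3_def mink_def)
  have f: "fst (N1 + N2) > 0" "fst (N2 + N3) > 0" "fst (N3 + N1) > 0"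
    by (simp_all add: N1_def N2_def N3_def)
  have ccw: "counterclockwise (proj (N1 + N2)) (proj (N2 + N3)) (proj (N3 + N1))"
    unfolding z counterclockwise_def by simp
  show ?thesis
    by (rule config_from_vectors[OF order_refl order_refl order_refl m _ _ _ f ccw]) simp_all
qed

lemma counterclockwise_rotate: "counterclockwise a b c \<Longrightarrow> counterclockwise b c a"
  by (simp add: counterclockwise_def algebra_simps)

lemma config_rotate:
  "three_circle_configuration k1 k2 k3 C1 C2 C3 \<Longrightarrow> three_circle_configuration k2 k3 k1 C2 C3 C1"
  unfolding three_circle_configuration_def using counterclockwise_rotate by blast

lemma config_exists:
  assumes "k1 \<ge> 0" "k2 \<ge> 0" "k3 \<ge> 0"
  shows "\<exists>C1 C2 C3. three_circle_configuration k1 k2 k3 C1 C2 C3"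
proof -
  consider "k1 + k2 > 0" | "k1 = 0" "k2 = 0" "k3 > 0" | "k1 = 0" "k2 = 0" "k3 = 0" using assms by linarith
  then show ?thesis
  proof cases
    case 1 then show ?thesis using config_exists_pos assms by blast
  next
    case 2
    then have "k2 + k3 > 0" by simp
    then obtain C2 C3 C1 where h: "three_circle_configuration k2 k3 k1 C2 C3 C1"
      using config_exists_pos[of k2 k3 k1] assms by blast
    have "three_circle_configuration k1 k2 k3 C1 C2 C3" by (rule config_rotate[OF config_rotate[OF h]])
    then show ?thesis by blast
  next
    case 3 then show ?thesis using config_exists_zero by simp
  qed
qed

lemma config_triple:
  assumes "three_circle_configuration k1 k2 k3 C1 C2 C3"
  obtains N1 N2 N3 where "triple C1 C2 C3 N1 N2 N3"
proof -
  obtain N1 N2 N3 where "represents N1 C1" "represents N2 C2" "represents N3 C3"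
    using assms generalized_circle_represents unfolding three_circle_configuration_def by metis
  then show thesis using that assms by (simp add: triple_def three_circle_configuration_def)
qed

section \<open>Total curvature of an arc\<close>

definition arcK :: "real \<Rightarrow> real \<Rightarrow> real" where
  "arcK k S = k * integral {0..1 / sqrt (1 + S)} (\<lambda>q. 2 / (1 - (1 - k\<^sup>2) * q\<^sup>2))"

lemma arc_curvature_eq:
  assumes "three_circle_configuration k1 k2 k3 C1 C2 C3"
  shows "arc_curvature C1 C2 C3 = arcK k1 (k1 * k2 + k2 * k3 + k3 * k1)"
proof -
  obtain N1 N2 N3 where "triple C1 C2 C3 N1 N2 N3" using config_triple[OF assms] .
  then interpret triple C1 C2 C3 N1 N2 N3 .
  have k: "curvature C1 = k1" "curvature C2 = k2" "curvature C3 = k3"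
    using assms by (auto simp: three_circle_configuration_def)
  show ?thesis
  proof (cases "k1 > 0")
    case True
    then show ?thesis using arc_length_eq k
      by (simp add: arc_curvature_def arcK_def K_def S_def e1_def)
  next
    case False
    then have "k1 = 0" using k_nonneg k by simp
    then show ?thesis by (simp add: arc_curvature_def k arcK_def)
  qed
qed

text \<open>The integrand of the angular form of the total curvature. For \<open>0 < t < pi / 2\<close> it lies between \<open>0\<close> and \<open>1\<close>, increases with
\<open>k\<close>, and tends to \<open>1\<close> as \<open>k\<close> tends to infinity.\<close>
definition hfun :: "real \<Rightarrow> real \<Rightarrow> real" where
  "hfun k t = k * cos t / sqrt ((sin t)\<^sup>2 + k\<^sup>2 * (cos t)\<^sup>2)"

text \<open>For \<open>S > 0\<close> this is \<open>arctan (k / sqrt S)\<close>; in this form the value for \<open>S = 0\<close> is the limit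
\<open>pi / 2\<close>. If \<open>S = k1 * k2 + k2 * k3 + k3 * k1\<close> with positive curvatures, the radius of the circle inscribed in the Euclidean triangle
of the centres of tangent circles of radii \<open>1 / k1\<close>, \<open>1 / k2\<close>, \<open>1 / k3\<close> is \<open>1 / sqrt S\<close>, so
\<open>half_angle k1 S\<close> is half of the angle at the first centre.\<close>
definition half_angle :: "real \<Rightarrow> real \<Rightarrow> real" where
  "half_angle k S = pi / 2 - arctan (sqrt S / k)"

lemma hden_pos: assumes "k > 0" shows "(sin t)\<^sup>2 + k\<^sup>2 * (cos t)\<^sup>2 > (0::real)"
proof (cases "cos t = 0")
  case True
  then have "(sin t)\<^sup>2 = 1" using sin_cos_squared_add[of t] by simp
  then show ?thesis using True by simp
next
  case False
  then show ?thesis using assms by (simp add: add_nonneg_pos)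
qed

lemma hfun_continuous: assumes "k > 0" shows "continuous_on A (hfun k)"
  unfolding hfun_def by (intro continuous_intros) (use hden_pos[OF assms] in \<open>auto simp: less_imp_neq[symmetric]\<close>)

lemma half_angle_bounds:
  assumes "k > 0" "S \<ge> 0" shows "0 < half_angle k S" "half_angle k S \<le> pi / 2"
  using assms arctan_ubound[of "sqrt S / k"] by (auto simp: half_angle_def zero_le_arctan_iff)

lemma half_angle_antimono: "k > 0 \<Longrightarrow> S \<le> S' \<Longrightarrow> half_angle k S' \<le> half_angle k S"
  by (simp add: half_angle_def arctan_le_iff divide_right_mono)

text \<open>Similar Euclidean triangles have the same angles.\<close>
lemma half_angle_scale: "k > 0 \<Longrightarrow> c > 0 \<Longrightarrow> half_angle (c * k) (c\<^sup>2 * S) = half_angle k S"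
  by (simp add: half_angle_def real_sqrt_mult)

lemma cos_nonneg_quarter: "0 \<le> t \<Longrightarrow> t \<le> pi / 2 \<Longrightarrow> cos t \<ge> 0"
  by (rule cos_ge_zero) auto

lemma sin_nonneg_quarter: "0 \<le> t \<Longrightarrow> t \<le> pi / 2 \<Longrightarrow> sin t \<ge> 0"
  by (rule sin_ge_zero) auto

lemma hfun_nonneg: "k > 0 \<Longrightarrow> 0 \<le> t \<Longrightarrow> t \<le> pi / 2 \<Longrightarrow> hfun k t \<ge> 0"
  by (simp add: hfun_def cos_nonneg_quarter)

lemma hfun_le_1:
  assumes "k > 0" "0 \<le> t" "t \<le> pi / 2" shows "hfun k t \<le> 1"
proof -
  have "k * cos t = sqrt ((k * cos t)\<^sup>2)" using assms cos_nonneg_quarter[of t] by simp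
  also have "\<dots> \<le> sqrt ((sin t)\<^sup>2 + k\<^sup>2 * (cos t)\<^sup>2)" by (simp add: power_mult_distrib)
  finally show ?thesis unfolding hfun_def using hden_pos[OF assms(1), of t] by (simp add: divide_le_eq)
qed

lemma hfun_less:
  assumes "0 < k" "k < k'" "0 < t" "t < pi / 2" shows "hfun k t < hfun k' t"
proof -
  have s: "sin t > 0" and c: "cos t > 0" using assms by (auto intro: sin_gt_zero cos_gt_zero)
  have "hfun j t = cos t / sqrt ((sin t / j)\<^sup>2 + (cos t)\<^sup>2)" if "j > 0" for j
  proof -
    have "sqrt ((sin t)\<^sup>2 + j\<^sup>2 * (cos t)\<^sup>2) = sqrt (j\<^sup>2 * ((sin t / j)\<^sup>2 + (cos t)\<^sup>2))"
      using that by (simp add: field_simps)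
    also have "\<dots> = j * sqrt ((sin t / j)\<^sup>2 + (cos t)\<^sup>2)" using that by (simp add: real_sqrt_mult)
    finally show ?thesis using that by (simp add: hfun_def)
  qed
  note h = this
  have "sin t / k' < sin t / k" using assms s by (simp add: divide_strict_left_mono)
  moreover have "sin t / k' > 0" using assms s by simp
  ultimately have "(sin t / k')\<^sup>2 < (sin t / k)\<^sup>2" by (intro power_strict_mono) auto
  then have "sqrt ((sin t / k')\<^sup>2 + (cos t)\<^sup>2) < sqrt ((sin t / k)\<^sup>2 + (cos t)\<^sup>2)" by simp
  moreover have "sqrt ((sin t / k')\<^sup>2 + (cos t)\<^sup>2) > 0" using c by (simp add: add_nonneg_pos)
  ultimately show ?thesis using h assms c by (simp add: divide_strict_left_mono)
qed

text \<open>The substitution is \<open>q = sin t / sqrt ((sin t)\<^sup>2 + k\<^sup>2 * (cos t)\<^sup>2)\<close>, for which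
\<open>1 - (1 - k\<^sup>2) * q\<^sup>2 = k\<^sup>2 / ((sin t)\<^sup>2 + k\<^sup>2 * (cos t)\<^sup>2)\<close>.\<close>
lemma arcK_half_angle:
  assumes k: "k > 0" and S: "S \<ge> 0"
  shows "arcK k S = 2 * integral {0..half_angle k S} (hfun k)"
proof -
  define D where "D t = (sin t)\<^sup>2 + k\<^sup>2 * (cos t)\<^sup>2" for t
  define g where "g t = sin t / sqrt (D t)" for t
  define g' where "g' t = k\<^sup>2 * cos t / (D t * sqrt (D t))" for t
  define Q where "Q = 1 / sqrt (1 + S)"
  define b where "b = half_angle k S"
  have D: "D t > 0" for t unfolding D_def using hden_pos[OF k] .
  have b: "0 < b" "b \<le> pi / 2" unfolding b_def using half_angle_bounds[OF k S] by auto
  have gd: "(g has_real_derivative g' t) (at t within A)" for t A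
  proof -
    have Dd: "(D has_real_derivative 2 * (1 - k\<^sup>2) * sin t * cos t) (at t within A)"
      unfolding D_def by (auto intro!: derivative_eq_intros simp: algebra_simps)
    have "(g has_real_derivative (cos t * sqrt (D t) - sin t * (2 * (1 - k\<^sup>2) * sin t * cos t * (inverse (sqrt (D t)) / 2))) / (sqrt (D t) * sqrt (D t))) (at t within A)"
      unfolding g_def using D[of t]
      by (auto intro!: derivative_eq_intros Dd)
    moreover have "(cos t * sqrt (D t) - sin t * (2 * (1 - k\<^sup>2) * sin t * cos t * (inverse (sqrt (D t)) / 2))) / (sqrt (D t) * sqrt (D t)) = g' t"
    proof -
      have r: "sqrt (D t) > 0" "sqrt (D t) * sqrt (D t) = D t" using D[of t] by auto
      have "cos t * sqrt (D t) - sin t * (2 * (1 - k\<^sup>2) * sin t * cos t * (inverse (sqrt (D t)) / 2))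
        = cos t * (D t - (1 - k\<^sup>2) * (sin t)\<^sup>2) / sqrt (D t)"
        using r by (simp add: field_simps power2_eq_square)
      also have "D t - (1 - k\<^sup>2) * (sin t)\<^sup>2 = k\<^sup>2"
        using sin_cos_squared_add[of t] by (simp add: D_def algebra_simps) (simp add: distrib_left[symmetric])
      finally show ?thesis using r by (simp add: g'_def mult.commute)
    qed
    ultimately show ?thesis by simp
  qed
  have g0: "g 0 = 0" by (simp add: g_def)
  have gb: "g b = Q"
  proof -
    define x where "x = sqrt S / k"
    have x: "x \<ge> 0" "k\<^sup>2 * x\<^sup>2 = S" using k S by (auto simp: x_def power_divide)
    have s: "sin b = 1 / sqrt (1 + x\<^sup>2)" "cos b = x / sqrt (1 + x\<^sup>2)"
      by (simp_all add: b_def half_angle_def x_def[symmetric] sin_diff cos_diff sin_arctan cos_arctan)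
    have p: "1 + x\<^sup>2 > 0" by (simp add: add_pos_nonneg)
    have "D b = (1 + S) / (1 + x\<^sup>2)" unfolding D_def s using p x(2)
      by (simp add: power_divide add_divide_distrib)
    then show ?thesis unfolding g_def s(1) Q_def using p by (simp add: real_sqrt_divide)
  qed
  have g'0: "g' t \<ge> 0" if "t \<in> {0..b}" for t
    unfolding g'_def using that b D[of t] cos_nonneg_quarter[of t] by (auto intro!: divide_nonneg_pos)
  have mono: "g s \<le> g t" if "0 \<le> s" "s \<le> t" "t \<le> b" for s t
  proof (rule DERIV_nonneg_imp_nondecreasing[OF that(2)])
    fix x assume "s \<le> x" "x \<le> t"
    then have "g' x \<ge> 0" using that by (intro g'0) auto
    then show "\<exists>y. DERIV g x :> y \<and> y \<ge> 0" using gd[of x UNIV] by blast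
  qed
  have sub: "g ` {0..b} \<subseteq> {0..Q}"
  proof
    fix y assume "y \<in> g ` {0..b}"
    then obtain t where t: "0 \<le> t" "t \<le> b" "y = g t" by auto
    have "g 0 \<le> g t" "g t \<le> g b" using t by (auto intro!: mono)
    then show "y \<in> {0..Q}" using t g0 gb by simp
  qed
  have e: "1 - (1 - k\<^sup>2) * q\<^sup>2 > 0" if "q \<in> {0..Q}" for q
  proof (cases "1 - k\<^sup>2 \<le> 0")
    case True
    then have "(1 - k\<^sup>2) * q\<^sup>2 \<le> 0" by (simp add: mult_nonpos_nonneg)
    then show ?thesis by linarith
  next
    case False
    have "Q \<le> 1" using S by (simp add: Q_def)
    then have "q\<^sup>2 \<le> 1" using that by (simp add: power_le_one)
    then have "(1 - k\<^sup>2) * q\<^sup>2 \<le> (1 - k\<^sup>2) * 1" using False by (intro mult_left_mono) auto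
    also have "\<dots> < 1" using k by simp
    finally show ?thesis by simp
  qed
  have "((\<lambda>t. g' t *\<^sub>R (2 / (1 - (1 - k\<^sup>2) * (g t)\<^sup>2))) has_integral
      (integral {g 0..g b} (\<lambda>q. 2 / (1 - (1 - k\<^sup>2) * q\<^sup>2)))) {0..b}"
  proof (rule has_integral_substitution[OF _ _ sub])
    show "continuous_on {0..Q} (\<lambda>q. 2 / (1 - (1 - k\<^sup>2) * q\<^sup>2))"
      by (intro continuous_intros) (use e in fastforce)
  qed (use b g0 gb S gd in \<open>auto simp: Q_def\<close>)
  moreover have "g' t *\<^sub>R (2 / (1 - (1 - k\<^sup>2) * (g t)\<^sup>2)) = (2 / k) * hfun k t" for t
  proof -
    have r: "sqrt (D t) > 0" "sqrt (D t) * sqrt (D t) = D t" using D[of t] by auto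
    have "1 - (1 - k\<^sup>2) * (g t)\<^sup>2 = (D t - (1 - k\<^sup>2) * (sin t)\<^sup>2) / D t"
      using D[of t] by (simp add: g_def power_divide diff_divide_distrib)
    also have "D t - (1 - k\<^sup>2) * (sin t)\<^sup>2 = k\<^sup>2"
      using sin_cos_squared_add[of t] by (simp add: D_def algebra_simps) (simp add: distrib_left[symmetric])
    finally have e2: "1 - (1 - k\<^sup>2) * (g t)\<^sup>2 = k\<^sup>2 / D t" .
    have "hfun k t = k * cos t / sqrt (D t)" by (simp add: hfun_def D_def)
    then show ?thesis unfolding e2 g'_def using k r D[of t] by (simp add: power2_eq_square)
  qed
  ultimately have "((\<lambda>t. (2 / k) * hfun k t) has_integral
      (integral {0..Q} (\<lambda>q. 2 / (1 - (1 - k\<^sup>2) * q\<^sup>2)))) {0..b}"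
    unfolding g0 gb by (simp only:)
  then have "integral {0..Q} (\<lambda>q. 2 / (1 - (1 - k\<^sup>2) * q\<^sup>2)) = integral {0..b} (\<lambda>t. (2 / k) * hfun k t)"
    by (rule integral_unique[symmetric])
  then show ?thesis unfolding arcK_def Q_def[symmetric] b_def[symmetric] using k by simp
qed

lemma hfun_integrable: "k > 0 \<Longrightarrow> hfun k integrable_on {a..b}"
  by (intro integrable_continuous_real hfun_continuous)

lemma arcK_zero: "arcK 0 S = 0" by (simp add: arcK_def)

text \<open>In the angular form only the range of integration depends on \<open>S\<close>.\<close>
lemma arcK_antimono:
  assumes "k \<ge> 0" "0 \<le> S" "S \<le> S'" shows "arcK k S' \<le> arcK k S"
proof (cases "k = 0")
  case False
  then have k: "k > 0" using assms by simp
  have "integral {0..half_angle k S'} (hfun k) \<le> integral {0..half_angle k S} (hfun k)"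
  proof (rule integral_subset_le)
    show "{0..half_angle k S'} \<subseteq> {0..half_angle k S}" using half_angle_antimono[OF k assms(3)] by auto
    show "\<forall>x\<in>{0..half_angle k S}. 0 \<le> hfun k x"
      using half_angle_bounds[OF k assms(2)] by (auto intro!: hfun_nonneg[OF k])
  qed (use hfun_integrable[OF k] in auto)
  then show ?thesis using assms k by (simp add: arcK_half_angle)
qed (simp add: arcK_zero)

text \<open>Scaling leaves the range of integration unchanged and increases the integrand.\<close>
lemma arcK_scale_less:
  assumes "k > 0" "S \<ge> 0" "c > 1" shows "arcK k S < arcK (c * k) (c\<^sup>2 * S)"
proof -
  define b where "b = half_angle k S"
  have b: "0 < b" "b \<le> pi / 2" unfolding b_def using half_angle_bounds assms by auto
  have "integral {0..b} (hfun k) < integral {0..b} (hfun (c * k))"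
  proof (rule integral_less_real)
    show "{0<..<b} \<noteq> {}" using b by simp
    show "hfun k x < hfun (c * k) x" if "x \<in> {0<..<b}" for x
      using that b assms by (intro hfun_less) auto
  qed (use assms in \<open>auto intro!: hfun_continuous\<close>)
  then show ?thesis using assms half_angle_scale[of k c S] by (simp add: arcK_half_angle b_def)
qed

lemma arcK_pos:
  assumes "k > 0" "S \<ge> 0" shows "arcK k S > 0"
proof -
  have b: "0 < half_angle k S" "half_angle k S \<le> pi / 2" using half_angle_bounds assms by auto
  have "integral {0..half_angle k S} (\<lambda>x. 0) < integral {0..half_angle k S} (hfun k)"
  proof (rule integral_less_real)
    show "{0<..<half_angle k S} \<noteq> {}" using b by simp
    show "0 < hfun k x" if "x \<in> {0<..<half_angle k S}" for x
    proof -
      have "cos x > 0" using that b by (intro cos_gt_zero) auto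
      then show ?thesis unfolding hfun_def using assms hden_pos[OF assms(1), of x] by simp
    qed
  qed (use assms in \<open>auto intro!: hfun_continuous\<close>)
  then show ?thesis using assms by (simp add: arcK_half_angle)
qed

lemma hfun_upper:
  assumes "k > 0" "0 < \<eta>" "\<eta> \<le> t" "t \<le> pi / 2" shows "hfun k t \<le> k / sin \<eta>"
proof -
  have s: "sin \<eta> > 0" using assms by (intro sin_gt_zero) auto
  have st: "sin \<eta> \<le> sin t" using assms by (intro sin_monotone_2pi_le) auto
  have "sin t = sqrt ((sin t)\<^sup>2)" using st s by simp
  also have "\<dots> \<le> sqrt ((sin t)\<^sup>2 + k\<^sup>2 * (cos t)\<^sup>2)" by (intro real_sqrt_le_mono) simp
  finally have le: "sin \<eta> \<le> sqrt ((sin t)\<^sup>2 + k\<^sup>2 * (cos t)\<^sup>2)" using st by simp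
  have "hfun k t \<le> k * 1 / sqrt ((sin t)\<^sup>2 + k\<^sup>2 * (cos t)\<^sup>2)" unfolding hfun_def
    using assms hden_pos[OF assms(1), of t] by (intro divide_right_mono mult_left_mono) auto
  also have "\<dots> \<le> k * 1 / sin \<eta>"
  proof (rule divide_left_mono[OF le])
    have "sqrt ((sin t)\<^sup>2 + k\<^sup>2 * (cos t)\<^sup>2) > 0" using le s by linarith
    then show "0 < sqrt ((sin t)\<^sup>2 + k\<^sup>2 * (cos t)\<^sup>2) * sin \<eta>" using s by simp
  qed (use assms in simp)
  also have "k * 1 / sin \<eta> = k / sin \<eta>" by simp
  finally show ?thesis .
qed

text \<open>An explicit form of the convergence to \<open>0\<close> as \<open>k\<close> tends to \<open>0\<close>, uniformly in \<open>S\<close>: the integrand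
is at most \<open>1\<close> below \<open>\<eta>\<close> and at most \<open>k / sin \<eta>\<close> above.\<close>
lemma arcK_upper:
  assumes k: "k > 0" and S: "S \<ge> 0" and e: "0 < \<eta>" "\<eta> < pi / 2"
  shows "arcK k S \<le> 2 * \<eta> + pi * k / sin \<eta>"
proof -
  have s: "sin \<eta> > 0" using e by (intro sin_gt_zero) auto
  have "integral {0..half_angle k S} (hfun k) \<le> integral {0..pi / 2} (hfun k)"
    by (rule integral_subset_le) (use half_angle_bounds[OF k S] hfun_integrable[OF k] hfun_nonneg[OF k] in auto)
  also have "\<dots> = integral {0..\<eta>} (hfun k) + integral {\<eta>..pi / 2} (hfun k)"
    using Henstock_Kurzweil_Integration.integral_combine[where a = 0 and c = \<eta> and b = "pi / 2" and f = "hfun k"] e hfun_integrable[OF k] by simp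
  also have "integral {0..\<eta>} (hfun k) \<le> integral {0..\<eta>} (\<lambda>x. 1)"
    by (rule integral_le) (use hfun_integrable[OF k] hfun_le_1[OF k] e in auto)
  also have "integral {\<eta>..pi / 2} (hfun k) \<le> integral {\<eta>..pi / 2} (\<lambda>x. k / sin \<eta>)"
    by (rule integral_le) (use hfun_integrable[OF k] hfun_upper[OF k e(1)] in auto)
  also have "integral {0..\<eta>} (\<lambda>x. 1::real) + integral {\<eta>..pi / 2} (\<lambda>x. k / sin \<eta>) = \<eta> + (pi / 2 - \<eta>) * (k / sin \<eta>)"
    using e by simp
  also have "\<dots> \<le> \<eta> + (pi / 2) * (k / sin \<eta>)"
    using e k s by (intro add_left_mono mult_right_mono) auto
  finally show ?thesis using k S by (simp add: arcK_half_angle)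
qed

lemma hfun_lower:
  assumes k: "k > 0" and e: "0 < \<eta>" and t: "0 \<le> t" "t \<le> pi / 2 - \<eta>" shows "hfun k t \<ge> 1 - 1 / (k * sin \<eta>)"
proof -
  have s: "sin \<eta> > 0" using e t by (intro sin_gt_zero) auto
  have "sin \<eta> = cos (pi / 2 - \<eta>)" by (simp add: cos_diff)
  also have "\<dots> \<le> cos t" using t e by (intro cos_monotone_0_pi_le) auto
  finally have c: "sin \<eta> \<le> cos t" .
  then have c0: "cos t > 0" using s by simp
  have st: "sin t \<ge> 0" "sin t \<le> 1" using t e by (auto intro: sin_nonneg_quarter)
  define r where "r = sqrt ((sin t)\<^sup>2 + k\<^sup>2 * (cos t)\<^sup>2)"
  have r: "r > 0" using hden_pos[OF k] by (simp add: r_def)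
  have "r \<le> sin t + k * cos t"
    unfolding r_def using st c0 k by (intro real_le_lsqrt) (auto simp: power2_eq_square algebra_simps)
  then have "r - k * cos t \<le> 1" using st by linarith
  have "k * cos t \<le> r" unfolding r_def using k c0
    by (intro real_le_rsqrt) (simp add: power_mult_distrib)
  have "1 - hfun k t = (r - k * cos t) / r" using r by (simp add: hfun_def r_def[symmetric] diff_divide_distrib)
  also have "\<dots> \<le> 1 / r" using \<open>r - k * cos t \<le> 1\<close> r by (intro divide_right_mono) auto
  also have "\<dots> \<le> 1 / (k * cos t)" using \<open>k * cos t \<le> r\<close> k c0 r by (intro divide_left_mono) auto
  also have "\<dots> \<le> 1 / (k * sin \<eta>)" using c k s by (intro divide_left_mono) auto
  finally show ?thesis by simp
qed

text \<open>An explicit form of the convergence to twice the half angle as \<open>k\<close> tends to infinity, uniformly in \<open>S\<close>. The integrand is close to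
\<open>1\<close> except near \<open>pi / 2\<close>, where a piece of length \<open>\<eta>\<close> is given away.\<close>
lemma arcK_lower:
  assumes k: "k > 0" and S: "S \<ge> 0" and e: "0 < \<eta>" "\<eta> < pi / 2"
  shows "arcK k S \<ge> 2 * half_angle k S - 2 * \<eta> - pi / (k * sin \<eta>)"
proof -
  define b where "b = half_angle k S"
  define \<delta> where "\<delta> = 1 / (k * sin \<eta>)"
  define m where "m = min b (pi / 2 - \<eta>)"
  have s: "sin \<eta> > 0" using e by (intro sin_gt_zero) auto
  have \<delta>: "\<delta> \<ge> 0" using k s by (simp add: \<delta>_def)
  have b: "0 < b" "b \<le> pi / 2" unfolding b_def using half_angle_bounds[OF k S] by auto
  have m: "0 \<le> m" "m \<le> b" "m \<le> pi / 2 - \<eta>" "m \<ge> b - \<eta>" using b e by (auto simp: m_def)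
  have m2: "m \<le> pi / 2" using m(2) b(2) by linarith
  have "m * \<delta> \<le> pi / 2 * \<delta>" using m2 \<delta> by (intro mult_right_mono) auto
  then have "b - \<eta> - pi / 2 * \<delta> \<le> m * (1 - \<delta>)" using m by (simp add: algebra_simps)
  also have "\<dots> = integral {0..m} (\<lambda>x. 1 - \<delta>)" using m by simp
  also have "\<dots> \<le> integral {0..m} (hfun k)"
    by (rule integral_le) (use hfun_integrable[OF k] hfun_lower[OF k e(1)] m in \<open>auto simp: \<delta>_def\<close>)
  also have "\<dots> \<le> integral {0..b} (hfun k)"
    by (rule integral_subset_le) (use hfun_integrable[OF k] hfun_nonneg[OF k] m b in auto)
  finally have "b - \<eta> - pi / 2 * \<delta> \<le> integral {0..b} (hfun k)" .
  moreover have "pi / (k * sin \<eta>) = pi * \<delta>" by (simp add: \<delta>_def)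
  ultimately show ?thesis unfolding arcK_half_angle[OF k S] b_def[symmetric] by linarith
qed

text \<open>Scaling the variable by \<open>sqrt (1 + S)\<close> makes the range of integration independent of \<open>S\<close>.\<close>
lemma arcK_continuous: "continuous_on ({0<..} \<times> {0..}) (\<lambda>(k, S). arcK k S)"
proof -
  define f where "f p u = 2 * fst p / (sqrt (1 + snd p) * (1 - (1 - (fst p)\<^sup>2) * (u / sqrt (1 + snd p))\<^sup>2))" for p :: "real \<times> real" and u :: real
  have den: "1 - (1 - k\<^sup>2) * (u / sqrt (1 + S))\<^sup>2 > 0" if k: "k > 0" and S: "S \<ge> 0" and u: "0 \<le> u" "u \<le> 1" for k S u :: real
  proof -
    have "(u / sqrt (1 + S))\<^sup>2 = u\<^sup>2 / (1 + S)" using S by (simp add: power_divide)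
    also have "\<dots> \<le> 1" using S u power_le_one[OF u, of 2] by (simp add: divide_le_eq)
    finally have q: "(u / sqrt (1 + S))\<^sup>2 \<le> 1" .
    have k2: "k\<^sup>2 > 0" using k by simp
    show ?thesis
    proof (cases "1 - k\<^sup>2 \<le> 0")
      case True
      then have "(1 - k\<^sup>2) * (u / sqrt (1 + S))\<^sup>2 \<le> 0" by (simp add: mult_nonpos_nonneg)
      then show ?thesis by linarith
    next
      case False
      then have "(1 - k\<^sup>2) * (u / sqrt (1 + S))\<^sup>2 \<le> (1 - k\<^sup>2) * 1" using q by (intro mult_left_mono) auto
      also have "\<dots> < 1" using k2 by simp
      finally show ?thesis by simp
    qed
  qed
  have eq: "arcK k S = integral (cbox 0 1) (f (k, S))" if "k > 0" "S \<ge> 0" for k S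
  proof -
    define Q where "Q = sqrt (1 + S)"
    have Q: "Q > 0" using that by (simp add: Q_def)
    have c: "continuous_on {0..1 / Q} (\<lambda>q. 2 / (1 - (1 - k\<^sup>2) * q\<^sup>2))"
    proof (intro continuous_intros ballI)
      fix q assume q: "q \<in> {0..1 / Q}"
      then have "0 \<le> q * Q" "q * Q \<le> 1" using Q by (auto simp: field_simps)
      from den[OF that this] show "1 - (1 - k\<^sup>2) * q\<^sup>2 \<noteq> 0" using Q by (simp add: Q_def[symmetric])
    qed
    have "((\<lambda>u. (1 / Q) *\<^sub>R (2 / (1 - (1 - k\<^sup>2) * (u / Q)\<^sup>2))) has_integral
       integral {0 / Q..1 / Q} (\<lambda>q. 2 / (1 - (1 - k\<^sup>2) * q\<^sup>2))) {0..1}"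
      by (rule has_integral_substitution[of 0 1 "\<lambda>u. u / Q" 0 "1 / Q"])
         (use Q c in \<open>auto intro!: derivative_eq_intros divide_right_mono\<close>)
    then have "integral {0..1 / Q} (\<lambda>q. 2 / (1 - (1 - k\<^sup>2) * q\<^sup>2)) = integral {0..1} (\<lambda>u. (1 / Q) *\<^sub>R (2 / (1 - (1 - k\<^sup>2) * (u / Q)\<^sup>2)))"
      by (simp add: integral_unique)
    then have "arcK k S = k * integral {0..1} (\<lambda>u. (1 / Q) *\<^sub>R (2 / (1 - (1 - k\<^sup>2) * (u / Q)\<^sup>2)))"
      by (simp add: arcK_def Q_def)
    also have "\<dots> = integral {0..1} (\<lambda>u. k * ((1 / Q) *\<^sub>R (2 / (1 - (1 - k\<^sup>2) * (u / Q)\<^sup>2))))" by (simp only: integral_mult_right)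
    also have "(\<lambda>u. k * ((1 / Q) *\<^sub>R (2 / (1 - (1 - k\<^sup>2) * (u / Q)\<^sup>2)))) = f (k, S)"
      by (auto simp: f_def Q_def)
    finally show ?thesis by simp
  qed
  have "continuous_on (({0<..} \<times> {0..}) \<times> cbox 0 1) (\<lambda>(p, u). f p u)"
    unfolding f_def case_prod_unfold
  proof (intro continuous_intros ballI)
    fix x assume x: "x \<in> (({0<..} :: real set) \<times> ({0..} :: real set)) \<times> cbox (0::real) 1"
    then have a: "fst (fst x) > 0" "snd (fst x) \<ge> 0" "0 \<le> snd x" "snd x \<le> 1" by auto
    then show "sqrt (1 + snd (fst x)) \<noteq> 0" by auto
    then show "sqrt (1 + snd (fst x)) * (1 - (1 - (fst (fst x))\<^sup>2) * (snd x / sqrt (1 + snd (fst x)))\<^sup>2) \<noteq> 0"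
      using den[OF a] by simp
  qed
  then have "continuous_on ({0<..} \<times> {0..}) (\<lambda>p. integral (cbox 0 1) (f p))"
    by (rule integral_continuous_on_param)
  then show ?thesis by (rule continuous_on_eq) (use eq in auto)
qed

section \<open>Triangles with large curvatures\<close>

lemma half_angle_arctan: "k > 0 \<Longrightarrow> S > 0 \<Longrightarrow> half_angle k S = arctan (k / sqrt S)"
  using arctan_inverse[of "sqrt S / k"] by (simp add: half_angle_def)

lemma frac_cancel: "p > 0 \<Longrightarrow> q > 0 \<Longrightarrow> r > 0 \<Longrightarrow> t > 0 \<Longrightarrow> p / q / (r * p / t) = t / q / (r::real)"
  by (simp add: field_simps)

text \<open>The half angles of a Euclidean triangle add up to a right angle. The third one is written with \<open>arctan\<close>, because
\<open>half_angle 0 S\<close> is not the angle \<open>0\<close> that belongs to a straight line.\<close>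
lemma half_angle_sum:
  assumes "a > 0" "b > 0" "c \<ge> 0"
  defines "S \<equiv> a * b + b * c + c * a"
  shows "half_angle a S + half_angle b S + arctan (c / sqrt S) = pi / 2"
proof -
  have S: "S > 0" using assms by (simp add: add_pos_nonneg)
  have ss: "sqrt S * sqrt S = S" "sqrt S > 0" using S by auto
  define x where "x = a / sqrt S"
  define y where "y = b / sqrt S"
  have xy: "x * y = a * b / S" "x > 0" using assms ss by (auto simp: x_def y_def)
  have "arctan x + arctan y + arctan (c / sqrt S) = pi / 2"
  proof (cases "c = 0")
    case True
    then have "y = inverse x" using xy assms S by (simp add: field_simps S_def)
    then show ?thesis using arctan_inverse[OF xy(2)] True by simp
  next
    case False
    then have c: "c > 0" using assms by simp
    have lt: "a * b < S" using assms c by (simp add: S_def add_pos_pos)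
    then have "\<bar>x * y\<bar> < 1" using assms S by (simp add: xy)
    then have "arctan x + arctan y = arctan ((x + y) / (1 - x * y))" by (rule arctan_add_small)
    also have "(x + y) / (1 - x * y) = inverse (c / sqrt S)"
    proof -
      have "x + y = (a + b) / sqrt S" by (simp add: x_def y_def add_divide_distrib)
      moreover have "1 - x * y = c * (a + b) / S"
        using S by (simp add: xy(1) field_simps) (simp add: S_def algebra_simps)
      moreover have "((a + b) / sqrt S) / (c * (a + b) / S) = sqrt S / c"
      proof -
        have ab: "a + b > 0" using assms(1,2) by simp
        have "((a + b) / sqrt S) / (c * (a + b) / S) = (S / sqrt S) / c" using ab c S
          frac_cancel[of "a + b" "sqrt S" c S] by simp
        then show ?thesis using S by (simp add: real_div_sqrt)
      qed
      ultimately show ?thesis by simp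
    qed
    also have "arctan (inverse (c / sqrt S)) = pi / 2 - arctan (c / sqrt S)"
      using c ss by (intro arctan_inverse) simp
    finally show ?thesis by simp
  qed
  then show ?thesis using half_angle_arctan[of a S] half_angle_arctan[of b S] assms(1,2) S by (simp add: x_def y_def)
qed

text \<open>Arcs of large curvature have almost the total curvature given by the Euclidean angles, by \<open>arcK_lower\<close>, and these
angles add up to almost \<open>pi\<close>, since an angle whose own curvature stays bounded while another one of the triangle is large tends to \<open>0\<close> (two large
curvatures), or since the angle of the only large curvature is close to \<open>pi\<close>.\<close>
lemma large_curvatures:
  assumes e: "\<epsilon> > 0" and B: "B \<ge> 0"
  obtains M where "M > B"
    "\<And>a b c. a \<ge> M \<Longrightarrow> 0 \<le> b \<Longrightarrow> b \<le> B \<Longrightarrow> 0 \<le> c \<Longrightarrow> c \<le> B \<Longrightarrow> arcK a (a * b + b * c + c * a) \<ge> pi - \<epsilon>"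
    "\<And>a b c. a \<ge> M \<Longrightarrow> b \<ge> M \<Longrightarrow> 0 \<le> c \<Longrightarrow> c \<le> B \<Longrightarrow>
       arcK a (a * b + b * c + c * a) + arcK b (a * b + b * c + c * a) \<ge> pi - \<epsilon>"
    "\<And>a b c. a \<ge> M \<Longrightarrow> b \<ge> M \<Longrightarrow> c \<ge> M \<Longrightarrow>
       arcK a (a * b + b * c + c * a) + arcK b (a * b + b * c + c * a) + arcK c (a * b + b * c + c * a) \<ge> pi - \<epsilon>"
proof -
  define \<eta> where "\<eta> = min (\<epsilon> / 12) 1"
  have \<eta>: "0 < \<eta>" "\<eta> < pi / 2" "\<eta> \<le> \<epsilon> / 12" using e pi_gt3 by (auto simp: \<eta>_def)
  have s: "sin \<eta> > 0" using \<eta> by (intro sin_gt_zero) auto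
  \<comment> \<open>The last three summands serve, in this order, the comparison with angles (\<open>low\<close>), two large curvatures, and one large curvature.\<close>
  define M where "M = 1 + B + 6 * pi / (\<epsilon> * sin \<eta>) + 6 * B / \<epsilon> + 64 * B / \<epsilon>\<^sup>2"
  have M0: "6 * pi / (\<epsilon> * sin \<eta>) \<ge> 0" "6 * B / \<epsilon> \<ge> 0" "64 * B / \<epsilon>\<^sup>2 \<ge> 0" using e B s by auto
  have M: "M > B" "M \<ge> 1" "M \<ge> 6 * pi / (\<epsilon> * sin \<eta>)" "M \<ge> 6 * B / \<epsilon>" "M \<ge> 64 * B / \<epsilon>\<^sup>2"
    using M0 B unfolding M_def by linarith+
  have low: "arcK k S \<ge> 2 * half_angle k S - \<epsilon> / 3" if k: "k \<ge> M" and S: "S \<ge> 0" for k S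
  proof -
    have kp: "k > 0" using k M by linarith
    have "6 * pi / (\<epsilon> * sin \<eta>) \<le> k" using k M by linarith
    then have "pi / (k * sin \<eta>) \<le> \<epsilon> / 6" using e s kp by (simp add: field_simps)
    then show ?thesis using arcK_lower[OF kp S \<eta>(1,2)] \<eta>(3) by linarith
  qed
  have S0: "a * b + b * c + c * a \<ge> 0" if "0 \<le> a" "0 \<le> b" "0 \<le> c" for a b c :: real using that by simp
  show thesis
  proof (rule that[OF M(1)])
    fix a b c assume a: "a \<ge> M" and b: "0 \<le> b" "b \<le> B" and c: "0 \<le> c" "c \<le> B"
    define S where "S = a * b + b * c + c * a"
    have ap: "a > 0" "a \<ge> B" using a M by linarith+
    have S: "S \<ge> 0" using S0[of a b c] ap b c by (simp add: S_def)
    have "S \<le> a * B + a * B + B * a"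
      unfolding S_def using ap b c by (intro add_mono mult_mono) auto
    then have "S / a\<^sup>2 \<le> 3 * B / a" using ap by (simp add: field_simps power2_eq_square)
    also have "\<dots> \<le> 4 * B / M"
      using a B M by (intro frac_le) auto
    also have "\<dots> \<le> (\<epsilon> / 4)\<^sup>2"
    proof -
      have "64 * B / \<epsilon>\<^sup>2 \<le> M" using M by simp
      then show ?thesis using e M(2) by (simp add: field_simps power2_eq_square)
    qed
    finally have "sqrt (S / a\<^sup>2) \<le> \<epsilon> / 4" using e by (intro real_le_lsqrt) (use S in auto)
    then have "sqrt S / a \<le> \<epsilon> / 4" using ap by (simp add: real_sqrt_divide)
    moreover have "arctan (sqrt S / a) \<le> sqrt S / a" using S ap by (intro arctan_le_self) simp
    ultimately have "arctan (sqrt S / a) \<le> \<epsilon> / 4" by linarith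
    then have "2 * half_angle a S \<ge> pi - \<epsilon> / 2" by (simp add: half_angle_def)
    then show "arcK a (a * b + b * c + c * a) \<ge> pi - \<epsilon>" using low[OF a S] e unfolding S_def by linarith
  next
    fix a b c assume a: "a \<ge> M" and b: "b \<ge> M" and c: "0 \<le> c" "c \<le> B"
    define S where "S = a * b + b * c + c * a"
    have ap: "a > 0" "b > 0" using a b M by linarith+
    have S: "S \<ge> 0" using S0[of a b c] ap c by (simp add: S_def)
    have "M * M \<le> a * b" using a b M by (intro mult_mono) auto
    also have "\<dots> \<le> S" using ap c by (simp add: S_def)
    finally have "M \<le> sqrt S" by (intro real_le_rsqrt) (simp add: power2_eq_square)
    then have "c / sqrt S \<le> B / M" using c M B by (intro frac_le) auto
    also have "B / M \<le> \<epsilon> / 6" using M e by (simp add: field_simps)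
    finally have "c / sqrt S \<le> \<epsilon> / 6" .
    moreover have "arctan (c / sqrt S) \<le> c / sqrt S" using S c by (intro arctan_le_self) simp
    ultimately have "arctan (c / sqrt S) \<le> \<epsilon> / 6" by linarith
    then show "arcK a (a * b + b * c + c * a) + arcK b (a * b + b * c + c * a) \<ge> pi - \<epsilon>"
      using low[OF a S] low[OF b S] half_angle_sum[OF ap c(1), folded S_def] e unfolding S_def[symmetric] by linarith
  next
    fix a b c assume a: "a \<ge> M" and b: "b \<ge> M" and c: "c \<ge> M"
    define S where "S = a * b + b * c + c * a"
    have ap: "a > 0" "b > 0" "c > 0" using a b c M by linarith+
    have S: "S > 0" using ap by (simp add: S_def add_pos_pos)
    have "half_angle a S + half_angle b S + half_angle c S = pi / 2"
      using half_angle_sum[OF ap(1,2) less_imp_le[OF ap(3)], folded S_def] half_angle_arctan[OF ap(3) S] by simp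
    then show "arcK a (a * b + b * c + c * a) + arcK b (a * b + b * c + c * a) + arcK c (a * b + b * c + c * a) \<ge> pi - \<epsilon>"
      using low[OF a less_imp_le[OF S]] low[OF b less_imp_le[OF S]] low[OF c less_imp_le[OF S]] unfolding S_def[symmetric] by linarith
  qed
qed

section \<open>Total curvature at the vertices\<close>

fun face_S :: "('s \<Rightarrow> real) \<Rightarrow> 's face \<Rightarrow> real" where
  "face_S k (u, v, w) = k u * k v + k v * k w + k w * k u"

definition total_curv :: "'s face set \<Rightarrow> ('s \<Rightarrow> real) \<Rightarrow> 's \<Rightarrow> real" where
  "total_curv F k x = (\<Sum>f\<in>{f \<in> F. x \<in> verts f}. arcK (k x) (face_S k f))"

lemma face_S_nonneg: "(\<And>x. k x \<ge> 0) \<Longrightarrow> face_S k f \<ge> 0"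
  by (cases f) simp

lemma face_S_mono: "(\<And>x. 0 \<le> k x) \<Longrightarrow> (\<And>x. k x \<le> k' x) \<Longrightarrow> face_S k f \<le> face_S k' f"
  by (cases f) (auto intro!: add_mono mult_mono intro: order_trans)

lemma face_S_scale: "face_S (\<lambda>x. c * k x) f = c\<^sup>2 * face_S k f"
  by (cases f) (simp add: power2_eq_square algebra_simps)

text \<open>If the own curvature is kept and the others grow, the total curvature does not grow.\<close>
lemma total_curv_antimono:
  assumes "\<And>y. 0 \<le> k y" "\<And>y. k y \<le> k' y" "k x = k' x"
  shows "total_curv F k' x \<le> total_curv F k x"
  unfolding total_curv_def assms(3)[symmetric]
  by (intro sum_mono arcK_antimono face_S_nonneg face_S_mono assms(1,2))

lemma total_curv_zero: "k x = 0 \<Longrightarrow> total_curv F k x = 0"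
  by (simp add: total_curv_def arcK_zero)

lemma total_curv_pos:
  assumes "finite F" "f \<in> F" "x \<in> verts f" "\<And>y. 0 \<le> k y" "k x > 0"
  shows "total_curv F k x > 0"
proof -
  have "{f \<in> F. x \<in> verts f} \<noteq> {}" using assms(2,3) by blast
  then show ?thesis unfolding total_curv_def
    by (intro sum_pos arcK_pos face_S_nonneg assms(4,5)) (use assms(1) in simp_all)
qed

text \<open>The assumption of a face at \<open>x\<close> makes the sum non-empty and the inequality strict.\<close>
lemma total_curv_scale_less:
  assumes "finite F" "f \<in> F" "x \<in> verts f" "\<And>y. 0 \<le> k y" "k x > 0" "c > 1"
  shows "total_curv F k x < total_curv F (\<lambda>y. c * k y) x"
proof -
  have "{f \<in> F. x \<in> verts f} \<noteq> {}" using assms(2,3) by blast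
  then show ?thesis unfolding total_curv_def face_S_scale
    by (intro sum_strict_mono arcK_scale_less face_S_nonneg assms(4-6)) (use assms(1) in simp_all)
qed

section \<open>Uniqueness\<close>

text \<open>A maximum principle. If \<open>k'\<close> exceeds \<open>k\<close> somewhere, let \<open>c > 1\<close> be the largest ratio \<open>k' v / k v\<close>. Then
\<open>k' \<le> c * k\<close> with equality at \<open>v\<close>, so the total curvature of \<open>k'\<close> at \<open>v\<close> is at least that of
\<open>c * k\<close>, which is larger than that of \<open>k\<close>.\<close>
lemma total_curv_determines_le:
  assumes F: "finite F" and V: "finite V" "\<And>x. x \<in> V \<Longrightarrow> \<exists>f\<in>F. x \<in> verts f"
    and k: "\<And>x. 0 \<le> k x" "\<And>x. x \<notin> V \<Longrightarrow> k x = 0" and k': "\<And>x. 0 \<le> k' x" "\<And>x. x \<notin> V \<Longrightarrow> k' x = 0"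
    and eq: "\<And>x. x \<in> V \<Longrightarrow> total_curv F k x = total_curv F k' x"
  shows "k' x \<le> k x"
proof (rule ccontr)
  assume n: "\<not> k' x \<le> k x"
  \<comment> \<open>The ratios are defined, because a vanishing curvature has vanishing total curvature.\<close>
  have supp: "k y > 0" if "k' y > 0" for y
  proof -
    have yV: "y \<in> V" using that k'(2) by force
    then obtain f where f: "f \<in> F" "y \<in> verts f" using V(2) by blast
    have "total_curv F k' y > 0" using total_curv_pos[OF F f, of k', OF k'(1) that] .
    then have "k y \<noteq> 0" using eq[OF yV] total_curv_zero[of k y F] by auto
    then show ?thesis using k(1)[of y] by (simp add: less_le)
  qed
  define P where "P = {y \<in> V. k' y > 0}"
  have P: "finite P" using V(1) by (simp add: P_def)
  have xP: "x \<in> P"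
  proof -
    have "k' x > 0" using n k(1)[of x] by linarith
    moreover have "x \<in> V" using k'(2)[of x] \<open>k' x > 0\<close> by force
    ultimately show ?thesis by (simp add: P_def)
  qed
  define c where "c = Max ((\<lambda>y. k' y / k y) ` P)"
  have "c \<in> (\<lambda>y. k' y / k y) ` P" unfolding c_def using P xP by (intro Max_in) auto
  then obtain v where v: "v \<in> P" "c = k' v / k v" by blast
  have c_ge: "k' y / k y \<le> c" if "y \<in> P" for y unfolding c_def using P that by simp
  have kp: "k y > 0" if "y \<in> P" for y using that supp by (simp add: P_def)
  have "1 < k' x / k x" using n kp[OF xP] by simp
  then have c1: "c > 1" using c_ge[OF xP] by linarith
  have le: "k' y \<le> c * k y" for y
  proof (cases "y \<in> P")
    case True
    then show ?thesis using c_ge[OF True] kp[OF True] by (simp add: divide_le_eq)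
  next
    case False
    then have "k' y = 0" using k'[of y] by (force simp: P_def less_le)
    then show ?thesis using k(1)[of y] c1 by simp
  qed
  have vV: "v \<in> V" using v by (simp add: P_def)
  then obtain f where f: "f \<in> F" "v \<in> verts f" using V(2) by blast
  have "k' v = c * k v" using v kp[OF v(1)] by simp
  then have "total_curv F (\<lambda>y. c * k y) v \<le> total_curv F k' v"
    by (intro total_curv_antimono k'(1) le)
  moreover have "total_curv F k v < total_curv F (\<lambda>y. c * k y) v"
    using total_curv_scale_less[OF F f, of k c, OF k(1) kp[OF v(1)] c1] .
  ultimately show False using eq[OF vV] by simp
qed

section \<open>Existence\<close>

definition distinct_face :: "'s face \<Rightarrow> bool" where
  "distinct_face f \<longleftrightarrow> (case f of (u, v, w) \<Rightarrow> u \<noteq> v \<and> v \<noteq> w \<and> w \<noteq> u)"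

text \<open>The three bounds on arcs of large curvature, for one, two or three corners in \<open>I\<close>, combined for a single face.\<close>
lemma face_large:
  assumes f: "distinct_face f" and ne: "verts f \<inter> I \<noteq> {}"
    and M1: "\<And>a b c. a \<ge> M \<Longrightarrow> 0 \<le> b \<Longrightarrow> b \<le> B \<Longrightarrow> 0 \<le> c \<Longrightarrow> c \<le> B \<Longrightarrow> arcK a (a * b + b * c + c * a) \<ge> l"
    and M2: "\<And>a b c. a \<ge> M \<Longrightarrow> b \<ge> M \<Longrightarrow> 0 \<le> c \<Longrightarrow> c \<le> B \<Longrightarrow>
       arcK a (a * b + b * c + c * a) + arcK b (a * b + b * c + c * a) \<ge> l"
    and M3: "\<And>a b c. a \<ge> M \<Longrightarrow> b \<ge> M \<Longrightarrow> c \<ge> M \<Longrightarrow>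
       arcK a (a * b + b * c + c * a) + arcK b (a * b + b * c + c * a) + arcK c (a * b + b * c + c * a) \<ge> l"
    and kI: "\<And>x. x \<in> I \<Longrightarrow> k x \<ge> M" and kn: "\<And>x. x \<notin> I \<Longrightarrow> 0 \<le> k x \<and> k x \<le> B"
  shows "(\<Sum>x\<in>verts f \<inter> I. arcK (k x) (face_S k f)) \<ge> (l::real)"
proof -
  obtain u v w where fu: "f = (u, v, w)" by (cases f)
  have d: "u \<noteq> v" "v \<noteq> w" "w \<noteq> u" using f by (auto simp: distinct_face_def fu)
  define S where "S = face_S k f"
  have S: "S = k u * k v + k v * k w + k w * k u" "S = k v * k w + k w * k u + k u * k v"
    "S = k w * k u + k u * k v + k v * k w" by (simp_all add: S_def fu)
  show ?thesis
  proof (cases "u \<in> I"; cases "v \<in> I"; cases "w \<in> I")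
    assume a: "u \<in> I" "v \<in> I" "w \<in> I"
    then have "verts f \<inter> I = {u, v, w}" by (auto simp: fu)
    then show ?thesis using d M3[OF kI[OF a(1)] kI[OF a(2)] kI[OF a(3)]] by (simp add: S_def[symmetric] S(1))
  next
    assume a: "u \<in> I" "v \<in> I" "w \<notin> I"
    then have "verts f \<inter> I = {u, v}" by (auto simp: fu)
    then show ?thesis using d M2[OF kI[OF a(1)] kI[OF a(2)], of "k w"] kn[OF a(3)] by (simp add: S_def[symmetric] S(1))
  next
    assume a: "u \<in> I" "v \<notin> I" "w \<in> I"
    then have "verts f \<inter> I = {w, u}" by (auto simp: fu)
    then show ?thesis using d M2[OF kI[OF a(3)] kI[OF a(1)], of "k v"] kn[OF a(2)] by (simp add: S_def[symmetric] S(3))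
  next
    assume a: "u \<in> I" "v \<notin> I" "w \<notin> I"
    then have "verts f \<inter> I = {u}" by (auto simp: fu)
    then show ?thesis using d M1[OF kI[OF a(1)], of "k v" "k w"] kn[OF a(2)] kn[OF a(3)] by (simp add: S_def[symmetric] S(1))
  next
    assume a: "u \<notin> I" "v \<in> I" "w \<in> I"
    then have "verts f \<inter> I = {v, w}" by (auto simp: fu)
    then show ?thesis using d M2[OF kI[OF a(2)] kI[OF a(3)], of "k u"] kn[OF a(1)] by (simp add: S_def[symmetric] S(2))
  next
    assume a: "u \<notin> I" "v \<in> I" "w \<notin> I"
    then have "verts f \<inter> I = {v}" by (auto simp: fu)
    then show ?thesis using d M1[OF kI[OF a(2)], of "k w" "k u"] kn[OF a(3)] kn[OF a(1)] by (simp add: S_def[symmetric] S(2))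
  next
    assume a: "u \<notin> I" "v \<notin> I" "w \<in> I"
    then have "verts f \<inter> I = {w}" by (auto simp: fu)
    then show ?thesis using d M1[OF kI[OF a(3)], of "k u" "k v"] kn[OF a(1)] kn[OF a(2)] by (simp add: S_def[symmetric] S(3))
  next
    assume "u \<notin> I" "v \<notin> I" "w \<notin> I"
    then show ?thesis using ne by (simp add: fu)
  qed
qed

lemma total_curv_continuous:
  assumes k: "\<And>y. 0 \<le> k y"
  shows "continuous_on {0<..} (\<lambda>s. total_curv F (k(x := s)) x)"
proof -
  have "continuous_on {0<..} (\<lambda>s. arcK s (face_S (k(x := s)) f))" for f
  proof -
    obtain u v w where fu: "f = (u, v, w)" by (cases f)
    have c: "continuous_on {0<..} (\<lambda>s. (k(x := s)) y)" for y by (cases "y = x") (auto intro: continuous_intros)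
    have "continuous_on {0<..} (\<lambda>s. (s, face_S (k(x := s)) f))"
      unfolding fu face_S.simps by (intro continuous_intros c)
    moreover have "(\<lambda>s. (s, face_S (k(x := s)) f)) ` {0<..} \<subseteq> {0<..} \<times> {0..}"
      using k by (auto intro!: face_S_nonneg)
    ultimately have "continuous_on {0<..} (\<lambda>s. (\<lambda>(k, S). arcK k S) (s, face_S (k(x := s)) f))"
      by (rule continuous_on_compose2[OF arcK_continuous])
    then show ?thesis by simp
  qed
  then show ?thesis unfolding total_curv_def fun_upd_same by (intro continuous_on_sum)
qed

text \<open>The Perron construction: the solution is the supremum of all subsolutions that vanish where \<open>T\<close> does.\<close>
lemma total_curv_exists:
  fixes V :: "'s set" and T :: "'s \<Rightarrow> real"
  assumes F: "finite F" "\<And>f. f \<in> F \<Longrightarrow> distinct_face f \<and> verts f \<subseteq> V" and V: "finite V"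
    and T: "\<And>x. x \<in> V \<Longrightarrow> T x \<ge> 0"
    and eta: "\<And>I. I \<noteq> {} \<Longrightarrow> I \<subseteq> V \<Longrightarrow> (\<Sum>x\<in>I. T x) < pi * real (card {f \<in> F. verts f \<inter> I \<noteq> {}})"
  obtains k where "\<And>x. 0 \<le> k x" "\<And>x. x \<notin> V \<Longrightarrow> k x = 0" "\<And>x. x \<in> V \<Longrightarrow> total_curv F k x = T x"
proof -
  define P where "P = {x \<in> V. T x > 0}"
  have P: "finite P" "P \<subseteq> V" using V by (auto simp: P_def)
  define Sub where "Sub = {k. (\<forall>x\<in>P. k x > 0) \<and> (\<forall>x. x \<notin> P \<longrightarrow> k x = 0) \<and> (\<forall>x\<in>P. total_curv F k x \<le> T x)}"
  have nn: "k x \<ge> 0" if "k \<in> Sub" for k x using that by (cases "x \<in> P") (auto simp: Sub_def less_imp_le)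
  have "Sub \<noteq> {}"
  proof -
    \<comment> \<open>A small constant on \<open>P\<close> is a subsolution by \<open>arcK_upper\<close>; \<open>\<eta>\<close> and \<open>\<delta>\<close> make each arc contribute at most \<open>t / m\<close>.\<close>
    define t where "t = Min (insert 1 (T ` P))"
    have t: "t > 0" "\<And>x. x \<in> P \<Longrightarrow> t \<le> T x" using P by (auto simp: t_def P_def)
    define m where "m = real (card F) + 1"
    have m: "m > 0" by (simp add: m_def)
    define \<eta> where "\<eta> = min 1 (t / (4 * m))"
    have \<eta>: "0 < \<eta>" "\<eta> < pi / 2" "\<eta> \<le> t / (4 * m)" using t m pi_gt3 by (auto simp: \<eta>_def)
    have s: "sin \<eta> > 0" using \<eta> by (intro sin_gt_zero) auto
    define \<delta> where "\<delta> = t * sin \<eta> / (2 * pi * m)"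
    have \<delta>: "\<delta> > 0" using t s m by (simp add: \<delta>_def)
    define k where "k x = (if x \<in> P then \<delta> else 0)" for x
    have k0: "\<And>x. k x \<ge> 0" using \<delta> by (simp add: k_def)
    have "total_curv F k x \<le> T x" if x: "x \<in> P" for x
    proof -
      have "pi * \<delta> / sin \<eta> = t / (2 * m)" using s m by (simp add: \<delta>_def)
      then have b: "2 * \<eta> + pi * \<delta> / sin \<eta> \<le> t / m" using \<eta>(3) m by (simp add: field_simps)
      have "total_curv F k x \<le> (\<Sum>f\<in>{f \<in> F. x \<in> verts f}. t / m)"
        unfolding total_curv_def
      proof (rule sum_mono)
        fix f
        have "arcK (k x) (face_S k f) \<le> 2 * \<eta> + pi * k x / sin \<eta>"
          using x \<delta> \<eta> by (intro arcK_upper face_S_nonneg k0) (auto simp: k_def)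
        then show "arcK (k x) (face_S k f) \<le> t / m" using b x by (simp add: k_def)
      qed
      also have "\<dots> = real (card {f \<in> F. x \<in> verts f}) * (t / m)" by simp
      also have "\<dots> \<le> m * (t / m)"
      proof (rule mult_right_mono)
        have "card {f \<in> F. x \<in> verts f} \<le> card F" using F(1) by (intro card_mono) auto
        then show "real (card {f \<in> F. x \<in> verts f}) \<le> m" by (simp add: m_def)
      qed (use t m in simp)
      also have "\<dots> = t" using m by simp
      finally show ?thesis using t(2)[OF x] by simp
    qed
    then have "k \<in> Sub" using \<delta> by (auto simp: Sub_def k_def)
    then show ?thesis by blast
  qed
  then obtain k0 where k0: "k0 \<in> Sub" by blast
  \<comment> \<open>At each vertex one of the two subsolutions has the value of the maximum, and the other curvatures only grow.\<close>
  have max: "(\<lambda>x. max (k x) (k' x)) \<in> Sub" if a: "k \<in> Sub" "k' \<in> Sub" for k k'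
  proof -
    have "total_curv F (\<lambda>x. max (k x) (k' x)) x \<le> T x" if x: "x \<in> P" for x
    proof (cases "k x \<ge> k' x")
      case True
      then have "total_curv F (\<lambda>x. max (k x) (k' x)) x \<le> total_curv F k x"
        by (intro total_curv_antimono nn[OF a(1)]) auto
      then show ?thesis using a(1) x by (force simp: Sub_def)
    next
      case False
      then have "total_curv F (\<lambda>x. max (k x) (k' x)) x \<le> total_curv F k' x"
        by (intro total_curv_antimono nn[OF a(2)]) auto
      then show ?thesis using a(2) x by (force simp: Sub_def)
    qed
    then show ?thesis using a by (auto simp: Sub_def less_max_iff_disj)
  qed
  \<comment> \<open>The vertices at which subsolutions are unbounded; by \<open>max\<close> they can be large at all of them simultaneously.\<close>
  define I where "I = {x \<in> P. \<forall>M. \<exists>k\<in>Sub. k x > M}"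
  have I: "finite I" "I \<subseteq> V" using P by (auto simp: I_def)
  have large: "\<exists>k\<in>Sub. \<forall>x\<in>J. k x \<ge> M" if "finite J" "J \<subseteq> I" for J M
    using that
  proof (induction J)
    case empty then show ?case using k0 by blast
  next
    case (insert y J)
    then obtain k where k: "k \<in> Sub" "\<forall>x\<in>J. k x \<ge> M" by blast
    have "\<exists>k\<in>Sub. k y > M" using insert.prems by (simp add: I_def)
    then obtain k' where k': "k' \<in> Sub" "k' y > M" by blast
    show ?case using max[OF k(1) k'(1)] k(2) k'(2) by (intro bexI[of _ "\<lambda>x. max (k x) (k' x)"]) (auto simp: le_max_iff_disj)
  qed
  have "\<exists>B\<ge>0. \<forall>x. x \<notin> I \<longrightarrow> (\<forall>k\<in>Sub. k x \<le> B)"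
  proof -
    have "\<forall>x\<in>P - I. \<exists>b. \<forall>k\<in>Sub. k x \<le> b" by (auto simp: I_def not_less)
    then obtain b where b: "\<And>x k. x \<in> P - I \<Longrightarrow> k \<in> Sub \<Longrightarrow> k x \<le> b x" by metis
    define B where "B = Max (insert 0 (b ` (P - I)))"
    have B: "B \<ge> 0" "\<And>x. x \<in> P - I \<Longrightarrow> b x \<le> B" using P by (auto simp: B_def)
    have "k x \<le> B" if "x \<notin> I" "k \<in> Sub" for x k
    proof (cases "x \<in> P")
      case True then show ?thesis using b[of x k] B(2)[of x] that by simp
    next
      case False then show ?thesis using that B(1) by (simp add: Sub_def)
    qed
    then show ?thesis using B(1) by blast
  qed
  then obtain B where B: "B \<ge> 0" "\<And>x k. x \<notin> I \<Longrightarrow> k \<in> Sub \<Longrightarrow> k x \<le> B" by blast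
  \<comment> \<open>Otherwise the faces meeting \<open>I\<close> contribute almost \<open>pi\<close> each, which exceeds the sum of \<open>T\<close> over \<open>I\<close>.\<close>
  have "I = {}"
  proof (rule ccontr)
    assume ne: "I \<noteq> {}"
    define FI where "FI = {f \<in> F. verts f \<inter> I \<noteq> {}}"
    define m where "m = real (card FI) + 1"
    define \<epsilon> where "\<epsilon> = (pi * real (card FI) - (\<Sum>x\<in>I. T x)) / m"
    have m: "m > 0" by (simp add: m_def)
    have \<epsilon>: "\<epsilon> > 0" using eta[OF ne I(2)] m by (simp add: \<epsilon>_def FI_def)
    obtain M where M: "M > B"
    "\<And>a b c. a \<ge> M \<Longrightarrow> 0 \<le> b \<Longrightarrow> b \<le> B \<Longrightarrow> 0 \<le> c \<Longrightarrow> c \<le> B \<Longrightarrow> arcK a (a * b + b * c + c * a) \<ge> pi - \<epsilon>"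
    "\<And>a b c. a \<ge> M \<Longrightarrow> b \<ge> M \<Longrightarrow> 0 \<le> c \<Longrightarrow> c \<le> B \<Longrightarrow>
       arcK a (a * b + b * c + c * a) + arcK b (a * b + b * c + c * a) \<ge> pi - \<epsilon>"
    "\<And>a b c. a \<ge> M \<Longrightarrow> b \<ge> M \<Longrightarrow> c \<ge> M \<Longrightarrow>
       arcK a (a * b + b * c + c * a) + arcK b (a * b + b * c + c * a) + arcK c (a * b + b * c + c * a) \<ge> pi - \<epsilon>"
      by (rule large_curvatures[OF \<epsilon> B(1)]) (rule that, assumption+)
    obtain k where k: "k \<in> Sub" "\<forall>x\<in>I. k x \<ge> M" using large[OF I(1) order_refl] by blast
    have "real (card FI) * (pi - \<epsilon>) = (\<Sum>f\<in>FI. pi - \<epsilon>)" by simp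
    also have "\<dots> \<le> (\<Sum>f\<in>FI. \<Sum>x\<in>verts f \<inter> I. arcK (k x) (face_S k f))"
    proof (rule sum_mono)
      fix f assume f: "f \<in> FI"
      show "pi - \<epsilon> \<le> (\<Sum>x\<in>verts f \<inter> I. arcK (k x) (face_S k f))"
      proof (rule face_large[OF _ _ M(2-4)])
        show "distinct_face f" "verts f \<inter> I \<noteq> {}" using f F(2) by (simp_all add: FI_def)
        show "k x \<ge> M" if "x \<in> I" for x using k(2) that by blast
        show "0 \<le> k x \<and> k x \<le> B" if "x \<notin> I" for x using B(2)[OF that k(1)] nn[OF k(1)] by blast
      qed
    qed
    also have "\<dots> = (\<Sum>f\<in>FI. \<Sum>x\<in>{x \<in> I. x \<in> verts f}. arcK (k x) (face_S k f))"
      by (intro sum.cong) auto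
    also have "\<dots> = (\<Sum>x\<in>I. \<Sum>f\<in>{f \<in> FI. x \<in> verts f}. arcK (k x) (face_S k f))"
      using F(1) I(1) by (intro sum.swap_restrict) (auto simp: FI_def)
    also have "\<dots> = (\<Sum>x\<in>I. total_curv F k x)" unfolding total_curv_def
      by (intro sum.cong refl) (auto simp: FI_def)
    also have "\<dots> \<le> (\<Sum>x\<in>I. T x)"
      by (intro sum_mono) (use k(1) in \<open>auto simp: Sub_def I_def\<close>)
    finally have le: "real (card FI) * (pi - \<epsilon>) \<le> (\<Sum>x\<in>I. T x)" .
    have "m * \<epsilon> = pi * real (card FI) - (\<Sum>x\<in>I. T x)" using m by (simp add: \<epsilon>_def)
    then show False using le \<epsilon> by (simp add: m_def algebra_simps)
  qed
  then have bd: "k x \<le> B" if "k \<in> Sub" for k x using B(2) that by simp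
  define ks where "ks x = (SUP k\<in>Sub. k x)" for x
  have bdd: "bdd_above ((\<lambda>k. k x) ` Sub)" for x using bd by (intro bdd_aboveI[of _ B]) auto
  have ub: "k x \<le> ks x" if "k \<in> Sub" for k x unfolding ks_def using that bdd by (rule cSUP_upper)
  have ks0: "ks x \<ge> 0" for x using ub[OF k0, of x] nn[OF k0, of x] by linarith
  have ksP: "ks x > 0" if "x \<in> P" for x using ub[OF k0, of x] k0 that by (force simp: Sub_def)
  have ksn: "ks x = 0" if "x \<notin> P" for x
  proof -
    have "(\<lambda>k. k x) ` Sub = {0}" using k0 that by (force simp: Sub_def)
    then show ?thesis by (simp add: ks_def)
  qed
  define \<phi> where "\<phi> x s = total_curv F (ks(x := s)) x" for x s
  have \<phi>c: "isCont (\<phi> x) (ks x)" if "x \<in> P" for x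
    using total_curv_continuous[of ks F x] ks0 ksP[OF that] unfolding \<phi>_def
    by (simp add: continuous_on_eq_continuous_at)
  have \<phi>k: "\<phi> x (ks x) = total_curv F ks x" for x by (simp add: \<phi>_def)
  \<comment> \<open>A subsolution \<open>k\<close> close to \<open>ks\<close> at \<open>x\<close> is at most \<open>ks\<close> elsewhere, so its total curvature at \<open>x\<close> is no smaller than that of \<open>ks\<close> with the value \<open>k x\<close> at \<open>x\<close>.\<close>
  have le: "total_curv F ks x \<le> T x" if x: "x \<in> P" for x
  proof (rule ccontr)
    assume "\<not> ?thesis"
    then have "\<phi> x (ks x) > T x" by (simp add: \<phi>k)
    then have "\<forall>\<^sub>F s in at (ks x). \<phi> x s > T x" using \<phi>c[OF x] unfolding isCont_def by (rule order_tendstoD(1)[rotated])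
    then obtain d where d: "d > 0" "\<And>s. s \<noteq> ks x \<Longrightarrow> dist s (ks x) < d \<Longrightarrow> \<phi> x s > T x"
      unfolding eventually_at by blast
    have "\<exists>k\<in>Sub. ks x - d < k x"
      using less_cSUP_iff[of Sub "\<lambda>k. k x" "ks x - d"] bdd[of x] k0 d(1) unfolding ks_def by auto
    then obtain k where k: "k \<in> Sub" "ks x - d < k x" by blast
    have "\<phi> x (k x) > T x"
    proof (cases "k x = ks x")
      case True then show ?thesis using \<open>\<phi> x (ks x) > T x\<close> by simp
    next
      case False then show ?thesis using d(2) k ub[OF k(1), of x] by (simp add: dist_real_def)
    qed
    moreover have "\<phi> x (k x) \<le> total_curv F k x"
      unfolding \<phi>_def by (rule total_curv_antimono) (use nn[OF k(1)] ub[OF k(1)] in auto)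
    moreover have "total_curv F k x \<le> T x" using k(1) x by (simp add: Sub_def)
    ultimately show False by simp
  qed
  have "total_curv F ks x = T x" if x: "x \<in> V" for x
  proof (cases "x \<in> P")
    case False
    then have "T x = 0" using x T[OF x] by (auto simp: P_def)
    then show ?thesis using total_curv_zero[of ks x F, OF ksn[OF False]] by simp
  next
    case xP: True
    show ?thesis
    proof (rule ccontr)
      assume "total_curv F ks x \<noteq> T x"
      then have "\<phi> x (ks x) < T x" using le[OF xP] by (simp add: \<phi>k)
      then have "\<forall>\<^sub>F s in at (ks x). \<phi> x s < T x" using \<phi>c[OF xP] unfolding isCont_def by (rule order_tendstoD(2)[rotated])
      then obtain d where d: "d > 0" "\<And>s. s \<noteq> ks x \<Longrightarrow> dist s (ks x) < d \<Longrightarrow> \<phi> x s < T x"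
        unfolding eventually_at by blast
      define s where "s = ks x + d / 2"
      have s: "s > ks x" "\<phi> x s < T x" using d by (auto simp: s_def dist_real_def)
      \<comment> \<open>Raising \<open>ks\<close> at a vertex with strict inequality keeps all inequalities, contradicting the supremum.\<close>
      have "ks(x := s) \<in> Sub"
        unfolding Sub_def mem_Collect_eq
      proof (intro conjI ballI allI impI)
        fix y assume y: "y \<in> P"
        show "(ks(x := s)) y > 0" using ksP[OF y] ksP[OF xP] s(1) by auto
        show "total_curv F (ks(x := s)) y \<le> T y"
        proof (cases "y = x")
          case True then show ?thesis using s(2) by (simp add: \<phi>_def)
        next
          case False
          have "total_curv F (ks(x := s)) y \<le> total_curv F ks y"
            by (rule total_curv_antimono) (use ks0 s(1) False in auto)
          then show ?thesis using le[OF y] by simp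
        qed
      next
        fix y assume "y \<notin> P"
        then show "(ks(x := s)) y = 0" using ksn xP by auto
      qed
      then have "s \<le> ks x" using ub[of "ks(x := s)" x] by simp
      then show False using s(1) by simp
    qed
  qed
  then show thesis using that[of ks] ks0 ksn P by blast
qed

section \<open>Faces of a triangulation\<close>

lemma bij_interval_endpoints:
  fixes h :: "real \<Rightarrow> real"
  assumes c: "continuous_on {0..1} h" and i: "inj_on h {0..1}" and im: "h ` {0..1} = {0..1}"
  shows "h 0 \<in> {0, 1}" "h 1 \<in> {0, 1}"
proof -
  obtain a where a: "a \<in> {0..1}" "h a = 0" using im by (metis atLeastAtMost_iff imageE order_refl zero_le_one)
  obtain b where b: "b \<in> {0..1}" "h b = 1" using im by (metis atLeastAtMost_iff imageE order_refl zero_le_one)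
  have r: "h x \<in> {0..1}" if "x \<in> {0..1}" for x using im that by blast
  have "strict_mono_on {0..1} h \<or> strict_antimono_on {0..1} h"
    using injective_eq_monotone_map[of "{0..1}" h] c i by (simp add: is_interval_cc)
  then have "(h 0 = 0 \<and> h 1 = 1) \<or> (h 0 = 1 \<and> h 1 = 0)"
  proof
    assume m: "strict_mono_on {0..1} h"
    have "a = 0"
    proof (rule ccontr)
      assume "a \<noteq> 0"
      then have "h 0 < h a" using a by (intro monotone_onD[OF m]) auto
      then show False using a(2) r[of 0] by simp
    qed
    moreover have "b = 1"
    proof (rule ccontr)
      assume "b \<noteq> 1"
      then have "h b < h 1" using b by (intro monotone_onD[OF m]) auto
      then show False using b(2) r[of 1] by simp
    qed
    ultimately show ?thesis using a b by simp
  next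
    assume m: "strict_antimono_on {0..1} h"
    have "a = 1"
    proof (rule ccontr)
      assume "a \<noteq> 1"
      then have "h 1 < h a" using a by (intro monotone_onD[OF m]) auto
      then show False using a(2) r[of 1] by simp
    qed
    moreover have "b = 0"
    proof (rule ccontr)
      assume "b \<noteq> 0"
      then have "h b < h 0" using b by (intro monotone_onD[OF m]) auto
      then show False using b(2) r[of 0] by simp
    qed
    ultimately show ?thesis using a b by simp
  qed
  then show "h 0 \<in> {0, 1}" "h 1 \<in> {0, 1}" by auto
qed

text \<open>An edge is given with some parametrization whose end points are in \<open>V\<close>. Any other one differs from it by a homeomorphism of
the unit interval, which preserves the set of end points.\<close>
lemma arc_endpoints_in_V:
  fixes \<rho> :: "real \<Rightarrow> 's"
  assumes e: "embedded_edge S V e" and r: "embedding_map (top_of_set {0..1}) S \<rho>" "\<rho> ` {0..1} = e"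
  shows "\<rho> 0 \<in> V" "\<rho> 1 \<in> V"
proof -
  obtain \<gamma> where g: "embedding_map (top_of_set {0..1::real}) S \<gamma>" "e = \<gamma> ` {0..1}" "\<gamma> 0 \<in> V" "\<gamma> 1 \<in> V"
    using e by (auto simp: embedded_edge_def)
  have hg: "homeomorphic_map (top_of_set {0..1}) (subtopology S e) \<gamma>"
    using g(1,2) by (simp add: embedding_map_def)
  have hr: "homeomorphic_map (top_of_set {0..1}) (subtopology S e) \<rho>"
    using r by (simp add: embedding_map_def)
  obtain \<gamma>' where gi: "homeomorphic_maps (top_of_set {0..1}) (subtopology S e) \<gamma> \<gamma>'"
    using hg by (auto simp: homeomorphic_map_maps)
  then have "homeomorphic_map (subtopology S e) (top_of_set {0..1}) \<gamma>'"
    by (meson homeomorphic_map_maps homeomorphic_maps_sym)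
  then have h: "homeomorphic_map (top_of_set {0..1}) (top_of_set {0..1::real}) (\<gamma>' \<circ> \<rho>)"
    using hr homeomorphic_map_compose by blast
  define \<theta> where "\<theta> = \<gamma>' \<circ> \<rho>"
  have "continuous_on {0..1} \<theta>" using homeomorphic_imp_continuous_map[OF h] by (simp add: \<theta>_def)
  moreover have "inj_on \<theta> {0..1}" using homeomorphic_imp_injective_map[OF h] by (simp add: \<theta>_def)
  moreover have "\<theta> ` {0..1} = {0..1}" using homeomorphic_imp_surjective_map[OF h] by (simp add: \<theta>_def)
  ultimately have t: "\<theta> 0 \<in> {0, 1}" "\<theta> 1 \<in> {0, 1}" by (rule bij_interval_endpoints)+
  have "\<gamma> (\<gamma>' y) = y" if "y \<in> topspace (subtopology S e)" for y
    using gi that by (simp add: homeomorphic_maps_def)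
  moreover have "\<rho> x \<in> topspace (subtopology S e)" if "x \<in> {0..1}" for x
    using homeomorphic_imp_surjective_map[OF hr] that by (metis imageI topspace_euclidean_subtopology)
  ultimately have "\<gamma> (\<theta> 0) = \<rho> 0" "\<gamma> (\<theta> 1) = \<rho> 1" by (simp_all add: \<theta>_def)
  then show "\<rho> 0 \<in> V" "\<rho> 1 \<in> V" using t g(3,4) by (metis insertE singletonD)+
qed

text \<open>Each side of the standard triangle is mapped onto an edge, and restricts to a parametrization of it, so that the corners
are end points of edges.\<close>
lemma positive_triangle_verts:
  assumes E: "\<And>e. e \<in> E \<Longrightarrow> embedded_edge S V e" and p: "positive_triangle S \<A> E f D"
  shows "distinct_face f" "verts f \<subseteq> V"
proof -
  obtain \<sigma> where s: "embedding_map (top_of_set std_triangle) S \<sigma>" "f = (\<sigma> 0, \<sigma> 1, \<sigma> \<i>)"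
     "\<sigma> ` closed_segment 0 1 \<in> E" "\<sigma> ` closed_segment 1 \<i> \<in> E"
    using p by (auto simp: positive_triangle_def)
  have v: "0 \<in> std_triangle" "1 \<in> std_triangle" "\<i> \<in> std_triangle"
    by (auto simp: std_triangle_def intro: hull_inc)
  have inj: "inj_on \<sigma> std_triangle" using s(1) by (auto simp: embedding_map_def dest: homeomorphic_imp_injective_map)
  then have "\<sigma> 0 \<noteq> \<sigma> 1" "\<sigma> 1 \<noteq> \<sigma> \<i>" "\<sigma> \<i> \<noteq> \<sigma> 0" using v by (auto dest!: inj_onD)
  then show "distinct_face f" by (simp add: distinct_face_def s(2))
  have seg: "\<sigma> a \<in> V \<and> \<sigma> b \<in> V" if ab: "a \<in> std_triangle" "b \<in> std_triangle" "a \<noteq> b" "\<sigma> ` closed_segment a b \<in> E" for a b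
  proof -
    define l where "l = linepath a b"
    have sub: "closed_segment a b \<subseteq> std_triangle"
      using ab(1,2) by (intro closed_segment_subset) (auto simp: std_triangle_def)
    have im: "l ` {0..1} = closed_segment a b" by (simp add: l_def linepath_image_01)
    have "homeomorphic_map (top_of_set {0..1}) (top_of_set (closed_segment a b)) l"
    proof -
      have "inj_on l {0..1}" using ab(3) by (auto simp: l_def inj_on_linepath)
      moreover have "continuous_on {0..1} l" unfolding l_def by (rule continuous_on_linepath)
      ultimately obtain l' where "homeomorphism {0..1} (closed_segment a b) l l'"
        using homeomorphism_compact[of "{0..1}" l "closed_segment a b"] im by auto
      then have "homeomorphic_maps (top_of_set {0..1}) (top_of_set (closed_segment a b)) l l'"
        unfolding homeomorphic_maps_def homeomorphism_def by auto
      then show ?thesis using homeomorphic_map_maps by blast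
    qed
    moreover have "homeomorphic_map (top_of_set (closed_segment a b)) (subtopology S (\<sigma> ` closed_segment a b)) \<sigma>"
    proof -
      have "homeomorphic_map (top_of_set std_triangle) (subtopology S (\<sigma> ` std_triangle)) \<sigma>"
        using s(1) by (simp add: embedding_map_def)
      then have "homeomorphic_map (subtopology (top_of_set std_triangle) (closed_segment a b))
         (subtopology (subtopology S (\<sigma> ` std_triangle)) (\<sigma> ` closed_segment a b)) \<sigma>"
      proof (rule homeomorphic_map_subtopologies_alt)
        fix x assume x: "x \<in> topspace (top_of_set std_triangle)"
        then show "\<sigma> x \<in> \<sigma> ` closed_segment a b \<longleftrightarrow> x \<in> closed_segment a b"
          using inj_on_image_mem_iff[OF inj, of x "closed_segment a b"] sub by simp
      qed
      moreover have "std_triangle \<inter> closed_segment a b = closed_segment a b"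
         "\<sigma> ` std_triangle \<inter> \<sigma> ` closed_segment a b = \<sigma> ` closed_segment a b" using sub by blast+
      ultimately show ?thesis by (simp only: subtopology_subtopology)
    qed
    ultimately have h: "homeomorphic_map (top_of_set {0..1}) (subtopology S (\<sigma> ` closed_segment a b)) (\<sigma> \<circ> l)"
      by (rule homeomorphic_map_compose)
    have im2: "(\<sigma> \<circ> l) ` {0..1} = \<sigma> ` closed_segment a b" by (simp only: image_comp[symmetric] im)
    then have "embedding_map (top_of_set {0..1}) S (\<sigma> \<circ> l)" using h by (simp add: embedding_map_def)
    from arc_endpoints_in_V[OF E[OF ab(4)] this im2] show ?thesis by (simp add: l_def linepath_0' linepath_1')
  qed
  show "verts f \<subseteq> V" using seg[of 0 1] seg[of 1 \<i>] v s by simp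
qed

lemma triangulation_faces:
  assumes "simple_triangulation S \<A> V E F"
  shows "finite V" "finite F" "\<And>f. f \<in> F \<Longrightarrow> distinct_face f \<and> verts f \<subseteq> V"
proof -
  show V: "finite V" using assms by (simp add: simple_triangulation_def)
  show f: "distinct_face f \<and> verts f \<subseteq> V" if "f \<in> F" for f
    using assms that positive_triangle_verts[of E S V] unfolding simple_triangulation_def Let_def by meson
  have "F \<subseteq> V \<times> V \<times> V"
  proof
    fix f assume "f \<in> F"
    then show "f \<in> V \<times> V \<times> V" using f[of f] by (cases f) auto
  qed
  then show "finite F" by (rule finite_subset) (use V in simp)
qed

section \<open>Circle packed surfaces\<close>

lemma face_curvature_eq:
  assumes "distinct_face f" "face_configuration k circ f" "x \<in> verts f"
  shows "face_curvature circ f x = arcK (k x) (face_S k f)"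
proof -
  obtain u v w where f: "f = (u, v, w)" by (cases f)
  have d: "u \<noteq> v" "v \<noteq> w" "w \<noteq> u" using assms(1) by (auto simp: distinct_face_def f)
  have c: "three_circle_configuration (k u) (k v) (k w) (circ f u) (circ f v) (circ f w)"
    using assms(2) by (simp add: f)
  note c2 = config_rotate[OF c] and c3 = config_rotate[OF config_rotate[OF c]]
  from assms(3) consider "x = u" | "x = v" | "x = w" by (auto simp: f)
  then show ?thesis
  proof cases
    case 1 then show ?thesis using arc_curvature_eq[OF c] by (simp add: f)
  next
    case 2 then show ?thesis using arc_curvature_eq[OF c2] d by (simp add: f add_ac)
  next
    case 3 then show ?thesis using arc_curvature_eq[OF c3] d by (simp add: f add_ac)
  qed
qed

lemma total_geodesic_curvature_eq:
  assumes "\<And>f. f \<in> F \<Longrightarrow> distinct_face f" "corresponding_surface F k X"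
  shows "total_geodesic_curvature F X x = total_curv F k x"
  unfolding total_geodesic_curvature_def total_curv_def
proof (rule sum.cong[OF refl])
  fix f assume f: "f \<in> {f \<in> F. x \<in> verts f}"
  then have "face_configuration k (circles X) f" using assms(2) unfolding corresponding_surface_def by blast
  then show "face_curvature (circles X) f x = arcK (k x) (face_S k f)" using f assms(1) by (intro face_curvature_eq) auto
qed

text \<open>Only the realizations of the faces have to be chosen; the gluing and the pairing of spikes are determined by them.\<close>
lemma corresponding_surface_exists:
  assumes "\<And>f. f \<in> F \<Longrightarrow> distinct_face f \<and> verts f \<subseteq> V" "\<And>x. x \<in> V \<Longrightarrow> k x \<ge> 0"
  shows "\<exists>X. corresponding_surface F k X"
proof -
  have "\<exists>C. case f of (u, v, w) \<Rightarrow> three_circle_configuration (k u) (k v) (k w) (C u) (C v) (C w)" if "f \<in> F" for f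
  proof -
    obtain u v w where f: "f = (u, v, w)" by (cases f)
    have d: "u \<noteq> v" "v \<noteq> w" "w \<noteq> u" "k u \<ge> 0" "k v \<ge> 0" "k w \<ge> 0"
      using assms that by (auto simp: distinct_face_def f)
    obtain C1 C2 C3 where "three_circle_configuration (k u) (k v) (k w) C1 C2 C3" using config_exists[OF d(4-6)] by blast
    then show ?thesis using d by (intro exI[of _ "(\<lambda>x. C1)(v := C2, w := C3)"]) (simp add: f)
  qed
  then have "\<forall>f\<in>F. \<exists>C. case f of (u, v, w) \<Rightarrow> three_circle_configuration (k u) (k v) (k w) (C u) (C v) (C w)" by blast
  from bchoice[OF this] obtain circ where c: "\<And>f. f \<in> F \<Longrightarrow> case f of (u, v, w) \<Rightarrow>
     three_circle_configuration (k u) (k v) (k w) (circ f u) (circ f v) (circ f w)" by blast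
  have fc: "face_configuration k circ f" if "f \<in> F" for f using c[OF that] by (cases f) simp
  define P where "P = Sigma F (realized_face circ)"
  define R where "R = (edge_gluing F k circ)\<^sup>*"
  show ?thesis
    by (rule exI[of _ "\<lparr>circles = circ, surface_points = P // R, surface_dist = quotient_dist P R,
      paired_spikes = spike_pairing F k circ\<rparr>"]) (simp add: corresponding_surface_def fc P_def R_def Let_def)
qed

text \<open>This relates curvatures extended by \<open>undefined\<close> and by \<open>0\<close> outside \<open>V\<close>.\<close>
lemma total_curv_cong:
  assumes "\<And>f. f \<in> F \<Longrightarrow> verts f \<subseteq> V" "\<And>x. x \<in> V \<Longrightarrow> k x = k' x" "x \<in> V"
  shows "total_curv F k x = total_curv F k' x"
  unfolding total_curv_def
proof (rule sum.cong[OF refl])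
  fix f assume "f \<in> {f \<in> F. x \<in> verts f}"
  then have "verts f \<subseteq> V" using assms(1) by blast
  then have "face_S k f = face_S k' f" using assms(2) by (cases f) auto
  then show "arcK (k x) (face_S k f) = arcK (k' x) (face_S k' f)" using assms(2,3) by simp
qed

theorem theorem1p1:
  fixes S :: "'s topology" and \<A> :: "('s set \<times> ('s \<Rightarrow> complex)) set"
    and V :: "'s set" and E :: "'s set set" and F :: "('s \<times> 's \<times> 's) set"
    and T :: "'s \<Rightarrow> real"
  assumes "connected_closed_oriented_surface S \<A>"
    and "simple_triangulation S \<A> V E F"
    and "T \<in> boundary0_Omega_T V F"
  shows "\<exists>!k. k \<in> boundary_Omega_k V \<and>
           (\<exists>X. corresponding_surface F k X \<and> (\<forall>v\<in>V. total_geodesic_curvature F X v = T v))"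
proof -
  note tr = triangulation_faces[OF assms(2)]
  have T: "\<And>x. x \<in> V \<Longrightarrow> T x \<ge> 0"
    and eta: "\<And>I. I \<noteq> {} \<Longrightarrow> I \<subseteq> V \<Longrightarrow> (\<Sum>x\<in>I. T x) < pi * real (card {f \<in> F. verts f \<inter> I \<noteq> {}})"
    using assms(3) by (auto simp: boundary0_Omega_T_def hat_Omega_T_def eta_def)
  \<comment> \<open>A boundary point of the admissible set that satisfies all strict inequalities has a zero.\<close>
  obtain z where z: "z \<in> V" "T z = 0"
  proof -
    have "T \<in> hat_Omega_T V F" "T \<notin> Omega_T V F" using assms(3) by (auto simp: boundary0_Omega_T_def)
    then have "\<not> (\<forall>x\<in>V. T x > 0)" unfolding hat_Omega_T_def Omega_T_def by (auto simp: PiE_iff)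
    then show thesis using that T by force
  qed
  have cover: "\<exists>f\<in>F. x \<in> verts f" if "x \<in> V" for x
  proof (rule ccontr)
    assume "\<not> ?thesis"
    then have "{f \<in> F. verts f \<inter> {x} \<noteq> {}} = {}" by blast
    then have "card {f \<in> F. verts f \<inter> {x} \<noteq> {}} = 0" by (simp only: card.empty)
    then show False using eta[of "{x}"] T[OF that] that by simp
  qed
  have tc: "total_geodesic_curvature F X x = total_curv F k x" if "corresponding_surface F k X" for k X x
    using total_geodesic_curvature_eq[OF _ that] tr(3) by blast
  obtain k where k: "\<And>x. 0 \<le> k x" "\<And>x. x \<notin> V \<Longrightarrow> k x = 0" "\<And>x. x \<in> V \<Longrightarrow> total_curv F k x = T x"
    using total_curv_exists[OF tr(2,3,1) T eta] by metis
  define kr where "kr = restrict k V"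
  have krt: "total_curv F kr x = T x" if "x \<in> V" for x
    using total_curv_cong[of F V kr k x] tr(3) that k(3)[OF that] by (simp add: kr_def)
  have kz: "k z = 0"
  proof (rule ccontr)
    assume "k z \<noteq> 0"
    then have "k z > 0" using k(1)[of z] by simp
    obtain f where f: "f \<in> F" "z \<in> verts f" using cover[OF z(1)] by blast
    have "total_curv F k z > 0" by (rule total_curv_pos[OF tr(2) f]) (use k(1) \<open>k z > 0\<close> in auto)
    then show False using k(3)[OF z(1)] z(2) by simp
  qed
  have "kr \<in> boundary_Omega_k V"
    using k(1) kz z(1) unfolding boundary_Omega_k_def closed_Omega_k_def Omega_k_def kr_def
    by (auto simp: PiE_iff intro!: bexI[of _ z])
  moreover obtain X where X: "corresponding_surface F kr X"
  proof -
    have "\<exists>X. corresponding_surface F kr X"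
      by (rule corresponding_surface_exists[of F V]) (use tr(3) k(1) in \<open>simp_all add: kr_def\<close>)
    then show thesis using that by blast
  qed
  moreover have "\<forall>v\<in>V. total_geodesic_curvature F X v = T v" using tc[OF X] krt by simp
  moreover have "k' = kr" if k': "k' \<in> boundary_Omega_k V" "corresponding_surface F k' X'"
      "\<forall>v\<in>V. total_geodesic_curvature F X' v = T v" for k' X'
  proof -
    have k'P: "k' \<in> V \<rightarrow>\<^sub>E {0..}" using k'(1) by (simp add: boundary_Omega_k_def closed_Omega_k_def)
    define j where "j x = (if x \<in> V then k' x else 0)" for x
    have j: "\<And>x. 0 \<le> j x" "\<And>x. x \<notin> V \<Longrightarrow> j x = 0" using k'P by (auto simp: j_def PiE_iff)
    have jt: "total_curv F j x = T x" if "x \<in> V" for x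
    proof -
      have "total_curv F j x = total_curv F k' x"
        using tr(3) that by (intro total_curv_cong[of F V]) (auto simp: j_def)
      then show ?thesis using k'(3) tc[OF k'(2)] that by simp
    qed
    have "j x = k x" for x
    proof (rule antisym)
      show "j x \<le> k x" by (rule total_curv_determines_le[OF tr(2,1) cover k(1,2) j]) (use k(3) jt in auto)
      show "k x \<le> j x" by (rule total_curv_determines_le[OF tr(2,1) cover j k(1,2)]) (use k(3) jt in auto)
    qed
    then have "k' x = k x" if "x \<in> V" for x using that by (simp add: j_def) metis
    then show ?thesis using k'P by (intro ext) (auto simp: kr_def PiE_iff extensional_def)
  qed
  ultimately show ?thesis by blast
qed

end
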